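(* Let $E$ be the closure of a Jordan domain with analytic boundary, and let $\{B_k\}_{k\ge0}$ be either the Szegő polynomials, or the Bergman polynomials, or the Faber polynomials of $E$. If the complex random variables $A_0,A_1,\dots$ satisfy Assumptions 1 and 2, then almost surely the zero counting measures of $P_n(z)=\sum_{k=0}^nA_kB_k(z)$ converge weakly to $\mu_E$ as $n\to\infty$.
   Context: Szegő polynomials: orthonormal polynomials (with $B_k$ of exact degree $k$) with respect to arclength measure $ds$ on $\partial E$. Bergman polynomials: orthonormal polynomials with respect to area measure $dA$ on $E$. Faber polynomials: with $\Phi$ the conformal map of $\overline{\mathbb C}\setminus E$ onto the exterior of the closed unit disk, $\Phi(\infty)=\infty$, $\Phi'(\infty)>0$, the $n$-th Faber polynomial is the polynomial part of the Laurent expansion of $\Phi(z)^n$ at $\infty$. $\mu_E$ is the equilibrium measure of $E$. $F_k(x)=\mathbb P(|A_k|\le x)$; the $A_k$ need not be independent or identically distributed. Assumption 1: there are $a>1$ and a decreasing $f:[a,\infty)\to[0,1]$ with $\int_a^\infty f(x)\,dx/x<\infty$ and $1-F_k(x)\le f(x)$ for all $x\ge a$, $k\ge0$. Assumption 2: there are $0<b<1$ and an increasing $g:[0,b]\to[0,1]$ with $\int_0^b g(x)\,dx/x<\infty$ and $F_k(x)\le g(x)$ for $x\in[0,b]$, $k\ge0$. Zero counting measure: $\tau_n=\frac1n\sum_j\delta_{Z_j}$ over zeros of $P_n$. *)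

theory Defs
  imports "HOL-Probability.Probability"
begin

definition annulus :: "real \<Rightarrow> real \<Rightarrow> complex set" where
  "annulus r R = {z. r < cmod z \<and> cmod z < R}"

text \<open>h parametrizes an analytic Jordan curve h(unit circle): h is holomorphic and
  univalent on an annulus containing the unit circle.\<close>
definition analytic_jordan_param :: "(complex \<Rightarrow> complex) \<Rightarrow> real \<Rightarrow> real \<Rightarrow> bool" where
  "analytic_jordan_param h r R \<longleftrightarrow> 0 \<le> r \<and> r < 1 \<and> 1 < R \<and>
     h holomorphic_on annulus r R \<and> inj_on h (annulus r R)"

text \<open>Szego polynomials: orthonormal w.r.t. arclength on the curve
  t \<mapsto> h(e^{it}), t\<in>[0,2pi]; ds = |h'(e^{it})| dt.\<close>
definition szego_polys :: "(complex \<Rightarrow> complex) \<Rightarrow> (nat \<Rightarrow> complex poly) \<Rightarrow> bool" where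
  "szego_polys h B \<longleftrightarrow> (\<forall>k. degree (B k) = k) \<and>
     (\<forall>j k. (LBINT t=0..2*pi. poly (B j) (h (cis t)) * cnj (poly (B k) (h (cis t)))
                 * complex_of_real (cmod (deriv h (cis t))))
           = (if j = k then 1 else 0))"

definition bergman_polys :: "complex set \<Rightarrow> (nat \<Rightarrow> complex poly) \<Rightarrow> bool" where
  "bergman_polys E B \<longleftrightarrow> (\<forall>k. degree (B k) = k) \<and>
     (\<forall>j k. (LINT z:E|lborel. poly (B j) z * cnj (poly (B k) z)) = (if j = k then 1 else 0))"

text \<open>Exterior conformal map: Phi maps C \ E conformally onto |w| > 1,
  Phi(infinity) = infinity, Phi'(infinity) = lim Phi(z)/z > 0.\<close>
definition exterior_map :: "complex set \<Rightarrow> (complex \<Rightarrow> complex) \<Rightarrow> bool" where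
  "exterior_map E \<Phi> \<longleftrightarrow> \<Phi> holomorphic_on (- E) \<and> inj_on \<Phi> (- E) \<and>
     \<Phi> ` (- E) = {w. 1 < cmod w} \<and>
     (\<exists>c::real. 0 < c \<and> ((\<lambda>z. \<Phi> z / z) \<longlongrightarrow> complex_of_real c) at_infinity)"

text \<open>Faber polynomials: F_n is the polynomial part of the Laurent expansion of
  Phi^n at infinity, i.e. the polynomial with Phi(z)^n - F_n(z) \<rightarrow> 0 as z \<rightarrow> \<infinity>.\<close>
definition faber_polys :: "(complex \<Rightarrow> complex) \<Rightarrow> (nat \<Rightarrow> complex poly) \<Rightarrow> bool" where
  "faber_polys \<Phi> B \<longleftrightarrow> (\<forall>n. ((\<lambda>z. \<Phi> z ^ n - poly (B n) z) \<longlongrightarrow> 0) at_infinity)"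

text \<open>Logarithmic energy of a measure, as an extended real
  (positive part minus negative part of the kernel log 1/|z-w|).\<close>
definition log_energy :: "complex measure \<Rightarrow> ereal" where
  "log_energy \<nu> =
     enn2ereal (\<integral>\<^sup>+ p. (if fst p = snd p then \<infinity> else ennreal (- ln (cmod (fst p - snd p)))) \<partial>(\<nu> \<Otimes>\<^sub>M \<nu>))
   - enn2ereal (\<integral>\<^sup>+ p. (if fst p = snd p then 0 else ennreal (ln (cmod (fst p - snd p)))) \<partial>(\<nu> \<Otimes>\<^sub>M \<nu>))"

definition prob_on :: "complex set \<Rightarrow> complex measure \<Rightarrow> bool" where
  "prob_on E \<nu> \<longleftrightarrow> sets \<nu> = sets borel \<and> prob_space \<nu> \<and> emeasure \<nu> (- E) = 0"

definition equilibrium_measure :: "complex set \<Rightarrow> complex measure \<Rightarrow> bool" where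
  "equilibrium_measure E \<mu> \<longleftrightarrow> prob_on E \<mu> \<and> (\<forall>\<sigma>. prob_on E \<sigma> \<longrightarrow> log_energy \<mu> \<le> log_energy \<sigma>)"

definition zero_count_int :: "nat \<Rightarrow> complex poly \<Rightarrow> (complex \<Rightarrow> real) \<Rightarrow> real" where
  "zero_count_int n p f = (1 / real n) * (\<Sum>z\<in>{z. poly p z = 0}. real (order z p) * f z)"

definition weak_conv_zeros :: "(nat \<Rightarrow> complex poly) \<Rightarrow> complex measure \<Rightarrow> bool" where
  "weak_conv_zeros P \<mu> \<longleftrightarrow> (\<forall>f::complex \<Rightarrow> real. continuous_on UNIV f \<and> bounded (range f) \<longrightarrow>
      (\<lambda>n. zero_count_int n (P n) f) \<longlonglongrightarrow> (\<integral>z. f z \<partial>\<mu>))"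

definition assumption1 :: "'a measure \<Rightarrow> (nat \<Rightarrow> 'a \<Rightarrow> complex) \<Rightarrow> bool" where
  "assumption1 M A \<longleftrightarrow> (\<exists>a::real. \<exists>f::real \<Rightarrow> real. 1 < a \<and> antimono_on {a..} f \<and>
     (\<forall>x\<ge>a. 0 \<le> f x \<and> f x \<le> 1) \<and> set_integrable lborel {a..} (\<lambda>x. f x / x) \<and>
     (\<forall>k x. a \<le> x \<longrightarrow> 1 - measure M {\<omega>\<in>space M. cmod (A k \<omega>) \<le> x} \<le> f x))"

definition assumption2 :: "'a measure \<Rightarrow> (nat \<Rightarrow> 'a \<Rightarrow> complex) \<Rightarrow> bool" where
  "assumption2 M A \<longleftrightarrow> (\<exists>b::real. \<exists>g::real \<Rightarrow> real. 0 < b \<and> b < 1 \<and> mono_on {0..b} g \<and>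
     (\<forall>x\<in>{0..b}. 0 \<le> g x \<and> g x \<le> 1) \<and> set_integrable lborel {0..b} (\<lambda>x. g x / x) \<and>
     (\<forall>k x. 0 \<le> x \<and> x \<le> b \<longrightarrow> measure M {\<omega>\<in>space M. cmod (A k \<omega>) \<le> x} \<le> g x))"

definition random_poly :: "(nat \<Rightarrow> 'a \<Rightarrow> complex) \<Rightarrow> (nat \<Rightarrow> complex poly) \<Rightarrow> 'a \<Rightarrow> nat \<Rightarrow> complex poly" where
  "random_poly A B \<omega> n = (\<Sum>k\<le>n. smult (A k \<omega>) (B k))"

end

theory Submission
  imports Defs "HOL-Complex_Analysis.Complex_Analysis" "HOL-Computational_Algebra.Fundamental_Theorem_Algebra"
begin

text \<open>Let \<open>g\<close> be the Green function of the exterior of \<open>E\<close> with pole at infinity and \<open>c\<close> the capacity.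
  By Borel--Cantelli the coefficients are almost surely nonzero, and together with their inverses of
  subexponential growth. For all three bases \<open>B k\<close> is subexponential on \<open>E\<close> and its leading coefficient is
  at least \<open>c ^ (- k)\<close> up to subexponential factors, so Bernstein--Walsh gives
  \<open>ln |P n| / n \<le> g + o(1)\<close>. Equality is nearly attained at some point outside \<open>E\<close> (Jensen's formula on
  a large circle and the leading coefficient) and at some point of a fixed compact subset of the
  interior: \<open>A 0\<close> is a mean of \<open>P n\<close> over the boundary or over \<open>E\<close>, and analyticity of the boundary allows
  the contour to be moved inside. The defect \<open>g + o(1) - ln |P n| / n\<close> is nonnegative and superharmonic away
  from the curve, so by the sub-mean value property it tends to zero locally in \<open>L\<^sup>1\<close>. Taking Laplacians,
  that is comparing circular means of radii \<open>s\<close> and \<open>s / 2\<close>, the zero counting measures converge to the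
  measure with potential \<open>g + ln c\<close>. This is the energy minimizer: the defect of energy between it and the
  level curve measures of \<open>g\<close>, which is an integral of squares of Gaussian convolutions, tends to zero.\<close>

section \<open>Circular means\<close>

text \<open>The growth bound alone does not decide the limit: on the unit disk \<open>z ^ n\<close>
  has the right growth outside, yet all its zeros sit at \<open>0\<close>. A lower bound inside
  \<open>E\<close> excludes this, and it must hold at points staying in a fixed compact part of
  \<open>interior E\<close>, because smallness of the defect spreads only through a connected open
  set on which \<open>green\<close> is harmonic. Hence \<open>admissible\<close> asks that the
  coefficient of \<open>B 0\<close> be controlled by the polynomial on such a compact set. The
  measure \<mu> is given only as a minimizer of \<open>log_energy\<close>. Its potential is found by
  comparison with explicit measures: the level curve measures lie outside \<open>E\<close>, but
  pulling one of them into \<open>E\<close> while shrinking distances by at most a factor near one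
  gives a competitor of almost the same energy, and so the upper bound \<open>- ln (cmod c)\<close>
  for the energy of \<mu>. The exterior is described by \<open>kap\<close>, with values in the
  punctured disk, so that infinity becomes the origin and is handled as a removable
  singularity.\<close>

definition uI :: "real measure" where
  "uI = density lborel (indicator {0..1})"

text \<open>The parameter interval is \<open>{0..1}\<close>, as for \<open>circlepath\<close>, so a
  mean over \<open>uI\<close> and a contour integral share one parametrization.\<close>

definition ucis :: "real \<Rightarrow> complex" where
  "ucis x = cis (2 * pi * x)"

abbreviation circ :: "real \<Rightarrow> real \<Rightarrow> complex" where
  "circ s x \<equiv> of_real s * ucis x"

lemma sets_uI [simp, measurable_cong]: "sets uI = sets borel"
  by (simp add: uI_def)

lemma space_uI [simp]: "space uI = UNIV"
  by (simp add: uI_def)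

lemma prob_space_uI: "prob_space uI"
  by (rule prob_spaceI) (simp add: uI_def emeasure_density)

interpretation uI: prob_space uI
  by (rule prob_space_uI)

lemma norm_ucis [simp]: "cmod (ucis x) = 1"
  by (simp add: ucis_def)

lemma ucis_nonzero [simp]: "ucis x \<noteq> 0"
  by (simp add: ucis_def)

lemma ucis_exp: "ucis x = exp (2 * of_real pi * \<i> * of_real x)"
  by (simp add: ucis_def cis_conv_exp mult_ac)

lemma continuous_on_ucis [continuous_intros]: "continuous_on A ucis"
  unfolding ucis_exp by (intro continuous_intros)

lemma measurable_ucis [measurable]: "ucis \<in> borel_measurable borel"
  by (intro borel_measurable_continuous_onI continuous_on_ucis)

lemma AE_uI: "(AE x in uI. P x) \<longleftrightarrow> (AE x in lborel. x \<in> {0..1} \<longrightarrow> P x)"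
  unfolding uI_def by (subst AE_density) (auto simp: indicator_def intro!: AE_cong split: if_splits)

lemma integrable_uI_continuous:
  fixes f :: "real \<Rightarrow> 'a::{banach, second_countable_topology}"
  assumes "continuous_on UNIV f"
  shows "integrable uI f"
proof -
  have "set_integrable lborel {0..1} f"
    by (intro borel_integrable_atLeastAtMost' continuous_on_subset[OF assms]) auto
  moreover have "f \<in> borel_measurable borel"
    by (intro borel_measurable_continuous_onI assms)
  ultimately show ?thesis
    unfolding uI_def
    by (subst integrable_density[where g = "indicator {0..1}", simplified ennreal_indicator])
       (auto simp: set_integrable_def)
qed

lemma has_integral_uI:
  fixes f :: "real \<Rightarrow> 'a::euclidean_space"
  assumes "continuous_on UNIV f"
  shows "(f has_integral (LINT x|uI. f x)) {0..1}"
proof -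
  have i: "set_integrable lborel {0..1} f"
    by (intro borel_integrable_atLeastAtMost' continuous_on_subset[OF assms]) auto
  have m: "f \<in> borel_measurable borel"
    by (intro borel_measurable_continuous_onI assms)
  have "(LINT x|uI. f x) = (LINT x:{0..1}|lborel. f x)"
    unfolding uI_def set_lebesgue_integral_def
    by (subst integral_density[where g = "indicator {0..1}", simplified ennreal_indicator])
       (use m in auto)
  then show ?thesis
    using set_borel_integral_eq_integral[OF i] by (simp add: has_integral_iff)
qed

lemma continuous_on_circle:
  assumes "continuous_on (sphere z s) F" "0 \<le> s"
  shows "continuous_on A (\<lambda>x. F (z + circ s x))"
  by (rule continuous_on_compose2[OF assms(1)])
     (use assms(2) in \<open>auto intro!: continuous_intros simp: dist_norm norm_mult\<close>)

lemma integrable_circle: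
  fixes F :: "complex \<Rightarrow> 'a::{banach, second_countable_topology}"
  assumes "continuous_on (sphere z s) F" "0 \<le> s"
  shows "integrable uI (\<lambda>x. F (z + circ s x))"
  by (intro integrable_uI_continuous continuous_on_circle assms)

text \<open>On the circle \<open>du / (u - z)\<close> is \<open>2 * pi * i\<close> times the
  parameter measure. Through this identity Cauchy's theorem and formula act on means, which combine
  well with Fubini and with norm estimates.\<close>

lemma circlepath_mean:
  assumes "continuous_on (sphere z s) F" "0 < s"
  shows "((\<lambda>u. F u / (u - z)) has_contour_integral
            (2 * of_real pi * \<i> * (LINT x|uI. F (z + circ s x)))) (circlepath z s)"
proof -
  have "((\<lambda>x. F (z + circ s x)) has_integral (LINT x|uI. F (z + circ s x))) {0..1}"
    by (intro has_integral_uI continuous_on_circle assms) (use assms in auto)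
  then have "((\<lambda>x. 2 * of_real pi * \<i> * F (z + circ s x)) has_integral
      2 * of_real pi * \<i> * (LINT x|uI. F (z + circ s x))) {0..1}"
    by (rule has_integral_mult_right)
  then show ?thesis
    unfolding has_contour_integral vector_derivative_circlepath
    by (rule has_integral_eq[rotated])
       (use assms in \<open>auto simp: circlepath ucis_exp\<close>)
qed

lemma mean_holomorphic:
  assumes "f holomorphic_on ball z R" "0 \<le> s" "s < R"
  shows "(LINT x|uI. f (z + circ s x)) = f z"
proof (cases "s = 0")
  case True
  then show ?thesis by (simp add: uI.prob_space[unfolded space_uI])
next
  case False
  have h: "f holomorphic_on cball z s"
    by (rule holomorphic_on_subset[OF assms(1)]) (use assms in auto)
  have "continuous_on (sphere z s) f"
    using holomorphic_on_imp_continuous_on[OF h] by (rule continuous_on_subset) auto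
  from circlepath_mean[OF this] False assms
  have "((\<lambda>u. f u / (u - z)) has_contour_integral
            (2 * of_real pi * \<i> * (LINT x|uI. f (z + circ s x)))) (circlepath z s)" by simp
  from has_contour_integral_unique[OF this Cauchy_integral_circlepath_simple[OF h, of z]] False assms
  show ?thesis by simp
qed

lemma holomorphic_continuous:
  assumes "f holomorphic_on A" "B \<subseteq> A"
  shows "continuous_on B f"
  using continuous_on_subset[OF holomorphic_on_imp_continuous_on] assms .

text \<open>Serves wherever infinity has been moved to the origin: there a function is known only
  through a limit.\<close>

lemma holomorphic_removable:
  assumes f: "f holomorphic_on (ball 0 e - {0})" and l: "(f \<longlongrightarrow> l) (at 0)"
  shows "(\<lambda>t. if t = 0 then l else f t) holomorphic_on ball 0 e"
proof (rule no_isolated_singularity'[where K = "{0}"])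
  show "(\<lambda>t. if t = 0 then l else f t) holomorphic_on (ball 0 e - {0})"
    using f by (rule holomorphic_transform) auto
  have "((\<lambda>t. if t = 0 then l else f t) \<longlongrightarrow> l) (at 0)"
    using l by (rule Lim_transform_eventually) (auto simp: eventually_at_filter)
  then show "((\<lambda>t. if t = 0 then l else f t) \<longlongrightarrow> (if z = 0 then l else f z)) (at z within ball 0 e)" if "z \<in> {0}" for z
    using that by (auto intro: tendsto_within_subset)
qed auto

lemma compact_norm_bound:
  fixes f :: "complex \<Rightarrow> complex"
  assumes "compact S" "continuous_on S f"
  obtains b where "0 < b" "\<And>x. x \<in> S \<Longrightarrow> cmod (f x) \<le> b"
proof -
  have "bounded (f ` S)" by (intro compact_imp_bounded compact_continuous_image assms)
  then obtain b where b: "\<And>x. x \<in> S \<Longrightarrow> cmod (f x) \<le> b" unfolding bounded_iff by blast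
  have "cmod (f x) \<le> max b 1" if "x \<in> S" for x using b[OF that] by (simp add: max.coboundedI1)
  then show ?thesis using that[of "max b 1"] by simp
qed

lemma open_annulus: "open (annulus r R)"
proof -
  have "annulus r R = {z. r < cmod z} \<inter> {z. cmod z < R}" by (auto simp: annulus_def)
  then show ?thesis by (auto intro!: open_Int open_Collect_less continuous_intros)
qed

text \<open>Division by \<open>u\<close> turns the mean into a contour integral, and the two circles
  are homotopic along radii inside the annulus. This is the device by which integrals over the
  boundary curve are later moved inside \<open>E\<close>.\<close>

lemma mean_annulus_radius:
  assumes F: "F holomorphic_on annulus r R" and s: "r < s" "s < R" and t: "r < t" "t < R"
    and r: "0 \<le> r"
  shows "(LINT x|uI. F (circ s x)) = (LINT x|uI. F (circ t x))"
proof -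
  have c: "continuous_on (sphere 0 a) F" if "r < a" "a < R" for a
    using holomorphic_on_imp_continuous_on[OF F] by (rule continuous_on_subset) (use that in \<open>auto simp: annulus_def\<close>)
  have hol: "(\<lambda>u. F u / (u - 0)) holomorphic_on annulus r R"
    using r by (intro holomorphic_intros F) (auto simp: annulus_def)
  have "homotopic_loops (annulus r R) (circlepath 0 s) (circlepath 0 t)"
  proof (rule homotopic_loops_linear)
    fix x :: real
    have "closed_segment (circlepath 0 s x) (circlepath 0 t x) \<subseteq> annulus r R"
    proof
      fix z assume "z \<in> closed_segment (circlepath 0 s x) (circlepath 0 t x)"
      then obtain u where u: "0 \<le> u" "u \<le> 1" "z = (1 - u) *\<^sub>R circlepath 0 s x + u *\<^sub>R circlepath 0 t x"
        by (auto simp: closed_segment_def)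
      have "z = circ ((1 - u) * s + u * t) x"
        using u(3) by (simp add: circlepath ucis_exp scaleR_conv_of_real algebra_simps)
      then have n: "cmod z = \<bar>(1 - u) * s + u * t\<bar>" by (simp add: norm_mult del: of_real_add of_real_mult)
      have "r < (1 - u) * s + u * t"
        using convex_bound_lt[of "-s" "-r" "-t" "1-u" u] u s t by simp
      moreover have "(1 - u) * s + u * t < R"
        using convex_bound_lt[of s R t "1-u" u] u s t by simp
      ultimately show "z \<in> annulus r R" using n r by (simp add: annulus_def)
    qed
    then show "closed_segment (circlepath 0 s x) (circlepath 0 t x) \<subseteq> annulus r R" .
  qed auto
  from Cauchy_theorem_homotopic_loops[OF this open_annulus hol]
  have "contour_integral (circlepath 0 s) (\<lambda>u. F u / (u - 0)) = contour_integral (circlepath 0 t) (\<lambda>u. F u / (u - 0))"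
    by simp
  with circlepath_mean[OF c[OF s]] circlepath_mean[OF c[OF t]] s t r show ?thesis
    by (auto dest!: contour_integral_unique)
qed

text \<open>A zero-free function on a ball has a holomorphic logarithm, whose real part obeys the
  mean value property.\<close>

lemma mean_ln_nonvanishing:
  assumes f: "f holomorphic_on ball z R" and nz: "\<And>w. w \<in> ball z R \<Longrightarrow> f w \<noteq> 0" and s: "0 \<le> s" "s < R"
  shows "(LINT x|uI. ln (cmod (f (z + circ s x)))) = ln (cmod (f z))"
proof -
  obtain l where l: "l holomorphic_on ball z R" "\<And>w. w \<in> ball z R \<Longrightarrow> f w = exp (l w)"
    using contractible_imp_holomorphic_log[OF f convex_imp_contractible[OF convex_ball] nz] by metis
  have eq: "ln (cmod (f w)) = Re (l w)" if "w \<in> ball z R" for w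
    using l(2)[OF that] by simp
  have in_ball: "z + circ s x \<in> ball z R" for x
    using s by (simp add: dist_norm norm_mult)
  have c: "continuous_on (sphere z s) l"
    by (rule holomorphic_continuous[OF l(1)]) (use s in auto)
  have "(LINT x|uI. ln (cmod (f (z + circ s x)))) = (LINT x|uI. Re (l (z + circ s x)))"
    using eq in_ball by simp
  also have "\<dots> = Re (LINT x|uI. l (z + circ s x))"
    by (intro integral_Re integrable_circle c s)
  also have "\<dots> = ln (cmod (f z))"
    using mean_holomorphic[OF l(1) s] eq[of z] s by simp
  finally show ?thesis .
qed

lemma ucis_eq_AE: "AE x in uI. ucis x \<noteq> a"
proof -
  have "finite {x \<in> {0..1}. ucis x = a}"
  proof (cases "\<exists>y\<in>{0..1}. ucis y = a")
    case True
    then obtain y where y: "ucis y = a" "y \<in> {0..1}" by blast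
    \<comment> \<open>Parameters with the same image differ by an integer, which inside
      \<open>{0..1}\<close> is at most one in absolute value; both endpoints belong to the interval,
      hence three candidates.\<close>
    have "{x \<in> {0..1}. ucis x = a} \<subseteq> {y, y + 1, y - 1}"
    proof
      fix x assume "x \<in> {x \<in> {0..1}. ucis x = a}"
      then have x: "x \<in> {0..1}" "ucis x = ucis y" using y by auto
      then obtain n :: int where "2 * of_real pi * \<i> * of_real x = 2 * of_real pi * \<i> * of_real y + of_real (real_of_int (2 * n) * pi) * \<i>"
        unfolding ucis_exp exp_eq by blast
      then have "2 * of_real pi * \<i> * of_real x = 2 * of_real pi * \<i> * (of_real (y + of_int n) :: complex)"
        by (simp add: algebra_simps)
      then have "(of_real x :: complex) = of_real (y + of_int n)"
        by (metis mult_cancel_left of_real_eq_0_iff pi_neq_zero complex_i_not_zero zero_neq_numeral no_zero_divisors)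
      then have xn: "x = y + of_int n" unfolding of_real_eq_iff .
      then have "-1 \<le> n" "n \<le> 1" using x y by auto
      then have "n = -1 \<or> n = 0 \<or> n = 1" by auto
      with xn show "x \<in> {y, y + 1, y - 1}" by auto
    qed
    then show ?thesis by (rule finite_subset) auto
  next
    case False
    then have "{x \<in> {0..1}. ucis x = a} = {}" by auto
    then show ?thesis by (simp only: finite.emptyI)
  qed
  then have "{x \<in> {0..1}. ucis x = a} \<in> null_sets lborel"
    by (rule finite_imp_null_set_lborel)
  then show ?thesis
    unfolding AE_uI by (rule AE_I') auto
qed

text \<open>On the unit circle \<open>cmod (ucis x - a) = cmod (1 - cnj a * ucis x)\<close>: the
  reflected factor has no zero in the closed disk and equals \<open>1\<close> at the origin.\<close>

lemma mean_ln_circle_aux: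
  assumes a: "cmod a < 1"
  shows "(LINT x|uI. ln (cmod (ucis x - a))) = 0" "integrable uI (\<lambda>x. ln (cmod (ucis x - a)))"
proof -
  have e: "cmod (ucis x - a) = cmod (1 - cnj a * ucis x)" for x
  proof -
    have "cmod (ucis x - a) = cmod (cnj (ucis x) * (ucis x - a))" by (simp add: norm_mult)
    also have "cnj (ucis x) * (ucis x - a) = cnj (1 - cnj a * ucis x)"
      using complex_norm_square[of "ucis x"] by (simp add: algebra_simps)
    finally show ?thesis by (simp only: complex_mod_cnj)
  qed
  obtain R where R: "1 < R" "cmod a * R < 1"
  proof (cases "a = 0")
    case True then show ?thesis using that[of 2] by simp
  next
    case False
    obtain R where "1 < R" "R < 1 / cmod a" using dense[of 1 "1 / cmod a"] a False by auto
    then show ?thesis using that[of R] False by (simp add: field_simps)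
  qed
  have nz: "1 - cnj a * w \<noteq> 0" if "w \<in> ball 0 R" for w
  proof
    assume "1 - cnj a * w = 0"
    then have "cmod (cnj a * w) = 1" by (metis eq_iff_diff_eq_0 norm_one)
    moreover have "cmod (cnj a * w) \<le> cmod a * R"
      using that by (auto simp: norm_mult intro!: mult_left_mono)
    ultimately show False using R by simp
  qed
  have "(LINT x|uI. ln (cmod ((\<lambda>w. 1 - cnj a * w) (0 + circ 1 x)))) = ln (cmod (1 - cnj a * 0))"
    by (rule mean_ln_nonvanishing[where R = R]) (use nz R in \<open>auto intro!: holomorphic_intros\<close>)
  then show "(LINT x|uI. ln (cmod (ucis x - a))) = 0" by (simp add: e)
  have "ucis x \<noteq> a" for x using a norm_ucis[of x] by auto
  then show "integrable uI (\<lambda>x. ln (cmod (ucis x - a)))"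
    by (intro integrable_uI_continuous continuous_intros continuous_on_ln) (auto simp: )
qed

text \<open>The singular case is a limit of \<open>mean_ln_circle_aux\<close> as \<open>a\<close> is
  approached along its radius. Fatou's lemma gives integrability from the vanishing means; the
  comparison \<open>low\<close>, by which the distance to \<open>a\<close> is at most twice that to
  the shifted point, then supplies the dominating function.\<close>

lemma mean_ln_circle_boundary:
  assumes a: "cmod a = 1"
  shows "(LINT x|uI. ln (cmod (ucis x - a))) = 0" "integrable uI (\<lambda>x. ln (cmod (ucis x - a)))"
proof -
  define r where "r n = 1 - 1 / (real n + 2)" for n :: nat
  have r: "0 \<le> r n" "r n < 1" for n by (auto simp: r_def field_simps)
  have rlim: "r \<longlonglongrightarrow> 1"
    unfolding r_def by real_asymp
  define \<phi> where "\<phi> n x = ln (cmod (ucis x - of_real (r n) * a))" for n x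
  have m: "(LINT x|uI. \<phi> n x) = 0" "integrable uI (\<phi> n)" for n
    unfolding \<phi>_def using mean_ln_circle_aux[of "of_real (r n) * a"] a r[of n] by (auto simp: norm_mult)
  have ne: "ucis x \<noteq> of_real (r n) * a" for x n
  proof
    assume "ucis x = of_real (r n) * a"
    then have "cmod (ucis x) = r n" using a r[of n] by (simp add: norm_mult)
    then show False using r[of n] by simp
  qed
  have low: "cmod (ucis x - a) \<le> 2 * cmod (ucis x - of_real (r n) * a)" for n x
  proof -
    have "cmod (ucis x - a) \<le> cmod (ucis x - of_real (r n) * a) + cmod (of_real (r n) * a - a)"
      using norm_triangle_ineq[of "ucis x - of_real (r n) * a" "of_real (r n) * a - a"] by simp
    also have "of_real (r n) * a - a = of_real (r n - 1) * a" by (simp add: algebra_simps)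
    also have "cmod (of_real (r n - 1) * a) = 1 - r n" using a r[of n] by (simp add: norm_mult del: of_real_diff)
    also have "1 - r n \<le> cmod (ucis x - of_real (r n) * a)"
      using norm_triangle_ineq2[of "ucis x" "of_real (r n) * a"] a r[of n] by (simp add: norm_mult)
    finally show ?thesis by simp
  qed
  have up: "\<phi> n x \<le> ln 2" for n x
  proof -
    have "cmod (ucis x - of_real (r n) * a) \<le> 2"
      using norm_triangle_ineq4[of "ucis x" "of_real (r n) * a"] a r[of n] by (simp add: norm_mult)
    then show ?thesis unfolding \<phi>_def using ne[of x n] by simp
  qed
  have lim: "AE x in uI. (\<lambda>n. \<phi> n x) \<longlonglongrightarrow> ln (cmod (ucis x - a))"
    using ucis_eq_AE[of a]
  proof eventually_elim
    case (elim x)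
    have "(\<lambda>n. cmod (ucis x - of_real (r n) * a)) \<longlonglongrightarrow> cmod (ucis x - of_real 1 * a)"
      by (intro tendsto_intros rlim)
    then show ?case unfolding \<phi>_def using elim by (intro tendsto_ln) auto
  qed
  have "(\<integral>\<^sup>+x. ennreal (ln 2 - ln (cmod (ucis x - a))) \<partial>uI) = (\<integral>\<^sup>+x. liminf (\<lambda>n. ennreal (ln 2 - \<phi> n x)) \<partial>uI)"
  proof (rule nn_integral_cong_AE, use lim in eventually_elim)
    case (elim x)
    then have "(\<lambda>n. ennreal (ln 2 - \<phi> n x)) \<longlonglongrightarrow> ennreal (ln 2 - ln (cmod (ucis x - a)))"
      by (intro tendsto_intros)
    then show ?case by (simp add: lim_imp_Liminf)
  qed
  also have "\<dots> \<le> liminf (\<lambda>n. \<integral>\<^sup>+x. ennreal (ln 2 - \<phi> n x) \<partial>uI)"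
    by (intro nn_integral_liminf) (simp add: \<phi>_def)
  also have "(\<lambda>n. \<integral>\<^sup>+x. ennreal (ln 2 - \<phi> n x) \<partial>uI) = (\<lambda>n. ennreal (ln 2))"
  proof
    fix n
    have "(\<integral>\<^sup>+x. ennreal (ln 2 - \<phi> n x) \<partial>uI) = ennreal (LINT x|uI. ln 2 - \<phi> n x)"
      using up[of n] m[of n] by (intro nn_integral_eq_integral) auto
    then show "(\<integral>\<^sup>+x. ennreal (ln 2 - \<phi> n x) \<partial>uI) = ennreal (ln 2)"
      using m[of n] uI.prob_space by simp
  qed
  finally have fin: "(\<integral>\<^sup>+x. ennreal (ln 2 - ln (cmod (ucis x - a))) \<partial>uI) < \<infinity>"
    by (auto simp: le_less_trans Liminf_const)
  have up2: "ln (cmod (ucis x - a)) \<le> ln 2" for x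
  proof (cases "ucis x = a")
    case False
    have "cmod (ucis x - a) \<le> 2" using norm_triangle_ineq4[of "ucis x" a] a by simp
    then show ?thesis using False by simp
  qed simp
  have i2: "integrable uI (\<lambda>x. ln 2 - ln (cmod (ucis x - a)))"
    using fin up2 by (intro integrableI_nonneg) auto
  have "integrable uI (\<lambda>x. ln 2 - (ln 2 - ln (cmod (ucis x - a))))"
    by (intro Bochner_Integration.integrable_diff i2) simp
  then show int: "integrable uI (\<lambda>x. ln (cmod (ucis x - a)))" by simp
  have "(\<lambda>n. LINT x|uI. \<phi> n x) \<longlonglongrightarrow> (LINT x|uI. ln (cmod (ucis x - a)))"
  proof (rule integral_dominated_convergence[where w = "\<lambda>x. \<bar>ln (cmod (ucis x - a))\<bar> + ln 2"])
    show "integrable uI (\<lambda>x. \<bar>ln (cmod (ucis x - a))\<bar> + ln 2)"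
      using int by auto
    show "AE x in uI. norm (\<phi> n x) \<le> \<bar>ln (cmod (ucis x - a))\<bar> + ln 2" for n
      using ucis_eq_AE[of a]
    proof eventually_elim
      case (elim x)
      have "ln (cmod (ucis x - a)) \<le> ln (2 * cmod (ucis x - of_real (r n) * a))"
        using low[of x n] elim by (intro ln_mono) auto
      also have "\<dots> = ln 2 + \<phi> n x" unfolding \<phi>_def using ne[of x n] by (subst ln_mult) auto
      finally show ?case using up[of n x] by auto
    qed
  qed (use lim in \<open>auto simp: \<phi>_def\<close>)
  moreover have "(\<lambda>n. LINT x|uI. \<phi> n x) = (\<lambda>n. 0)" using m by auto
  ultimately show "(LINT x|uI. ln (cmod (ucis x - a))) = 0"
    by (simp add: LIMSEQ_const_iff)
qed

text \<open>The potential of the uniform measure on a circle: constant inside, that of a point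
  charge outside. Rescaling to the unit circle leaves three positions of \<open>a\<close>; if it
  lies outside, the integrand is the logarithm of a function that is zero-free on a larger
  ball.\<close>

lemma mean_ln_circle:
  assumes s: "0 < s"
  shows "(LINT x|uI. ln (cmod (c + circ s x - a))) = ln (max s (cmod (c - a)))" (is ?A)
    and "integrable uI (\<lambda>x. ln (cmod (c + circ s x - a)))" (is ?B)
proof -
  define b where "b = (a - c) / of_real s"
  have eq: "cmod (c + circ s x - a) = s * cmod (ucis x - b)" for x
  proof -
    have "c + circ s x - a = of_real s * (ucis x - b)" using s by (simp add: b_def field_simps)
    then show ?thesis using s by (simp add: norm_mult)
  qed
  have ca: "cmod (c - a) = s * cmod b" using s by (simp add: b_def norm_divide norm_minus_commute)
  have split: "AE x in uI. ln (cmod (c + circ s x - a)) = ln s + ln (cmod (ucis x - b))"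
    using ucis_eq_AE[of b] by eventually_elim (use s in \<open>simp add: eq ln_mult\<close>)
  have *: "(LINT x|uI. ln (cmod (ucis x - b))) = ln (max 1 (cmod b)) \<and> integrable uI (\<lambda>x. ln (cmod (ucis x - b)))"
  proof -
    consider "cmod b < 1" | "cmod b = 1" | "cmod b > 1" by linarith
    then show ?thesis
    proof cases
      case 1 then show ?thesis using mean_ln_circle_aux[OF 1] by simp
    next
      case 2 then show ?thesis using mean_ln_circle_boundary[OF 2] by simp
    next
      case 3
      have "(LINT x|uI. ln (cmod ((\<lambda>w. w - b) (0 + circ 1 x)))) = ln (cmod (0 - b))"
        by (rule mean_ln_nonvanishing[where R = "cmod b"]) (use 3 in \<open>auto intro!: holomorphic_intros\<close>)
      moreover have "ucis x \<noteq> b" for x using 3 norm_ucis[of x] by auto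
      then have "integrable uI (\<lambda>x. ln (cmod (ucis x - b)))"
        by (intro integrable_uI_continuous continuous_intros continuous_on_ln) auto
      ultimately show ?thesis using 3 by simp
    qed
  qed
  show ?B
    by (subst integrable_cong_AE[OF _ _ split]) (use * in auto)
  have "(LINT x|uI. ln (cmod (c + circ s x - a))) = (LINT x|uI. ln s + ln (cmod (ucis x - b)))"
    by (intro integral_cong_AE split) auto
  also have "\<dots> = ln s + ln (max 1 (cmod b))"
    using * uI.prob_space by simp
  also have "\<dots> = ln (s * max 1 (cmod b))" using s by (subst ln_mult) auto
  also have "s * max 1 (cmod b) = max s (cmod (c - a))" using s by (simp add: ca max_mult_distrib_left)
  finally show ?A .
qed

lemma borel_measurable_poly [measurable]:
  fixes p :: "complex poly"
  assumes [measurable]: "f \<in> borel_measurable M"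
  shows "(\<lambda>x. poly p (f x)) \<in> borel_measurable M"
  by (rule measurable_compose[OF assms borel_measurable_continuous_onI])
     (intro continuous_on_poly continuous_on_id)

text \<open>At a root the convention \<open>ln 0 = 0\<close> would break the identity, so it is
  restricted to other points; on a circle this costs only a null set.\<close>

lemma ln_poly_decompose:
  fixes p :: "complex poly"
  assumes "poly p z \<noteq> 0"
  shows "ln (cmod (poly p z)) = ln (cmod (lead_coeff p)) + (\<Sum>a\<in>{a. poly p a = 0}. real (order a p) * ln (cmod (z - a)))"
proof -
  have p: "p \<noteq> 0" using assms by auto
  have fin: "finite {a. poly p a = 0}" by (rule poly_roots_finite[OF p])
  have "poly p z = lead_coeff p * (\<Prod>a\<in>{a. poly p a = 0}. (z - a) ^ order a p)"
    by (subst complex_poly_decompose[symmetric]) (simp add: poly_prod)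
  then have "cmod (poly p z) = cmod (lead_coeff p) * (\<Prod>a\<in>{a. poly p a = 0}. cmod (z - a) ^ order a p)"
    by (simp add: norm_mult prod_norm[symmetric] norm_power)
  also have "ln \<dots> = ln (cmod (lead_coeff p)) + ln (\<Prod>a\<in>{a. poly p a = 0}. cmod (z - a) ^ order a p)"
    using p assms by (subst ln_mult) (auto simp: prod_zero_iff[OF fin])
  also have "ln (\<Prod>a\<in>{a. poly p a = 0}. cmod (z - a) ^ order a p) = (\<Sum>a\<in>{a. poly p a = 0}. real (order a p) * ln (cmod (z - a)))"
    using assms by (subst ln_prod[OF fin]) (auto intro!: sum.cong simp: ln_realpow)
  finally show ?thesis .
qed

lemma poly_circle_nonzero_AE:
  fixes p :: "complex poly"
  assumes "p \<noteq> 0" "0 < s"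
  shows "AE x in uI. poly p (c + circ s x) \<noteq> 0"
proof -
  have fin: "finite {a. poly p a = 0}" by (rule poly_roots_finite[OF assms(1)])
  have "AE x in uI. \<forall>a\<in>{a. poly p a = 0}. ucis x \<noteq> (a - c) / of_real s"
    by (rule AE_finite_allI[OF fin]) (rule ucis_eq_AE)
  then show ?thesis
    by eventually_elim (use assms(2) in \<open>auto simp: field_simps\<close>)
qed

text \<open>Jensen's formula, root by root from \<open>mean_ln_circle\<close>. Roots on the circle
  itself are covered, so every radius may be used.\<close>

lemma mean_ln_poly:
  fixes p :: "complex poly"
  assumes p: "p \<noteq> 0" and s: "0 < s"
  shows "(LINT x|uI. ln (cmod (poly p (c + circ s x)))) =
      ln (cmod (lead_coeff p)) + (\<Sum>a\<in>{a. poly p a = 0}. real (order a p) * ln (max s (cmod (c - a))))" (is ?A)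
    and "integrable uI (\<lambda>x. ln (cmod (poly p (c + circ s x))))" (is ?B)
proof -
  let ?g = "\<lambda>x. ln (cmod (lead_coeff p)) + (\<Sum>a\<in>{a. poly p a = 0}. real (order a p) * ln (cmod (c + circ s x - a)))"
  have ae: "AE x in uI. ln (cmod (poly p (c + circ s x))) = ?g x"
    using poly_circle_nonzero_AE[OF p s] by eventually_elim (rule ln_poly_decompose)
  have m: "(\<lambda>x. ln (cmod (poly p (c + circ s x)))) \<in> borel_measurable uI"
    by measurable
  have i: "integrable uI ?g"
    by (intro Bochner_Integration.integrable_add Bochner_Integration.integrable_sum integrable_mult_right mean_ln_circle s) simp
  show ?B by (subst integrable_cong_AE[OF m _ ae]) (use i in auto)
  have "(LINT x|uI. ln (cmod (poly p (c + circ s x)))) = (LINT x|uI. ?g x)"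
    by (rule integral_cong_AE[OF m _ ae]) (use i in auto)
  also have "\<dots> = ln (cmod (lead_coeff p)) + (\<Sum>a\<in>{a. poly p a = 0}. real (order a p) * ln (max s (cmod (c - a))))"
    using mean_ln_circle[OF s, of c] uI.prob_space by simp
  finally show ?A .
qed

section \<open>Area means\<close>

text \<open>Determinants and orthogonal maps live on \<open>real^2\<close>; \<open>vc\<close> and
  \<open>cv\<close> carry facts about Lebesgue measure from there to the complex plane.\<close>

definition vc :: "real^2 \<Rightarrow> complex" where
  "vc v = Complex (v$1) (v$2)"

definition cv :: "complex \<Rightarrow> real^2" where
  "cv z = (\<chi> i. if i = 1 then Re z else Im z)"

lemma cv_nth [simp]: "cv z $ 1 = Re z" "cv z $ 2 = Im z"
  by (auto simp: cv_def)

lemma vc_cv [simp]: "vc (cv z) = z"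
  by (simp add: vc_def)

lemma cv_vc [simp]: "cv (vc v) = v"
  by (simp add: vec_eq_iff forall_2 vc_def)

lemma bounded_linear_vc: "bounded_linear vc"
  by (rule linear_conv_bounded_linear[THEN iffD1], rule linearI) (auto simp: vc_def complex_eq_iff)

lemma bounded_linear_cv: "bounded_linear cv"
  by (rule linear_conv_bounded_linear[THEN iffD1], rule linearI) (auto simp: vec_eq_iff forall_2)

lemma measurable_vc [measurable]: "vc \<in> borel_measurable borel"
  by (intro borel_measurable_continuous_onI bounded_linear.continuous_on[OF bounded_linear_vc] continuous_on_id)

lemma measurable_cv [measurable]: "cv \<in> borel_measurable borel"
  by (intro borel_measurable_continuous_onI bounded_linear.continuous_on[OF bounded_linear_cv] continuous_on_id)

lemma vc_vimage_box: "vc -` box l u = box (cv l) (cv u)"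
  by (auto simp: vc_def mem_box_cart in_box_complex_iff forall_2)

lemma emeasure_box_cv:
  assumes "Re l \<le> Re u" "Im l \<le> Im u"
  shows "emeasure lborel (box (cv l) (cv u)) = ennreal ((Re u - Re l) * (Im u - Im l))"
proof -
  have "\<forall>b\<in>Basis. cv l \<bullet> b \<le> cv u \<bullet> b"
    using assms by (auto simp: Basis_vec_def inner_axis forall_2)
  then have "emeasure lborel (box (cv l) (cv u)) = (\<Prod>b\<in>Basis. (cv u - cv l) \<bullet> b)"
    by (intro emeasure_lborel_box) auto
  also have "(\<Prod>b\<in>Basis. (cv u - cv l) \<bullet> b) = (\<Prod>i\<in>UNIV. (cv u - cv l) $ i)"
  proof -
    have B: "(Basis :: (real^2) set) = (\<lambda>i. axis i 1) ` UNIV"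
      by (auto simp: Basis_vec_def)
    have "inj (\<lambda>i. axis i (1::real) :: real^2)" by (auto simp: inj_on_def axis_eq_axis)
    then show ?thesis unfolding B by (subst prod.reindex) (auto simp: inner_axis)
  qed
  also have "\<dots> = (Re u - Re l) * (Im u - Im l)" by (simp add: UNIV_2)
  finally show ?thesis .
qed

lemma lborel_complex_eq: "(lborel :: complex measure) = distr lborel borel vc"
proof (rule lborel_eqI)
  fix l u :: complex
  assume b: "\<And>b. b \<in> Basis \<Longrightarrow> l \<bullet> b \<le> u \<bullet> b"
  have lu: "Re l \<le> Re u" "Im l \<le> Im u" using b[of 1] b[of \<i>] by (auto simp: Basis_complex_def)
  have "emeasure (distr lborel borel vc) (box l u) = emeasure lborel (box (cv l) (cv u))"
    by (subst emeasure_distr) (auto simp: vc_vimage_box)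
  also have "\<dots> = ennreal ((Re u - Re l) * (Im u - Im l))" by (rule emeasure_box_cv[OF lu])
  also have "(Re u - Re l) * (Im u - Im l) = (\<Prod>b\<in>Basis. (u - l) \<bullet> b)"
    by (simp add: Basis_complex_def)
  finally show "emeasure (distr lborel borel vc) (box l u) = ennreal (\<Prod>b\<in>Basis. (u - l) \<bullet> b)" .
qed simp

lemma orthogonal_rotation:
  assumes "cmod c = 1"
  shows "orthogonal_transformation (\<lambda>v. cv (c * vc v))"
proof -
  have "linear (\<lambda>v. cv (c * vc v))"
    using bounded_linear_compose[OF bounded_linear_cv bounded_linear_compose[OF bounded_linear_mult_right[of c] bounded_linear_vc]]
    by (simp add: bounded_linear.linear)
  moreover have "norm (cv z) = cmod z" for z
    by (simp add: norm_vec_def L2_set_def UNIV_2 cmod_def)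
  moreover have "cmod (vc v) = norm v" for v
    by (simp add: norm_vec_def L2_set_def UNIV_2 cmod_def vc_def)
  ultimately show ?thesis
    using assms by (simp add: orthogonal_transformation norm_mult)
qed

text \<open>Lebesgue measure is determined by its values on boxes, and a rotation does not map boxes
  to boxes. The preimage of a box is therefore described as its image under the inverse rotation, an
  orthogonal map, which preserves Lebesgue measure.\<close>

lemma lborel_rotation:
  assumes c: "cmod c = 1"
  shows "distr lborel borel (\<lambda>z. c * z) = (lborel :: complex measure)"
proof (rule lborel_eqI[symmetric])
  fix l u :: complex
  assume b: "\<And>b. b \<in> Basis \<Longrightarrow> l \<bullet> b \<le> u \<bullet> b"
  have lu: "Re l \<le> Re u" "Im l \<le> Im u" using b[of 1] b[of \<i>] by (auto simp: Basis_complex_def)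
  have cc: "cnj c * c = 1" "c * cnj c = 1" using c by (simp_all add: complex_norm_square[symmetric] mult.commute)
  let ?T = "\<lambda>v. cv (cnj c * vc v)"
  have im: "vc -` ((\<lambda>z. c * z) -` box l u) = ?T ` box (cv l) (cv u)"
  proof (intro equalityI subsetI)
    fix v assume "v \<in> vc -` ((\<lambda>z. c * z) -` box l u)"
    then have "cv (c * vc v) \<in> box (cv l) (cv u)"
      using vc_vimage_box[of l u] by auto
    moreover have "v = ?T (cv (c * vc v))" using cc by (simp flip: mult.assoc)
    ultimately show "v \<in> ?T ` box (cv l) (cv u)" by blast
  next
    fix v assume "v \<in> ?T ` box (cv l) (cv u)"
    then show "v \<in> vc -` ((\<lambda>z. c * z) -` box l u)"
      using vc_vimage_box[of l u] cc by (auto simp flip: mult.assoc)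
  qed
  have orth: "orthogonal_transformation ?T" by (rule orthogonal_rotation) (use c in simp)
  have lm: "box (cv l) (cv u) \<in> lmeasurable" by (simp add: lmeasurable_box)
  have ms: "vc -` ((\<lambda>z. c * z) -` box l u) \<in> sets borel"
    using measurable_sets[of "\<lambda>v. c * vc v" borel borel "box l u"] by (simp add: vimage_def)
  have "emeasure (distr lborel borel (\<lambda>z. c * z)) (box l u) = emeasure lborel (vc -` ((\<lambda>z. c * z) -` box l u))"
    by (subst emeasure_distr, simp, simp, subst lborel_complex_eq, subst emeasure_distr) (auto simp: vimage_def)
  also have "\<dots> = emeasure lebesgue (?T ` box (cv l) (cv u))"
    using ms by (simp add: im)
  also have "\<dots> = ennreal (measure lebesgue (?T ` box (cv l) (cv u)))"
    by (rule emeasure_eq_ennreal_measure[OF fmeasurableD2[OF measurable_orthogonal_image[OF orth lm]]])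
  also have "\<dots> = ennreal (measure lebesgue (box (cv l) (cv u)))"
    by (simp only: measure_orthogonal_image[OF orth lm])
  also have "\<dots> = emeasure lborel (box (cv l) (cv u))"
    using emeasure_eq_ennreal_measure[OF fmeasurableD2[OF lm]] by simp
  also have "\<dots> = ennreal ((Re u - Re l) * (Im u - Im l))" by (rule emeasure_box_cv[OF lu])
  also have "(Re u - Re l) * (Im u - Im l) = (\<Prod>b\<in>Basis. (u - l) \<bullet> b)"
    by (simp add: Basis_complex_def)
  finally show "emeasure (distr lborel borel (\<lambda>z. c * z)) (box l u) = ennreal (\<Prod>b\<in>Basis. (u - l) \<bullet> b)" .
qed simp

lemma nn_integral_rotation:
  assumes c: "cmod c = 1" and [measurable]: "f \<in> borel_measurable borel"
  shows "(\<integral>\<^sup>+w. f (z + (w - z) * c) \<partial>lborel) = (\<integral>\<^sup>+w. f w \<partial>lborel)"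
proof -
  have tr: "(\<integral>\<^sup>+w. F (w + a) \<partial>lborel) = (\<integral>\<^sup>+w. F w \<partial>lborel)" if [measurable]: "F \<in> borel_measurable borel" for F and a :: complex
  proof -
    have "(\<integral>\<^sup>+w. F (w + a) \<partial>lborel) = (\<integral>\<^sup>+w. F w \<partial>distr lborel borel (\<lambda>w. w + a))"
      by (subst nn_integral_distr) auto
    also have "distr lborel borel (\<lambda>w. w + a) = (lborel :: complex measure)"
      using lborel_distr_plus[of a] by (simp add: add.commute[of _ a])
    finally show ?thesis .
  qed
  have "(\<integral>\<^sup>+w. f (z + (w - z) * c) \<partial>lborel) = (\<integral>\<^sup>+w. (\<lambda>w. f (z + c * w)) (w + (- z)) \<partial>lborel)"
    by (simp add: mult.commute)
  also have "\<dots> = (\<integral>\<^sup>+w. f (z + c * w) \<partial>lborel)" by (rule tr) measurable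
  also have "\<dots> = (\<integral>\<^sup>+w. f (z + w) \<partial>distr lborel borel (\<lambda>w. c * w))"
    by (subst nn_integral_distr) auto
  also have "\<dots> = (\<integral>\<^sup>+w. f (w + z) \<partial>lborel)" by (simp add: lborel_rotation[OF c] add.commute)
  also have "\<dots> = (\<integral>\<^sup>+w. f w \<partial>lborel)" by (rule tr) measurable
  finally show ?thesis .
qed

text \<open>Replaces polar coordinates: the ball is invariant under rotations about its centre, so
  averaging over all of them changes nothing, and Tonelli puts a circular mean in place of the
  integrand. No radial Jacobian appears.\<close>

lemma nn_integral_ball_rotation:
  fixes z :: complex
  assumes [measurable]: "f \<in> borel_measurable borel"
  shows "(\<integral>\<^sup>+w. f w * indicator (ball z R) w \<partial>lborel) =
         (\<integral>\<^sup>+w. (\<integral>\<^sup>+x. f (z + (w - z) * ucis x) \<partial>uI) * indicator (ball z R) w \<partial>lborel)"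
proof -
  interpret pair_sigma_finite "lborel :: complex measure" uI ..
  have [measurable]: "ball z R \<in> sets borel" by simp
  have ind: "indicator (ball z R) (z + (w - z) * ucis x) = indicator (ball z R) w" for w x
    by (simp add: indicator_def dist_norm norm_mult norm_minus_commute)
  have "(\<integral>\<^sup>+w. (\<integral>\<^sup>+x. f (z + (w - z) * ucis x) \<partial>uI) * indicator (ball z R) w \<partial>lborel) =
     (\<integral>\<^sup>+w. (\<integral>\<^sup>+x. f (z + (w - z) * ucis x) * indicator (ball z R) w \<partial>uI) \<partial>lborel)"
    by (intro nn_integral_cong) (simp add: nn_integral_multc)
  also have "\<dots> = (\<integral>\<^sup>+x. (\<integral>\<^sup>+w. f (z + (w - z) * ucis x) * indicator (ball z R) w \<partial>lborel) \<partial>uI)"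
    by (rule Fubini'[symmetric]) measurable
  also have "\<dots> = (\<integral>\<^sup>+x. (\<integral>\<^sup>+w. f w * indicator (ball z R) w \<partial>lborel) \<partial>uI)"
  proof (rule nn_integral_cong)
    fix x
    have "(\<integral>\<^sup>+w. f (z + (w - z) * ucis x) * indicator (ball z R) w \<partial>lborel) =
      (\<integral>\<^sup>+w. (\<lambda>w. f w * indicator (ball z R) w) (z + (w - z) * ucis x) \<partial>lborel)"
      by (simp only: ind)
    also have "\<dots> = (\<integral>\<^sup>+w. f w * indicator (ball z R) w \<partial>lborel)"
      by (rule nn_integral_rotation) auto
    finally show "(\<integral>\<^sup>+w. f (z + (w - z) * ucis x) * indicator (ball z R) w \<partial>lborel) = (\<integral>\<^sup>+w. f w * indicator (ball z R) w \<partial>lborel)" .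
  qed
  also have "\<dots> = (\<integral>\<^sup>+w. f w * indicator (ball z R) w \<partial>lborel)"
    by (simp add: uI.emeasure_space_1[simplified])
  finally show ?thesis by simp
qed

lemma measure_ball_complex: "0 \<le> R \<Longrightarrow> measure lborel (ball (z::complex) R) = pi * R\<^sup>2"
  by (simp add: content_ball unit_ball_vol_2)

lemma emeasure_ball_complex: "0 \<le> R \<Longrightarrow> emeasure lborel (ball (z::complex) R) = ennreal (pi * R\<^sup>2)"
  by (simp add: emeasure_ball unit_ball_vol_2)

text \<open>In Jensen's formula each maximum is bounded below by its second argument, and what
  remains is the decomposition of \<open>ln (cmod (poly q 0))\<close>. This is subharmonicity at the
  centre.\<close>

lemma mean_ln_poly_ge:
  fixes q :: "complex poly"
  assumes "poly q 0 \<noteq> 0"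
  shows "ln (cmod (poly q 0)) \<le> (LINT x|uI. ln (cmod (poly q (ucis x))))"
    and "integrable uI (\<lambda>x. ln (cmod (poly q (ucis x))))"
proof -
  have q: "q \<noteq> 0" using assms by auto
  have "(\<Sum>a\<in>{a. poly q a = 0}. real (order a q) * ln (cmod (0 - a))) \<le> (\<Sum>a\<in>{a. poly q a = 0}. real (order a q) * ln (max 1 (cmod (0 - a))))"
  proof (intro sum_mono mult_left_mono)
    fix a assume "a \<in> {a. poly q a = 0}"
    then have "a \<noteq> 0" using assms by auto
    then show "ln (cmod (0 - a)) \<le> ln (max 1 (cmod (0 - a)))" by (intro ln_mono) auto
  qed auto
  then show "ln (cmod (poly q 0)) \<le> (LINT x|uI. ln (cmod (poly q (ucis x))))"
    using mean_ln_poly(1)[OF q, of 1 0] ln_poly_decompose[OF assms] by simp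
  show "integrable uI (\<lambda>x. ln (cmod (poly q (ucis x))))"
    using mean_ln_poly(2)[OF q, of 1 0] by simp
qed

lemma poly_bounded_ball:
  fixes p :: "complex poly"
  obtains C where "\<And>w. w \<in> ball z R \<Longrightarrow> cmod (poly p w) \<le> exp C"
proof -
  have "compact (poly p ` cball z R)"
    by (intro compact_continuous_image continuous_on_poly continuous_on_id) auto
  then obtain B where "\<And>w. w \<in> cball z R \<Longrightarrow> cmod (poly p w) \<le> B"
    using compact_imp_bounded[of "poly p ` cball z R"] unfolding bounded_iff by blast
  then have "\<And>w. w \<in> ball z R \<Longrightarrow> cmod (poly p w) \<le> exp (ln (max B 1))"
    by (fastforce simp: le_max_iff_disj)
  then show ?thesis using that by blast
qed

text \<open>The circular inequality \<open>mean_ln_poly_ge\<close> is integrated over the ball by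
  rotation averaging. Working with \<open>C - ln (cmod (poly p w))\<close>, which is nonnegative,
  makes Tonelli applicable and yields integrability across the roots as a by-product.\<close>

lemma area_submean:
  fixes p :: "complex poly"
  assumes pz: "poly p z \<noteq> 0" and R: "0 < R"
  shows "set_integrable lborel (ball z R) (\<lambda>w. ln (cmod (poly p w)))"
    and "pi * R\<^sup>2 * ln (cmod (poly p z)) \<le> (LINT w:ball z R|lborel. ln (cmod (poly p w)))"
proof -
  have [measurable]: "ball z R \<in> sets borel" by simp
  obtain C0 where C0: "\<And>w. w \<in> ball z R \<Longrightarrow> cmod (poly p w) \<le> exp C0"
    by (rule poly_bounded_ball[where p = p and z = z and R = R]) blast
  \<comment> \<open>The bound must also be nonnegative: at a root the logarithm takes the value
    \<open>0\<close>.\<close>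
  define C where "C = max C0 0"
  have C: "ln (cmod (poly p w)) \<le> C" if "w \<in> ball z R" for w
  proof (cases "poly p w = 0")
    case False
    then have "ln (cmod (poly p w)) \<le> ln (exp C0)" using C0[OF that] by (intro ln_mono) auto
    then show ?thesis by (simp add: C_def)
  qed (simp add: C_def)
  let ?f = "\<lambda>w. ennreal (C - ln (cmod (poly p w)))"
  have inner: "(\<integral>\<^sup>+x. ?f (z + (w - z) * ucis x) \<partial>uI) \<le> ennreal (C - ln (cmod (poly p z)))" if w: "w \<in> ball z R" for w
  proof -
    \<comment> \<open>Reparametrization: the circle about \<open>z\<close> through \<open>w\<close>
      becomes the unit circle in the variable of \<open>q\<close>, and the centre becomes
      \<open>0\<close>.\<close>
    define q where "q = pcompose p [:z, w - z:]"
    have q: "poly q u = poly p (z + (w - z) * u)" for u by (simp add: q_def poly_pcompose mult.commute)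
    have q0: "poly q 0 \<noteq> 0" using pz q by simp
    have le: "ln (cmod (poly q (ucis x))) \<le> C" for x
      unfolding q by (rule C) (use w in \<open>simp add: dist_norm norm_mult norm_minus_commute\<close>)
    have "(\<integral>\<^sup>+x. ?f (z + (w - z) * ucis x) \<partial>uI) = (\<integral>\<^sup>+x. ennreal (C - ln (cmod (poly q (ucis x)))) \<partial>uI)"
      by (simp add: q)
    also have "\<dots> = ennreal (LINT x|uI. C - ln (cmod (poly q (ucis x))))"
      by (intro nn_integral_eq_integral Bochner_Integration.integrable_diff mean_ln_poly_ge(2) q0) (use le in auto)
    also have "\<dots> = ennreal (C - (LINT x|uI. ln (cmod (poly q (ucis x)))))"
      using mean_ln_poly_ge(2)[OF q0] uI.prob_space by simp
    also have "\<dots> \<le> ennreal (C - ln (cmod (poly p z)))"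
      using mean_ln_poly_ge(1)[OF q0] by (intro ennreal_leI) (simp add: q)
    finally show ?thesis .
  qed
  have "(\<integral>\<^sup>+w. ?f w * indicator (ball z R) w \<partial>lborel) =
         (\<integral>\<^sup>+w. (\<integral>\<^sup>+x. ?f (z + (w - z) * ucis x) \<partial>uI) * indicator (ball z R) w \<partial>lborel)"
    by (rule nn_integral_ball_rotation) measurable
  also have "\<dots> \<le> (\<integral>\<^sup>+w. ennreal (C - ln (cmod (poly p z))) * indicator (ball z R) w \<partial>lborel)"
    by (intro nn_integral_mono) (use inner in \<open>auto simp: indicator_def\<close>)
  also have "\<dots> = ennreal ((C - ln (cmod (poly p z))) * (pi * R\<^sup>2))"
    using R C[of z] by (simp add: nn_integral_cmult_indicator emeasure_ball_complex ennreal_mult'' ennreal_mult)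
  finally have le: "(\<integral>\<^sup>+w. ?f w * indicator (ball z R) w \<partial>lborel) \<le> ennreal ((C - ln (cmod (poly p z))) * (pi * R\<^sup>2))" .
  let ?h = "\<lambda>w. indicator (ball z R) w * (C - ln (cmod (poly p w)))"
  have eq: "(\<integral>\<^sup>+w. ?f w * indicator (ball z R) w \<partial>lborel) = (\<integral>\<^sup>+w. ennreal (?h w) \<partial>lborel)"
    by (intro nn_integral_cong) (auto simp: indicator_def)
  have nn: "0 \<le> ?h w" for w using C[of w] by (auto simp: indicator_def)
  have ih: "integrable lborel ?h"
    using le eq nn by (intro integrableI_nonneg) (auto simp: le_less_trans)
  have ic: "integrable lborel (\<lambda>w. indicator (ball z R) w * C)"
    using R by (intro integrable_mult_left integrable_real_indicator) (auto simp: emeasure_ball_complex)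
  have eq2: "(\<lambda>w. indicator (ball z R) w * C - ?h w) = (\<lambda>w. indicator (ball z R) w *\<^sub>R ln (cmod (poly p w)))"
    by (auto simp: fun_eq_iff algebra_simps)
  show "set_integrable lborel (ball z R) (\<lambda>w. ln (cmod (poly p w)))"
    using Bochner_Integration.integrable_diff[OF ic ih] unfolding set_integrable_def eq2 .
  have "(\<integral>\<^sup>+w. ennreal (?h w) \<partial>lborel) = ennreal (LINT w|lborel. ?h w)"
    using nn by (intro nn_integral_eq_integral ih) auto
  with le eq have "ennreal (LINT w|lborel. ?h w) \<le> ennreal ((C - ln (cmod (poly p z))) * (pi * R\<^sup>2))" by simp
  then have l2: "(LINT w|lborel. ?h w) \<le> (C - ln (cmod (poly p z))) * (pi * R\<^sup>2)"
    using C[of z] R by (subst (asm) ennreal_le_iff) auto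
  have "(LINT w:ball z R|lborel. ln (cmod (poly p w))) = (LINT w|lborel. indicator (ball z R) w * C) - (LINT w|lborel. ?h w)"
    unfolding set_lebesgue_integral_def eq2[symmetric] by (rule Bochner_Integration.integral_diff[OF ic ih])
  also have "(LINT w|lborel. indicator (ball z R) w * C) = pi * R\<^sup>2 * C"
    using R by (simp add: measure_ball_complex)
  finally show "pi * R\<^sup>2 * ln (cmod (poly p z)) \<le> (LINT w:ball z R|lborel. ln (cmod (poly p w)))"
    using l2 by (simp add: algebra_simps)
qed

text \<open>The centre may itself be a root. Since the roots are finitely many, some nearby point is
  none, and a larger ball about it covers \<open>ball z R\<close>.\<close>

lemma ln_poly_integrable_ball:
  fixes p :: "complex poly"
  assumes p: "p \<noteq> 0"
  shows "set_integrable lborel (ball z R) (\<lambda>w. ln (cmod (poly p w)))"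
proof -
  have "finite {a. poly p a = 0}" by (rule poly_roots_finite[OF p])
  then have "\<not> ball z 1 \<subseteq> {a. poly p a = 0}"
    using finite_subset[of "ball z 1" "{a. poly p a = 0}"] uncountable_ball[of 1 z] countable_finite by auto
  then obtain a where a: "a \<in> ball z 1" "poly p a \<noteq> 0" by blast
  have "ball z R \<subseteq> ball a (\<bar>R\<bar> + 1)"
  proof
    fix w assume "w \<in> ball z R"
    then show "w \<in> ball a (\<bar>R\<bar> + 1)" using a(1) dist_triangle[of a w z] by (simp add: dist_commute)
  qed
  then show ?thesis
    by (intro set_integrable_subset[OF area_submean(1)[OF a(2), of "\<bar>R\<bar> + 1"]]) auto
qed

text \<open>Signed counterpart of \<open>nn_integral_ball_rotation\<close>, about the origin:
  rotations preserve area, so the angle may be averaged first. It also serves the area integral over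
  the collar.\<close>

lemma rotation_average:
  fixes f :: "complex \<Rightarrow> complex"
  assumes f: "integrable lborel f"
  shows "(LINT w|lborel. f w) = (LINT w|lborel. (LINT x|uI. f (ucis x * w)))"
proof -
  interpret P: pair_sigma_finite uI "lborel :: complex measure" ..
  have [measurable]: "f \<in> borel_measurable borel" using borel_measurable_integrable[OF f] by simp
  have ri: "integrable lborel (\<lambda>w. f (ucis x * w))" for x
    using integrable_distr_eq[of "\<lambda>w. ucis x * w" lborel borel f] f lborel_rotation[of "ucis x"] by simp
  have "integrable (uI \<Otimes>\<^sub>M lborel) (case_prod (\<lambda>x w. f (ucis x * w)))"
  proof (rule P.Fubini_integrable)
    show "case_prod (\<lambda>x w. f (ucis x * w)) \<in> borel_measurable (uI \<Otimes>\<^sub>M lborel)" by measurable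
    have "(\<lambda>x. LINT w|lborel. norm (f (ucis x * w))) = (\<lambda>x. LINT w|lborel. norm (f w))"
    proof
      fix x show "(LINT w|lborel. norm (f (ucis x * w))) = (LINT w|lborel. norm (f w))"
        using integral_distr[of "\<lambda>w. ucis x * w" lborel borel "\<lambda>w. norm (f w)"] lborel_rotation[of "ucis x"] by simp
    qed
    then show "integrable uI (\<lambda>x. LINT w|lborel. norm (case (x, w) of (x, w) \<Rightarrow> f (ucis x * w)))" by simp
    show "AE x in uI. integrable lborel (\<lambda>w. case (x, w) of (x, w) \<Rightarrow> f (ucis x * w))" using ri by simp
  qed
  from P.Fubini_integral[OF this]
  have "(LINT w|lborel. (LINT x|uI. f (ucis x * w))) = (LINT x|uI. (LINT w|lborel. f (ucis x * w)))" .
  also have "\<dots> = (LINT w|lborel. f w)"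
    using integral_distr[of "\<lambda>w. ucis _ * w" lborel borel f] lborel_rotation uI.prob_space by simp
  finally show ?thesis by simp
qed

lemma lborel_integral_translate:
  fixes f :: "complex \<Rightarrow> 'b::{banach, second_countable_topology}"
  assumes "f \<in> borel_measurable borel"
  shows "(LINT a|lborel. f (a - z)) = (LINT a|lborel. f a)"
  using integral_distr[of "(+) (- z)" lborel borel f] assms by (simp add: lborel_distr_plus)

lemma area_mean_holomorphic:
  fixes l :: "complex \<Rightarrow> complex"
  assumes l: "l holomorphic_on ball z R'" and R: "0 < R" "R < R'"
  shows "(LINT w:ball z R|lborel. l w) = of_real (pi * R\<^sup>2) * l z" and "set_integrable lborel (ball z R) l"
proof -
  have sub: "cball z R \<subseteq> ball z R'" using R by auto
  have i0: "set_integrable lborel (cball z R) l"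
    unfolding set_integrable_def by (intro borel_integrable_compact holomorphic_continuous[OF l sub]) auto
  show i: "set_integrable lborel (ball z R) l" by (rule set_integrable_subset[OF i0]) auto
  define f where "f w = indicator (ball z R) w *\<^sub>R l w" for w
  have fi: "integrable lborel f" using i unfolding f_def[abs_def] set_integrable_def .
  then have [measurable]: "f \<in> borel_measurable borel" by auto
  have "integrable (distr lborel borel ((+) z)) f" using fi by (simp add: lborel_distr_plus)
  then have gi: "integrable lborel (\<lambda>w. f (z + w))" by (subst (asm) integrable_distr_eq) auto
  have mean: "(LINT x|uI. f (z + ucis x * w)) = indicator (ball 0 R) w *\<^sub>R l z" for w
  proof (cases "w \<in> ball 0 R")
    case True
    have "(LINT x|uI. (\<lambda>u. l (z + u * w)) (0 + circ 1 x)) = l (z + 0 * w)"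
    proof (rule mean_holomorphic[where R = "R' / R"])
      show "(\<lambda>u. l (z + u * w)) holomorphic_on ball 0 (R' / R)"
      proof (rule holomorphic_on_compose_gen[OF _ l, unfolded o_def])
        show "(\<lambda>u. z + u * w) ` ball 0 (R' / R) \<subseteq> ball z R'"
        proof
          fix v assume "v \<in> (\<lambda>u. z + u * w) ` ball 0 (R' / R)"
          then obtain u where u: "cmod u < R' / R" "v = z + u * w" by auto
          have "cmod u * cmod w \<le> cmod u * R" using True by (intro mult_left_mono) auto
          also have "\<dots> < R'" using u(1) R by (simp add: field_simps)
          finally show "v \<in> ball z R'" using u(2) by (simp add: dist_norm norm_mult)
        qed
      qed (intro holomorphic_intros)
    qed (use R in auto)
    then show ?thesis using True by (simp add: f_def dist_norm norm_mult)
  next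
    case False
    then show ?thesis by (simp add: f_def dist_norm norm_mult)
  qed
  have "(LINT w:ball z R|lborel. l w) = (LINT w|lborel. f (z + w))"
    using integral_distr[of "(+) z" lborel borel f] by (simp add: lborel_distr_plus set_lebesgue_integral_def flip: f_def)
  also have "\<dots> = (LINT w|lborel. indicator (ball (0::complex) R) w *\<^sub>R l z)"
    unfolding rotation_average[OF gi] mean ..
  finally show "(LINT w:ball z R|lborel. l w) = of_real (pi * R\<^sup>2) * l z"
    using R by (simp add: measure_ball_complex emeasure_ball_complex scaleR_conv_of_real)
qed

lemma area_mean_ln:
  assumes k: "k holomorphic_on ball z R'" and nz: "\<And>w. w \<in> ball z R' \<Longrightarrow> k w \<noteq> 0" and R: "0 < R" "R < R'"
  shows "(LINT w:ball z R|lborel. ln (cmod (k w))) = pi * R\<^sup>2 * ln (cmod (k z))"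
proof -
  obtain l where l: "l holomorphic_on ball z R'" "\<And>w. w \<in> ball z R' \<Longrightarrow> k w = exp (l w)"
    using contractible_imp_holomorphic_log[OF k convex_imp_contractible[OF convex_ball] nz] by metis
  note A = area_mean_holomorphic[OF l(1) R]
  have "(LINT w:ball z R|lborel. ln (cmod (k w))) = (LINT w|lborel. Re (indicator (ball z R) w *\<^sub>R l w))"
    unfolding set_lebesgue_integral_def using l(2) R by (intro Bochner_Integration.integral_cong) (auto simp: indicator_def)
  also have "\<dots> = Re (LINT w:ball z R|lborel. l w)"
    using A(2) unfolding set_lebesgue_integral_def set_integrable_def by (rule integral_Re)
  finally show ?thesis using A(1) l(2)[of z] R by simp
qed

lemma area_mean_norm:
  fixes p :: "complex poly"
  assumes R: "0 < R"
  shows "pi * R\<^sup>2 * cmod (poly p z) \<le> (LINT w:ball z R|lborel. cmod (poly p w))"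
proof -
  have "poly p holomorphic_on ball z (R + 1)" by (intro holomorphic_intros)
  from area_mean_holomorphic(1)[OF this, of R]
  have "pi * R\<^sup>2 * cmod (poly p z) = cmod (LINT w|lborel. indicator (ball z R) w *\<^sub>R poly p w)"
    using R by (simp add: norm_mult norm_power set_lebesgue_integral_def)
  also have "\<dots> \<le> (LINT w:ball z R|lborel. cmod (poly p w))"
    using integral_norm_bound[of lborel "\<lambda>w. indicator (ball z R) w *\<^sub>R poly p w"] by (simp add: set_lebesgue_integral_def)
  finally show ?thesis .
qed

section \<open>The exterior conformal map and the Green function\<close>

text \<open>\<open>kap\<close> is the reciprocal of an exterior conformal map and \<open>psi\<close>
  its inverse, so infinity corresponds to the puncture \<open>0\<close>. The map is left
  undetermined up to a rotation: \<open>c\<close> may be any nonzero number, and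
  \<open>cmod c\<close> is the capacity of \<open>E\<close>.\<close>

locale exterior_conformal =
  fixes E :: "complex set" and psi kap :: "complex \<Rightarrow> complex" and c :: complex
  assumes compact_E: "compact E"
    and psi_hol: "psi holomorphic_on (ball 0 1 - {0})"
    and kappa_hol: "kap holomorphic_on (- E)"
    and psi_in: "zeta \<in> ball 0 1 - {0} \<Longrightarrow> psi zeta \<notin> E"
    and kappa_in: "z \<notin> E \<Longrightarrow> kap z \<in> ball 0 1 - {0}"
    and psi_kappa: "z \<notin> E \<Longrightarrow> psi (kap z) = z"
    and kappa_psi: "zeta \<in> ball 0 1 - {0} \<Longrightarrow> kap (psi zeta) = zeta"
    and psi_lim: "((\<lambda>zeta. zeta * psi zeta) \<longlongrightarrow> c) (at 0)"
    and c_nonzero: "c \<noteq> 0"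
begin

definition green :: "complex \<Rightarrow> real" where
  "green z = (if z \<in> E then 0 else - ln (cmod (kap z)))"

text \<open>\<open>psi\<close> has a simple pole at \<open>0\<close>; \<open>H\<close> removes it.
  Expressions in \<open>psi\<close> are made holomorphic on the whole disk by writing them through
  \<open>H\<close>.\<close>

definition H :: "complex \<Rightarrow> complex" where
  "H zeta = (if zeta = 0 then c else zeta * psi zeta)"

lemma kappa_bounds: "z \<notin> E \<Longrightarrow> 0 < cmod (kap z)" "z \<notin> E \<Longrightarrow> cmod (kap z) < 1"
  using kappa_in[of z] by auto

lemma open_compl_E: "open (- E)"
  using compact_E by (simp add: compact_imp_closed open_Compl)

lemma green_nonneg: "0 \<le> green z"
  using kappa_bounds[of z] by (auto simp: green_def)

lemma H_hol: "H holomorphic_on ball 0 1"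
proof -
  have "(\<lambda>zeta. zeta * psi zeta) holomorphic_on (ball 0 1 - {0})" by (intro holomorphic_intros psi_hol)
  from holomorphic_removable[OF this psi_lim] show ?thesis by (simp add: H_def[abs_def])
qed

lemma psi_inj: "inj_on psi (ball 0 1 - {0})"
  by (rule inj_onI) (metis kappa_psi)

text \<open>Near the origin \<open>1 / psi\<close> extends to an injective holomorphic function
  vanishing there, and its image is open. Hence every point of large modulus is
  \<open>psi zeta\<close> with \<open>zeta\<close> small.\<close>

lemma kappa_small:
  assumes "0 < rho"
  obtains T where "0 < T" "\<And>z. T < cmod z \<Longrightarrow> z \<notin> E \<and> cmod (kap z) < rho"
proof -
  have "continuous (at 0) H"
    using continuous_on_eq_continuous_at[OF open_ball, of 0 1 H] holomorphic_on_imp_continuous_on[OF H_hol] by simp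
  moreover have "H 0 \<noteq> 0" using c_nonzero by (simp add: H_def)
  ultimately obtain e where e: "e > 0" "\<And>zeta. dist 0 zeta < e \<Longrightarrow> H zeta \<noteq> 0"
    using continuous_at_avoid[of 0 H 0] by auto
  define d where "d = min e (min 1 rho)"
  have d: "0 < d" "d \<le> e" "d \<le> 1" "d \<le> rho" using e assms by (auto simp: d_def)
  have Hnz: "H zeta \<noteq> 0" if "zeta \<in> ball 0 d" for zeta using e(2)[of zeta] that d by auto
  define j where "j zeta = zeta / H zeta" for zeta
  have jh: "j holomorphic_on ball 0 d"
    unfolding j_def by (intro holomorphic_intros holomorphic_on_subset[OF H_hol]) (use d Hnz in auto)
  have jchi: "j zeta = 1 / psi zeta" if "zeta \<noteq> 0" for zeta using that by (simp add: j_def H_def)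
  have j0: "j zeta = 0 \<longleftrightarrow> zeta = 0" if "zeta \<in> ball 0 d" for zeta using Hnz[OF that] by (simp add: j_def)
  have "inj_on j (ball 0 d)"
  proof (rule inj_onI)
    fix a b assume ab: "a \<in> ball 0 d" "b \<in> ball 0 d" "j a = j b"
    show "a = b"
    proof (cases "a = 0 \<or> b = 0")
      case True then show ?thesis using j0 ab by metis
    next
      case False
      then have "psi a = psi b" using ab jchi by auto
      then show ?thesis using False ab d psi_inj by (auto simp: inj_on_def)
    qed
  qed
  then have "open (j ` ball 0 d)" by (intro open_mapping_thm3[OF jh]) auto
  moreover have "0 \<in> j ` ball 0 d" using j0[of 0] d by (auto intro!: image_eqI[of _ _ 0])
  ultimately obtain dlt where dlt: "dlt > 0" "ball 0 dlt \<subseteq> j ` ball 0 d"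
    by (meson open_contains_ball)
  have "z \<notin> E \<and> cmod (kap z) < rho" if z: "1 / dlt < cmod z" for z
  proof -
    have z0: "z \<noteq> 0" using z dlt by (auto simp: field_simps)
    have "1 / z \<in> ball 0 dlt" using z z0 dlt by (simp add: norm_divide field_simps)
    then obtain zeta where zeta: "zeta \<in> ball 0 d" "1 / z = j zeta" using dlt by blast
    have nz: "zeta \<noteq> 0" using zeta j0[of zeta] z0 by auto
    then have "z = psi zeta" using zeta(2) jchi[of zeta] z0 by (simp add: field_simps)
    moreover have "zeta \<in> ball 0 1 - {0}" using zeta nz d by auto
    ultimately show ?thesis using psi_in[of zeta] kappa_psi[of zeta] zeta d by auto
  qed
  then show ?thesis using that[of "1 / dlt"] dlt by auto
qed

lemma kappa_infinity: "(kap \<longlongrightarrow> 0) at_infinity"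
proof (rule tendstoI)
  fix e :: real assume "0 < e"
  then obtain T where "0 < T" "\<And>z. T < cmod z \<Longrightarrow> z \<notin> E \<and> cmod (kap z) < e" by (rule kappa_small) blast
  then show "\<forall>\<^sub>F z in at_infinity. dist (kap z) 0 < e"
    unfolding eventually_at_infinity by (intro exI[of _ "T + 1"]) auto
qed

lemma outside_E_infinity: "\<forall>\<^sub>F z in at_infinity. z \<notin> E"
proof -
  obtain T where "0 < T" "\<And>z. T < cmod z \<Longrightarrow> z \<notin> E \<and> cmod (kap z) < 1" by (rule kappa_small[of 1]) auto
  then show ?thesis unfolding eventually_at_infinity by (intro exI[of _ "T + 1"]) auto
qed

lemma kappa_asymp: "((\<lambda>z. z * kap z) \<longlongrightarrow> c) at_infinity"
proof -
  have "filterlim kap (at 0) at_infinity"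
    using kappa_infinity outside_E_infinity kappa_bounds(1)
    by (auto simp: filterlim_at elim!: eventually_mono)
  from filterlim_compose[OF psi_lim this]
  show ?thesis
    by (rule Lim_transform_eventually)
       (use outside_E_infinity in \<open>auto elim!: eventually_mono simp: psi_kappa mult.commute\<close>)
qed

text \<open>Compactness handles the bounded part of the complement of \<open>W\<close>, and
  \<open>kappa_small\<close> the part near infinity. It serves to place level curves with radius
  close to one inside a given neighbourhood of \<open>E\<close>.\<close>

lemma kappa_exhaust:
  assumes "open W" "E \<subseteq> W"
  obtains rho where "0 < rho" "rho < 1" "\<And>z. z \<notin> W \<Longrightarrow> cmod (kap z) \<le> rho"
proof -
  obtain T where T: "0 < T" "\<And>z. T < cmod z \<Longrightarrow> z \<notin> E \<and> cmod (kap z) < 1 / 2" by (rule kappa_small[of "1/2"]) auto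
  define K where "K = cball 0 T - W"
  have K: "compact K" unfolding K_def using assms by (intro compact_diff) auto
  have KE: "K \<subseteq> - E" using assms by (auto simp: K_def)
  have cont: "continuous_on K (\<lambda>z. cmod (kap z))"
    by (intro continuous_intros holomorphic_continuous[OF kappa_hol] KE)
  obtain m where m: "m < 1" "\<And>z. z \<in> K \<Longrightarrow> cmod (kap z) \<le> m"
  proof (cases "K = {}")
    case True then show ?thesis using that[of 0] by auto
  next
    case False
    then obtain a where "a \<in> K" "\<And>z. z \<in> K \<Longrightarrow> cmod (kap z) \<le> cmod (kap a)"
      using continuous_attains_sup[OF K _ cont] by blast
    then show ?thesis using that[of "cmod (kap a)"] kappa_bounds[of a] KE by auto
  qed
  have "cmod (kap z) \<le> max (1 / 2) m" if "z \<notin> W" for z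
  proof (cases "cmod z \<le> T")
    case True then show ?thesis using that m(2)[of z] by (auto simp: K_def le_max_iff_disj)
  next
    case False then show ?thesis using T(2)[of z] by auto
  qed
  then show ?thesis using that[of "max (1 / 2) m"] m by auto
qed

text \<open>If \<open>kap\<close> stayed in a smaller disk along a sequence tending to
  \<open>z\<close>, a limit point \<open>zeta\<close> would lie in the open disk and satisfy
  \<open>psi zeta = z\<close>, although \<open>psi\<close> avoids \<open>E\<close>. This properness
  makes \<open>green\<close> continuous across the boundary.\<close>

lemma kappa_near_E:
  assumes z: "z \<in> E" and rho: "rho < 1"
  shows "\<exists>d>0. \<forall>w. w \<notin> E \<longrightarrow> dist w z < d \<longrightarrow> rho < cmod (kap w)"
proof (rule ccontr)
  assume "\<not> ?thesis"
  then have "\<And>d. d > 0 \<Longrightarrow> \<exists>w. w \<notin> E \<and> dist w z < d \<and> cmod (kap w) \<le> rho"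
    by (meson not_less)
  then have "\<forall>n. \<exists>w. w \<notin> E \<and> dist w z < inverse (real (Suc n)) \<and> cmod (kap w) \<le> rho"
    by simp
  then obtain w where w: "\<And>n. w n \<notin> E" "\<And>n. dist (w n) z < inverse (real (Suc n))" "\<And>n. cmod (kap (w n)) \<le> rho"
    by metis
  have wl: "w \<longlonglongrightarrow> z"
    by (rule tendsto_dist_iff[THEN iffD2], rule tendsto_sandwich[OF _ _ tendsto_const LIMSEQ_inverse_real_of_nat])
       (intro always_eventually allI zero_le_dist less_imp_le[OF w(2)])+
  have "\<forall>n. kap (w n) \<in> cball 0 rho" using w by simp
  then obtain zeta r where zeta: "zeta \<in> cball 0 rho" "strict_mono r" "((\<lambda>n. kap (w n)) \<circ> r) \<longlonglongrightarrow> zeta"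
    using compact_cball[of "0::complex" rho, unfolded compact_def, rule_format, of "\<lambda>n. kap (w n)"] by blast
  have zeta1: "zeta \<in> ball 0 1" using zeta(1) rho by auto
  have wr: "(\<lambda>n. w (r n)) \<longlonglongrightarrow> z" using LIMSEQ_subseq_LIMSEQ[OF wl zeta(2)] by (simp add: o_def)
  have kl: "(\<lambda>n. kap (w (r n))) \<longlonglongrightarrow> zeta" using zeta(3) by (simp add: o_def)
  have "isCont H zeta"
    using continuous_on_eq_continuous_at[OF open_ball, of 0 1 H] holomorphic_on_imp_continuous_on[OF H_hol] zeta1 by simp
  then have "(\<lambda>n. H (kap (w (r n)))) \<longlonglongrightarrow> H zeta" using kl by (rule isCont_tendsto_compose)
  moreover have "H (kap (w (r n))) = kap (w (r n)) * w (r n)" for n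
    using w(1)[of "r n"] kappa_bounds[of "w (r n)"] psi_kappa by (auto simp: H_def)
  ultimately have "(\<lambda>n. kap (w (r n)) * w (r n)) \<longlonglongrightarrow> H zeta" by simp
  moreover have "(\<lambda>n. kap (w (r n)) * w (r n)) \<longlonglongrightarrow> zeta * z" by (intro tendsto_intros kl wr)
  \<comment> \<open>The relation through \<open>H\<close> covers \<open>zeta = 0\<close> as well,
    where it would force \<open>c = 0\<close>.\<close>
  ultimately have eq: "H zeta = zeta * z" by (rule LIMSEQ_unique)
  show False
  proof (cases "zeta = 0")
    case True then show ?thesis using eq c_nonzero by (simp add: H_def)
  next
    case False
    then have "psi zeta = z" using eq by (simp add: H_def)
    then show ?thesis using psi_in[of zeta] False zeta1 z by auto
  qed
qed

lemma green_continuous: "continuous_on UNIV green"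
proof (rule continuous_at_imp_continuous_on, intro ballI)
  fix z
  show "isCont green z"
  proof (cases "z \<in> E")
    case False
    have "continuous_on (- E) (\<lambda>z. - ln (cmod (kap z)))"
      by (intro continuous_intros holomorphic_on_imp_continuous_on[OF kappa_hol]) (use kappa_bounds in force)
    then have "continuous_on (- E) green"
      by (rule continuous_on_eq) (simp add: green_def)
    then show ?thesis using False open_compl_E by (simp add: continuous_on_eq_continuous_at)
  next
    case True
    show ?thesis unfolding continuous_at_eps_delta
    proof (intro allI impI)
      fix e :: real assume e: "0 < e"
      obtain d where d: "d > 0" "\<And>w. w \<notin> E \<Longrightarrow> dist w z < d \<Longrightarrow> exp (- e) < cmod (kap w)"
        using kappa_near_E[OF True, of "exp (- e)"] e by auto
      have "dist (green w) (green z) < e" if "dist w z < d" for w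
      proof (cases "w \<in> E")
        case True then show ?thesis using e \<open>z \<in> E\<close> by (simp add: green_def)
      next
        case False
        have "ln (exp (- e)) < ln (cmod (kap w))"
          using d(2)[OF False that] kappa_bounds[OF False] by (subst ln_less_cancel_iff) auto
        moreover have "ln (cmod (kap w)) < 0" using kappa_bounds[OF False] by simp
        ultimately show ?thesis using False \<open>z \<in> E\<close> by (simp add: green_def dist_real_def)
      qed
      then show "\<exists>d>0. \<forall>w. dist w z < d \<longrightarrow> dist (green w) (green z) < e" using d by blast
    qed
  qed
qed

lemma green_measurable [measurable]: "green \<in> borel_measurable borel"
  by (rule borel_measurable_continuous_onI[OF green_continuous])

lemma psi_circle_continuous:
  assumes "0 < rho" "rho < 1"
  shows "continuous_on A (\<lambda>x. psi (circ rho x))"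
  by (rule continuous_on_compose2[OF holomorphic_on_imp_continuous_on[OF psi_hol]])
     (use assms in \<open>auto intro!: continuous_intros simp: norm_mult\<close>)

lemma psi_circle_bounded:
  assumes rho: "0 < rho" "rho < 1"
  obtains b where "\<And>x. cmod (psi (circ rho x)) \<le> b"
proof -
  have "sphere 0 rho \<subseteq> ball 0 1 - {0}" using rho by auto
  from compact_norm_bound[OF compact_sphere holomorphic_continuous[OF psi_hol this]]
  obtain b where b: "\<And>z. z \<in> sphere 0 rho \<Longrightarrow> cmod (psi z) \<le> b" by blast
  show ?thesis by (rule that[of b], rule b) (use rho in \<open>simp add: norm_mult\<close>)
qed

text \<open>The maximum principle for \<open>zeta ^ n * poly p (psi zeta)\<close>: the pole of the
  polynomial at infinity is cancelled by \<open>zeta ^ n\<close>. On a circle of radius near one the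
  point \<open>psi zeta\<close> is so close to \<open>E\<close> that the polynomial is below
  \<open>m + e\<close> there; the slack \<open>e\<close> is removed at the end.\<close>

lemma bernstein_walsh:
  fixes p :: "complex poly"
  assumes m: "\<And>z. z \<in> E \<Longrightarrow> cmod (poly p z) \<le> m" and m0: "0 \<le> m"
  shows "cmod (poly p z) \<le> m * exp (real (degree p) * green z)"
proof (cases "z \<in> E")
  case True then show ?thesis using m by (simp add: green_def)
next
  case False
  define n where "n = degree p"
  have "cmod (poly p z) \<le> (m + e) * exp (real n * green z)" if e: "e > 0" for e
  proof -
    have "open {z. cmod (poly p z) < m + e}"
      by (intro open_Collect_less continuous_intros)
    moreover have "E \<subseteq> {z. cmod (poly p z) < m + e}" using m e by fastforce
    ultimately obtain rho where rho: "0 < rho" "rho < 1" "\<And>z. z \<notin> {z. cmod (poly p z) < m + e} \<Longrightarrow> cmod (kap z) \<le> rho"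
      by (rule kappa_exhaust) blast
    \<comment> \<open>The disk of radius \<open>s\<close> must contain \<open>kap z\<close>, and its
      boundary must correspond to points in the neighbourhood of \<open>E\<close>; the midpoint
      between the larger constraint and one satisfies both.\<close>
    define s where "s = (max rho (cmod (kap z)) + 1) / 2"
    have s: "rho < s" "cmod (kap z) < s" "s < 1" "0 < s" using rho kappa_bounds[OF False] by (auto simp: s_def)
    \<comment> \<open>Written as a polynomial in \<open>H\<close> and \<open>zeta\<close>, so that
      holomorphy at \<open>0\<close> is immediate.\<close>
    define q where "q zeta = (\<Sum>i\<le>n. coeff p i * H zeta ^ i * zeta ^ (n - i))" for zeta
    have q: "q zeta = zeta ^ n * poly p (psi zeta)" if "zeta \<noteq> 0" for zeta
    proof -
      have "coeff p i * H zeta ^ i * zeta ^ (n - i) = zeta ^ n * (coeff p i * psi zeta ^ i)" if "i \<le> n" for i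
      proof -
        have "zeta ^ n = zeta ^ i * zeta ^ (n - i)" using that by (simp flip: power_add)
        then show ?thesis using \<open>zeta \<noteq> 0\<close> by (simp add: H_def power_mult_distrib)
      qed
      then show ?thesis unfolding q_def poly_altdef n_def[symmetric] sum_distrib_left by (intro sum.cong) auto
    qed
    have qh: "q holomorphic_on ball 0 1"
      unfolding q_def by (intro holomorphic_intros H_hol)
    have b: "cmod (q zeta) \<le> s ^ n * (m + e)" if "zeta \<in> frontier (ball 0 s)" for zeta
    proof -
      have zeta: "cmod zeta = s" using that s by (simp add: frontier_ball)
      then have zeta1: "zeta \<in> ball 0 1 - {0}" using s by auto
      have "psi zeta \<in> {z. cmod (poly p z) < m + e}"
        using rho(3)[of "psi zeta"] kappa_psi[OF zeta1] zeta s by force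
      then show ?thesis using zeta1 zeta s by (auto simp: q norm_mult norm_power intro!: mult_left_mono)
    qed
    have "cmod (q (kap z)) \<le> s ^ n * (m + e)"
      by (rule maximum_modulus_frontier[where S = "ball 0 s", OF _ _ _ b])
         (use s in \<open>auto intro!: holomorphic_on_subset[OF qh] holomorphic_continuous[OF qh]\<close>)
    also have "\<dots> \<le> 1 * (m + e)" using s m0 e by (intro mult_right_mono power_le_one) auto
    finally have "cmod (kap z) ^ n * cmod (poly p z) \<le> m + e"
      using q[of "kap z"] kappa_in[OF False] psi_kappa[OF False] by (simp add: norm_mult norm_power)
    moreover have "exp (real n * green z) = 1 / cmod (kap z) ^ n"
      using kappa_bounds[OF False] False by (simp add: green_def exp_of_nat_mult exp_minus field_simps)
    ultimately show ?thesis using kappa_bounds[OF False] by (simp add: pos_le_divide_eq mult.commute)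
  qed
  note bound = this
  have "cmod (poly p z) \<le> m * exp (real n * green z) + e" if "e > 0" for e
    using bound[of "e / exp (real n * green z)"] that by (simp add: distrib_right)
  then show ?thesis unfolding n_def by (rule field_le_epsilon)
qed

text \<open>Jensen's formula for \<open>f zeta = zeta * (psi zeta - z)\<close>: its value at
  \<open>0\<close> is \<open>c\<close>, and its only possible zero in the disk is
  \<open>kap z\<close>, present exactly when \<open>z\<close> lies outside \<open>E\<close>. The
  resulting potential is constant inside the level curve \<open>green = - ln rho\<close> and equals
  \<open>green\<close> up to \<open>ln (cmod c)\<close> outside.\<close>

lemma potential_level:
  assumes rho: "0 < rho" "rho < 1"
  shows "(LINT x|uI. ln (cmod (z - psi (circ rho x)))) = ln (cmod c) + max (- ln rho) (green z)" (is ?A)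
    and "integrable uI (\<lambda>x. ln (cmod (z - psi (circ rho x))))" (is ?B)
proof -
  define f where "f zeta = H zeta - z * zeta" for zeta
  have fh: "f holomorphic_on ball 0 1" unfolding f_def by (intro holomorphic_intros H_hol)
  have f: "f zeta = zeta * (psi zeta - z)" if "zeta \<noteq> 0" for zeta using that by (simp add: f_def H_def algebra_simps)
  have f0: "f 0 = c" by (simp add: f_def H_def)
  have inb: "circ rho x \<in> ball 0 1 - {0}" for x using rho by (simp add: norm_mult)
  have eqn: "cmod (f (circ rho x)) = rho * cmod (z - psi (circ rho x))" for x
    using inb[of x] rho by (simp add: f norm_mult norm_minus_commute)
  have main: "integrable uI (\<lambda>x. ln (cmod (f (circ rho x)))) \<and>
     (LINT x|uI. ln (cmod (f (circ rho x)))) = ln (cmod c) + ln rho + max (- ln rho) (green z) \<and>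
     (AE x in uI. f (circ rho x) \<noteq> 0)"
  proof (cases "z \<in> E")
    case True
    have nz: "f zeta \<noteq> 0" if "zeta \<in> ball 0 1" for zeta
      using that f[of zeta] f0 c_nonzero psi_in[of zeta] True by (cases "zeta = 0") auto
    have "continuous_on (sphere 0 rho) (\<lambda>w. ln (cmod (f w)))"
      by (intro continuous_on_ln continuous_intros holomorphic_continuous[OF fh])
         (use nz rho in auto)
    from integrable_circle[OF this] mean_ln_nonvanishing[OF fh nz, of rho] nz inb rho
    show ?thesis using True f0 by (auto simp: green_def)
  next
    case False
    define k where "k = kap z"
    have k: "k \<in> ball 0 1" "k \<noteq> 0" "psi k = z" using kappa_in[OF False] psi_kappa[OF False] by (auto simp: k_def)
    have fz: "f zeta = 0 \<longleftrightarrow> zeta = k" if "zeta \<in> ball 0 1" for zeta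
    proof (cases "zeta = 0")
      case True then show ?thesis using f0 c_nonzero k by auto
    next
      case nz: False
      then have "zeta = k" if "psi zeta = z"
        using kappa_psi[of zeta] \<open>zeta \<in> ball 0 1\<close> that by (simp add: k_def)
      then show ?thesis using f[OF nz] nz k by auto
    qed
    have dchi: "(psi has_field_derivative deriv psi k) (at k)"
      using holomorphic_derivI[OF psi_hol _ , of k] k by auto
    have d: "(f has_field_derivative (k * deriv psi k)) (at k)"
    proof (rule has_field_derivative_transform_within_open[where f = "\<lambda>zeta. zeta * (psi zeta - z)" and S = "ball 0 1 - {0}"])
      show "((\<lambda>zeta. zeta * (psi zeta - z)) has_field_derivative k * deriv psi k) (at k)"
        by (rule derivative_eq_intros dchi refl)+ (use k in simp)
    qed (use k f in auto)
    \<comment> \<open>The zero at \<open>k\<close> is simple because \<open>psi\<close> is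
      injective; dividing it out leaves a zero-free factor.\<close>
    have dnz: "k * deriv psi k \<noteq> 0"
      using holomorphic_injective_imp_regular[OF psi_hol _ psi_inj, of k] k by auto
    define e where "e zeta = (if zeta = k then k * deriv psi k else f zeta / (zeta - k))" for zeta
    have eh: "e holomorphic_on ball 0 1"
      using pole_lemma[OF fh, of k] k fz[OF k(1)] DERIV_imp_deriv[OF d] by (simp add: e_def[abs_def] cong: if_cong)
    have enz: "e zeta \<noteq> 0" if "zeta \<in> ball 0 1" for zeta using fz[OF that] dnz by (auto simp: e_def)
    have fe: "f zeta = (zeta - k) * e zeta" if "zeta \<in> ball 0 1" for zeta
      using fz[OF that] by (auto simp: e_def)
    have e0: "cmod (e 0) = cmod c / cmod k" using k f0 by (simp add: e_def norm_divide)
    have ce: "continuous_on (sphere 0 rho) (\<lambda>w. ln (cmod (e w)))"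
      by (intro continuous_on_ln continuous_intros holomorphic_continuous[OF eh])
         (use enz rho in auto)
    have ie: "integrable uI (\<lambda>x. ln (cmod (e (circ rho x))))"
      using integrable_circle[OF ce] rho by simp
    have me: "(LINT x|uI. ln (cmod (e (circ rho x)))) = ln (cmod c) - ln (cmod k)"
      using mean_ln_nonvanishing[OF eh enz, of rho] rho e0 k c_nonzero by (simp add: ln_div)
    have ik: "integrable uI (\<lambda>x. ln (cmod (circ rho x - k)))"
      and mk: "(LINT x|uI. ln (cmod (circ rho x - k))) = ln (max rho (cmod k))"
      using mean_ln_circle[OF rho(1), of 0 k] by auto
    have ne: "AE x in uI. f (circ rho x) \<noteq> 0"
      using ucis_eq_AE[of "k / of_real rho"]
    proof eventually_elim
      case (elim x)
      then have "circ rho x \<noteq> k" using rho by (auto simp: field_simps)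
      then show ?case using fz inb[of x] by blast
    qed
    have ae: "AE x in uI. ln (cmod (f (circ rho x))) = ln (cmod (circ rho x - k)) + ln (cmod (e (circ rho x)))"
      using ne
    proof eventually_elim
      case (elim x)
      then show ?case using fe[of "circ rho x"] inb[of x] enz by (auto simp: norm_mult ln_mult)
    qed
    have mf: "(\<lambda>x. ln (cmod (f (circ rho x)))) \<in> borel_measurable uI"
    proof -
      have "continuous_on UNIV (\<lambda>x. f (circ rho x))"
        by (rule continuous_on_compose2[OF holomorphic_on_imp_continuous_on[OF fh]])
           (use rho in \<open>auto intro!: continuous_intros simp: norm_mult\<close>)
      then have "(\<lambda>x. f (circ rho x)) \<in> borel_measurable borel" by (rule borel_measurable_continuous_onI)
      then show ?thesis by simp
    qed
    have if1: "integrable uI (\<lambda>x. ln (cmod (f (circ rho x))))"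
      by (subst integrable_cong_AE[OF mf _ ae]) (use ie ik in auto)
    have "(LINT x|uI. ln (cmod (f (circ rho x)))) = (LINT x|uI. ln (cmod (circ rho x - k)) + ln (cmod (e (circ rho x))))"
      by (rule integral_cong_AE[OF mf _ ae]) (use ie ik in auto)
    also have "\<dots> = ln (max rho (cmod k)) + (ln (cmod c) - ln (cmod k))"
      using ie ik me mk by simp
    also have "ln (max rho (cmod k)) = max (ln rho) (ln (cmod k))"
      using rho k by (auto simp: max_def)
    also have "max (ln rho) (ln (cmod k)) + (ln (cmod c) - ln (cmod k)) = ln (cmod c) + ln rho + max (- ln rho) (green z)"
      using False by (auto simp: green_def k_def max_def)
    finally show ?thesis using if1 ne by blast
  qed
  have ae: "AE x in uI. ln (cmod (z - psi (circ rho x))) = ln (cmod (f (circ rho x))) - ln rho"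
    using main[THEN conjunct2, THEN conjunct2]
  proof eventually_elim
    case (elim x)
    then show ?case using eqn[of x] rho by (auto simp: ln_mult)
  qed
  have [measurable]: "(\<lambda>x. psi (circ rho x)) \<in> borel_measurable borel"
    by (intro borel_measurable_continuous_onI psi_circle_continuous rho)
  show ?B by (subst integrable_cong_AE[OF _ _ ae]) (use main in auto)
  have "(LINT x|uI. ln (cmod (z - psi (circ rho x)))) = (LINT x|uI. ln (cmod (f (circ rho x))) - ln rho)"
    by (rule integral_cong_AE[OF _ _ ae]) (use main in auto)
  then show ?A using main uI.prob_space by simp
qed

text \<open>Tonelli for the logarithmic distance between a circle about \<open>a\<close> and a level
  curve: one order of integration is \<open>mean_ln_circle\<close>, the other
  \<open>potential_level\<close>. Subtracting from an upper bound \<open>C\<close> makes the kernel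
  nonnegative.\<close>

lemma mean_green_level:
  assumes rho: "0 < rho" "rho < 1" and s: "0 < s"
  shows "(LINT y|uI. ln (max s (cmod (a - psi (circ rho y))))) =
    ln (cmod c) + (LINT x|uI. max (- ln rho) (green (a + circ s x)))"
proof -
  let ?X = "\<lambda>y. psi (circ rho y)"
  have Xc: "continuous_on UNIV ?X" by (rule psi_circle_continuous[OF rho])
  have [measurable]: "?X \<in> borel_measurable borel"
    by (rule borel_measurable_continuous_onI[OF Xc])
  obtain b where b': "\<And>y. cmod (?X y) \<le> b" by (rule psi_circle_bounded[OF rho]) blast
  define C where "C = max 0 (ln (max s (cmod a + s + b)))"
  have le: "ln (cmod (a + circ s x - ?X y)) \<le> C" for x y
  proof (cases "a + circ s x - ?X y = 0")
    case False
    have "cmod (a + circ s x - ?X y) \<le> cmod a + s + b"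
      using norm_triangle_ineq4[of "a + circ s x" "?X y"] norm_triangle_ineq[of a "circ s x"] b'[of y] s
      by (simp add: norm_mult)
    then have "ln (cmod (a + circ s x - ?X y)) \<le> ln (max s (cmod a + s + b))"
      using False by (intro ln_mono) auto
    then show ?thesis by (simp add: C_def)
  qed (simp add: C_def)
  interpret P: pair_sigma_finite uI uI ..
  let ?F = "\<lambda>x y. ennreal (C - ln (cmod (a + circ s x - ?X y)))"
  have i1: "(\<integral>\<^sup>+x. ?F x y \<partial>uI) = ennreal (C - ln (max s (cmod (a - ?X y))))" for y
  proof -
    have "(\<integral>\<^sup>+x. ?F x y \<partial>uI) = ennreal (LINT x|uI. C - ln (cmod (a + circ s x - ?X y)))"
      using le mean_ln_circle(2)[OF s, of a "?X y"] by (intro nn_integral_eq_integral) auto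
    then show ?thesis using mean_ln_circle[OF s, of a "?X y"] uI.prob_space by simp
  qed
  have i2: "(\<integral>\<^sup>+y. ?F x y \<partial>uI) = ennreal (C - (ln (cmod c) + max (- ln rho) (green (a + circ s x))))" for x
  proof -
    have "(\<integral>\<^sup>+y. ?F x y \<partial>uI) = ennreal (LINT y|uI. C - ln (cmod (a + circ s x - ?X y)))"
      using le potential_level(2)[OF rho, of "a + circ s x"] by (intro nn_integral_eq_integral) auto
    then show ?thesis using potential_level[OF rho, of "a + circ s x"] uI.prob_space by simp
  qed
  have gc: "continuous_on UNIV (\<lambda>x. max (- ln rho) (green (a + circ s x)))"
    by (intro continuous_on_max continuous_intros continuous_on_compose2[OF green_continuous]) auto
  have lc: "continuous_on UNIV (\<lambda>y. ln (max s (cmod (a - ?X y))))"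
    by (intro continuous_on_ln continuous_on_max continuous_intros Xc) (use s in auto)
  have l1: "ln (max s (cmod (a - ?X y))) \<le> C" for y
    using integral_mono[OF mean_ln_circle(2)[OF s, of a "?X y"], of "\<lambda>_. C"] le mean_ln_circle(1)[OF s, of a "?X y"] uI.prob_space by simp
  have l2: "ln (cmod c) + max (- ln rho) (green (a + circ s x)) \<le> C" for x
    using integral_mono[OF potential_level(2)[OF rho, of "a + circ s x"], of "\<lambda>_. C"] le potential_level(1)[OF rho, of "a + circ s x"] uI.prob_space by simp
  have "(\<integral>\<^sup>+y. (\<integral>\<^sup>+x. ?F x y \<partial>uI) \<partial>uI) = (\<integral>\<^sup>+x. (\<integral>\<^sup>+y. ?F x y \<partial>uI) \<partial>uI)"
    by (rule P.Fubini') measurable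
  then have "(\<integral>\<^sup>+y. ennreal (C - ln (max s (cmod (a - ?X y)))) \<partial>uI) = (\<integral>\<^sup>+x. ennreal (C - (ln (cmod c) + max (- ln rho) (green (a + circ s x)))) \<partial>uI)"
    unfolding i1 i2 .
  moreover have "(\<integral>\<^sup>+y. ennreal (C - ln (max s (cmod (a - ?X y)))) \<partial>uI) = ennreal (LINT y|uI. C - ln (max s (cmod (a - ?X y))))"
    using l1 by (intro nn_integral_eq_integral Bochner_Integration.integrable_diff integrable_uI_continuous lc) auto
  moreover have "(\<integral>\<^sup>+x. ennreal (C - (ln (cmod c) + max (- ln rho) (green (a + circ s x)))) \<partial>uI) =
      ennreal (LINT x|uI. C - (ln (cmod c) + max (- ln rho) (green (a + circ s x))))"
    using l2 by (intro nn_integral_eq_integral Bochner_Integration.integrable_diff Bochner_Integration.integrable_add integrable_uI_continuous gc) auto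
  ultimately have "(LINT y|uI. C - ln (max s (cmod (a - ?X y)))) = (LINT x|uI. C - (ln (cmod c) + max (- ln rho) (green (a + circ s x))))"
    using l1 l2 by (auto simp: ennreal_inj integral_nonneg)
  then show ?thesis
    using integrable_uI_continuous[OF lc] integrable_uI_continuous[OF gc] uI.prob_space by simp
qed

end

section \<open>Polynomials of almost maximal growth\<close>

text \<open>\<open>N\<close> will be the root set. The point found is to be the centre of a further
  mean value estimate, which is available only off the roots, and removing a finite set does not
  affect an average.\<close>

lemma exists_le_average:
  fixes w :: "complex \<Rightarrow> real"
  assumes r: "0 < r" and i: "set_integrable lborel (ball z r) w"
    and N: "finite N"
    and m: "(LINT x:ball z r|lborel. w x) \<le> m"
  obtains y where "y \<in> ball z r" "y \<notin> N" "w y \<le> m / (pi * r\<^sup>2)"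
proof (rule ccontr)
  note nt = that
  assume "\<not> thesis"
  then have gt: "m / (pi * r\<^sup>2) < w y" if "y \<in> ball z r" "y \<notin> N" for y
    using that nt[of y] by (meson not_less)
  define a where "a = m / (pi * r\<^sup>2)"
  let ?f = "\<lambda>x. indicator (ball z r) x *\<^sub>R w x - indicator (ball z r) x * a"
  have ic: "integrable lborel (\<lambda>x. indicator (ball z r) x * a)"
    using r by (intro integrable_mult_left integrable_real_indicator) (auto simp: emeasure_ball_complex)
  have if1: "integrable lborel ?f"
    using i ic unfolding set_integrable_def by (rule Bochner_Integration.integrable_diff)
  have N0: "N \<in> null_sets lborel" by (rule finite_imp_null_set_lborel[OF N])
  have AEN: "AE x in lborel. x \<notin> N" using AE_not_in[OF N0] .
  have nn: "AE x in lborel. 0 \<le> ?f x"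
    using AEN by eventually_elim (use gt in \<open>force simp: a_def indicator_def\<close>)
  have "(LINT x|lborel. ?f x) = (LINT x:ball z r|lborel. w x) - pi * r\<^sup>2 * a"
    using Bochner_Integration.integral_diff[OF i[unfolded set_integrable_def] ic] r
    by (simp add: measure_ball_complex set_lebesgue_integral_def)
  also have "\<dots> \<le> 0" using m r by (simp add: a_def)
  finally have "(LINT x|lborel. ?f x) = 0" using integral_nonneg_AE[OF nn] by linarith
  then have "AE x in lborel. ?f x = 0"
    using integral_nonneg_eq_0_iff_AE[OF if1 nn] by simp
  then have "AE x in lborel. x \<notin> ball z r"
    using AEN by eventually_elim (use gt in \<open>force simp: a_def indicator_def\<close>)
  then have "ball z r \<in> null_sets lborel"
    by (subst (asm) AE_iff_null_sets[symmetric]) auto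
  then show False using r by (auto simp: null_sets_def emeasure_ball_complex)
qed

lemma set_integral_mono_ball:
  fixes w :: "complex \<Rightarrow> real"
  assumes "A \<subseteq> B" "A \<in> sets lborel" "set_integrable lborel B w" "\<And>x. 0 \<le> w x"
  shows "(LINT x:A|lborel. w x) \<le> (LINT x:B|lborel. w x)"
  unfolding set_lebesgue_integral_def
  using assms set_integrable_subset[OF assms(3,2,1)]
  by (intro integral_mono) (auto simp: set_integrable_def indicator_def)

lemma set_integrable_const_ball: "set_integrable lborel (ball (z::complex) r) (\<lambda>_. a::real)"
  unfolding set_integrable_def
  by (intro integrable_scaleR_left integrable_real_indicator) (use emeasure_bounded_finite[OF bounded_ball[of z r]] in auto)

lemma set_integral_const_ball: "0 \<le> r \<Longrightarrow> (LINT x:ball (z::complex) r|lborel. a::real) = pi * r\<^sup>2 * a"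
  unfolding set_lebesgue_integral_def by (simp add: measure_ball_complex)

lemma set_integrable_continuous_ball:
  fixes f :: "complex \<Rightarrow> real"
  assumes "continuous_on UNIV f"
  shows "set_integrable lborel (ball z r) f"
proof -
  have "set_integrable lborel (cball z r) f"
    unfolding set_integrable_def
    by (intro borel_integrable_compact continuous_on_subset[OF assms]) auto
  then show ?thesis by (rule set_integrable_subset) auto
qed

text \<open>The index is separated from the degree \<open>d k\<close> because convergence is proved
  along subsequences. The upper bound is the Bernstein--Walsh estimate with the subexponential loss
  put into \<open>eps\<close>.\<close>

locale asymptotic_polys = exterior_conformal +
  fixes p :: "nat \<Rightarrow> complex poly" and d :: "nat \<Rightarrow> nat" and eps :: "nat \<Rightarrow> real"
  assumes d_pos: "0 < d k" and p_nz: "p k \<noteq> 0"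
    and upper: "cmod (poly (p k) z) \<le> exp (real (d k) * (green z + eps k))"
    and eps_lim: "eps \<longlonglongrightarrow> 0" and eps_nonneg: "0 \<le> eps k"
begin

text \<open>The defect of the growth bound: nonnegative, and superharmonic wherever
  \<open>green\<close> is harmonic. At a root its true value is infinite; the convention
  \<open>ln 0 = 0\<close> alters it on a finite set only.\<close>

definition w :: "nat \<Rightarrow> complex \<Rightarrow> real" where
  "w k z = green z + eps k - ln (cmod (poly (p k) z)) / real (d k)"

lemma w_nonneg: "0 \<le> w k z"
proof (cases "poly (p k) z = 0")
  case True then show ?thesis using green_nonneg[of z] eps_nonneg[of k] by (simp add: w_def)
next
  case False
  then have "ln (cmod (poly (p k) z)) \<le> ln (exp (real (d k) * (green z + eps k)))"
    using upper[of k z] by (intro ln_mono) auto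
  then show ?thesis using d_pos[of k] by (simp add: w_def field_simps)
qed

lemma w_integrable: "set_integrable lborel (ball z r) (w k)"
proof -
  have "set_integrable lborel (ball z r) (\<lambda>x. (green x + eps k) - ln (cmod (poly (p k) x)) / real (d k))"
    by (intro set_integral_diff set_integral_add set_integrable_const_ball set_integrable_continuous_ball green_continuous
        set_integrable_divide ln_poly_integrable_ball p_nz)
  then show ?thesis by (simp add: w_def[abs_def])
qed

text \<open>\<open>eta\<close> is the failure of the mean value property for \<open>green\<close> on
  this ball: \<open>0\<close> where \<open>green\<close> is harmonic, and small by uniform
  continuity on small balls that meet the curve.\<close>

lemma w_ball:
  assumes nz: "poly (p k) z \<noteq> 0" and R: "0 < R"
    and g: "(LINT x:ball z R|lborel. green x) \<le> pi * R\<^sup>2 * (green z + eta)"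
  shows "(LINT x:ball z R|lborel. w k x) \<le> pi * R\<^sup>2 * (eta + w k z)"
proof -
  have i1: "set_integrable lborel (ball z R) green" by (intro set_integrable_continuous_ball green_continuous)
  have i3: "set_integrable lborel (ball z R) (\<lambda>x. ln (cmod (poly (p k) x)) / real (d k))"
    by (intro set_integrable_divide ln_poly_integrable_ball p_nz)
  have "(LINT x:ball z R|lborel. w k x) = (LINT x:ball z R|lborel. green x) + pi * R\<^sup>2 * eps k - (LINT x:ball z R|lborel. ln (cmod (poly (p k) x))) / real (d k)"
    unfolding w_def using i1 i3 set_integral_const_ball[of R z "eps k"] R
    by (simp add: set_integral_diff set_integral_add set_integrable_const_ball)
  also have "\<dots> \<le> pi * R\<^sup>2 * (green z + eta) + pi * R\<^sup>2 * eps k - (pi * R\<^sup>2 * ln (cmod (poly (p k) z))) / real (d k)"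
    using area_submean(2)[OF nz R] g d_pos[of k] by (intro diff_mono add_mono divide_right_mono) auto
  also have "\<dots> = pi * R\<^sup>2 * (eta + w k z)" by (simp add: w_def algebra_simps)
  finally show ?thesis .
qed

definition good :: "complex \<Rightarrow> bool" where
  "good z \<longleftrightarrow> (\<exists>r>0. (\<lambda>k. LINT x:ball z r|lborel. w k x) \<longlonglongrightarrow> 0)"

lemma ball_conv_mono:
  assumes "(\<lambda>k. LINT x:ball z r|lborel. w k x) \<longlonglongrightarrow> 0" "ball y s \<subseteq> ball z r"
  shows "(\<lambda>k. LINT x:ball y s|lborel. w k x) \<longlonglongrightarrow> 0"
proof (rule tendsto_sandwich[OF _ _ tendsto_const assms(1)])
  show "\<forall>\<^sub>F k in sequentially. 0 \<le> (LINT x:ball y s|lborel. w k x)"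
    by (auto intro!: always_eventually integral_nonneg simp: set_lebesgue_integral_def w_nonneg)
  show "\<forall>\<^sub>F k in sequentially. (LINT x:ball y s|lborel. w k x) \<le> (LINT x:ball z r|lborel. w k x)"
    by (intro always_eventually allI set_integral_mono_ball assms(2) w_integrable w_nonneg) auto
qed

lemma good_points:
  assumes "good z" "0 < R"
  obtains y where "\<And>k. y k \<in> ball z R" "\<And>k. poly (p k) (y k) \<noteq> 0" "(\<lambda>k. w k (y k)) \<longlonglongrightarrow> 0"
proof -
  obtain r0 where r0: "0 < r0" "(\<lambda>k. LINT x:ball z r0|lborel. w k x) \<longlonglongrightarrow> 0"
    using assms(1) by (auto simp: good_def)
  define r where "r = min r0 R"
  have r: "0 < r" "r \<le> R" using r0 assms by (auto simp: r_def)
  have conv: "(\<lambda>k. LINT x:ball z r|lborel. w k x) \<longlonglongrightarrow> 0"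
    by (rule ball_conv_mono[OF r0(2)]) (auto simp: r_def)
  have "\<exists>y. y \<in> ball z r \<and> poly (p k) y \<noteq> 0 \<and> w k y \<le> (LINT x:ball z r|lborel. w k x) / (pi * r\<^sup>2)" for k
    by (rule exists_le_average[OF r(1) w_integrable[of z r k] poly_roots_finite[OF p_nz[of k]] order_refl]) blast
  then obtain y where y: "\<And>k. y k \<in> ball z r" "\<And>k. poly (p k) (y k) \<noteq> 0"
    "\<And>k. w k (y k) \<le> (LINT x:ball z r|lborel. w k x) / (pi * r\<^sup>2)" by metis
  have "(\<lambda>k. (LINT x:ball z r|lborel. w k x) / (pi * r\<^sup>2)) \<longlonglongrightarrow> 0 / (pi * r\<^sup>2)"
    by (intro tendsto_intros conv) (use r in auto)
  then have "(\<lambda>k. (LINT x:ball z r|lborel. w k x) / (pi * r\<^sup>2)) \<longlonglongrightarrow> 0" by simp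
  then have "(\<lambda>k. w k (y k)) \<longlonglongrightarrow> 0"
    by (rule tendsto_sandwich[OF _ _ tendsto_const, rotated 2])
       (intro always_eventually allI w_nonneg y(3))+
  moreover have "y k \<in> ball z R" for k using y(1)[of k] r by auto
  ultimately show ?thesis using that y(2) by blast
qed

text \<open>A Harnack-type step: since \<open>w\<close> is nonnegative, its integral over
  \<open>ball z R\<close> is at most the one over \<open>ball (y k) (2 * R)\<close>, and the mean
  value inequality \<open>w_ball\<close> bounds the latter by the value at its centre
  \<open>y k\<close>.\<close>

lemma points_imp_good:
  assumes R: "0 < R" and y: "\<forall>\<^sub>F k in sequentially. y k \<in> ball z R" "\<And>k. poly (p k) (y k) \<noteq> 0" "(\<lambda>k. w k (y k)) \<longlonglongrightarrow> 0"
    and h: "\<And>x. x \<in> ball z R \<Longrightarrow> (LINT x:ball x (2 * R)|lborel. green x) \<le> pi * (2 * R)\<^sup>2 * green x"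
  shows "good z"
proof -
  have lim: "(\<lambda>k. pi * (2 * R)\<^sup>2 * w k (y k)) \<longlonglongrightarrow> 0"
    using tendsto_mult_right_zero[OF y(3), of "pi * (2 * R)\<^sup>2"] .
  have "(\<lambda>k. LINT x:ball z R|lborel. w k x) \<longlonglongrightarrow> 0"
  proof (rule tendsto_sandwich[OF _ _ tendsto_const lim])
    show "\<forall>\<^sub>F k in sequentially. 0 \<le> (LINT x:ball z R|lborel. w k x)"
      by (auto intro!: always_eventually integral_nonneg simp: set_lebesgue_integral_def w_nonneg)
    show "\<forall>\<^sub>F k in sequentially. (LINT x:ball z R|lborel. w k x) \<le> pi * (2 * R)\<^sup>2 * w k (y k)"
      using y(1)
    proof eventually_elim
      case (elim k)
      have "ball z R \<subseteq> ball (y k) (2 * R)"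
      proof
        fix x assume "x \<in> ball z R"
        then show "x \<in> ball (y k) (2 * R)" using elim dist_triangle[of "y k" x z] by (simp add: dist_commute)
      qed
      then have "(LINT x:ball z R|lborel. w k x) \<le> (LINT x:ball (y k) (2 * R)|lborel. w k x)"
        by (intro set_integral_mono_ball w_integrable w_nonneg) auto
      also have "\<dots> \<le> pi * (2 * R)\<^sup>2 * (0 + w k (y k))"
        using h[OF elim] R by (intro w_ball y(2)) auto
      finally show ?case by simp
    qed
  qed
  then show ?thesis using R by (auto simp: good_def)
qed

lemma harmonic_radius:
  assumes "G = - E \<or> G = interior E" "z \<in> G"
  obtains R where "0 < R" "ball z R \<subseteq> G" "\<And>x. x \<in> ball z R \<Longrightarrow> (LINT x:ball x (2 * R)|lborel. green x) \<le> pi * (2 * R)\<^sup>2 * green x"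
proof -
  have "open G" using assms open_compl_E by auto
  then obtain r where r: "r > 0" "ball z r \<subseteq> G" using assms(2) by (meson openE)
  \<comment> \<open>Balls of radius \<open>3 * R\<close> about points of \<open>ball z R\<close>
    must stay inside \<open>ball z r\<close>; the mean value property over radius
    \<open>2 * R\<close> uses this margin.\<close>
  define R where "R = r / 4"
  have R: "R > 0" using r by (simp add: R_def)
  have sub: "ball x (3 * R) \<subseteq> G" if "x \<in> ball z R" for x
  proof -
    have "ball x (3 * R) \<subseteq> ball z r"
    proof
      fix y assume "y \<in> ball x (3 * R)"
      then show "y \<in> ball z r" using that dist_triangle[of z y x] by (simp add: R_def)
    qed
    then show ?thesis using r by blast
  qed
  have "(LINT x:ball x (2 * R)|lborel. green x) = pi * (2 * R)\<^sup>2 * green x" if x: "x \<in> ball z R" for x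
  proof (cases "G = - E")
    case True
    have s: "ball x (3 * R) \<subseteq> - E" using sub[OF x] True by simp
    have "(LINT y:ball x (2 * R)|lborel. green y) = (LINT y:ball x (2 * R)|lborel. - ln (cmod (kap y)))"
      using s R by (intro set_lebesgue_integral_cong) (auto simp: green_def subset_iff)
    also have "\<dots> = - (LINT y:ball x (2 * R)|lborel. ln (cmod (kap y)))"
      by (simp add: set_lebesgue_integral_def)
    also have "(LINT y:ball x (2 * R)|lborel. ln (cmod (kap y))) = pi * (2 * R)\<^sup>2 * ln (cmod (kap x))"
      by (rule area_mean_ln[where R' = "3 * R"])
         (use s R kappa_bounds in \<open>force intro!: holomorphic_on_subset[OF kappa_hol]\<close>)+
    finally show ?thesis using s R by (force simp: green_def)
  next
    case False
    then have s: "ball x (3 * R) \<subseteq> E" using sub[OF x] assms(1) interior_subset[of E] by auto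
    have "(LINT y:ball x (2 * R)|lborel. green y) = (LINT y:ball x (2 * R)|lborel. 0)"
      using s R by (intro set_lebesgue_integral_cong) (auto simp: green_def subset_iff)
    moreover have "x \<in> E" using s R by auto
    ultimately show ?thesis by (simp add: green_def set_lebesgue_integral_def)
  qed
  moreover have "ball z R \<subseteq> G" using r by (auto simp: R_def)
  ultimately show ?thesis using that[of R] R by auto
qed

text \<open>Both the good points and the others form open subsets of \<open>G\<close>: smallness on
  a ball passes to smaller balls, and a good point near \<open>z\<close> makes \<open>z\<close> good
  through \<open>good_points\<close> and \<open>points_imp_good\<close>. One good point, obtained
  from the sequence \<open>y\<close>, then decides by connectedness.\<close>

lemma good_propagate:
  assumes G: "G = - E \<or> G = interior E" and conn: "connected G"
    and y: "y \<longlonglongrightarrow> z0" "z0 \<in> G" "\<And>k. poly (p k) (y k) \<noteq> 0" "(\<lambda>k. w k (y k)) \<longlonglongrightarrow> 0"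
    and z: "z \<in> G"
  shows "good z"
proof -
  have oG: "open G" using G open_compl_E by auto
  have step: "\<exists>R>0. \<forall>x\<in>ball z R. good x \<longrightarrow> good z" if z: "z \<in> G" for z
  proof -
    obtain R where R: "0 < R" "\<And>x. x \<in> ball z R \<Longrightarrow> (LINT x:ball x (2 * R)|lborel. green x) \<le> pi * (2 * R)\<^sup>2 * green x"
      by (rule harmonic_radius[OF G z]) blast
    have "good z" if x: "x \<in> ball z R" "good x" for x
    proof -
      obtain r where r: "r > 0" "ball x r \<subseteq> ball z R" using x(1) by (meson open_ball openE)
      obtain u where u: "\<And>k. u k \<in> ball x r" "\<And>k. poly (p k) (u k) \<noteq> 0" "(\<lambda>k. w k (u k)) \<longlonglongrightarrow> 0"
        by (rule good_points[OF x(2) r(1)]) blast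
      show ?thesis
        by (rule points_imp_good[OF R(1) _ u(2,3) R(2)]) (use u(1) r(2) in \<open>blast intro: always_eventually\<close>)
    qed
    then show ?thesis using R(1) by blast
  qed
  have "good z0"
  proof -
    obtain R where R: "0 < R" "\<And>x. x \<in> ball z0 R \<Longrightarrow> (LINT x:ball x (2 * R)|lborel. green x) \<le> pi * (2 * R)\<^sup>2 * green x"
      by (rule harmonic_radius[OF G y(2)]) blast
    have "\<forall>\<^sub>F k in sequentially. y k \<in> ball z0 R"
      using y(1) R(1) by (simp add: tendsto_iff dist_commute)
    then show ?thesis by (rule points_imp_good[OF R(1) _ y(3,4) R(2)])
  qed
  define A where "A = {z \<in> G. good z}"
  define B where "B = {z \<in> G. \<not> good z}"
  have "open A" unfolding open_contains_ball
  proof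
    fix z assume z: "z \<in> A"
    then obtain r where r: "r > 0" "(\<lambda>k. LINT x:ball z r|lborel. w k x) \<longlonglongrightarrow> 0" by (auto simp: A_def good_def)
    obtain s where s: "s > 0" "ball z s \<subseteq> G" using z oG by (auto simp: A_def elim: openE)
    have "x \<in> A" if x: "x \<in> ball z (min r s)" for x
    proof -
      obtain t where "t > 0" "ball x t \<subseteq> ball z r" using x openE[OF open_ball, of x z r] by auto
      then have "good x" using ball_conv_mono[OF r(2)] by (auto simp: good_def)
      then show ?thesis using s x by (auto simp: A_def)
    qed
    then show "\<exists>e>0. ball z e \<subseteq> A" using r(1) s(1) by (intro exI[of _ "min r s"]) auto
  qed
  moreover have "open B" unfolding open_contains_ball
  proof
    fix z assume z: "z \<in> B"
    then obtain R where R: "R > 0" "\<forall>x\<in>ball z R. good x \<longrightarrow> good z" using step[of z] by (auto simp: B_def)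
    obtain s where s: "s > 0" "ball z s \<subseteq> G" using z oG by (auto simp: B_def elim: openE)
    have "ball z (min R s) \<subseteq> B" using z R(2) s(2) by (auto simp: B_def)
    then show "\<exists>e>0. ball z e \<subseteq> B" using R(1) s(1) by (intro exI[of _ "min R s"]) auto
  qed
  moreover have "A \<inter> B \<inter> G = {}" "G \<subseteq> A \<union> B" by (auto simp: A_def B_def)
  ultimately have "A \<inter> G = {} \<or> B \<inter> G = {}" using connectedD[OF conn] by blast
  moreover have "z0 \<in> A" using \<open>good z0\<close> y(2) by (simp add: A_def)
  ultimately show ?thesis using z y(2) by (auto simp: B_def)
qed

text \<open>\<open>green\<close> is not harmonic across the curve, so propagation stops there. But
  good points are dense, and on a small ball about a point near one of them the mean value property
  of \<open>green\<close> fails by at most \<open>eta\<close>. The balls needed to cover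
  \<open>ball 0 T\<close> have bounded total area, so the accumulated error is proportional to
  \<open>eta\<close>.\<close>

lemma L1_convergence:
  assumes conn: "connected (- E)" "connected (interior E)"
    and y: "y \<longlonglongrightarrow> y0" "y0 \<in> - E" "\<And>k. poly (p k) (y k) \<noteq> 0" "(\<lambda>k. w k (y k)) \<longlonglongrightarrow> 0"
    and x: "x \<longlonglongrightarrow> x0" "x0 \<in> interior E" "\<And>k. poly (p k) (x k) \<noteq> 0" "(\<lambda>k. w k (x k)) \<longlonglongrightarrow> 0"
    and T: "0 < T"
  shows "(\<lambda>k. LINT z:ball 0 T|lborel. w k z) \<longlonglongrightarrow> 0"
proof -
  have good1: "good z" if "z \<notin> E" for z using good_propagate[OF _ conn(1) y] that by auto
  have good2: "good z" if "z \<in> interior E" for z using good_propagate[OF _ conn(2) x] that by auto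
  have dense: "\<exists>v\<in>ball z r. good v" if "0 < r" for z r
  proof (cases "ball z r \<subseteq> E")
    case True
    then have "z \<in> interior E" using that by (meson centre_in_ball interiorI open_ball)
    then show ?thesis using good2 that centre_in_ball by blast
  next
    case False then show ?thesis using good1 by blast
  qed
  \<comment> \<open>At most \<open>9 * N ^ 2\<close> balls with \<open>r = 2 * T / N\<close>, each
    contributing at most \<open>pi * (2 * r) ^ 2 * (2 * eta)\<close>, give the factor
    \<open>288 * pi * T ^ 2\<close>, independent of \<open>N\<close>.\<close>
  have ev: "\<forall>\<^sub>F k in sequentially. (LINT z:ball 0 T|lborel. w k z) \<le> 288 * pi * T\<^sup>2 * eta" if eta: "0 < eta" for eta
  proof -
    \<comment> \<open>Grid points have modulus at most \<open>2 * T\<close> and \<open>r\<close> is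
      at most \<open>2 * T\<close>; the points compared below are thus within \<open>8 * T\<close>
      of the origin.\<close>
    have "uniformly_continuous_on (cball 0 (10 * T)) green"
      by (intro compact_uniformly_continuous continuous_on_subset[OF green_continuous]) auto
    then obtain dlt where dlt: "dlt > 0" "\<And>a b. a \<in> cball 0 (10 * T) \<Longrightarrow> b \<in> cball 0 (10 * T) \<Longrightarrow> dist a b < dlt \<Longrightarrow> dist (green a) (green b) < eta"
      unfolding uniformly_continuous_on_def using eta by metis
    obtain N0 :: nat where N0: "4 * T / dlt < real N0" using reals_Archimedean2 by blast
    define N where "N = Suc N0"
    have N: "1 \<le> N" "4 * T / real N < dlt" using N0 dlt T by (auto simp: N_def field_simps)
    \<comment> \<open>Rounding down in a grid of mesh \<open>T / N\<close> moves each coordinate by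
      less than \<open>T / N\<close>, hence the point by less than \<open>r\<close>.\<close>
    define r where "r = 2 * T / real N"
    have r: "0 < r" "r \<le> 2 * T" "2 * r < dlt" using N T by (auto simp: r_def field_simps)
    define I where "I = {- int N..int N} \<times> {- int N..int N}"
    define a where "a ij = Complex (of_int (fst ij) * T / real N) (of_int (snd ij) * T / real N)" for ij :: "int \<times> int"
    have aT: "cmod (a ij) \<le> 2 * T" if "ij \<in> I" for ij
    proof -
      have "\<bar>of_int i * T / real N\<bar> \<le> T" if "i \<in> {- int N..int N}" for i
      proof -
        have "\<bar>real_of_int i\<bar> \<le> real N" using that by auto
        then have "\<bar>real_of_int i\<bar> * T \<le> real N * T" using T by (intro mult_right_mono) auto
        then show ?thesis using N T by (simp add: abs_mult field_simps)
      qed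
      then have "\<bar>Re (a ij)\<bar> \<le> T" "\<bar>Im (a ij)\<bar> \<le> T" using that by (auto simp: I_def a_def)
      then show ?thesis using cmod_le[of "a ij"] by linarith
    qed
    have local: "\<forall>\<^sub>F k in sequentially. (LINT z:ball b r|lborel. w k z) \<le> pi * (2 * r)\<^sup>2 * (2 * eta)" if b: "cmod b \<le> 2 * T" for b
    proof -
      obtain v where v: "v \<in> ball b r" "good v" using dense[OF r(1)] by blast
      obtain s where s: "s > 0" "ball v s \<subseteq> ball b r" using v(1) by (meson open_ball openE)
      obtain u where u: "\<And>k. u k \<in> ball v s" "\<And>k. poly (p k) (u k) \<noteq> 0" "(\<lambda>k. w k (u k)) \<longlonglongrightarrow> 0"
        by (rule good_points[OF v(2) s(1)]) blast
      have "\<forall>\<^sub>F k in sequentially. w k (u k) < eta" using order_tendstoD(2)[OF u(3) eta] .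
      then show ?thesis
      proof eventually_elim
        case (elim k)
        have ub: "u k \<in> ball b r" using u(1)[of k] s by auto
        have ucl: "cmod (u k) \<le> 4 * T"
          using ub b r norm_triangle_ineq2[of "u k" b] by (simp add: dist_norm norm_minus_commute)
        have sub: "ball b r \<subseteq> ball (u k) (2 * r)"
        proof
          fix x assume "x \<in> ball b r"
          then show "x \<in> ball (u k) (2 * r)" using ub dist_triangle[of "u k" x b] by (simp add: dist_commute)
        qed
        have gle: "green x \<le> green (u k) + eta" if "x \<in> ball (u k) (2 * r)" for x
        proof -
          have "cmod x \<le> 10 * T" using that ucl r norm_triangle_ineq2[of x "u k"] by (simp add: dist_norm norm_minus_commute)
          then have "dist (green x) (green (u k)) < eta" using that r ucl T by (intro dlt) (auto simp: dist_commute)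
          then show ?thesis by (simp add: dist_real_def)
        qed
        have "(LINT x:ball (u k) (2 * r)|lborel. green x) \<le> (LINT x:ball (u k) (2 * r)|lborel. green (u k) + eta)"
          by (intro set_integral_mono set_integrable_continuous_ball green_continuous set_integrable_const_ball gle)
        also have "\<dots> = pi * (2 * r)\<^sup>2 * (green (u k) + eta)" using r by (intro set_integral_const_ball) auto
        finally have g: "(LINT x:ball (u k) (2 * r)|lborel. green x) \<le> pi * (2 * r)\<^sup>2 * (green (u k) + eta)" .
        have "(LINT z:ball b r|lborel. w k z) \<le> (LINT z:ball (u k) (2 * r)|lborel. w k z)"
          by (intro set_integral_mono_ball sub w_integrable w_nonneg) auto
        also have "\<dots> \<le> pi * (2 * r)\<^sup>2 * (eta + w k (u k))" using r by (intro w_ball u(2) g) auto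
        also have "\<dots> \<le> pi * (2 * r)\<^sup>2 * (2 * eta)" using elim by (intro mult_left_mono) auto
        finally show ?case .
      qed
    qed
    have "\<forall>\<^sub>F k in sequentially. \<forall>ij\<in>I. (LINT z:ball (a ij) r|lborel. w k z) \<le> pi * (2 * r)\<^sup>2 * (2 * eta)"
      by (rule eventually_ball_finite) (simp add: I_def, intro ballI local aT)
    then show ?thesis
    proof eventually_elim
      case (elim k)
      have cover: "\<exists>ij\<in>I. z \<in> ball (a ij) r" if z: "z \<in> ball 0 T" for z
      proof -
        define i where "i = \<lfloor>Re z * real N / T\<rfloor>"
        define j where "j = \<lfloor>Im z * real N / T\<rfloor>"
        have bd: "\<lfloor>u * real N / T\<rfloor> \<in> {- int N..int N} \<and> \<bar>u - of_int \<lfloor>u * real N / T\<rfloor> * T / real N\<bar> < T / real N" if u: "\<bar>u\<bar> < T" for u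
        proof -
          define X where "X = u * real N / T"
          have uX: "u = X * T / real N" using T N by (simp add: X_def)
          have "\<bar>X\<bar> * T < real N * T" using u T N by (simp add: X_def abs_mult mult.commute)
          then have "\<bar>X\<bar> < real N" using T by simp
          then have 1: "\<lfloor>X\<rfloor> \<in> {- int N..int N}" by (auto simp: le_floor_iff floor_le_iff)
          have "\<bar>X - of_int \<lfloor>X\<rfloor>\<bar> * (T / real N) < 1 * (T / real N)"
            using T N by (intro mult_strict_right_mono) (auto, linarith)
          moreover have "u - of_int \<lfloor>X\<rfloor> * T / real N = (X - of_int \<lfloor>X\<rfloor>) * (T / real N)"
            by (simp add: uX algebra_simps diff_divide_distrib)
          ultimately show ?thesis using 1 T N by (simp add: abs_mult flip: X_def)
        qed
        have re: "\<bar>Re z\<bar> < T" and im: "\<bar>Im z\<bar> < T" using z abs_Re_le_cmod[of z] abs_Im_le_cmod[of z] by auto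
        have ij: "(i, j) \<in> I" using bd[OF re] bd[OF im] by (auto simp: I_def i_def j_def)
        have "cmod (a (i, j) - z) \<le> \<bar>Re (a (i, j) - z)\<bar> + \<bar>Im (a (i, j) - z)\<bar>" by (rule cmod_le)
        also have "\<dots> < T / real N + T / real N"
          using bd[OF re] bd[OF im] by (simp add: a_def i_def j_def abs_minus_commute)
        finally have "z \<in> ball (a (i, j)) r" by (simp add: dist_norm r_def)
        then show ?thesis using ij by blast
      qed
      have pw: "indicator (ball 0 T) z *\<^sub>R w k z \<le> (\<Sum>ij\<in>I. indicator (ball (a ij) r) z *\<^sub>R w k z)" for z
      proof (cases "z \<in> ball 0 T")
        case True
        then obtain ij where ij: "ij \<in> I" "z \<in> ball (a ij) r" using cover by blast
        have "indicator (ball (a ij) r) z *\<^sub>R w k z \<le> (\<Sum>ij\<in>I. indicator (ball (a ij) r) z *\<^sub>R w k z)"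
          by (rule member_le_sum) (use ij w_nonneg in \<open>auto simp: I_def\<close>)
        then show ?thesis using ij True by simp
      next
        case False then show ?thesis using w_nonneg by (auto intro!: sum_nonneg)
      qed
      have ii: "integrable lborel (\<lambda>z. indicator (ball b s) z *\<^sub>R w k z)" for b s
        using w_integrable[of b s k] by (simp add: set_integrable_def)
      have "(LINT z:ball 0 T|lborel. w k z) \<le> (LINT z|lborel. (\<Sum>ij\<in>I. indicator (ball (a ij) r) z *\<^sub>R w k z))"
        unfolding set_lebesgue_integral_def by (intro integral_mono Bochner_Integration.integrable_sum ii pw)
      also have "\<dots> = (\<Sum>ij\<in>I. LINT z:ball (a ij) r|lborel. w k z)"
        unfolding set_lebesgue_integral_def by (intro Bochner_Integration.integral_sum ii)
      also have "\<dots> \<le> (\<Sum>ij\<in>I. pi * (2 * r)\<^sup>2 * (2 * eta))" using elim by (intro sum_mono) auto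
      also have "\<dots> = real ((2 * N + 1)\<^sup>2) * (pi * (2 * r)\<^sup>2 * (2 * eta))"
      proof -
        have "card {- int N..int N} = 2 * N + 1" by simp
        then have "card I = (2 * N + 1)\<^sup>2" unfolding I_def by (simp only: card_cartesian_product power2_eq_square)
        then show ?thesis by simp
      qed
      also have "\<dots> \<le> (9 * (real N)\<^sup>2) * (pi * (2 * r)\<^sup>2 * (2 * eta))"
      proof (intro mult_right_mono)
        have "real (2 * N + 1) \<le> 3 * real N" using N by simp
        then have "(real (2 * N + 1))\<^sup>2 \<le> (3 * real N)\<^sup>2" by (intro power_mono) auto
        then show "real ((2 * N + 1)\<^sup>2) \<le> 9 * (real N)\<^sup>2" by (simp add: power_mult_distrib)
      qed (use eta in auto)
      also have "\<dots> = 288 * pi * T\<^sup>2 * eta" using N by (simp add: r_def power2_eq_square field_simps)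
      finally show ?case .
    qed
  qed
  show ?thesis
  proof (rule tendsto_norm_zero_cancel, rule order_tendstoI)
    fix a :: real assume a: "0 < a"
    define eta where "eta = a / (2 * (288 * pi * T\<^sup>2))"
    have eta: "0 < eta" using a T by (simp add: eta_def)
    have "288 * pi * T\<^sup>2 * eta = a / 2" using T by (simp add: eta_def field_simps)
    then have lt: "288 * pi * T\<^sup>2 * eta < a" using a by simp
    show "\<forall>\<^sub>F k in sequentially. norm (LINT z:ball 0 T|lborel. w k z) < a"
      using ev[OF eta]
    proof eventually_elim
      case (elim k)
      have "0 \<le> (LINT z:ball 0 T|lborel. w k z)"
        by (auto intro!: integral_nonneg simp: set_lebesgue_integral_def w_nonneg)
      then show ?case using elim lt by simp
    qed
  qed (auto intro!: always_eventually elim: order_less_le_trans)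
qed

end

section \<open>Zero counting measures through differences of circular means\<close>

lemma sum_order_eq_degree:
  fixes p :: "complex poly"
  assumes "p \<noteq> 0"
  shows "(\<Sum>z\<in>{z. poly p z = 0}. order z p) = degree p"
proof -
  have "degree p = degree (smult (lead_coeff p) (\<Prod>z|poly p z = 0. [:-z, 1:] ^ order z p))"
    by (simp only: complex_poly_decompose)
  also have "\<dots> = degree (\<Prod>z|poly p z = 0. [:-z, 1:] ^ order z p)"
    using assms by simp
  also have "\<dots> = (\<Sum>z\<in>{z. poly p z = 0}. order z p)"
    by (subst degree_prod_eq_sum_degree) (auto simp: degree_power_eq)
  finally show ?thesis by simp
qed

text \<open>The difference of the potentials of the uniform measures on circles of radii
  \<open>s\<close> and \<open>s / 2\<close>. It vanishes outside the larger circle, which makes it a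
  test function, and Jensen's formula at the two radii produces it at every root.\<close>

definition bump :: "real \<Rightarrow> complex \<Rightarrow> real" where
  "bump s z = ln (max s (cmod z)) - ln (max (s / 2) (cmod z))"

lemma bump_continuous: "0 < s \<Longrightarrow> continuous_on A (bump s)"
  unfolding bump_def by (intro continuous_intros continuous_on_ln continuous_on_max) auto

lemma bump_measurable [measurable]: "0 < s \<Longrightarrow> bump s \<in> borel_measurable borel"
  by (intro borel_measurable_continuous_onI bump_continuous)

lemma bump_nonneg: "0 < s \<Longrightarrow> 0 \<le> bump s z"
  unfolding bump_def by (auto intro!: ln_mono)

lemma bump_zero: "s \<le> cmod z \<Longrightarrow> 0 < s \<Longrightarrow> bump s z = 0"
  unfolding bump_def by (simp add: max_def)

lemma bump_shift_integrable:
  assumes s: "0 < s"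
  shows "integrable lborel (\<lambda>a. bump s (a - z))"
proof -
  have "integrable lborel (\<lambda>a. indicator (cball z s) a *\<^sub>R bump s (a - z))"
    by (intro borel_integrable_compact continuous_on_compose2[OF bump_continuous[of s UNIV]])
       (use s in \<open>auto intro!: continuous_intros\<close>)
  moreover have "(\<lambda>a. indicator (cball z s) a *\<^sub>R bump s (a - z)) = (\<lambda>a. bump s (a - z))"
    using bump_zero[of s] s by (auto simp: fun_eq_iff indicator_def dist_norm norm_minus_commute)
  ultimately show ?thesis by simp
qed

definition bump_mass :: "real \<Rightarrow> real" where
  "bump_mass s = (LINT a|lborel. bump s a)"

lemma bump_mass_shift: "0 < s \<Longrightarrow> (LINT a|lborel. bump s (a - z)) = bump_mass s"
  unfolding bump_mass_def by (rule lborel_integral_translate[OF bump_measurable])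

lemma bump_mass_pos:
  assumes s: "0 < s"
  shows "0 < bump_mass s"
proof -
  have "pi * (s / 2)\<^sup>2 * ln 2 = (LINT a|lborel. indicator (ball (0::complex) (s / 2)) a * ln 2)"
    using s by (simp add: measure_ball_complex)
  also have "\<dots> \<le> bump_mass s"
    unfolding bump_mass_def
  proof (rule integral_mono)
    show "integrable lborel (bump s)" using bump_shift_integrable[OF s, of 0] by simp
    show "integrable lborel (\<lambda>a::complex. indicator (ball 0 (s / 2)) a * ln (2::real))"
      using s by (intro integrable_mult_left integrable_real_indicator) (auto simp: emeasure_ball_complex)
    fix a :: complex
    show "indicator (ball 0 (s / 2)) a * ln 2 \<le> bump s a"
    proof (cases "a \<in> ball 0 (s / 2)")
      case True
      then have "bump s a = ln s - ln (s / 2)" using s by (simp add: bump_def max_def)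
      then show ?thesis using True s by (simp add: ln_div)
    qed (use bump_nonneg s in auto)
  qed
  finally show ?thesis using s by (smt (verit) divide_pos_pos ln_gt_zero mult_pos_pos pi_gt_zero zero_less_power)
qed

text \<open>Not normalized: after division by \<open>bump_mass s\<close> it is an approximate
  identity, as \<open>smoothed_close\<close> shows.\<close>

definition smoothed :: "real \<Rightarrow> (complex \<Rightarrow> real) \<Rightarrow> complex \<Rightarrow> real" where
  "smoothed s f z = (LINT a|lborel. f a * bump s (a - z))"

lemma smoothed_integrable:
  assumes s: "0 < s" and f: "f \<in> borel_measurable borel" and b: "\<And>z. \<bar>f z\<bar> \<le> C"
  shows "integrable lborel (\<lambda>a. f a * bump s (a - z))"
proof (rule Bochner_Integration.integrable_bound[OF integrable_mult_right[OF bump_shift_integrable[OF s], of C]])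
  show "AE a in lborel. norm (f a * bump s (a - z)) \<le> norm (C * bump s (a - z))"
    using b bump_nonneg[OF s] by (intro AE_I2) (simp add: abs_mult mult_mono order_trans[OF abs_ge_zero b])
qed (use s f in measurable)

lemma smoothed_close:
  assumes s: "0 < s" and f: "f \<in> borel_measurable borel" and b: "\<And>z. \<bar>f z\<bar> \<le> C"
    and eta: "\<And>x y. dist x y < s \<Longrightarrow> \<bar>f x - f y\<bar> \<le> eta"
  shows "\<bar>smoothed s f z / bump_mass s - f z\<bar> \<le> eta"
proof -
  have "\<bar>smoothed s f z - f z * bump_mass s\<bar> = \<bar>LINT a|lborel. f a * bump s (a - z) - f z * bump s (a - z)\<bar>"
    using smoothed_integrable[OF s f b, of z] bump_shift_integrable[OF s, of z]
    by (simp add: smoothed_def bump_mass_shift[OF s])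
  also have "\<dots> \<le> (LINT a|lborel. norm (f a * bump s (a - z) - f z * bump s (a - z)))"
    using integral_norm_bound[of lborel "\<lambda>a. f a * bump s (a - z) - f z * bump s (a - z)"] by simp
  also have "\<dots> \<le> (LINT a|lborel. eta * bump s (a - z))"
  proof (rule integral_mono)
    show "integrable lborel (\<lambda>a. norm (f a * bump s (a - z) - f z * bump s (a - z)))"
      using smoothed_integrable[OF s f b, of z] bump_shift_integrable[OF s, of z] by auto
    show "integrable lborel (\<lambda>a. eta * bump s (a - z))" using bump_shift_integrable[OF s, of z] by simp
    fix a
    have "norm (f a * bump s (a - z) - f z * bump s (a - z)) = \<bar>f a - f z\<bar> * bump s (a - z)"
      using bump_nonneg[OF s, of "a - z"] by (simp add: abs_mult flip: left_diff_distrib)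
    also have "\<dots> \<le> eta * bump s (a - z)"
    proof (cases "dist a z < s")
      case True then show ?thesis using eta[OF True] bump_nonneg[OF s] by (intro mult_right_mono) auto
    next
      case False then show ?thesis using bump_zero[of s "a - z"] s by (simp add: dist_norm)
    qed
    finally show "norm (f a * bump s (a - z) - f z * bump s (a - z)) \<le> eta * bump s (a - z)" .
  qed
  also have "\<dots> = eta * bump_mass s" by (simp add: bump_mass_shift[OF s])
  finally have "\<bar>smoothed s f z - f z * bump_mass s\<bar> \<le> eta * bump_mass s" .
  moreover have "smoothed s f z / bump_mass s - f z = (smoothed s f z - f z * bump_mass s) / bump_mass s"
    using bump_mass_pos[OF s] by (simp add: field_simps)
  ultimately show ?thesis using bump_mass_pos[OF s] by (simp add: abs_divide pos_divide_le_eq)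
qed

lemma compact_support_uniform:
  fixes f :: "complex \<Rightarrow> real"
  assumes c: "continuous_on UNIV f" and T: "\<And>z. T \<le> cmod z \<Longrightarrow> f z = 0" and eta: "0 < eta"
  obtains s where "0 < s" "s \<le> 1" "\<And>x y. dist x y < s \<Longrightarrow> \<bar>f x - f y\<bar> \<le> eta"
proof -
  have "uniformly_continuous_on (cball 0 (T + 1)) f"
    by (intro compact_uniformly_continuous continuous_on_subset[OF c]) auto
  then obtain dlt where dlt: "dlt > 0" "\<And>a b. a \<in> cball 0 (T + 1) \<Longrightarrow> b \<in> cball 0 (T + 1) \<Longrightarrow> dist a b < dlt \<Longrightarrow> dist (f a) (f b) < eta"
    unfolding uniformly_continuous_on_def using eta by metis
  have "\<bar>f x - f y\<bar> \<le> eta" if d: "dist x y < min dlt 1" for x y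
  proof (cases "x \<in> cball 0 (T + 1) \<and> y \<in> cball 0 (T + 1)")
    case True then show ?thesis using dlt(2)[of x y] d by (auto simp: dist_real_def)
  next
    case False
    then have "T \<le> cmod x \<and> T \<le> cmod y"
      using d norm_triangle_ineq2[of x y] norm_triangle_ineq2[of y x] by (auto simp: dist_norm norm_minus_commute)
    then show ?thesis using T[of x] T[of y] eta by simp
  qed
  then show ?thesis using that[of "min dlt 1"] dlt by auto
qed

lemma compact_support_bounded:
  fixes f :: "complex \<Rightarrow> real"
  assumes c: "continuous_on UNIV f" and T: "\<And>z. T \<le> cmod z \<Longrightarrow> f z = 0"
  obtains C where "0 \<le> C" "\<And>z. \<bar>f z\<bar> \<le> C"
proof -
  have "compact (f ` cball 0 T)" by (intro compact_continuous_image continuous_on_subset[OF c]) auto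
  then have "bounded (f ` cball 0 T)" by (rule compact_imp_bounded)
  then obtain B where B: "\<And>z. z \<in> cball 0 T \<Longrightarrow> \<bar>f z\<bar> \<le> B" unfolding bounded_iff real_norm_def by blast
  have "\<bar>f z\<bar> \<le> max B 0" for z
    using B[of z] T[of z] by (cases "cmod z \<le> T") auto
  then show ?thesis using that[of "max B 0"] by auto
qed

lemma ennreal_abs_mult_diff_le:
  fixes F m1 m2 :: real
  assumes "\<bar>F\<bar> \<le> C * indicator B a" "0 \<le> C" "0 \<le> m1" "0 \<le> m2"
  shows "ennreal \<bar>F * (m1 - m2)\<bar> \<le> ennreal C * (ennreal m1 * indicator B a + ennreal m2 * indicator B a)"
proof (cases "a \<in> B")
  case True
  have "\<bar>F * (m1 - m2)\<bar> \<le> C * (m1 + m2)"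
    unfolding abs_mult using assms True by (intro mult_mono) auto
  then have "ennreal \<bar>F * (m1 - m2)\<bar> \<le> ennreal (C * (m1 + m2))" by (rule ennreal_leI)
  also have "\<dots> = ennreal C * (ennreal m1 + ennreal m2)"
    using assms by (simp add: ennreal_mult ennreal_plus)
  finally show ?thesis using True by simp
qed (use assms in simp)

context asymptotic_polys
begin

lemma mean_w: "0 < s \<Longrightarrow> integrable uI (\<lambda>x. w k (a + circ s x))"
  unfolding w_def
  by (intro Bochner_Integration.integrable_diff Bochner_Integration.integrable_add integrable_divide mean_ln_poly p_nz
      integrable_uI_continuous continuous_on_compose2[OF green_continuous] continuous_intros) auto

lemma w_measurable [measurable]: "w k \<in> borel_measurable borel"
  unfolding w_def by measurable

text \<open>Tonelli and translation invariance: moving the centre by a vector of length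
  \<open>s\<close> enlarges the ball by \<open>s\<close>. In this way the smallness of integrals of
  the defect passes to its circular means.\<close>

lemma area_mean_w:
  assumes s: "0 < s"
  shows "(\<integral>\<^sup>+a. ennreal (LINT x|uI. w k (a + circ s x)) * indicator (ball 0 T) a \<partial>lborel)
     \<le> ennreal (LINT z:ball 0 (T + s)|lborel. w k z)"
proof -
  interpret P: pair_sigma_finite "lborel :: complex measure" uI ..
  have [measurable]: "ball 0 r \<in> sets (borel :: complex measure)" for r :: real by simp
  have "(\<integral>\<^sup>+a. ennreal (LINT x|uI. w k (a + circ s x)) * indicator (ball 0 T) a \<partial>lborel) =
     (\<integral>\<^sup>+a. (\<integral>\<^sup>+x. ennreal (w k (a + circ s x)) * indicator (ball 0 T) a \<partial>uI) \<partial>lborel)"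
    by (intro nn_integral_cong) (simp add: nn_integral_multc nn_integral_eq_integral[OF mean_w[OF s]] w_nonneg)
  also have "\<dots> = (\<integral>\<^sup>+x. (\<integral>\<^sup>+a. ennreal (w k (a + circ s x)) * indicator (ball 0 T) a \<partial>lborel) \<partial>uI)"
    by (rule P.Fubini'[symmetric]) measurable
  also have "\<dots> \<le> (\<integral>\<^sup>+x. ennreal (LINT z:ball 0 (T + s)|lborel. w k z) \<partial>uI)"
  proof (rule nn_integral_mono)
    fix x
    have "(\<integral>\<^sup>+a. ennreal (w k (a + circ s x)) * indicator (ball 0 T) a \<partial>lborel)
      \<le> (\<integral>\<^sup>+a. (\<lambda>a. ennreal (w k a) * indicator (ball 0 (T + s)) a) (circ s x + a) \<partial>lborel)"
    proof (rule nn_integral_mono)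
      fix a
      have "a \<in> ball 0 T \<Longrightarrow> circ s x + a \<in> ball 0 (T + s)"
        using norm_triangle_ineq[of "circ s x" a] s by (simp add: norm_mult)
      then show "ennreal (w k (a + circ s x)) * indicator (ball 0 T) a \<le> ennreal (w k (circ s x + a)) * indicator (ball 0 (T + s)) (circ s x + a)"
        by (auto simp: indicator_def add.commute)
    qed
    also have "\<dots> = (\<integral>\<^sup>+a. ennreal (w k a) * indicator (ball 0 (T + s)) a \<partial>distr lborel borel ((+) (circ s x)))"
      by (subst nn_integral_distr) auto
    also have "\<dots> = (\<integral>\<^sup>+a. ennreal (indicator (ball 0 (T + s)) a *\<^sub>R w k a) \<partial>lborel)"
      by (simp add: lborel_distr_plus) (intro nn_integral_cong, auto simp: indicator_def)
    also have "\<dots> = ennreal (LINT z:ball 0 (T + s)|lborel. w k z)"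
      unfolding set_lebesgue_integral_def
      using w_integrable[of 0 "T + s" k] by (intro nn_integral_eq_integral) (auto simp: set_integrable_def w_nonneg)
    finally show "(\<integral>\<^sup>+a. ennreal (w k (a + circ s x)) * indicator (ball 0 T) a \<partial>lborel) \<le> ennreal (LINT z:ball 0 (T + s)|lborel. w k z)" .
  qed
  also have "\<dots> = ennreal (LINT z:ball 0 (T + s)|lborel. w k z)"
    by (simp add: uI.emeasure_space_1[simplified])
  finally show ?thesis .
qed

lemma zero_count_diff:
  assumes le: "\<And>z. \<bar>f z - g z\<bar> \<le> b z"
  shows "\<bar>zero_count_int (d k) (p k) f - zero_count_int (d k) (p k) g\<bar> \<le> zero_count_int (d k) (p k) b"
proof -
  have "\<bar>zero_count_int (d k) (p k) f - zero_count_int (d k) (p k) g\<bar> =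
     \<bar>\<Sum>z\<in>{z. poly (p k) z = 0}. real (order z (p k)) * (f z - g z)\<bar> / real (d k)"
    by (simp add: zero_count_int_def algebra_simps sum_subtractf flip: diff_divide_distrib abs_divide)
       (simp add: abs_divide)
  also have "\<dots> \<le> (\<Sum>z\<in>{z. poly (p k) z = 0}. real (order z (p k)) * b z) / real (d k)"
    using le by (intro divide_right_mono order_trans[OF sum_abs] sum_mono) (auto simp: abs_mult intro!: mult_left_mono)
  finally show ?thesis by (simp add: zero_count_int_def)
qed

lemma zero_count_const:
  assumes "degree (p k) = d k"
  shows "zero_count_int (d k) (p k) (\<lambda>_. b) = b"
  using sum_order_eq_degree[OF p_nz[of k]] assms d_pos[of k]
  by (simp add: zero_count_int_def flip: sum_distrib_right of_nat_sum)

text \<open>The leading coefficient and \<open>eps k\<close> do not depend on the radius, so they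
  cancel between Jensen's formula at \<open>s\<close> and at \<open>s / 2\<close>; only
  \<open>green\<close>, the defect and the roots survive. This is the Laplacian in integrated
  form.\<close>

lemma zero_count_bump:
  assumes s: "0 < s"
  shows "zero_count_int (d k) (p k) (\<lambda>z. bump s (a - z)) =
     (LINT x|uI. green (a + circ s x)) - (LINT x|uI. green (a + circ (s / 2) x))
     - ((LINT x|uI. w k (a + circ s x)) - (LINT x|uI. w k (a + circ (s / 2) x)))"
proof -
  have gi: "integrable uI (\<lambda>x. green (a + circ t x))" for t
    by (intro integrable_uI_continuous continuous_on_compose2[OF green_continuous] continuous_intros) auto
  have m: "(LINT x|uI. w k (a + circ t x)) = (LINT x|uI. green (a + circ t x)) + eps k
      - (ln (cmod (lead_coeff (p k))) + (\<Sum>z\<in>{z. poly (p k) z = 0}. real (order z (p k)) * ln (max t (cmod (a - z))))) / real (d k)" if "0 < t" for t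
    unfolding w_def using mean_ln_poly[OF p_nz[of k] that, of a] gi[of t] uI.prob_space by simp
  have s2: "0 < s / 2" using s by simp
  show ?thesis
    unfolding m[OF s] m[OF s2] zero_count_int_def bump_def
    by (simp add: right_diff_distrib sum_subtractf diff_divide_distrib add_divide_distrib)
qed

lemma zero_count_smoothed:
  assumes s: "0 < s" and f: "f \<in> borel_measurable borel" and b: "\<And>z. \<bar>f z\<bar> \<le> C"
  shows "zero_count_int (d k) (p k) (smoothed s f) = (LINT a|lborel. f a * zero_count_int (d k) (p k) (\<lambda>z. bump s (a - z)))"
    and "integrable lborel (\<lambda>a. f a * zero_count_int (d k) (p k) (\<lambda>z. bump s (a - z)))"
proof -
  have i: "integrable lborel (\<lambda>a. real (order z (p k)) * (f a * bump s (a - z)))" for z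
    using smoothed_integrable[OF s f b] by simp
  have e: "f a * zero_count_int (d k) (p k) (\<lambda>z. bump s (a - z)) = (\<Sum>z\<in>{z. poly (p k) z = 0}. real (order z (p k)) * (f a * bump s (a - z))) / real (d k)" for a
    by (simp add: zero_count_int_def sum_distrib_left mult_ac sum_divide_distrib)
  show "integrable lborel (\<lambda>a. f a * zero_count_int (d k) (p k) (\<lambda>z. bump s (a - z)))"
    unfolding e by (intro integrable_divide Bochner_Integration.integrable_sum i)
  show "zero_count_int (d k) (p k) (smoothed s f) = (LINT a|lborel. f a * zero_count_int (d k) (p k) (\<lambda>z. bump s (a - z)))"
    unfolding e using i by (simp add: zero_count_int_def smoothed_def)
qed

text \<open>By \<open>pot\<close> the part involving \<open>green\<close> is the same for the zeros
  and for \<mu>, so the difference of the two sides, tested against a smoothed function, is an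
  average of the defect and tends to zero. Uniform continuity removes the smoothing for compactly
  supported test functions, and conservation of mass extends the result to bounded ones.\<close>

theorem zeros_converge:
  assumes deg: "\<And>k. degree (p k) = d k"
    and L1: "\<And>T. 0 < T \<Longrightarrow> (\<lambda>k. LINT z:ball 0 T|lborel. w k z) \<longlonglongrightarrow> 0"
    and \<mu>: "prob_space \<mu>" "sets \<mu> = sets borel" "emeasure \<mu> (- E) = 0"
    and pot: "\<And>a s. 0 < s \<Longrightarrow> (LINT z|\<mu>. bump s (a - z)) =
         (LINT x|uI. green (a + circ s x)) - (LINT x|uI. green (a + circ (s / 2) x))"
    and f: "continuous_on UNIV f" "bounded (range f)"
  shows "(\<lambda>k. zero_count_int (d k) (p k) f) \<longlonglongrightarrow> (\<integral>z. f z \<partial>\<mu>)"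
proof -
  interpret M: prob_space \<mu> by (rule \<mu>(1))
  note [measurable_cong] = \<mu>(2)
  have sp: "space \<mu> = UNIV" using sets_eq_imp_space_eq[OF \<mu>(2)] by simp
  let ?N = "\<lambda>k. zero_count_int (d k) (p k)"
  have step1: "(\<lambda>k. ?N k (smoothed s f)) \<longlonglongrightarrow> (LINT z|\<mu>. smoothed s f z) \<and> integrable \<mu> (smoothed s f)"
    if s: "0 < s" and f: "continuous_on UNIV f" "\<And>z. T \<le> cmod z \<Longrightarrow> f z = 0" "0 < T" for s f and T :: real
  proof -
    obtain C where C: "0 \<le> C" "\<And>z. \<bar>f z\<bar> \<le> C" by (rule compact_support_bounded[OF f(1), of T]) (erule f(2), rule that)
    have fm [measurable]: "f \<in> borel_measurable borel" by (intro borel_measurable_continuous_onI f)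
    note [measurable] = bump_measurable[OF s]
    interpret P: pair_sigma_finite \<mu> "lborel :: complex measure" ..
    have supp: "\<bar>f a\<bar> \<le> C * indicator (ball 0 T) a" for a
      using C f(2)[of a] by (cases "cmod a < T") auto
    have ip: "integrable (\<mu> \<Otimes>\<^sub>M lborel) (\<lambda>(z, a). f a * bump s (a - z))"
    proof (rule P.Fubini_integrable)
      show "(\<lambda>(z, a). f a * bump s (a - z)) \<in> borel_measurable (\<mu> \<Otimes>\<^sub>M lborel)" by measurable
      show "AE z in \<mu>. integrable lborel (\<lambda>y. case (z, y) of (z, a) \<Rightarrow> f a * bump s (a - z))"
        using smoothed_integrable[OF s fm C(2)] by simp
      show "integrable \<mu> (\<lambda>z. LINT y|lborel. norm (case (z, y) of (z, a) \<Rightarrow> f a * bump s (a - z)))"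
      proof (rule M.integrable_const_bound[where B = "C * bump_mass s"])
        show "AE z in \<mu>. norm (LINT y|lborel. norm (case (z, y) of (z, a) \<Rightarrow> f a * bump s (a - z))) \<le> C * bump_mass s"
        proof (rule AE_I2)
          fix z
          have "(LINT y|lborel. norm (f y * bump s (y - z))) \<le> (LINT y|lborel. C * bump s (y - z))"
            using smoothed_integrable[OF s fm C(2), of z] bump_shift_integrable[OF s, of z] C(2) bump_nonneg[OF s]
            by (intro integral_mono integrable_norm) (auto simp: abs_mult intro!: mult_right_mono)
          then show "norm (LINT y|lborel. norm (case (z, y) of (z, a) \<Rightarrow> f a * bump s (a - z))) \<le> C * bump_mass s"
            by (simp add: bump_mass_shift[OF s] Bochner_Integration.integral_nonneg)
        qed
        show "(\<lambda>z. LINT y|lborel. norm (case (z, y) of (z, a) \<Rightarrow> f a * bump s (a - z))) \<in> borel_measurable \<mu>" by measurable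
      qed
    qed
    have im: "integrable \<mu> (smoothed s f)"
      using P.integrable_fst[OF ip] unfolding smoothed_def[abs_def] by simp
    have fub: "(LINT z|\<mu>. smoothed s f z) = (LINT a|lborel. f a * (LINT z|\<mu>. bump s (a - z)))"
      using P.integral_fst[OF ip] P.integral_snd[OF ip] by (simp add: smoothed_def)
    have iS: "integrable lborel (\<lambda>a. f a * (LINT z|\<mu>. bump s (a - z)))"
      using P.integrable_snd[OF ip] by simp
    have diff: "\<bar>?N k (smoothed s f) - (LINT z|\<mu>. smoothed s f z)\<bar> \<le>
        C * ((LINT z:ball 0 (T + s)|lborel. w k z) + (LINT z:ball 0 (T + s / 2)|lborel. w k z))" for k
    proof -
      let ?m = "\<lambda>s a. LINT x|uI. w k (a + circ s x)"
      have s2: "0 < s / 2" using s by simp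
      have Inn: "0 \<le> (LINT z:ball 0 r|lborel. w k z)" for r
        unfolding set_lebesgue_integral_def by (intro Bochner_Integration.integral_nonneg) (simp add: w_nonneg)
      have nn: "0 \<le> ?m t a" for t a by (intro Bochner_Integration.integral_nonneg w_nonneg)
      have "?N k (smoothed s f) - (LINT z|\<mu>. smoothed s f z) = (LINT a|lborel. f a * ?N k (\<lambda>z. bump s (a - z)) - f a * (LINT z|\<mu>. bump s (a - z)))"
        using zero_count_smoothed[OF s fm C(2), of k] iS by (simp add: fub)
      also have "\<dots> = (LINT a|lborel. - (f a * (?m s a - ?m (s / 2) a)))"
        by (intro Bochner_Integration.integral_cong refl) (simp add: zero_count_bump[OF s] pot[OF s] algebra_simps)
      finally have eqN: "\<bar>?N k (smoothed s f) - (LINT z|\<mu>. smoothed s f z)\<bar> = \<bar>LINT a|lborel. f a * (?m s a - ?m (s / 2) a)\<bar>" by simp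
      \<comment> \<open>The integral of a non-integrable function is \<open>0\<close> by convention,
        so the estimate holds in either case.\<close>
      have "ennreal \<bar>LINT a|lborel. f a * (?m s a - ?m (s / 2) a)\<bar> \<le> (\<integral>\<^sup>+a. ennreal \<bar>f a * (?m s a - ?m (s / 2) a)\<bar> \<partial>lborel)"
        using integral_norm_bound_ennreal[of lborel "\<lambda>a. f a * (?m s a - ?m (s / 2) a)"]
        by (cases "integrable lborel (\<lambda>a. f a * (?m s a - ?m (s / 2) a))") (auto simp: not_integrable_integral_eq)
      also have "\<dots> \<le> (\<integral>\<^sup>+a. ennreal C * (ennreal (?m s a) * indicator (ball 0 T) a + ennreal (?m (s / 2) a) * indicator (ball 0 T) a) \<partial>lborel)"
        by (intro nn_integral_mono ennreal_abs_mult_diff_le supp C(1) nn)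
      also have "\<dots> = ennreal C * ((\<integral>\<^sup>+a. ennreal (?m s a) * indicator (ball 0 T) a \<partial>lborel) + (\<integral>\<^sup>+a. ennreal (?m (s / 2) a) * indicator (ball 0 T) a \<partial>lborel))"
      proof -
        have [measurable]: "ball 0 r \<in> sets (borel :: complex measure)" for r :: real by simp
        have [measurable]: "(\<lambda>a. ?m t a) \<in> borel_measurable lborel" for t
          by measurable
        show ?thesis by (subst nn_integral_cmult, measurable, subst nn_integral_add) auto
      qed
      also have "\<dots> \<le> ennreal C * (ennreal (LINT z:ball 0 (T + s)|lborel. w k z) + ennreal (LINT z:ball 0 (T + s / 2)|lborel. w k z))"
        by (intro mult_left_mono add_mono area_mean_w s s2) auto
      also have "\<dots> = ennreal (C * ((LINT z:ball 0 (T + s)|lborel. w k z) + (LINT z:ball 0 (T + s / 2)|lborel. w k z)))"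
        using C(1) Inn by (simp add: ennreal_mult ennreal_plus)
      finally show ?thesis unfolding eqN
        using C(1) Inn by (subst (asm) ennreal_le_iff) auto
    qed
    have "(\<lambda>k. C * ((LINT z:ball 0 (T + s)|lborel. w k z) + (LINT z:ball 0 (T + s / 2)|lborel. w k z))) \<longlonglongrightarrow> C * (0 + 0)"
      using s f(3) by (intro tendsto_intros L1) auto
    then have "(\<lambda>k. C * ((LINT z:ball 0 (T + s)|lborel. w k z) + (LINT z:ball 0 (T + s / 2)|lborel. w k z))) \<longlonglongrightarrow> 0" by simp
    then have "(\<lambda>k. ?N k (smoothed s f) - (LINT z|\<mu>. smoothed s f z)) \<longlonglongrightarrow> 0"
      by (rule Lim_null_comparison[rotated]) (auto intro!: always_eventually simp: diff)
    then show ?thesis using im by (simp add: LIM_zero_iff)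
  qed
  have step2: "(\<lambda>k. ?N k f) \<longlonglongrightarrow> (LINT z|\<mu>. f z)"
    if f: "continuous_on UNIV f" "\<And>z. T \<le> cmod z \<Longrightarrow> f z = 0" "0 < T" for f and T :: real
  proof (rule LIMSEQ_I)
    fix e :: real assume e: "0 < e"
    define eta where "eta = e / 4"
    have eta: "0 < eta" using e by (simp add: eta_def)
    obtain C where C: "0 \<le> C" "\<And>z. \<bar>f z\<bar> \<le> C" by (rule compact_support_bounded[OF f(1), of T]) (erule f(2), rule that)
    have fm [measurable]: "f \<in> borel_measurable borel" by (intro borel_measurable_continuous_onI f)
    obtain s where s: "0 < s" "\<And>x y. dist x y < s \<Longrightarrow> \<bar>f x - f y\<bar> \<le> eta"
      by (rule compact_support_uniform[OF f(1) _ eta, of T]) (erule f(2), rule that)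
    define F where "F = (\<lambda>z. smoothed s f z / bump_mass s)"
    have cl: "\<bar>F z - f z\<bar> \<le> eta" for z unfolding F_def by (rule smoothed_close[OF s(1) fm C(2) s(2)])
    have NF: "?N k F = ?N k (smoothed s f) / bump_mass s" for k
      by (simp add: zero_count_int_def F_def sum_divide_distrib mult.commute)
    have st: "(\<lambda>k. ?N k (smoothed s f)) \<longlonglongrightarrow> (LINT z|\<mu>. smoothed s f z) \<and> integrable \<mu> (smoothed s f)"
      by (rule step1[OF s(1) f(1), of T]) (use f(2,3) in auto)
    have "(\<lambda>k. ?N k F) \<longlonglongrightarrow> (LINT z|\<mu>. smoothed s f z) / bump_mass s"
      unfolding NF using st bump_mass_pos[OF s(1)] by (intro tendsto_divide) auto
    then have NFl: "(\<lambda>k. ?N k F) \<longlonglongrightarrow> (LINT z|\<mu>. F z)" by (simp add: F_def)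
    then obtain k0 where k0: "\<And>k. k0 \<le> k \<Longrightarrow> \<bar>?N k F - (LINT z|\<mu>. F z)\<bar> < eta"
      using LIMSEQ_D[OF NFl eta] unfolding real_norm_def by blast
    have iF: "integrable \<mu> F" using st by (simp add: F_def)
    have if1: "integrable \<mu> f" by (rule M.integrable_const_bound[where B = C]) (use C in auto)
    have "\<bar>(LINT z|\<mu>. F z) - (LINT z|\<mu>. f z)\<bar> = \<bar>LINT z|\<mu>. F z - f z\<bar>" using iF if1 by simp
    also have "\<dots> \<le> (LINT z|\<mu>. \<bar>F z - f z\<bar>)" by (rule integral_abs_bound)
    also have "\<dots> \<le> (LINT z|\<mu>. eta)" using iF if1 cl by (intro integral_mono) auto
    finally have 2: "\<bar>(LINT z|\<mu>. F z) - (LINT z|\<mu>. f z)\<bar> \<le> eta" using M.prob_space by simp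
    have "norm (?N k f - (LINT z|\<mu>. f z)) < e" if "k0 \<le> k" for k
    proof -
      have "\<bar>?N k F - ?N k f\<bar> \<le> eta" using zero_count_diff[OF cl, of k] zero_count_const[OF deg, of k] by simp
      then show ?thesis using k0[OF that] 2 unfolding eta_def real_norm_def by linarith
    qed
    then show "\<exists>k0. \<forall>k\<ge>k0. norm (?N k f - (LINT z|\<mu>. f z)) < e" by blast
  qed
  obtain T0 where T0: "E \<subseteq> ball 0 T0" "0 < T0"
    using bounded_subset_ballD[OF compact_imp_bounded[OF compact_E], of 0] by auto
  \<comment> \<open>A cut-off equal to one on \<open>E\<close>, which carries \<mu>. Its averages
    over the zeros tend to one, so no proportion of the zeros escapes to infinity and a bounded test
    function may be multiplied by it.\<close>
  define \<theta> where "\<theta> z = max 0 (min 1 (T0 + 1 - cmod z))" for z :: complex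
  have \<theta>: "continuous_on UNIV \<theta>" "0 \<le> \<theta> z" "\<theta> z \<le> 1" for z
    by (auto simp: \<theta>_def[abs_def] intro!: continuous_intros continuous_on_max continuous_on_min)
  have \<theta>E: "\<theta> z = 1" if "z \<in> E" for z using that T0 by (force simp: \<theta>_def)
  have \<theta>0: "\<theta> z = 0" if "T0 + 1 \<le> cmod z" for z using that by (simp add: \<theta>_def)
  obtain C where C: "\<And>z. \<bar>f z\<bar> \<le> C" using f(2) unfolding bounded_iff by auto
  have C0: "0 \<le> C" using C[of 0] by linarith
  have AEE: "AE z in \<mu>. z \<in> E"
    using \<mu>(3) compact_E by (intro AE_I[where N = "- E"]) (auto simp: \<mu>(2) borel_closed compact_imp_closed)
  have [measurable]: "f \<in> borel_measurable borel" "\<theta> \<in> borel_measurable borel"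
    by (intro borel_measurable_continuous_onI f \<theta>)+
  have l1: "(\<lambda>k. ?N k (\<lambda>z. f z * \<theta> z)) \<longlonglongrightarrow> (LINT z|\<mu>. f z * \<theta> z)"
    by (rule step2[of "\<lambda>z. f z * \<theta> z" "T0 + 1"]) (use f \<theta> \<theta>0 T0 in \<open>auto intro!: continuous_intros\<close>)
  have e1: "(LINT z|\<mu>. f z * \<theta> z) = (LINT z|\<mu>. f z)"
    by (intro integral_cong_AE) (use AEE \<theta>E in auto)
  have l2: "(\<lambda>k. ?N k \<theta>) \<longlonglongrightarrow> (LINT z|\<mu>. \<theta> z)"
    by (rule step2[of \<theta> "T0 + 1"]) (use \<theta> \<theta>0 T0 in auto)
  have e2: "(LINT z|\<mu>. \<theta> z) = (LINT z|\<mu>. 1)"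
    by (intro integral_cong_AE) (use AEE \<theta>E in auto)
  have bd: "\<bar>?N k f - ?N k (\<lambda>z. f z * \<theta> z)\<bar> \<le> C * (1 - ?N k \<theta>)" for k
  proof -
    have "\<bar>f z - f z * \<theta> z\<bar> \<le> C - C * \<theta> z" for z
    proof -
      have "\<bar>f z - f z * \<theta> z\<bar> = \<bar>f z\<bar> * (1 - \<theta> z)" using abs_mult[of "f z" "1 - \<theta> z"] \<theta>(3)[of z] by (simp add: right_diff_distrib)
      also have "\<dots> \<le> C * (1 - \<theta> z)" using C \<theta>(3)[of z] by (intro mult_right_mono) auto
      finally show ?thesis by (simp add: right_diff_distrib)
    qed
    from zero_count_diff[OF this, of k]
    have "\<bar>?N k f - ?N k (\<lambda>z. f z * \<theta> z)\<bar> \<le> ?N k (\<lambda>z. C - C * \<theta> z)" .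
    also have "?N k (\<lambda>z. C - C * \<theta> z) = ?N k (\<lambda>_. C) - C * ?N k \<theta>"
      by (simp add: zero_count_int_def algebra_simps sum_subtractf sum_distrib_left diff_divide_distrib)
    finally show ?thesis using zero_count_const[OF deg] by (simp add: right_diff_distrib)
  qed
  have "(\<lambda>k. C * (1 - ?N k \<theta>)) \<longlonglongrightarrow> C * (1 - 1)"
    using l2 e2 M.prob_space by (intro tendsto_intros) simp
  then have "(\<lambda>k. C * (1 - ?N k \<theta>)) \<longlonglongrightarrow> 0" by simp
  then have "(\<lambda>k. ?N k f - ?N k (\<lambda>z. f z * \<theta> z)) \<longlonglongrightarrow> 0"
    by (rule Lim_null_comparison[rotated]) (auto intro!: always_eventually simp: bd)
  from tendsto_add[OF this l1] show ?thesis by (simp add: e1)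
qed

end

section \<open>Positivity of the logarithmic energy\<close>

text \<open>The quotient is the integral of \<open>exp (- x * y)\<close> over \<open>y\<close>
  between \<open>A\<close> and \<open>B\<close>, and integrating over \<open>x\<close> first leaves
  \<open>1 / y\<close>.\<close>

lemma nn_integral_frullani:
  assumes A: "0 < A" "A \<le> B"
  shows "(\<integral>\<^sup>+x. ennreal ((exp (- x * A) - exp (- x * B)) / x) * indicator {0<..} x \<partial>lborel) = ennreal (ln B - ln A)"
proof -
  have inner1: "(\<integral>\<^sup>+y. ennreal (exp (- x * y)) * indicator {A..B} y \<partial>lborel) = ennreal ((exp (- x * A) - exp (- x * B)) / x)" if x: "0 < x" for x :: real
  proof -
    have "(\<integral>\<^sup>+y. ennreal (exp (- x * y)) * indicator {A..B} y \<partial>lborel) = ennreal ((- exp (- x * B) / x) - (- exp (- x * A) / x))"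
      by (rule nn_integral_FTC_Icc) (use x A in \<open>auto intro!: derivative_eq_intros\<close>)
    then show ?thesis by (simp add: diff_divide_distrib)
  qed
  have inner2: "(\<integral>\<^sup>+x. ennreal (exp (- x * y)) * indicator {0..} x \<partial>lborel) = ennreal (1 / y)" if y: "0 < y" for y :: real
  proof -
    have "(\<integral>\<^sup>+x. ennreal (exp (- x * y)) * indicator {0..} x \<partial>lborel) = ennreal (0 - (- exp (- 0 * y) / y))"
    proof (rule nn_integral_FTC_atLeast)
      show "((\<lambda>x. - exp (- x * y) / y) \<longlongrightarrow> 0) at_top" using y by real_asymp
    qed (use y in \<open>auto intro!: derivative_eq_intros\<close>)
    then show ?thesis by simp
  qed
  have "(\<integral>\<^sup>+x. ennreal ((exp (- x * A) - exp (- x * B)) / x) * indicator {0<..} x \<partial>lborel) =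
      (\<integral>\<^sup>+x. (\<integral>\<^sup>+y. ennreal (exp (- x * y)) * indicator {A..B} y * indicator {0<..} x \<partial>lborel) \<partial>lborel)"
  proof (rule nn_integral_cong)
    fix x :: real
    show "ennreal ((exp (- x * A) - exp (- x * B)) / x) * indicator {0<..} x = (\<integral>\<^sup>+y. ennreal (exp (- x * y)) * indicator {A..B} y * indicator {0<..} x \<partial>lborel)"
      using inner1[of x] by (cases "0 < x") auto
  qed
  also have "\<dots> = (\<integral>\<^sup>+y. (\<integral>\<^sup>+x. ennreal (exp (- x * y)) * indicator {A..B} y * indicator {0<..} x \<partial>lborel) \<partial>lborel)"
    by (rule lborel_pair.Fubini') measurable
  also have "\<dots> = (\<integral>\<^sup>+y. ennreal (1 / y) * indicator {A..B} y \<partial>lborel)"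
  proof (rule nn_integral_cong)
    fix y :: real
    show "(\<integral>\<^sup>+x. ennreal (exp (- x * y)) * indicator {A..B} y * indicator {0<..} x \<partial>lborel) = ennreal (1 / y) * indicator {A..B} y"
    proof (cases "y \<in> {A..B}")
      case True
      then have y: "0 < y" using A by auto
      have "(\<integral>\<^sup>+x. ennreal (exp (- x * y)) * indicator {A..B} y * indicator {0<..} x \<partial>lborel) = (\<integral>\<^sup>+x. ennreal (exp (- x * y)) * indicator {0..} x \<partial>lborel)"
        using True by (intro nn_integral_cong_AE AE_I[where N = "{0}"]) (auto simp: indicator_def)
      then show ?thesis using inner2[OF y] True by simp
    qed simp
  qed
  also have "\<dots> = ennreal (ln B - ln A)"
    by (rule nn_integral_FTC_Icc) (use A in \<open>auto intro!: derivative_eq_intros\<close>)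
  finally show ?thesis .
qed

text \<open>Integrates over \<open>x\<close> to \<open>- ln D\<close> and so writes the logarithmic
  kernel as a superposition of Gaussians, once \<open>D\<close> is a squared distance. The term
  \<open>exp (- x)\<close> makes the integral converge at \<open>0\<close>; it cancels between
  probability measures in the energy defect.\<close>

definition frul :: "real \<Rightarrow> real \<Rightarrow> real" where
  "frul D x = indicator {0<..} x * ((exp (- x * D) - exp (- x)) / x)"

lemma frul_measurable [measurable]:
  assumes [measurable]: "f \<in> borel_measurable M" "g \<in> borel_measurable M"
  shows "(\<lambda>x. frul (f x) (g x)) \<in> borel_measurable M"
  unfolding frul_def by measurable

lemma frullani:
  assumes D: "0 < D"
  shows "integrable lborel (frul D)" "(LINT x|lborel. frul D x) = - ln D" "(LINT x|lborel. \<bar>frul D x\<bar>) = \<bar>ln D\<bar>"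
proof -
  define A where "A = min D 1"
  define B where "B = max D 1"
  define sig where "sig = (if D \<le> 1 then 1 else - 1 :: real)"
  have AB: "0 < A" "A \<le> B" using D by (auto simp: A_def B_def)
  let ?f = "\<lambda>x. (exp (- x * A) - exp (- x * B)) / x * indicator {0<..} x"
  have nn: "0 \<le> ?f x" for x using AB by (auto simp: indicator_def)
  have nnf: "(\<integral>\<^sup>+x. ennreal (?f x) \<partial>lborel) = ennreal (ln B - ln A)"
    unfolding nn_integral_frullani[OF AB, symmetric] by (intro nn_integral_cong) (auto simp: indicator_def)
  have lnn: "0 \<le> ln B - ln A" using AB by simp
  have i: "integrable lborel ?f" using nnf nn by (intro integrableI_nonneg) auto
  have v: "(LINT x|lborel. ?f x) = ln B - ln A"
    using nnf nn lnn by (intro integral_eq_nn_integral[THEN trans]) auto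
  have eq: "frul D = (\<lambda>x. sig * ?f x)"
    by (auto simp: fun_eq_iff frul_def sig_def A_def B_def min_def max_def indicator_def diff_divide_distrib)
  have eqa: "\<bar>frul D x\<bar> = ?f x" for x
  proof -
    have "\<bar>frul D x\<bar> = \<bar>sig\<bar> * \<bar>?f x\<bar>" by (simp only: eq abs_mult)
    moreover have "\<bar>?f x\<bar> = ?f x" by (rule abs_of_nonneg[OF nn])
    moreover have "\<bar>sig\<bar> = 1" by (simp add: sig_def)
    ultimately show ?thesis by (simp only: mult_1)
  qed
  show "integrable lborel (frul D)" unfolding eq using i by (rule integrable_mult_right)
  show "(LINT x|lborel. frul D x) = - ln D"
  proof -
    have "(LINT x|lborel. frul D x) = sig * (ln B - ln A)"
      unfolding eq by (simp only: integral_mult_right_zero v)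
    then show ?thesis by (simp add: sig_def A_def B_def min_def max_def)
  qed
  show "(LINT x|lborel. \<bar>frul D x\<bar>) = \<bar>ln D\<bar>"
    unfolding eqa v using D by (auto simp: A_def B_def min_def max_def)
qed

text \<open>Mutual energy for the Gaussian kernel; \<open>x\<close> is an inverse squared
  width.\<close>

definition gE :: "complex measure \<Rightarrow> complex measure \<Rightarrow> real \<Rightarrow> real" where
  "gE \<alpha> \<beta> x = (LINT q|(\<alpha> \<Otimes>\<^sub>M \<beta>). exp (- x * (cmod (fst q - snd q))\<^sup>2))"

locale two_probs = A: prob_space \<alpha> + B: prob_space \<beta> for \<alpha> \<beta> :: "complex measure" +
  assumes sets_A: "sets \<alpha> = sets borel" and sets_B: "sets \<beta> = sets borel"
begin

sublocale PP: pair_prob_space \<alpha> \<beta> ..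

lemma gauss_integrable:
  assumes "0 \<le> x"
  shows "integrable (\<alpha> \<Otimes>\<^sub>M \<beta>) (\<lambda>q. exp (- x * (cmod (fst q - snd q))\<^sup>2))"
proof -
  note [measurable_cong] = sets_A sets_B
  show ?thesis
    by (rule PP.P.integrable_const_bound[where B = 1]) (use assms in \<open>auto simp: mult_nonneg_nonneg\<close>)
qed

text \<open>Frullani's integral with \<open>D\<close> the squared distance, whence the factor two.
  The diagonal has to be a null set, since there \<open>ln 0 = 0\<close> is not the value of the
  kernel.\<close>

lemma energy_frullani:
  assumes i: "integrable (\<alpha> \<Otimes>\<^sub>M \<beta>) (\<lambda>q. ln (cmod (fst q - snd q)))"
    and ne: "AE q in \<alpha> \<Otimes>\<^sub>M \<beta>. fst q \<noteq> snd q"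
  shows "integrable lborel (\<lambda>x. indicator {0<..} x * ((gE \<alpha> \<beta> x - exp (- x)) / x))"
    and "(LINT x|lborel. indicator {0<..} x * ((gE \<alpha> \<beta> x - exp (- x)) / x)) = - 2 * (LINT q|(\<alpha> \<Otimes>\<^sub>M \<beta>). ln (cmod (fst q - snd q)))"
proof -
  note [measurable_cong] = sets_A sets_B
  interpret Q: pair_sigma_finite "\<alpha> \<Otimes>\<^sub>M \<beta>" "lborel :: real measure" ..
  let ?D = "\<lambda>q. (cmod (fst q - snd q))\<^sup>2"
  have pos: "AE q in \<alpha> \<Otimes>\<^sub>M \<beta>. 0 < ?D q" using ne by eventually_elim simp
  have lnD: "ln (?D q) = 2 * ln (cmod (fst q - snd q))" if "0 < ?D q" for q
    using that by (simp add: ln_realpow)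
  have ip: "integrable ((\<alpha> \<Otimes>\<^sub>M \<beta>) \<Otimes>\<^sub>M lborel) (\<lambda>(q, x). frul (?D q) x)"
  proof (rule Q.Fubini_integrable)
    show "(\<lambda>(q, x). frul (?D q) x) \<in> borel_measurable ((\<alpha> \<Otimes>\<^sub>M \<beta>) \<Otimes>\<^sub>M lborel)" by measurable
    show "AE q in \<alpha> \<Otimes>\<^sub>M \<beta>. integrable lborel (\<lambda>y. case (q, y) of (q, x) \<Rightarrow> frul (?D q) x)"
      using pos by eventually_elim (use frullani in simp)
    have e: "AE q in \<alpha> \<Otimes>\<^sub>M \<beta>. (LINT y|lborel. norm (case (q, y) of (q, x) \<Rightarrow> frul (?D q) x)) = \<bar>2 * ln (cmod (fst q - snd q))\<bar>"
      using pos by eventually_elim (simp add: frullani(3) lnD)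
    show "integrable (\<alpha> \<Otimes>\<^sub>M \<beta>) (\<lambda>q. LINT y|lborel. norm (case (q, y) of (q, x) \<Rightarrow> frul (?D q) x))"
      by (subst integrable_cong_AE[OF _ _ e]) (use i in \<open>measurable, auto\<close>)
  qed
  have sl: "(LINT q|(\<alpha> \<Otimes>\<^sub>M \<beta>). frul (?D q) x) = indicator {0<..} x * ((gE \<alpha> \<beta> x - exp (- x)) / x)" for x
  proof (cases "0 < x")
    case True
    then show ?thesis using gauss_integrable[of x] PP.P.prob_space by (simp add: frul_def gE_def)
  qed (simp add: frul_def)
  show "integrable lborel (\<lambda>x. indicator {0<..} x * ((gE \<alpha> \<beta> x - exp (- x)) / x))"
    using Q.integrable_snd[OF ip] by (simp add: sl)
  have "(LINT x|lborel. indicator {0<..} x * ((gE \<alpha> \<beta> x - exp (- x)) / x)) = (LINT q|(\<alpha> \<Otimes>\<^sub>M \<beta>). (LINT x|lborel. frul (?D q) x))"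
    using Q.integral_snd[OF ip] Q.integral_fst[OF ip] by (simp add: sl)
  also have "\<dots> = (LINT q|(\<alpha> \<Otimes>\<^sub>M \<beta>). - 2 * ln (cmod (fst q - snd q)))"
  proof (rule integral_cong_AE)
    show "AE q in \<alpha> \<Otimes>\<^sub>M \<beta>. (LINT x|lborel. frul (?D q) x) = - 2 * ln (cmod (fst q - snd q))"
      using pos by eventually_elim (simp add: frullani(2) lnD)
  qed measurable
  finally show "(LINT x|lborel. indicator {0<..} x * ((gE \<alpha> \<beta> x - exp (- x)) / x)) = - 2 * (LINT q|(\<alpha> \<Otimes>\<^sub>M \<beta>). ln (cmod (fst q - snd q)))" by simp
qed

end

section \<open>Gaussian convolutions and the energy defect\<close>

lemma gaussian_real:
  assumes "0 < (a::real)"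
  shows "(\<integral>\<^sup>+t. ennreal (exp (- a * t\<^sup>2)) \<partial>lborel) = ennreal (sqrt (pi / a))"
proof -
  define sig where "sig = sqrt (1 / (2 * a))"
  have sig: "0 < sig" "sig\<^sup>2 = 1 / (2 * a)" using assms by (auto simp: sig_def)
  have nd: "exp (- a * t\<^sup>2) = sqrt (pi / a) * normal_density 0 sig t" for t
    using assms by (simp add: normal_density_def sig(2) field_simps)
  have "(\<integral>\<^sup>+t. ennreal (exp (- a * t\<^sup>2)) \<partial>lborel) = ennreal (LINT t|lborel. exp (- a * t\<^sup>2))"
    unfolding nd using integrable_normal_density[OF sig(1)] assms
    by (intro nn_integral_eq_integral integrable_mult_right) (auto simp: normal_density_nonneg)
  also have "(LINT t|lborel. exp (- a * t\<^sup>2)) = sqrt (pi / a)"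
    unfolding nd using integral_normal_density[OF sig(1)] by simp
  finally show ?thesis .
qed

lemma gaussian_complex:
  assumes a: "0 < a"
  shows "integrable lborel (\<lambda>z::complex. exp (- a * (cmod z)\<^sup>2))" "(LINT z|lborel. exp (- a * (cmod z)\<^sup>2)) = pi / a"
proof -
  have "(\<integral>\<^sup>+z. ennreal (exp (- a * (cmod z)\<^sup>2)) \<partial>lborel) = (\<integral>\<^sup>+z. (\<Prod>b\<in>(Basis::complex set). (\<lambda>t. ennreal (exp (- a * t\<^sup>2))) (z \<bullet> b)) \<partial>lborel)"
  proof (rule nn_integral_cong)
    fix z :: complex
    have "exp (- a * (cmod z)\<^sup>2) = exp (- a * (Re z)\<^sup>2) * exp (- a * (Im z)\<^sup>2)"
      by (simp add: cmod_power2 distrib_left flip: exp_add)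
    then show "ennreal (exp (- a * (cmod z)\<^sup>2)) = (\<Prod>b\<in>Basis. (\<lambda>t. ennreal (exp (- a * t\<^sup>2))) (z \<bullet> b))"
      by (simp add: Basis_complex_def ennreal_mult)
  qed
  also have "\<dots> = (\<Prod>b\<in>(Basis::complex set). (\<integral>\<^sup>+t. ennreal (exp (- a * t\<^sup>2)) \<partial>lborel))"
    by (rule nn_integral_lborel_prod) auto
  also have "\<dots> = ennreal (pi / a)"
    unfolding gaussian_real[OF a] using a by (simp add: Basis_complex_def flip: ennreal_mult)
  finally have n: "(\<integral>\<^sup>+z. ennreal (exp (- a * (cmod z)\<^sup>2)) \<partial>lborel) = ennreal (pi / a)" .
  then show "integrable lborel (\<lambda>z::complex. exp (- a * (cmod z)\<^sup>2))" by (intro integrableI_nonneg) auto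
  show "(LINT z|lborel. exp (- a * (cmod z)\<^sup>2)) = pi / a"
    using n a by (intro integral_eq_nn_integral[THEN trans]) auto
qed

lemma gaussian_complex_shift:
  assumes a: "0 < a"
  shows "integrable lborel (\<lambda>z::complex. exp (- a * (cmod (z - w))\<^sup>2))" "(LINT z|lborel. exp (- a * (cmod (z - w))\<^sup>2)) = pi / a"
proof -
  have "integrable (distr lborel borel ((+) (- w))) (\<lambda>z::complex. exp (- a * (cmod z)\<^sup>2))"
    using gaussian_complex(1)[OF a] by (simp add: lborel_distr_plus)
  then show "integrable lborel (\<lambda>z::complex. exp (- a * (cmod (z - w))\<^sup>2))"
    by (subst (asm) integrable_distr_eq) auto
  have "(LINT z|lborel. exp (- a * (cmod z)\<^sup>2)) = (LINT z|distr lborel borel ((+) (- w)). exp (- a * (cmod z)\<^sup>2))"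
    by (simp add: lborel_distr_plus)
  also have "\<dots> = (LINT z|lborel. exp (- a * (cmod (z - w))\<^sup>2))"
    by (subst integral_distr) auto
  finally show "(LINT z|lborel. exp (- a * (cmod (z - w))\<^sup>2)) = pi / a" using gaussian_complex(2)[OF a] by simp
qed

text \<open>The rate is \<open>2 * x\<close> because the product of two such factors, integrated
  over the centre \<open>a\<close>, reproduces the kernel of rate \<open>x\<close>; see
  \<open>parallelogram_gauss\<close>.\<close>

definition gA :: "complex measure \<Rightarrow> real \<Rightarrow> complex \<Rightarrow> real" where
  "gA nu x a = (LINT z|nu. exp (- (2 * x) * (cmod (z - a))\<^sup>2))"

lemma parallelogram_gauss:
  "exp (- (2 * x) * (cmod (z - a))\<^sup>2) * exp (- (2 * x) * (cmod (w - a))\<^sup>2) =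
   exp (- x * (cmod (z - w))\<^sup>2) * exp (- (4 * x) * (cmod (a - (z + w) / 2))\<^sup>2)"
proof -
  have "(- (2 * x) * (cmod (z - a))\<^sup>2) + (- (2 * x) * (cmod (w - a))\<^sup>2) = (- x * (cmod (z - w))\<^sup>2) + (- (4 * x) * (cmod (a - (z + w) / 2))\<^sup>2)"
    unfolding cmod_power2 by (simp add: power2_eq_square algebra_simps) (simp add: field_simps)
  then show ?thesis by (simp only: exp_add[symmetric])
qed

context two_probs
begin

text \<open>By the parallelogram law the product of the two Gaussians separates into the kernel in
  \<open>z - w\<close> and a Gaussian in \<open>a\<close> about the midpoint, whose mass is
  \<open>pi / (4 * x)\<close>. The Gaussian energy thus becomes an inner product of convolutions,
  which shows its positivity.\<close>

lemma gauss_convolution: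
  assumes x: "0 < x"
  shows "integrable lborel (\<lambda>a. gA \<alpha> x a * gA \<beta> x a)"
    and "(LINT a|lborel. gA \<alpha> x a * gA \<beta> x a) = pi / (4 * x) * gE \<alpha> \<beta> x"
proof -
  note [measurable_cong] = sets_A sets_B
  interpret Q: pair_sigma_finite "\<alpha> \<Otimes>\<^sub>M \<beta>" "lborel :: complex measure" ..
  let ?K = "\<lambda>q a. exp (- x * (cmod (fst q - snd q))\<^sup>2) * exp (- (4 * x) * (cmod (a - (fst q + snd q) / 2))\<^sup>2)"
  have x4: "0 < 4 * x" using x by simp
  have inner: "integrable lborel (?K q)" "(LINT a|lborel. ?K q a) = exp (- x * (cmod (fst q - snd q))\<^sup>2) * (pi / (4 * x))" for q
    using gaussian_complex_shift[OF x4, of "(fst q + snd q) / 2"] by auto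
  have ip: "integrable ((\<alpha> \<Otimes>\<^sub>M \<beta>) \<Otimes>\<^sub>M lborel) (\<lambda>(q, a). ?K q a)"
  proof (rule Q.Fubini_integrable)
    show "(\<lambda>(q, a). ?K q a) \<in> borel_measurable ((\<alpha> \<Otimes>\<^sub>M \<beta>) \<Otimes>\<^sub>M lborel)" by measurable
    show "integrable (\<alpha> \<Otimes>\<^sub>M \<beta>) (\<lambda>q. LINT y|lborel. norm (case (q, y) of (q, a) \<Rightarrow> ?K q a))"
      using gauss_integrable[of x] x inner(2) by simp
  qed (use inner in auto)
  have ga: "integrable \<alpha> (\<lambda>z. exp (- (2 * x) * (cmod (z - a))\<^sup>2))" for a
    by (rule A.integrable_const_bound[where B = 1]) (use x in auto)
  have gb: "integrable \<beta> (\<lambda>z. exp (- (2 * x) * (cmod (z - a))\<^sup>2))" for a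
    by (rule B.integrable_const_bound[where B = 1]) (use x in auto)
  have sl: "(LINT q|(\<alpha> \<Otimes>\<^sub>M \<beta>). ?K q a) = gA \<alpha> x a * gA \<beta> x a" for a
  proof -
    have i2: "integrable (\<alpha> \<Otimes>\<^sub>M \<beta>) (\<lambda>q. exp (- (2 * x) * (cmod (fst q - a))\<^sup>2) * exp (- (2 * x) * (cmod (snd q - a))\<^sup>2))"
      by (rule PP.P.integrable_const_bound[where B = 1]) (use x in \<open>auto intro!: AE_I2 mult_le_one simp: abs_mult\<close>)
    have "(LINT q|(\<alpha> \<Otimes>\<^sub>M \<beta>). ?K q a) = (LINT q|(\<alpha> \<Otimes>\<^sub>M \<beta>). exp (- (2 * x) * (cmod (fst q - a))\<^sup>2) * exp (- (2 * x) * (cmod (snd q - a))\<^sup>2))"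
      by (simp only: parallelogram_gauss)
    also have "\<dots> = (LINT z|\<alpha>. LINT w|\<beta>. exp (- (2 * x) * (cmod (z - a))\<^sup>2) * exp (- (2 * x) * (cmod (w - a))\<^sup>2))"
      using PP.integral_fst'[OF i2] by simp
    also have "\<dots> = gA \<alpha> x a * gA \<beta> x a" by (simp add: gA_def)
    finally show ?thesis .
  qed
  show "integrable lborel (\<lambda>a. gA \<alpha> x a * gA \<beta> x a)"
    using Q.integrable_snd[OF ip] by (simp only: sl)
  have "(LINT a|lborel. gA \<alpha> x a * gA \<beta> x a) = (LINT q|(\<alpha> \<Otimes>\<^sub>M \<beta>). (LINT a|lborel. ?K q a))"
    using Q.integral_snd[OF ip] Q.integral_fst[OF ip] by (simp only: sl)
  also have "\<dots> = pi / (4 * x) * gE \<alpha> \<beta> x"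
    unfolding inner(2) by (simp add: gE_def)
  finally show "(LINT a|lborel. gA \<alpha> x a * gA \<beta> x a) = pi / (4 * x) * gE \<alpha> \<beta> x" .
qed

end

text \<open>Takes the place of the Cauchy--Schwarz inequality; the weight \<open>t\<close> will be
  chosen once for all large indices.\<close>

lemma weighted_am_gm:
  fixes t u v :: real
  assumes t: "0 < t"
  shows "\<bar>u * v\<bar> \<le> (t * u\<^sup>2 + v\<^sup>2 / t) / 2"
proof -
  have "0 \<le> (t * \<bar>u\<bar> - \<bar>v\<bar>)\<^sup>2" by simp
  also have "\<dots> = t * (t * u\<^sup>2 + v\<^sup>2 / t - 2 * \<bar>u * v\<bar>)"
    using t by (simp add: power2_diff power_mult_distrib abs_mult algebra_simps power2_eq_square)
  finally show ?thesis using t by (simp add: zero_le_mult_iff)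
qed

lemma gauss_smooth_close:
  assumes x: "0 < x" and s: "0 < s" and f: "f \<in> borel_measurable borel" and b: "\<And>z. \<bar>f z\<bar> \<le> C"
    and eta: "\<And>u v. dist u v < s \<Longrightarrow> \<bar>f u - f v\<bar> \<le> eta" and eta0: "0 \<le> eta"
  shows "\<bar>(LINT a|lborel. f a * exp (- (2 * x) * (cmod (z - a))\<^sup>2)) * (2 * x / pi) - f z\<bar> \<le> eta + 4 * C * exp (- x * s\<^sup>2)"
proof -
  let ?G = "\<lambda>a. exp (- (2 * x) * (cmod (a - z))\<^sup>2)"
  have x2: "0 < 2 * x" using x by simp
  have C0: "0 \<le> C" using b[of 0] by linarith
  note G = gaussian_complex_shift[OF x2, of z]
  have iG: "integrable lborel (\<lambda>a. f a * ?G a)"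
    by (rule Bochner_Integration.integrable_bound[OF integrable_mult_right[OF G(1), of C]])
       (use f b in \<open>auto simp: abs_mult order_trans[OF b abs_ge_self]\<close>)
  have "\<bar>(LINT a|lborel. f a * ?G a) - f z * (pi / (2 * x))\<bar> = \<bar>LINT a|lborel. (f a - f z) * ?G a\<bar>"
    using iG G by (simp add: left_diff_distrib)
  also have "\<dots> \<le> (LINT a|lborel. \<bar>(f a - f z) * ?G a\<bar>)" by (rule integral_abs_bound)
  also have "\<dots> \<le> (LINT a|lborel. eta * ?G a + 2 * C * exp (- x * s\<^sup>2) * exp (- x * (cmod (a - z))\<^sup>2))"
  proof (rule integral_mono)
    show "integrable lborel (\<lambda>a. \<bar>(f a - f z) * ?G a\<bar>)"
      using iG G(1) by (intro integrable_abs) (simp add: left_diff_distrib)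
    show "integrable lborel (\<lambda>a. eta * ?G a + 2 * C * exp (- x * s\<^sup>2) * exp (- x * (cmod (a - z))\<^sup>2))"
      using G(1) gaussian_complex_shift(1)[OF x, of z] by (intro Bochner_Integration.integrable_add integrable_mult_right)
    fix a
    show "\<bar>(f a - f z) * ?G a\<bar> \<le> eta * ?G a + 2 * C * exp (- x * s\<^sup>2) * exp (- x * (cmod (a - z))\<^sup>2)"
    proof (cases "dist a z < s")
      case True
      have "\<bar>(f a - f z) * ?G a\<bar> \<le> eta * ?G a" using eta[OF True] by (simp add: abs_mult)
      moreover have "0 \<le> 2 * C * exp (- x * s\<^sup>2) * exp (- x * (cmod (a - z))\<^sup>2)" using C0 by simp
      ultimately show ?thesis by linarith
    next
      case False
      then have "s\<^sup>2 \<le> (cmod (a - z))\<^sup>2" using s by (intro power_mono) (auto simp: dist_norm)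
      \<comment> \<open>Half of the exponent supplies the factor \<open>exp (- x * s ^ 2)\<close>,
        the other half stays integrable. Its mass is twice that of the full Gaussian, which turns
        \<open>2 * C\<close> into \<open>4 * C\<close>.\<close>
      then have "- (2 * x) * (cmod (a - z))\<^sup>2 \<le> - x * s\<^sup>2 + (- x * (cmod (a - z))\<^sup>2)"
        using x by (simp add: algebra_simps)
      then have G1: "?G a \<le> exp (- x * s\<^sup>2) * exp (- x * (cmod (a - z))\<^sup>2)" by (simp flip: exp_add)
      have "\<bar>f a - f z\<bar> \<le> 2 * C" using b[of a] b[of z] by linarith
      then have "\<bar>(f a - f z) * ?G a\<bar> \<le> 2 * C * (exp (- x * s\<^sup>2) * exp (- x * (cmod (a - z))\<^sup>2))"
        unfolding abs_mult using G1 C0 by (intro mult_mono) auto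
      moreover have "0 \<le> eta * ?G a" using eta0 by simp
      ultimately show ?thesis by (simp add: mult.assoc)
    qed
  qed
  also have "\<dots> = eta * (pi / (2 * x)) + 2 * C * exp (- x * s\<^sup>2) * (pi / x)"
    using G gaussian_complex_shift[OF x, of z] by simp
  finally have le: "\<bar>(LINT a|lborel. f a * ?G a) - f z * (pi / (2 * x))\<bar> \<le> eta * (pi / (2 * x)) + 2 * C * exp (- x * s\<^sup>2) * (pi / x)" .
  have "\<bar>(LINT a|lborel. f a * ?G a) * (2 * x / pi) - f z\<bar> = \<bar>(LINT a|lborel. f a * ?G a) - f z * (pi / (2 * x))\<bar> * (2 * x / pi)"
  proof -
    have "(LINT a|lborel. f a * ?G a) * (2 * x / pi) - f z = ((LINT a|lborel. f a * ?G a) - f z * (pi / (2 * x))) * (2 * x / pi)"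
      using x by (simp add: field_simps)
    then show ?thesis using x by (simp only: abs_mult) simp
  qed
  also have "\<dots> \<le> (eta * (pi / (2 * x)) + 2 * C * exp (- x * s\<^sup>2) * (pi / x)) * (2 * x / pi)"
    using le x by (intro mult_right_mono) auto
  also have "\<dots> = eta + 4 * C * exp (- x * s\<^sup>2)" using x by (simp add: field_simps)
  finally show ?thesis by (simp add: norm_minus_commute)
qed

lemma gauss_smooth_integral:
  assumes nu: "prob_space nu" "sets nu = sets borel" and x: "0 < x" and f: "integrable lborel f"
  shows "(LINT z|nu. (LINT a|lborel. f a * exp (- (2 * x) * (cmod (z - a))\<^sup>2))) = (LINT a|lborel. f a * gA nu x a)"
    and "integrable lborel (\<lambda>a. f a * gA nu x a)"
    and "integrable nu (\<lambda>z. LINT a|lborel. f a * exp (- (2 * x) * (cmod (z - a))\<^sup>2))"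
proof -
  interpret N: prob_space nu by fact
  note [measurable_cong] = nu(2)
  have [measurable]: "f \<in> borel_measurable borel" using borel_measurable_integrable[OF f] by simp
  interpret P: pair_sigma_finite nu "lborel :: complex measure" ..
  have dom: "integrable lborel (\<lambda>a. f a * exp (- (2 * x) * (cmod (z - a))\<^sup>2))" for z
    by (rule Bochner_Integration.integrable_bound[OF f]) (use x in \<open>auto simp: abs_mult mult_left_le\<close>)
  have ip: "integrable (nu \<Otimes>\<^sub>M lborel) (\<lambda>(z, a). f a * exp (- (2 * x) * (cmod (z - a))\<^sup>2))"
  proof (rule P.Fubini_integrable)
    show "(\<lambda>(z, a). f a * exp (- (2 * x) * (cmod (z - a))\<^sup>2)) \<in> borel_measurable (nu \<Otimes>\<^sub>M lborel)" by measurable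
    show "integrable nu (\<lambda>z. LINT a|lborel. norm (case (z, a) of (z, a) \<Rightarrow> f a * exp (- (2 * x) * (cmod (z - a))\<^sup>2)))"
    proof (rule N.integrable_const_bound[where B = "LINT a|lborel. \<bar>f a\<bar>"])
      show "AE z in nu. norm (LINT a|lborel. norm (case (z, a) of (z, a) \<Rightarrow> f a * exp (- (2 * x) * (cmod (z - a))\<^sup>2))) \<le> (LINT a|lborel. \<bar>f a\<bar>)"
      proof (rule AE_I2)
        fix z
        have "(LINT a|lborel. norm (f a * exp (- (2 * x) * (cmod (z - a))\<^sup>2))) \<le> (LINT a|lborel. \<bar>f a\<bar>)"
          using f x by (intro integral_mono integrable_norm integrable_abs dom) (auto simp: abs_mult mult_left_le)
        then show "norm (LINT a|lborel. norm (case (z, a) of (z, a) \<Rightarrow> f a * exp (- (2 * x) * (cmod (z - a))\<^sup>2))) \<le> (LINT a|lborel. \<bar>f a\<bar>)"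
          by (simp add: Bochner_Integration.integral_nonneg)
      qed
    qed measurable
  qed (use dom in auto)
  show "(LINT z|nu. (LINT a|lborel. f a * exp (- (2 * x) * (cmod (z - a))\<^sup>2))) = (LINT a|lborel. f a * gA nu x a)"
    using P.integral_fst[OF ip] P.integral_snd[OF ip] by (simp add: gA_def)
  show "integrable lborel (\<lambda>a. f a * gA nu x a)" using P.integrable_snd[OF ip] by (simp add: gA_def)
  show "integrable nu (\<lambda>z. LINT a|lborel. f a * exp (- (2 * x) * (cmod (z - a))\<^sup>2))" using P.integrable_fst[OF ip] by simp
qed

text \<open>The Gaussian energy of the signed measure \<mu> - \<omega>, and therefore a multiple of
  a squared L2 norm.\<close>

definition energy_defect :: "complex measure \<Rightarrow> complex measure \<Rightarrow> real \<Rightarrow> real" where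
  "energy_defect \<mu> \<omega> x = gE \<mu> \<mu> x - 2 * gE \<mu> \<omega> x + gE \<omega> \<omega> x"

lemma energy_defect_square:
  assumes "prob_space \<mu>" "sets \<mu> = sets borel" "prob_space \<omega>" "sets \<omega> = sets borel" and x: "0 < x"
  shows "(LINT a|lborel. (gA \<mu> x a - gA \<omega> x a)\<^sup>2) = pi / (4 * x) * energy_defect \<mu> \<omega> x"
    and "integrable lborel (\<lambda>a. (gA \<mu> x a - gA \<omega> x a)\<^sup>2)" and "0 \<le> energy_defect \<mu> \<omega> x"
proof -
  interpret T1: two_probs \<mu> \<mu> using assms by (simp add: two_probs_def two_probs_axioms_def)
  interpret T2: two_probs \<mu> \<omega> using assms by (simp add: two_probs_def two_probs_axioms_def)
  interpret T3: two_probs \<omega> \<omega> using assms by (simp add: two_probs_def two_probs_axioms_def)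
  have e: "(gA \<mu> x a - gA \<omega> x a)\<^sup>2 = gA \<mu> x a * gA \<mu> x a - 2 * (gA \<mu> x a * gA \<omega> x a) + gA \<omega> x a * gA \<omega> x a" for a
    by (simp add: power2_eq_square algebra_simps)
  show i: "integrable lborel (\<lambda>a. (gA \<mu> x a - gA \<omega> x a)\<^sup>2)"
    unfolding e by (intro Bochner_Integration.integrable_add Bochner_Integration.integrable_diff integrable_mult_right
        T1.gauss_convolution T2.gauss_convolution T3.gauss_convolution x)
  show s: "(LINT a|lborel. (gA \<mu> x a - gA \<omega> x a)\<^sup>2) = pi / (4 * x) * energy_defect \<mu> \<omega> x"
    unfolding e using T1.gauss_convolution[OF x] T2.gauss_convolution[OF x] T3.gauss_convolution[OF x]
    by (simp add: energy_defect_def algebra_simps)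
  have "0 \<le> (LINT a|lborel. (gA \<mu> x a - gA \<omega> x a)\<^sup>2)" by (intro Bochner_Integration.integral_nonneg) simp
  then show "0 \<le> energy_defect \<mu> \<omega> x" unfolding s using x pi_gt_zero by (auto simp: zero_le_mult_iff zero_le_divide_iff)
qed

text \<open>Smallness is known only after integration over \<open>x\<close>. Since
  \<open>dx / x\<close> has mass at least one half on \<open>{X..2 * X}\<close>, some
  \<open>x\<close> in this range has a small defect.\<close>

lemma energy_defect_select:
  assumes P: "prob_space \<mu>" "sets \<mu> = sets borel" "prob_space \<omega>" "sets \<omega> = sets borel"
    and i: "integrable lborel (\<lambda>x. indicator {0<..} x * (energy_defect \<mu> \<omega> x / x))"
    and le: "(LINT x|lborel. indicator {0<..} x * (energy_defect \<mu> \<omega> x / x)) < dlt" and X: "0 < X"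
  obtains x where "X \<le> x" "x \<le> 2 * X" "energy_defect \<mu> \<omega> x \<le> 2 * dlt"
proof (rule ccontr)
  note t = that
  assume "\<not> thesis"
  then have gt: "2 * dlt < energy_defect \<mu> \<omega> x" if "X \<le> x" "x \<le> 2 * X" for x using t[OF that] by (meson not_less)
  have ic: "integrable lborel (\<lambda>x. indicator {X..2 * X} x * (dlt / X))"
    using X by (intro integrable_mult_left integrable_real_indicator) auto
  have "dlt = (LINT x|lborel. indicator {X..2 * X} x * (dlt / X))" using X by simp
  also have "\<dots> \<le> (LINT x|lborel. indicator {0<..} x * (energy_defect \<mu> \<omega> x / x))"
  proof (rule integral_mono[OF ic i])
    fix x
    show "indicator {X..2 * X} x * (dlt / X) \<le> indicator {0<..} x * (energy_defect \<mu> \<omega> x / x)"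
    proof (cases "x \<in> {X..2 * X}")
      case True
      then have x: "0 < x" "X \<le> x" "x \<le> 2 * X" using X by auto
      have d0: "0 \<le> energy_defect \<mu> \<omega> x" by (rule energy_defect_square(3)[OF P x(1)])
      have "dlt / X = 2 * dlt / (2 * X)" by simp
      also have "\<dots> \<le> energy_defect \<mu> \<omega> x / (2 * X)" using gt[OF x(2,3)] X by (intro divide_right_mono) auto
      also have "\<dots> \<le> energy_defect \<mu> \<omega> x / x" using x d0 by (intro divide_left_mono) auto
      finally show ?thesis using True x by simp
    next
      case False
      then show ?thesis using energy_defect_square(3)[OF P, of x] by (auto simp: indicator_def)
    qed
  qed
  finally show False using le by simp
qed

text \<open>The order of choices matters: \<open>X\<close> is fixed first, large enough that
  smoothing at any rate beyond it moves \<open>f\<close> by at most \<open>2 * eta\<close>; then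
  comes \<open>t\<close>, and only then the index. The rate \<open>x\<close> depends on
  \<open>k\<close> but stays between \<open>X\<close> and \<open>2 * X\<close>, so all bounds are
  uniform.\<close>

lemma energy_weak_convergence:
  fixes \<omega> :: "nat \<Rightarrow> complex measure" and f :: "complex \<Rightarrow> real"
  assumes P: "prob_space \<mu>" "sets \<mu> = sets borel" "\<And>k. prob_space (\<omega> k)" "\<And>k. sets (\<omega> k) = sets borel"
    and i: "\<And>k. integrable lborel (\<lambda>x. indicator {0<..} x * (energy_defect \<mu> (\<omega> k) x / x))"
    and le: "\<And>k. (LINT x|lborel. indicator {0<..} x * (energy_defect \<mu> (\<omega> k) x / x)) < dlt k" and dlt: "dlt \<longlonglongrightarrow> 0"
    and f: "continuous_on UNIV f" "\<And>z. T \<le> cmod z \<Longrightarrow> f z = 0"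
  shows "(\<lambda>k. LINT z|\<omega> k. f z) \<longlonglongrightarrow> (LINT z|\<mu>. f z)"
proof (rule LIMSEQ_I)
  fix e :: real assume e: "0 < e"
  define eta where "eta = e / 8"
  have eta: "0 < eta" using e by (simp add: eta_def)
  obtain C where C: "0 \<le> C" "\<And>z. \<bar>f z\<bar> \<le> C" by (rule compact_support_bounded[OF f(1), of T]) (erule f(2), rule that)
  obtain s where s: "0 < s" "\<And>x y. dist x y < s \<Longrightarrow> \<bar>f x - f y\<bar> \<le> eta"
    by (rule compact_support_uniform[OF f(1) _ eta, of T]) (erule f(2), rule that)
  have fm [measurable]: "f \<in> borel_measurable borel" by (intro borel_measurable_continuous_onI f)
  have cut: "indicator (cball 0 T) z *\<^sub>R g z = g z" if "\<And>z. T \<le> cmod z \<Longrightarrow> g z = 0" for g :: "complex \<Rightarrow> real" and z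
    using that[of z] by (cases "cmod z \<le> T") auto
  have "integrable lborel (\<lambda>z. indicator (cball 0 T) z *\<^sub>R f z)"
    by (intro borel_integrable_compact continuous_on_subset[OF f(1)]) auto
  moreover have "(\<lambda>z. indicator (cball 0 T) z *\<^sub>R f z) = f" by (rule ext, rule cut, erule f(2))
  ultimately have fi: "integrable lborel f" by simp
  have "integrable lborel (\<lambda>z. indicator (cball 0 T) z *\<^sub>R (f z)\<^sup>2)"
    by (intro borel_integrable_compact continuous_intros continuous_on_subset[OF f(1)]) auto
  moreover have "(\<lambda>z. indicator (cball 0 T) z *\<^sub>R (f z)\<^sup>2) = (\<lambda>z. (f z)\<^sup>2)"
    by (rule ext, rule cut[of "\<lambda>z. (f z)\<^sup>2"]) (simp add: f(2))
  ultimately have f2i: "integrable lborel (\<lambda>z. (f z)\<^sup>2)" by simp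
  define F2 where "F2 = (LINT a|lborel. (f a)\<^sup>2)"
  have F2: "0 \<le> F2" unfolding F2_def by (intro Bochner_Integration.integral_nonneg) simp
  have "((\<lambda>x. 4 * C * exp (- x * s\<^sup>2)) \<longlongrightarrow> 0) at_top"
    using s(1) by real_asymp
  then have "\<forall>\<^sub>F x in at_top. 4 * C * exp (- x * s\<^sup>2) < eta" using eta by (rule order_tendstoD(2))
  then obtain X0 where X0: "\<And>x. X0 \<le> x \<Longrightarrow> 4 * C * exp (- x * s\<^sup>2) < eta" by (auto simp: eventually_at_top_linorder)
  define X where "X = max X0 1"
  have X: "0 < X" "\<And>x. X \<le> x \<Longrightarrow> 4 * C * exp (- x * s\<^sup>2) < eta" using X0 by (auto simp: X_def)
  \<comment> \<open>Chosen so that the part of the estimate containing \<open>F2\<close> stays below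
    \<open>eta\<close> for all \<open>x\<close> up to \<open>2 * X\<close>; adding one covers
    \<open>F2 = 0\<close>.\<close>
  define t where "t = eta * pi / (2 * X * (F2 + 1))"
  have t: "0 < t" using eta X F2 by (auto simp: t_def)
  have tF: "2 * X / pi * (t * F2) \<le> eta"
  proof -
    have "2 * X / pi * (t * F2) = eta * (F2 / (F2 + 1))" using X(1) F2 by (simp add: t_def)
    also have "\<dots> \<le> eta * 1" using eta F2 by (intro mult_left_mono) auto
    finally show ?thesis by simp
  qed
  have "\<forall>\<^sub>F k in sequentially. dlt k < eta * t" using dlt eta t by (intro order_tendstoD(2)[OF dlt]) auto
  then obtain k0 where k0: "\<And>k. k0 \<le> k \<Longrightarrow> dlt k < eta * t" by (auto simp: eventually_sequentially)
  have "norm ((LINT z|\<omega> k. f z) - (LINT z|\<mu>. f z)) < e" if k: "k0 \<le> k" for k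
  proof -
    obtain x where x: "X \<le> x" "x \<le> 2 * X" "energy_defect \<mu> (\<omega> k) x \<le> 2 * dlt k"
      by (rule energy_defect_select[OF P(1,2,3,4) i le X(1)])
    have x0: "0 < x" using x X by linarith
    define S where "S z = (LINT a|lborel. f a * exp (- (2 * x) * (cmod (z - a))\<^sup>2)) * (2 * x / pi)" for z
    have cl: "\<bar>S z - f z\<bar> \<le> 2 * eta" for z
    proof -
      have "\<bar>S z - f z\<bar> \<le> eta + 4 * C * exp (- x * s\<^sup>2)"
        unfolding S_def by (rule gauss_smooth_close[OF x0 s(1) fm C(2) s(2)]) (use eta in auto)
      then show ?thesis using X(2)[OF x(1)] by simp
    qed
    have close: "\<bar>(LINT z|nu. S z) - (LINT z|nu. f z)\<bar> \<le> 2 * eta" if nu: "prob_space nu" "sets nu = sets borel" for nu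
    proof -
      interpret N: prob_space nu by fact
      note [measurable_cong] = nu(2)
      have iS: "integrable nu S" unfolding S_def using gauss_smooth_integral(3)[OF nu x0 fi] by (rule integrable_mult_left)
      have if1: "integrable nu f" by (rule N.integrable_const_bound[where B = C]) (use C in auto)
      have "\<bar>(LINT z|nu. S z) - (LINT z|nu. f z)\<bar> = \<bar>LINT z|nu. S z - f z\<bar>" using iS if1 by simp
      also have "\<dots> \<le> (LINT z|nu. \<bar>S z - f z\<bar>)" by (rule integral_abs_bound)
      also have "\<dots> \<le> (LINT z|nu. 2 * eta)" using iS if1 cl by (intro integral_mono) auto
      finally show ?thesis using N.prob_space by simp
    qed
    have Sint: "(LINT z|nu. S z) = (LINT a|lborel. f a * gA nu x a) * (2 * x / pi)" if "prob_space nu" "sets nu = sets borel" for nu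
      unfolding S_def using gauss_smooth_integral(1)[OF that x0 fi] by simp
    let ?D = "\<lambda>a. gA \<mu> x a - gA (\<omega> k) x a"
    have iD: "integrable lborel (\<lambda>a. (?D a)\<^sup>2)" by (rule energy_defect_square(2)[OF P x0])
    have ifD: "integrable lborel (\<lambda>a. f a * ?D a)"
      using Bochner_Integration.integrable_diff[OF gauss_smooth_integral(2)[OF P(1,2) x0 fi] gauss_smooth_integral(2)[OF P(3,4)[of k] x0 fi]]
      by (simp add: right_diff_distrib)
    have "\<bar>LINT a|lborel. f a * ?D a\<bar> \<le> (LINT a|lborel. \<bar>f a * ?D a\<bar>)" by (rule integral_abs_bound)
    also have "\<dots> \<le> (LINT a|lborel. (t * (f a)\<^sup>2 + (?D a)\<^sup>2 / t) / 2)"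
    proof (rule integral_mono)
      show "integrable lborel (\<lambda>a. \<bar>f a * ?D a\<bar>)" using ifD by simp
      show "integrable lborel (\<lambda>a. (t * (f a)\<^sup>2 + (?D a)\<^sup>2 / t) / 2)" using f2i iD by simp
      fix a
      show "\<bar>f a * ?D a\<bar> \<le> (t * (f a)\<^sup>2 + (?D a)\<^sup>2 / t) / 2" by (rule weighted_am_gm[OF t])
    qed
    also have "\<dots> = (t * F2 + (pi / (4 * x) * energy_defect \<mu> (\<omega> k) x) / t) / 2"
      using f2i iD energy_defect_square(1)[OF P x0, of k] by (simp add: F2_def)
    also have "\<dots> \<le> (t * F2 + (pi / (4 * x) * (2 * dlt k)) / t) / 2"
      using x(3) x0 t by (intro divide_right_mono add_left_mono mult_left_mono) auto
    finally have D: "\<bar>LINT a|lborel. f a * ?D a\<bar> \<le> (t * F2 + (pi / (4 * x) * (2 * dlt k)) / t) / 2" .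
    have "(LINT z|\<mu>. S z) - (LINT z|\<omega> k. S z) = (LINT a|lborel. f a * ?D a) * (2 * x / pi)"
      unfolding Sint[OF P(1,2)] Sint[OF P(3,4)]
      using gauss_smooth_integral(2)[OF P(1,2) x0 fi] gauss_smooth_integral(2)[OF P(3,4)[of k] x0 fi]
      by (simp add: right_diff_distrib left_diff_distrib diff_divide_distrib)
    then have "\<bar>(LINT z|\<mu>. S z) - (LINT z|\<omega> k. S z)\<bar> = \<bar>LINT a|lborel. f a * ?D a\<bar> * (2 * x / pi)"
      using x0 by (simp add: abs_mult)
    also have "\<dots> \<le> ((t * F2 + (pi / (4 * x) * (2 * dlt k)) / t) / 2) * (2 * x / pi)"
      using D x0 by (intro mult_right_mono) auto
    also have "\<dots> = x / pi * (t * F2) + dlt k / (2 * t)" using x0 t by (simp add: field_simps)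
    also have "\<dots> \<le> 2 * X / pi * (t * F2) + dlt k / (2 * t)"
      using x F2 t by (intro add_right_mono mult_right_mono divide_right_mono) auto
    also have "\<dots> \<le> eta + eta"
    proof (rule add_mono[OF tF])
      have "dlt k / (2 * t) \<le> (eta * t) / (2 * t)" using k0[OF k] t by (intro divide_right_mono) auto
      also have "\<dots> \<le> eta" using t eta by simp
      finally show "dlt k / (2 * t) \<le> eta" .
    qed
    finally have "\<bar>(LINT z|\<mu>. S z) - (LINT z|\<omega> k. S z)\<bar> \<le> 2 * eta" by simp
    then show ?thesis using close[OF P(1,2)] close[OF P(3,4), of k] eta unfolding eta_def real_norm_def by linarith
  qed
  then show "\<exists>k0. \<forall>k\<ge>k0. norm ((LINT z|\<omega> k. f z) - (LINT z|\<mu>. f z)) < e" by blast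
qed

section \<open>The equilibrium measure\<close>

definition neglog :: "complex measure \<Rightarrow> ennreal" where
  "neglog nu = (\<integral>\<^sup>+ p. (if fst p = snd p then \<infinity> else ennreal (- ln (cmod (fst p - snd p)))) \<partial>(nu \<Otimes>\<^sub>M nu))"

definition poslog :: "complex measure \<Rightarrow> ennreal" where
  "poslog nu = (\<integral>\<^sup>+ p. (if fst p = snd p then 0 else ennreal (ln (cmod (fst p - snd p)))) \<partial>(nu \<Otimes>\<^sub>M nu))"

lemma log_energy_parts: "log_energy nu = enn2ereal (neglog nu) - enn2ereal (poslog nu)"
  by (simp add: log_energy_def neglog_def poslog_def)

lemma enn2ereal_finite: "x \<noteq> \<infinity> \<Longrightarrow> enn2ereal x = ereal (enn2real x)"
  by (cases x) (auto simp: enn2ereal_ennreal)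

lemma log_energy_integral:
  assumes nu: "prob_space nu" "sets nu = sets borel"
    and i: "integrable (nu \<Otimes>\<^sub>M nu) (\<lambda>q. ln (cmod (fst q - snd q)))"
    and ne: "AE q in nu \<Otimes>\<^sub>M nu. fst q \<noteq> snd q"
  shows "log_energy nu = ereal (- (LINT q|(nu \<Otimes>\<^sub>M nu). ln (cmod (fst q - snd q))))"
proof -
  let ?P = "nu \<Otimes>\<^sub>M nu" and ?l = "\<lambda>q. ln (cmod (fst q - snd q))"
  have n: "neglog nu = (\<integral>\<^sup>+q. ennreal (- ?l q) \<partial>?P)"
    unfolding neglog_def by (rule nn_integral_cong_AE) (use ne in auto)
  have p: "poslog nu = (\<integral>\<^sup>+q. ennreal (?l q) \<partial>?P)"
    unfolding poslog_def by (rule nn_integral_cong_AE) (use ne in auto)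
  have fin: "(\<integral>\<^sup>+q. ennreal (- ?l q) \<partial>?P) \<noteq> \<infinity>" "(\<integral>\<^sup>+q. ennreal (?l q) \<partial>?P) \<noteq> \<infinity>"
    using i by (auto simp: real_integrable_def)
  have "(LINT q|?P. ?l q) = enn2real (poslog nu) - enn2real (neglog nu)"
    unfolding n p by (rule real_lebesgue_integral_def[OF i])
  moreover have "enn2ereal (neglog nu) = ereal (enn2real (neglog nu))" "enn2ereal (poslog nu) = ereal (enn2real (poslog nu))"
    using fin enn2ereal_finite unfolding n p by blast+
  ultimately show ?thesis by (simp add: log_energy_parts)
qed

text \<open>On a bounded support the kernel is bounded below, so an upper bound for the energy
  forces both parts to be finite. As the kernel is infinite on the diagonal, the diagonal must then
  be a null set.\<close>

lemma log_energy_bounded: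
  assumes nu: "prob_space nu" "sets nu = sets borel" and b: "AE z in nu. cmod z \<le> b"
    and le: "log_energy nu \<le> ereal V"
  shows "integrable (nu \<Otimes>\<^sub>M nu) (\<lambda>q. ln (cmod (fst q - snd q)))"
    and "AE q in nu \<Otimes>\<^sub>M nu. fst q \<noteq> snd q"
    and "- (LINT q|(nu \<Otimes>\<^sub>M nu). ln (cmod (fst q - snd q))) \<le> V"
proof -
  interpret two_probs nu nu using nu by (simp add: two_probs_def two_probs_axioms_def)
  note [measurable_cong] = nu(2)
  let ?P = "nu \<Otimes>\<^sub>M nu" and ?l = "\<lambda>q. ln (cmod (fst q - snd q))"
  define B where "B = ln (max 1 (2 * b))"
  have AEb: "AE q in ?P. cmod (fst q) \<le> b \<and> cmod (snd q) \<le> b"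
  proof -
    have "AE x in nu. AE y in nu. cmod (fst (x, y)) \<le> b \<and> cmod (snd (x, y)) \<le> b"
      using b by eventually_elim (use b in auto)
    then show ?thesis by (intro PP.AE_pair_measure) auto
  qed
  have "poslog nu \<le> (\<integral>\<^sup>+q. ennreal B \<partial>?P)"
    unfolding poslog_def
  proof (rule nn_integral_mono_AE, use AEb in eventually_elim)
    case (elim q)
    show ?case
    proof (cases "fst q = snd q")
      case False
      have "cmod (fst q - snd q) \<le> max 1 (2 * b)" using elim norm_triangle_ineq4[of "fst q" "snd q"] by auto
      then have "?l q \<le> B" unfolding B_def using False by (intro ln_mono) auto
      then show ?thesis using False by (simp add: ennreal_leI)
    qed simp
  qed
  also have "\<dots> < \<infinity>" by (simp add: PP.P.emeasure_space_1)
  finally have pf: "poslog nu < \<infinity>" .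
  have nf: "neglog nu \<noteq> \<infinity>"
  proof
    assume "neglog nu = \<infinity>"
    then have "log_energy nu = \<infinity>"
      using pf by (cases "poslog nu") (auto simp: log_energy_parts enn2ereal_ennreal)
    then show False using le by simp
  qed
  have nm: "(\<lambda>p. if fst p = snd p then \<infinity> else ennreal (- ?l p)) \<in> borel_measurable ?P" by measurable
  have "AE q in ?P. (if fst q = snd q then \<infinity> else ennreal (- ?l q)) \<noteq> \<infinity>"
    using nn_integral_PInf_AE[OF nm] nf unfolding neglog_def by auto
  then show ne: "AE q in ?P. fst q \<noteq> snd q" by eventually_elim (auto split: if_splits)
  have n: "neglog nu = (\<integral>\<^sup>+q. ennreal (- ?l q) \<partial>?P)"
    unfolding neglog_def by (rule nn_integral_cong_AE) (use ne in auto)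
  have p: "poslog nu = (\<integral>\<^sup>+q. ennreal (?l q) \<partial>?P)"
    unfolding poslog_def by (rule nn_integral_cong_AE) (use ne in auto)
  show i: "integrable ?P ?l"
    unfolding real_integrable_def using pf nf unfolding n p by auto
  show "- (LINT q|?P. ?l q) \<le> V"
    using le log_energy_integral[OF nu i ne] by simp
qed

text \<open>The parametrization is oriented so that the outer side of the unit circle goes outside
  \<open>E\<close>. The annulus is symmetric under reflection in that circle, as the later
  reflection arguments require.\<close>

locale oriented_jordan = exterior_conformal +
  fixes h :: "complex \<Rightarrow> complex" and r0 :: real
  assumes r0: "0 < r0" "r0 < 1"
    and h_hol: "h holomorphic_on annulus r0 (1 / r0)"
    and h_inj: "inj_on h (annulus r0 (1 / r0))"
    and h_outer: "1 < cmod u \<Longrightarrow> cmod u < 1 / r0 \<Longrightarrow> h u \<notin> E"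
    and h_inner: "r0 < cmod u \<Longrightarrow> cmod u < 1 \<Longrightarrow> h u \<in> interior E"
    and h_circle: "E = interior E \<union> h ` sphere 0 1" "interior E \<inter> h ` sphere 0 1 = {}"
    and conn_ext: "connected (- E)" and conn_int: "connected (interior E)" and int_ne: "interior E \<noteq> {}"
begin

abbreviation collar :: "complex set" where
  "collar \<equiv> annulus r0 (1 / r0)"

definition level :: "real \<Rightarrow> complex measure" where
  "level rho = distr uI borel (\<lambda>x. psi (circ rho x))"

lemma psi_circle_measurable: "0 < rho \<Longrightarrow> rho < 1 \<Longrightarrow> (\<lambda>x. psi (circ rho x)) \<in> borel_measurable borel"
  by (intro borel_measurable_continuous_onI psi_circle_continuous)

lemma level_prob: "0 < rho \<Longrightarrow> rho < 1 \<Longrightarrow> prob_space (level rho)" "sets (level rho) = sets borel"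
  unfolding level_def using psi_circle_measurable[of rho] by (auto intro!: uI.prob_space_distr)

lemma level_null:
  assumes rho: "0 < rho" "rho < 1"
  shows "AE u in level rho. z \<noteq> u"
proof -
  have "AE x in uI. z \<noteq> psi (circ rho x)"
  proof (cases "z \<in> E")
    case True
    then show ?thesis using rho psi_in by (intro AE_I2) (auto simp: norm_mult)
  next
    case False
    show ?thesis using ucis_eq_AE[of "kap z / of_real rho"]
    proof eventually_elim
      case (elim x)
      have "kap (psi (circ rho x)) = circ rho x" using rho by (intro kappa_psi) (auto simp: norm_mult)
      then show ?case using elim rho by (auto simp: field_simps)
    qed
  qed
  then show ?thesis unfolding level_def using psi_circle_measurable[OF rho] by (subst AE_distr_iff) auto
qed

text \<open>Up to \<open>ln (cmod c)\<close>, \<open>m\<close> is the constant value on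
  \<open>nu\<close> of the potential of the level curve. It is \<open>- ln rho\<close> both for
  measures on \<open>E\<close> and for the level curve itself, so mutual energy and self-energy come
  from one statement.\<close>

lemma level_energy:
  assumes rho: "0 < rho" "rho < 1" and nu: "prob_space nu" "sets nu = sets borel" and b: "AE z in nu. cmod z \<le> b"
    and m: "AE z in nu. max (- ln rho) (green z) = m"
  shows "integrable (nu \<Otimes>\<^sub>M level rho) (\<lambda>q. ln (cmod (fst q - snd q)))"
    and "(LINT q|(nu \<Otimes>\<^sub>M level rho). ln (cmod (fst q - snd q))) = ln (cmod c) + m"
    and "AE q in nu \<Otimes>\<^sub>M level rho. fst q \<noteq> snd q"
proof -
  interpret two_probs nu "level rho" using nu level_prob[of rho] rho by (simp add: two_probs_def two_probs_axioms_def)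
  note [measurable_cong] = nu(2) level_prob(2)
  note [measurable] = psi_circle_measurable[OF rho]
  obtain b' where b': "\<And>x. cmod (psi (circ rho x)) \<le> b'" by (rule psi_circle_bounded[OF rho]) blast
  define C where "C = ln (max 1 (b + b'))"
  have C0: "0 \<le> C" by (simp add: C_def)
  have Ui: "integrable (level rho) (\<lambda>u. ln (cmod (z - u)))" for z
    unfolding level_def using potential_level(2)[OF rho, of z] by (subst integrable_distr_eq) auto
  have Uv: "(LINT u|level rho. ln (cmod (z - u))) = ln (cmod c) + max (- ln rho) (green z)" for z
    unfolding level_def using potential_level(1)[OF rho, of z] by (subst integral_distr) auto
  have bl: "AE u in level rho. cmod u \<le> b'"
    unfolding level_def using b' by (subst AE_distr_iff) auto
  have ab: "AE z in nu. (LINT u|level rho. \<bar>ln (cmod (z - u))\<bar>) \<le> 2 * C - (ln (cmod c) + m)"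
    using b m
  proof eventually_elim
    case (elim z)
    have "(LINT u|level rho. \<bar>ln (cmod (z - u))\<bar>) \<le> (LINT u|level rho. 2 * C - ln (cmod (z - u)))"
    proof (rule integral_mono_AE)
      show "AE u in level rho. \<bar>ln (cmod (z - u))\<bar> \<le> 2 * C - ln (cmod (z - u))"
        using bl level_null[OF rho, of z]
      proof eventually_elim
        case (elim u)
        have "cmod (z - u) \<le> max 1 (b + b')" using \<open>cmod z \<le> b\<close> elim norm_triangle_ineq4[of z u] by auto
        then have "ln (cmod (z - u)) \<le> C" unfolding C_def using elim by (intro ln_mono) auto
        then show ?case using C0 by linarith
      qed
    qed (use Ui in auto)
    also have "\<dots> = 2 * C - (ln (cmod c) + m)"
      using Ui[of z] Uv[of z] elim B.prob_space by simp
    finally show ?case .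
  qed
  show i: "integrable (nu \<Otimes>\<^sub>M level rho) (\<lambda>q. ln (cmod (fst q - snd q)))"
  proof (rule PP.Fubini_integrable)
    show "(\<lambda>q. ln (cmod (fst q - snd q))) \<in> borel_measurable (nu \<Otimes>\<^sub>M level rho)" by measurable
    show "AE z in nu. integrable (level rho) (\<lambda>u. ln (cmod (fst (z, u) - snd (z, u))))" using Ui by simp
    show "integrable nu (\<lambda>z. LINT u|level rho. norm (ln (cmod (fst (z, u) - snd (z, u)))))"
      using ab by (intro A.integrable_const_bound[where B = "2 * C - (ln (cmod c) + m)"])
                  (auto simp: Bochner_Integration.integral_nonneg)
  qed
  have "(LINT q|(nu \<Otimes>\<^sub>M level rho). ln (cmod (fst q - snd q))) = (LINT z|nu. LINT u|level rho. ln (cmod (z - u)))"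
    using PP.integral_fst'[OF i] by simp
  also have "\<dots> = (LINT z|nu. ln (cmod c) + m)"
    unfolding Uv by (rule integral_cong_AE) (use m in auto)
  also have "\<dots> = ln (cmod c) + m" using A.prob_space by simp
  finally show "(LINT q|(nu \<Otimes>\<^sub>M level rho). ln (cmod (fst q - snd q))) = ln (cmod c) + m" .
  show "AE q in nu \<Otimes>\<^sub>M level rho. fst q \<noteq> snd q"
    by (rule PP.AE_pair_measure) (use level_null[OF rho] in auto)
qed

lemma level_self:
  assumes rho: "0 < rho" "rho < 1"
  obtains b where "AE z in level rho. cmod z \<le> b" "AE z in level rho. max (- ln rho) (green z) = - ln rho"
proof -
  note [measurable] = psi_circle_measurable[OF rho]
  obtain b' where b': "\<And>x. cmod (psi (circ rho x)) \<le> b'" by (rule psi_circle_bounded[OF rho]) blast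
  have g: "green (psi (circ rho x)) = - ln rho" for x
  proof -
    have z: "circ rho x \<in> ball 0 1 - {0}" using rho by (simp add: norm_mult)
    then show ?thesis using psi_in[OF z] kappa_psi[OF z] rho by (simp add: green_def norm_mult)
  qed
  have "AE z in level rho. cmod z \<le> b'"
    unfolding level_def using b' by (subst AE_distr_iff) auto
  moreover have "AE z in level rho. max (- ln rho) (green z) = - ln rho"
    unfolding level_def using g by (subst AE_distr_iff) auto
  ultimately show ?thesis using that by blast
qed

text \<open>The divided difference of \<open>h\<close>, completed by the derivative on the diagonal.
  Univalence makes it zero-free, so distances between image points can be compared through the
  logarithm of its modulus.\<close>

definition quot :: "complex \<times> complex \<Rightarrow> complex" where
  "quot q = (if fst q = snd q then deriv h (fst q) else (h (fst q) - h (snd q)) / (fst q - snd q))"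

lemma quot_continuous: "continuous_on (collar \<times> collar) quot"
proof (rule continuous_at_imp_continuous_on, intro ballI)
  let ?A = "collar"
  fix q assume q: "q \<in> ?A \<times> ?A"
  show "isCont quot q"
  proof (cases "fst q = snd q")
    case False
    have o: "open (?A \<times> ?A - {q. fst q = snd q})"
      by (intro open_Diff open_Times open_annulus closed_Collect_eq continuous_intros)
    have "continuous_on (?A \<times> ?A - {q. fst q = snd q}) (\<lambda>q. (h (fst q) - h (snd q)) / (fst q - snd q))"
      by (intro continuous_intros continuous_on_compose2[OF holomorphic_on_imp_continuous_on[OF h_hol]]) auto
    then have "continuous_on (?A \<times> ?A - {q. fst q = snd q}) quot"
      by (rule continuous_on_eq) (auto simp: quot_def)
    then show ?thesis using o q False by (simp add: continuous_on_eq_continuous_at)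
  next
    case True
    define a where "a = fst q"
    have a: "a \<in> ?A" "q = (a, a)" using q True by (auto simp: a_def mem_Times_iff prod_eq_iff)
    have dh: "deriv h holomorphic_on ?A" by (intro holomorphic_deriv h_hol open_annulus)
    then have cont: "isCont (deriv h) a"
      using continuous_on_eq_continuous_at[OF open_annulus] holomorphic_on_imp_continuous_on a by blast
    show ?thesis unfolding continuous_at_eps_delta
    proof (intro allI impI)
      fix e :: real assume e: "0 < e"
      obtain d1 where d1: "0 < d1" "\<And>u. dist u a < d1 \<Longrightarrow> dist (deriv h u) (deriv h a) < e / 2"
        using cont e unfolding continuous_at_eps_delta by (meson half_gt_zero)
      obtain d2 where d2: "0 < d2" "ball a d2 \<subseteq> ?A" using openE[OF open_annulus a(1)] by blast
      define d where "d = min d1 d2"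
      have d: "0 < d" "ball a d \<subseteq> ?A" using d1 d2 by (auto simp: d_def)
      have bnd: "cmod (deriv h z - deriv h a) \<le> e / 2" if "z \<in> ball a d" for z
        using d1(2)[of z] that by (auto simp: d_def dist_norm norm_minus_commute)
      have "dist (quot w) (quot q) < e" if w: "dist w q < d" for w
      proof -
        obtain u v where uv: "w = (u, v)" by (cases w)
        have u: "u \<in> ball a d" and v: "v \<in> ball a d"
          using w dist_fst_le[of w q] dist_snd_le[of w q] by (auto simp: uv a(2) dist_commute)
        have "cmod (quot w - deriv h a) \<le> e / 2"
        proof (cases "u = v")
          case True
          then show ?thesis using bnd[OF u] by (simp add: uv quot_def)
        next
          case False
          \<comment> \<open>Subtracting the linear part at \<open>a\<close> leaves a function whose
            derivative is at most \<open>e / 2\<close> near \<open>a\<close>; this controls the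
            divided difference at all pairs close to the diagonal point.\<close>
          have "cmod ((\<lambda>z. h z - deriv h a * z) u - (\<lambda>z. h z - deriv h a * z) v) \<le> e / 2 * cmod (u - v)"
          proof (rule field_differentiable_bound[where S = "ball a d" and f' = "\<lambda>z. deriv h z - deriv h a"])
            fix z assume z: "z \<in> ball a d"
            have "(h has_field_derivative deriv h z) (at z)"
              using holomorphic_derivI[OF h_hol open_annulus, of z] z d by auto
            then have "((\<lambda>z. h z - deriv h a * z) has_field_derivative deriv h z - deriv h a) (at z)"
              by (auto intro!: derivative_eq_intros)
            then show "((\<lambda>z. h z - deriv h a * z) has_field_derivative deriv h z - deriv h a) (at z within ball a d)"
              by (rule has_field_derivative_at_within)
          qed (use u v bnd in auto)
          moreover have "quot w - deriv h a = ((h u - deriv h a * u) - (h v - deriv h a * v)) / (u - v)"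
            using False by (simp add: quot_def uv field_simps)
          ultimately show ?thesis using False by (simp add: norm_divide pos_divide_le_eq)
        qed
        then show ?thesis using e by (simp add: dist_norm a(2) quot_def)
      qed
      then show "\<exists>d>0. \<forall>w. dist w q < d \<longrightarrow> dist (quot w) (quot q) < e" using d(1) by blast
    qed
  qed
qed

text \<open>The logarithm of the modulus of \<open>quot\<close> is uniformly continuous on a compact
  annulus, so it changes little when both points are divided by some \<open>sig\<close> close to
  one. The factor \<open>sig\<close> between \<open>u - v\<close> and its scaled copy is the only
  other source of distortion.\<close>

lemma dilation_ratio:
  assumes tau: "0 < tau"
  obtains sig where "1 < sig" "sig < 1 / r0"
    "\<And>u v. 1 \<le> cmod u \<Longrightarrow> cmod u \<le> sig \<Longrightarrow> 1 \<le> cmod v \<Longrightarrow> cmod v \<le> sig \<Longrightarrow>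
       cmod (h u - h v) \<le> (1 + tau) * cmod (h (u / of_real sig) - h (v / of_real sig))"
proof -
  let ?A = "collar"
  define sig1 where "sig1 = (1 + 1 / r0) / 2"
  have r1: "1 < 1 / r0" using r0 by simp
  have sig1: "1 < sig1" "sig1 < 1 / r0" using r1 by (auto simp: sig1_def)
  have "r0 < 1 / sig1" using sig1 r0 by (simp add: field_simps)
  define S where "S = cball 0 sig1 - ball (0::complex) (1 / sig1)"
  have SA: "S \<subseteq> ?A" using \<open>r0 < 1 / sig1\<close> sig1 by (auto simp: S_def annulus_def)
  have qnz: "quot q \<noteq> 0" if "q \<in> S \<times> S" for q
  proof -
    have "fst q \<in> ?A" "snd q \<in> ?A" using that SA by (auto simp: mem_Times_iff)
    then show ?thesis using holomorphic_injective_imp_regular[OF h_hol open_annulus h_inj] inj_onD[OF h_inj]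
      by (auto simp: quot_def)
  qed
  have "compact (S \<times> S)" unfolding S_def by (intro compact_Times compact_diff) auto
  then have "uniformly_continuous_on (S \<times> S) (\<lambda>q. ln (cmod (quot q)))"
    using qnz by (intro compact_uniformly_continuous continuous_on_ln continuous_intros
        continuous_on_subset[OF quot_continuous] Sigma_mono SA) auto
  then obtain dlt where dlt: "0 < dlt" "\<And>p q. p \<in> S \<times> S \<Longrightarrow> q \<in> S \<times> S \<Longrightarrow> dist p q < dlt \<Longrightarrow> dist (ln (cmod (quot p))) (ln (cmod (quot q))) < ln (1 + tau) / 2"
    unfolding uniformly_continuous_on_def using tau by (metis half_gt_zero ln_gt_zero less_add_same_cancel1)
  \<comment> \<open>The three bounds keep the points in the compact annulus, make the displacement
    smaller than \<open>dlt\<close>, and leave half of \<open>ln (1 + tau)\<close> for the scale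
    factor.\<close>
  define sig where "sig = min sig1 (min (1 + dlt / 4) (exp (ln (1 + tau) / 2)))"
  have sig: "1 < sig" "sig \<le> sig1" "sig - 1 \<le> dlt / 4" "ln sig \<le> ln (1 + tau) / 2"
  proof -
    show s1: "1 < sig" using sig1 dlt tau by (auto simp: sig_def)
    show "sig \<le> sig1" "sig - 1 \<le> dlt / 4" unfolding sig_def by linarith+
    have "ln sig \<le> ln (exp (ln (1 + tau) / 2))" using s1 by (intro ln_mono) (auto simp: sig_def)
    then show "ln sig \<le> ln (1 + tau) / 2" by simp
  qed
  have "cmod (h u - h v) \<le> (1 + tau) * cmod (h (u / of_real sig) - h (v / of_real sig))"
    if uv: "1 \<le> cmod u" "cmod u \<le> sig" "1 \<le> cmod v" "cmod v \<le> sig" for u v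
  proof (cases "u = v")
    case False
    have mem: "w \<in> S \<and> w / of_real sig \<in> S \<and> dist w (w / of_real sig) \<le> dlt / 4" if w: "1 \<le> cmod w" "cmod w \<le> sig" for w
    proof -
      have "1 / sig1 \<le> 1 / sig" using sig by (intro divide_left_mono) auto
      also have "\<dots> \<le> cmod w / sig" using w sig by (intro divide_right_mono) auto
      finally have l: "1 / sig1 \<le> cmod w / sig" .
      have "cmod w / sig \<le> 1" using w sig by simp
      moreover have "1 / sig1 < 1" using sig1 by simp
      moreover have "dist w (w / of_real sig) = cmod w / sig * (sig - 1)"
      proof -
        have "w - w / of_real sig = w / of_real sig * of_real (sig - 1)" using sig by (simp add: field_simps)
        then show ?thesis using sig(1) by (simp add: dist_norm norm_mult norm_divide del: of_real_diff)
      qed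
      moreover have "cmod w / sig * (sig - 1) \<le> 1 * (dlt / 4)" using \<open>cmod w / sig \<le> 1\<close> sig by (intro mult_mono) auto
      moreover have "\<not> cmod w < 1 / sig1" "cmod w / sig \<le> sig1" using calculation w sig1 by linarith+
      ultimately show ?thesis using l w sig by (simp add: S_def norm_divide)
    qed
    note mu = mem[OF uv(1,2)] and mv = mem[OF uv(3,4)]
    let ?p = "(u, v)" and ?q = "(u / of_real sig, v / of_real sig)"
    have pq: "?p \<in> S \<times> S" "?q \<in> S \<times> S" using mu mv by auto
    have "dist ?p ?q \<le> dist u (u / of_real sig) + dist v (v / of_real sig)"
      unfolding dist_Pair_Pair by (rule sqrt_sum_squares_le_sum) auto
    then have "dist ?p ?q < dlt" using mu mv dlt(1) by linarith
    from dlt(2)[OF pq this] have "ln (cmod (quot ?p)) \<le> ln (cmod (quot ?q)) + ln (1 + tau) / 2" unfolding dist_real_def by linarith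
    then have "ln (sig * cmod (quot ?p)) \<le> ln ((1 + tau) * cmod (quot ?q))"
      using sig tau qnz[OF pq(1)] qnz[OF pq(2)] by (simp add: ln_mult)
    then have "sig * cmod (quot ?p) \<le> (1 + tau) * cmod (quot ?q)"
      using sig tau qnz[OF pq(1)] qnz[OF pq(2)] by (subst (asm) ln_le_cancel_iff) auto
    then have "sig * cmod (quot ?p) * cmod (u - v) \<le> (1 + tau) * cmod (quot ?q) * cmod (u - v)" by (rule mult_right_mono) simp
    moreover have "cmod (quot ?p) * cmod (u - v) = cmod (h u - h v)" using False by (simp add: quot_def norm_divide)
    moreover have "cmod (quot ?q) * cmod (u - v) = sig * cmod (h (u / of_real sig) - h (v / of_real sig))"
      using False sig by (simp add: quot_def norm_divide norm_mult flip: diff_divide_distrib)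
    ultimately have "sig * cmod (h u - h v) \<le> sig * ((1 + tau) * cmod (h (u / of_real sig) - h (v / of_real sig)))"
      by (simp add: mult.assoc mult.left_commute)
    then show ?thesis using sig(1) by simp
  qed simp
  moreover have "sig < 1 / r0" using sig(2) sig1(2) by linarith
  ultimately show ?thesis using that[OF sig(1)] by blast
qed

end

lemma pair_uI_distr:
  assumes [measurable]: "X \<in> borel_measurable borel"
  shows "distr uI borel X \<Otimes>\<^sub>M distr uI borel X = distr (uI \<Otimes>\<^sub>M uI) (borel \<Otimes>\<^sub>M borel) (\<lambda>(x, y). (X x, X y))"
proof (rule pair_measure_distr)
  show "sigma_finite_measure (distr uI borel X)"
    using uI.prob_space_distr[of X borel] assms by (simp add: prob_space_imp_sigma_finite)
qed (use assms in auto)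

lemma pair_uI_transfer:
  fixes X :: "real \<Rightarrow> complex"
  assumes X [measurable]: "X \<in> borel_measurable borel"
  shows "integrable (distr uI borel X \<Otimes>\<^sub>M distr uI borel X) (\<lambda>q. ln (cmod (fst q - snd q))) \<longleftrightarrow>
      integrable (uI \<Otimes>\<^sub>M uI) (\<lambda>q. ln (cmod (X (fst q) - X (snd q))))"
    and "(LINT q|(distr uI borel X \<Otimes>\<^sub>M distr uI borel X). ln (cmod (fst q - snd q))) =
      (LINT q|(uI \<Otimes>\<^sub>M uI). ln (cmod (X (fst q) - X (snd q))))"
    and "(AE q in (distr uI borel X \<Otimes>\<^sub>M distr uI borel X). fst q \<noteq> snd q) \<longleftrightarrow>
      (AE q in uI \<Otimes>\<^sub>M uI. X (fst q) \<noteq> X (snd q))"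
proof -
  have [measurable]: "(\<lambda>(x, y). (X x, X y)) \<in> uI \<Otimes>\<^sub>M uI \<rightarrow>\<^sub>M borel \<Otimes>\<^sub>M borel" by measurable
  show "integrable (distr uI borel X \<Otimes>\<^sub>M distr uI borel X) (\<lambda>q. ln (cmod (fst q - snd q))) \<longleftrightarrow>
      integrable (uI \<Otimes>\<^sub>M uI) (\<lambda>q. ln (cmod (X (fst q) - X (snd q))))"
    unfolding pair_uI_distr[OF X] by (subst integrable_distr_eq) (auto simp: case_prod_unfold)
  show "(LINT q|(distr uI borel X \<Otimes>\<^sub>M distr uI borel X). ln (cmod (fst q - snd q))) =
      (LINT q|(uI \<Otimes>\<^sub>M uI). ln (cmod (X (fst q) - X (snd q))))"
    unfolding pair_uI_distr[OF X] by (subst integral_distr) (auto simp: case_prod_unfold)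
  show "(AE q in (distr uI borel X \<Otimes>\<^sub>M distr uI borel X). fst q \<noteq> snd q) \<longleftrightarrow>
      (AE q in uI \<Otimes>\<^sub>M uI. X (fst q) \<noteq> X (snd q))"
    unfolding pair_uI_distr[OF X] by (subst AE_distr_iff) (auto simp: case_prod_unfold)
qed

context oriented_jordan
begin

text \<open>\<open>kappa_exhaust\<close> is applied to \<open>interior E\<close> enlarged by the
  image of a thin annulus: a level curve with radius close to one lies in this neighbourhood but
  outside \<open>E\<close>, hence in the outer half of the collar.\<close>

lemma collar_coordinate:
  assumes "1 < sig" "sig < 1 / r0"
  obtains rho1 hi where "0 < rho1" "rho1 < 1" "hi holomorphic_on h ` collar"
    "\<And>u. u \<in> collar \<Longrightarrow> hi (h u) = u"
    "\<And>zeta. rho1 < cmod zeta \<Longrightarrow> cmod zeta < 1 \<Longrightarrow> psi zeta \<in> h ` collar \<and> h (hi (psi zeta)) = psi zeta \<and> 1 < cmod (hi (psi zeta)) \<and> cmod (hi (psi zeta)) < sig"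
proof -
  obtain hi where hi: "hi holomorphic_on h ` collar" "\<And>u. u \<in> collar \<Longrightarrow> hi (h u) = u"
    using holomorphic_has_inverse[OF h_hol open_annulus h_inj] by metis
  define W where "W = interior E \<union> h ` annulus r0 sig"
  have sub: "annulus r0 sig \<subseteq> collar" using assms by (auto simp: annulus_def)
  have "open (h ` annulus r0 sig)"
    by (intro open_mapping_thm3 holomorphic_on_subset[OF h_hol sub] inj_on_subset[OF h_inj sub] open_annulus)
  then have oW: "open W" by (auto simp: W_def)
  have EW: "E \<subseteq> W"
  proof
    fix z assume "z \<in> E"
    then have "z \<in> interior E \<or> z \<in> h ` sphere 0 1" using h_circle(1) by blast
    moreover have "sphere 0 1 \<subseteq> annulus r0 sig" using assms r0 by (auto simp: annulus_def)
    ultimately show "z \<in> W" by (auto simp: W_def)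
  qed
  obtain rho1 where rho1: "0 < rho1" "rho1 < 1" "\<And>z. z \<notin> W \<Longrightarrow> cmod (kap z) \<le> rho1"
    by (rule kappa_exhaust[OF oW EW]) blast
  have "psi zeta \<in> h ` collar \<and> h (hi (psi zeta)) = psi zeta \<and> 1 < cmod (hi (psi zeta)) \<and> cmod (hi (psi zeta)) < sig"
    if zeta: "rho1 < cmod zeta" "cmod zeta < 1" for zeta
  proof -
    have z: "zeta \<in> ball 0 1 - {0}" using zeta rho1 by auto
    have nE: "psi zeta \<notin> E" by (rule psi_in[OF z])
    have "psi zeta \<in> W" using rho1(3)[of "psi zeta"] kappa_psi[OF z] zeta by fastforce
    then have "psi zeta \<in> h ` annulus r0 sig" using nE interior_subset[of E] by (auto simp: W_def)
    then obtain u where u: "u \<in> annulus r0 sig" "psi zeta = h u" by auto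
    have "\<not> cmod u < 1" using u h_inner[of u] nE interior_subset[of E] by (auto simp: annulus_def)
    moreover have "cmod u \<noteq> 1" using u(2) nE h_circle(1) by auto
    ultimately have "1 < cmod u" by linarith
    then show ?thesis using u sub hi(2)[of u] by (auto simp: annulus_def)
  qed
  then show ?thesis using that[of rho1 hi] rho1 hi by blast
qed

text \<open>Dividing the collar coordinate of a nearby level curve by \<open>sig\<close> moves the
  curve into \<open>interior E\<close>, and by \<open>dilation_ratio\<close> distances shrink by at
  most the factor \<open>1 + tau\<close>. The energy thus rises by at most
  \<open>ln (1 + tau)\<close> above that of the level curve, which is below
  \<open>- ln (cmod c)\<close>.\<close>

lemma competitor:
  assumes tau: "0 < tau"
  obtains nu where "prob_on E nu" "log_energy nu \<le> ereal (- ln (cmod c) + ln (1 + tau))"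
proof -
  obtain sig where sig: "1 < sig" "sig < 1 / r0"
    and ratio: "\<And>u v. 1 \<le> cmod u \<Longrightarrow> cmod u \<le> sig \<Longrightarrow> 1 \<le> cmod v \<Longrightarrow> cmod v \<le> sig \<Longrightarrow>
       cmod (h u - h v) \<le> (1 + tau) * cmod (h (u / of_real sig) - h (v / of_real sig))"
    by (rule dilation_ratio[OF tau]) blast
  obtain rho1 hi where hi: "0 < rho1" "rho1 < 1" "hi holomorphic_on h ` collar"
    and col: "\<And>zeta. rho1 < cmod zeta \<Longrightarrow> cmod zeta < 1 \<Longrightarrow> psi zeta \<in> h ` collar \<and> h (hi (psi zeta)) = psi zeta \<and> 1 < cmod (hi (psi zeta)) \<and> cmod (hi (psi zeta)) < sig"
    by (rule collar_coordinate[OF sig]) blast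
  define rho where "rho = (1 + rho1) / 2"
  have rho: "rho1 < rho" "rho < 1" "0 < rho" using hi by (auto simp: rho_def)
  define X where "X x = psi (circ rho x)" for x
  let ?lX = "\<lambda>q. ln (cmod (X (fst q) - X (snd q)))"
  define v where "v x = hi (X x)" for x
  define Y where "Y x = h (v x / of_real sig)" for x
  let ?lY = "\<lambda>q. ln (cmod (Y (fst q) - Y (snd q)))"
  have Xc: "continuous_on UNIV X" unfolding X_def using rho by (intro psi_circle_continuous) auto
  have vX: "X x \<in> h ` collar" "h (v x) = X x" "1 < cmod (v x)" "cmod (v x) < sig" for x
    using col[of "circ rho x"] rho by (auto simp: X_def v_def norm_mult)
  have vc: "continuous_on UNIV v"
    unfolding v_def by (rule continuous_on_compose2[OF holomorphic_on_imp_continuous_on[OF hi(3)] Xc]) (use vX in auto)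
  have sr: "r0 < 1 / sig" using sig r0 by (simp add: field_simps)
  have vs: "r0 < cmod (v x / of_real sig)" "cmod (v x / of_real sig) < 1" for x
  proof -
    have "1 / sig < cmod (v x) / sig" using vX(3)[of x] sig by (intro divide_strict_right_mono) auto
    then show "r0 < cmod (v x / of_real sig)" using sr sig by (simp add: norm_divide)
    show "cmod (v x / of_real sig) < 1" using vX(4)[of x] sig by (simp add: norm_divide)
  qed
  have vb: "cmod (v x / of_real sig) < 1 / r0" for x
    by (rule less_trans[OF vs(2)]) (use r0 in simp)
  have Yc: "continuous_on UNIV Y"
    unfolding Y_def
    by (rule continuous_on_compose2[OF holomorphic_on_imp_continuous_on[OF h_hol]])
       (use vs vb sig in \<open>auto intro!: continuous_intros vc simp: annulus_def\<close>)
  have [measurable]: "X \<in> borel_measurable borel" "Y \<in> borel_measurable borel"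
    by (intro borel_measurable_continuous_onI Xc Yc)+
  have YE: "Y x \<in> E" for x using h_inner[OF vs] interior_subset by (auto simp: Y_def)
  obtain bE where bE: "\<And>z. z \<in> E \<Longrightarrow> cmod z \<le> bE" using compact_imp_bounded[OF compact_E] unfolding bounded_iff by blast
  define nu where "nu = distr uI borel Y"
  have nup: "prob_space nu" "sets nu = sets borel" unfolding nu_def by (auto intro!: uI.prob_space_distr)
  have pE: "prob_on E nu"
    unfolding prob_on_def using nup YE compact_E
    by (auto simp: nu_def emeasure_distr compact_imp_closed borel_closed vimage_def)
  have lv: "level rho = distr uI borel X" by (simp add: level_def X_def[abs_def])
  obtain b where b: "AE z in level rho. cmod z \<le> b" "AE z in level rho. max (- ln rho) (green z) = - ln rho"
    by (rule level_self[OF rho(3,2)])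
  note le = level_energy[OF rho(3,2) level_prob(1)[OF rho(3,2)] level_prob(2) b, unfolded lv]
  have Xi: "integrable (uI \<Otimes>\<^sub>M uI) ?lX"
    using le(1) by (subst (asm) pair_uI_transfer(1)) auto
  have Xv: "(LINT q|(uI \<Otimes>\<^sub>M uI). ?lX q) = ln (cmod c) - ln rho"
    using le(2) by (subst (asm) pair_uI_transfer(2)) auto
  have Xne: "AE q in uI \<Otimes>\<^sub>M uI. X (fst q) \<noteq> X (snd q)"
    using le(3) by (subst (asm) pair_uI_transfer(3)) auto
  have lr: "ln rho < 0" using rho by simp
  define C where "C = ln (max 1 (2 * bE))"
  have XY: "AE q in uI \<Otimes>\<^sub>M uI. Y (fst q) \<noteq> Y (snd q) \<and> ?lX q \<le> ln (1 + tau) + ?lY q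
     \<and> ?lY q \<le> C"
    using Xne
  proof eventually_elim
    case (elim q)
    have r: "cmod (X (fst q) - X (snd q)) \<le> (1 + tau) * cmod (Y (fst q) - Y (snd q))"
      using ratio[of "v (fst q)" "v (snd q)"] vX(2,3,4) by (simp add: Y_def less_imp_le)
    then have Yne: "Y (fst q) \<noteq> Y (snd q)" using elim by auto
    have "?lX q \<le> ln ((1 + tau) * cmod (Y (fst q) - Y (snd q)))"
      using r elim by (intro ln_mono) auto
    also have "\<dots> = ln (1 + tau) + ?lY q" using tau Yne by (subst ln_mult) auto
    finally have 1: "?lX q \<le> ln (1 + tau) + ?lY q" .
    have "cmod (Y (fst q) - Y (snd q)) \<le> max 1 (2 * bE)"
      using norm_triangle_ineq4[of "Y (fst q)" "Y (snd q)"] bE[OF YE, of "fst q"] bE[OF YE, of "snd q"] by auto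
    then have "?lY q \<le> C" unfolding C_def using Yne by (intro ln_mono) auto
    then show ?case using 1 Yne by blast
  qed
  have lt: "0 \<le> ln (1 + tau)" "0 \<le> C" using tau by (auto simp: C_def)
  interpret UU: pair_prob_space uI uI ..
  have Yi: "integrable (uI \<Otimes>\<^sub>M uI) ?lY"
  proof (rule Bochner_Integration.integrable_bound)
    show "integrable (uI \<Otimes>\<^sub>M uI) (\<lambda>q. \<bar>?lX q\<bar> + (ln (1 + tau) + C))" using Xi by auto
    show "AE q in uI \<Otimes>\<^sub>M uI. norm (?lY q) \<le> norm (\<bar>?lX q\<bar> + (ln (1 + tau) + C))"
      using XY by eventually_elim (use lt in auto)
  qed measurable
  have "(LINT q|(uI \<Otimes>\<^sub>M uI). ?lX q - ln (1 + tau)) \<le> (LINT q|(uI \<Otimes>\<^sub>M uI). ?lY q)"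
    using XY Xi Yi by (intro integral_mono_AE) auto
  then have Yv: "ln (cmod c) - ln rho - ln (1 + tau) \<le> (LINT q|(uI \<Otimes>\<^sub>M uI). ?lY q)"
    using Xi Xv UU.prob_space by simp
  have "log_energy nu = ereal (- (LINT q|(nu \<Otimes>\<^sub>M nu). ln (cmod (fst q - snd q))))"
  proof (rule log_energy_integral[OF nup])
    show "integrable (nu \<Otimes>\<^sub>M nu) (\<lambda>q. ln (cmod (fst q - snd q)))" unfolding nu_def using Yi by (subst pair_uI_transfer(1)) auto
    show "AE q in nu \<Otimes>\<^sub>M nu. fst q \<noteq> snd q" unfolding nu_def using XY by (subst pair_uI_transfer(3)) auto
  qed
  also have "(LINT q|(nu \<Otimes>\<^sub>M nu). ln (cmod (fst q - snd q))) = (LINT q|(uI \<Otimes>\<^sub>M uI). ?lY q)"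
    unfolding nu_def by (rule pair_uI_transfer(2)) measurable
  finally have "log_energy nu \<le> ereal (- ln (cmod c) + ln (1 + tau))"
    using Yv lr by simp
  then show ?thesis using that pE by blast
qed

lemma equilibrium_energy:
  assumes eq: "equilibrium_measure E \<mu>"
  shows "prob_space \<mu>" "sets \<mu> = sets borel" "emeasure \<mu> (- E) = 0" "AE z in \<mu>. z \<in> E"
    and "integrable (\<mu> \<Otimes>\<^sub>M \<mu>) (\<lambda>q. ln (cmod (fst q - snd q)))"
    and "AE q in \<mu> \<Otimes>\<^sub>M \<mu>. fst q \<noteq> snd q"
    and "- (LINT q|(\<mu> \<Otimes>\<^sub>M \<mu>). ln (cmod (fst q - snd q))) \<le> - ln (cmod c)"
proof -
  show \<mu>: "prob_space \<mu>" "sets \<mu> = sets borel" "emeasure \<mu> (- E) = 0"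
    using eq by (auto simp: equilibrium_measure_def prob_on_def)
  show AEE: "AE z in \<mu>. z \<in> E"
    using \<mu>(3) compact_E by (intro AE_I[where N = "- E"]) (auto simp: \<mu>(2) borel_closed compact_imp_closed)
  obtain bE where bE: "\<And>z. z \<in> E \<Longrightarrow> cmod z \<le> bE" using compact_imp_bounded[OF compact_E] unfolding bounded_iff by blast
  have b: "AE z in \<mu>. cmod z \<le> bE" using AEE by eventually_elim (rule bE)
  have le: "log_energy \<mu> \<le> ereal (- ln (cmod c) + ln (1 + tau))" if "0 < tau" for tau
  proof -
    obtain nu where "prob_on E nu" "log_energy nu \<le> ereal (- ln (cmod c) + ln (1 + tau))" by (rule competitor[OF \<open>0 < tau\<close>])
    then show ?thesis using eq unfolding equilibrium_measure_def by (meson order_trans)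
  qed
  note B = log_energy_bounded[OF \<mu>(1,2) b le]
  show "integrable (\<mu> \<Otimes>\<^sub>M \<mu>) (\<lambda>q. ln (cmod (fst q - snd q)))" "AE q in \<mu> \<Otimes>\<^sub>M \<mu>. fst q \<noteq> snd q"
    using B(1,2)[of 1] by simp_all
  show "- (LINT q|(\<mu> \<Otimes>\<^sub>M \<mu>). ln (cmod (fst q - snd q))) \<le> - ln (cmod c)"
  proof (rule field_le_epsilon)
    fix e :: real assume "0 < e"
    then show "- (LINT q|(\<mu> \<Otimes>\<^sub>M \<mu>). ln (cmod (fst q - snd q))) \<le> - ln (cmod c) + e"
      using B(3)[of "exp e - 1"] by simp
  qed
qed

text \<open>The potential of the level curve has the same constant value on \<open>E\<close> and on
  the curve, so its mutual energy with \<mu> and its own energy coincide and are known. The bound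
  for the energy of \<mu> handles the remaining term, and what is left is
  \<open>- 2 * ln rho\<close>.\<close>

lemma equilibrium_defect:
  assumes eq: "equilibrium_measure E \<mu>" and rho: "0 < rho" "rho < 1"
  shows "integrable lborel (\<lambda>x. indicator {0<..} x * (energy_defect \<mu> (level rho) x / x))"
    and "(LINT x|lborel. indicator {0<..} x * (energy_defect \<mu> (level rho) x / x)) \<le> - 2 * ln rho"
proof -
  note \<mu> = equilibrium_energy[OF eq]
  note lp = level_prob(1)[OF rho] level_prob(2)[of rho]
  interpret T1: two_probs \<mu> \<mu> using \<mu>(1,2) by (simp add: two_probs_def two_probs_axioms_def)
  interpret T2: two_probs \<mu> "level rho" using \<mu>(1,2) lp by (simp add: two_probs_def two_probs_axioms_def)
  interpret T3: two_probs "level rho" "level rho" using lp by (simp add: two_probs_def two_probs_axioms_def)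
  obtain bE where bE: "\<And>z. z \<in> E \<Longrightarrow> cmod z \<le> bE" using compact_imp_bounded[OF compact_E] unfolding bounded_iff by blast
  have b: "AE z in \<mu>. cmod z \<le> bE" using \<mu>(4) by eventually_elim (rule bE)
  have m: "AE z in \<mu>. max (- ln rho) (green z) = - ln rho"
    using \<mu>(4) by eventually_elim (use rho in \<open>simp add: green_def\<close>)
  note M = level_energy[OF rho \<mu>(1,2) b m]
  obtain b2 where b2: "AE z in level rho. cmod z \<le> b2" "AE z in level rho. max (- ln rho) (green z) = - ln rho"
    by (rule level_self[OF rho])
  note L = level_energy[OF rho lp b2]
  note F1 = T1.energy_frullani[OF \<mu>(5,6)]
  note F2 = T2.energy_frullani[OF M(1,3)]
  note F3 = T3.energy_frullani[OF L(1,3)]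
  have e: "indicator {0<..} x * (energy_defect \<mu> (level rho) x / x) =
     indicator {0<..} x * ((gE \<mu> \<mu> x - exp (- x)) / x) - 2 * (indicator {0<..} x * ((gE \<mu> (level rho) x - exp (- x)) / x))
     + indicator {0<..} x * ((gE (level rho) (level rho) x - exp (- x)) / x)" for x :: real
    by (auto simp: energy_defect_def indicator_def field_simps)
  show "integrable lborel (\<lambda>x. indicator {0<..} x * (energy_defect \<mu> (level rho) x / x))"
    unfolding e by (intro Bochner_Integration.integrable_add Bochner_Integration.integrable_diff integrable_mult_right F1(1) F2(1) F3(1))
  have "(LINT x|lborel. indicator {0<..} x * (energy_defect \<mu> (level rho) x / x)) =
    - 2 * (LINT q|(\<mu> \<Otimes>\<^sub>M \<mu>). ln (cmod (fst q - snd q))) - 2 * (- 2 * (ln (cmod c) + - ln rho)) + - 2 * (ln (cmod c) + - ln rho)"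
    unfolding e
    by (subst Bochner_Integration.integral_add, intro Bochner_Integration.integrable_diff integrable_mult_right F1(1) F2(1), rule F3(1),
        subst Bochner_Integration.integral_diff, rule F1(1), intro integrable_mult_right F2(1), subst integral_mult_right_zero)
       (simp only: F1(2) F2(2) F3(2) M(2) L(2))
  then show "(LINT x|lborel. indicator {0<..} x * (energy_defect \<mu> (level rho) x / x)) \<le> - 2 * ln rho"
    using \<mu>(7) by simp
qed

text \<open>The level curve measures converge to \<mu> by energy, and against \<open>bump\<close>
  they are computed by \<open>mean_green_level\<close>. As \<open>rho\<close> tends to one,
  \<open>max (- ln rho) (green z)\<close> tends uniformly to \<open>green z\<close>. The potential
  of \<mu> enters only through differences of circular means, so exceptional sets do not
  arise.\<close>

lemma equilibrium_potential:
  assumes eq: "equilibrium_measure E \<mu>" and s: "0 < s"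
  shows "(LINT z|\<mu>. bump s (a - z)) =
     (LINT x|uI. green (a + circ s x)) - (LINT x|uI. green (a + circ (s / 2) x))"
proof -
  define rho where "rho k = 1 - 1 / (real k + 2)" for k :: nat
  have rho: "0 < rho k" "rho k < 1" for k by (auto simp: rho_def field_simps)
  have ll: "(\<lambda>k. - ln (rho k)) \<longlonglongrightarrow> 0" unfolding rho_def by real_asymp
  \<comment> \<open>The extra \<open>1 / (real k + 1)\<close> turns the weak inequality of
    \<open>equilibrium_defect\<close> into a strict one.\<close>
  define dlt where "dlt k = - 2 * ln (rho k) + 1 / (real k + 1)" for k
  have dlt: "dlt \<longlonglongrightarrow> 0" unfolding dlt_def rho_def by real_asymp
  note \<mu> = equilibrium_energy[OF eq]
  have bc: "continuous_on UNIV (\<lambda>z. bump s (a - z))"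
    by (rule continuous_on_compose2[OF bump_continuous[OF s, of UNIV]]) (auto intro!: continuous_intros)
  have conv: "(\<lambda>k. LINT z|level (rho k). bump s (a - z)) \<longlonglongrightarrow> (LINT z|\<mu>. bump s (a - z))"
  proof (rule energy_weak_convergence[where T = "cmod a + s" and dlt = dlt])
    fix k
    show "integrable lborel (\<lambda>x. indicator {0<..} x * (energy_defect \<mu> (level (rho k)) x / x))"
      by (rule equilibrium_defect(1)[OF eq rho])
    have "(LINT x|lborel. indicator {0<..} x * (energy_defect \<mu> (level (rho k)) x / x)) \<le> - 2 * ln (rho k)"
      by (rule equilibrium_defect(2)[OF eq rho])
    moreover have "0 < 1 / (real k + 1)" by simp
    ultimately show "(LINT x|lborel. indicator {0<..} x * (energy_defect \<mu> (level (rho k)) x / x)) < dlt k"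
      unfolding dlt_def by linarith
  next
    fix z assume "cmod a + s \<le> cmod z"
    then have "s \<le> cmod (a - z)" using norm_triangle_ineq2[of z a] by (simp add: norm_minus_commute)
    then show "bump s (a - z) = 0" using s by (intro bump_zero)
  qed (use \<mu> rho level_prob dlt bc in auto)
  have s2: "0 < s / 2" using s by simp
  have gc: "continuous_on UNIV (\<lambda>x. green (a + circ t x))" for t
    by (intro continuous_on_compose2[OF green_continuous] continuous_intros) auto
  have gmc: "continuous_on UNIV (\<lambda>x. max (- ln (rho k)) (green (a + circ t x)))" for t k
    by (intro continuous_on_max continuous_intros gc)
  have gl: "(\<lambda>k. LINT x|uI. max (- ln (rho k)) (green (a + circ t x))) \<longlonglongrightarrow> (LINT x|uI. green (a + circ t x))" for t
  proof -
    have "\<bar>(LINT x|uI. max (- ln (rho k)) (green (a + circ t x))) - (LINT x|uI. green (a + circ t x))\<bar> \<le> - ln (rho k)" for k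
    proof -
      have lk: "0 \<le> - ln (rho k)" using rho[of k] by simp
      have "\<bar>(LINT x|uI. max (- ln (rho k)) (green (a + circ t x))) - (LINT x|uI. green (a + circ t x))\<bar> =
        \<bar>LINT x|uI. max (- ln (rho k)) (green (a + circ t x)) - green (a + circ t x)\<bar>"
        by (subst Bochner_Integration.integral_diff[OF integrable_uI_continuous[OF gmc] integrable_uI_continuous[OF gc]]) (rule refl)
      also have "\<dots> \<le> (LINT x|uI. \<bar>max (- ln (rho k)) (green (a + circ t x)) - green (a + circ t x)\<bar>)"
        by (rule integral_abs_bound)
      also have "\<dots> \<le> (LINT x|uI. - ln (rho k))"
      proof (rule integral_mono)
        show "integrable uI (\<lambda>x. \<bar>max (- ln (rho k)) (green (a + circ t x)) - green (a + circ t x)\<bar>)"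
          by (intro integrable_abs Bochner_Integration.integrable_diff integrable_uI_continuous gmc gc)
        fix x
        show "\<bar>max (- ln (rho k)) (green (a + circ t x)) - green (a + circ t x)\<bar> \<le> - ln (rho k)"
          using green_nonneg[of "a + circ t x"] lk by (auto simp: max_def)
      qed auto
      finally show ?thesis using uI.prob_space by simp
    qed
    then have "(\<lambda>k. (LINT x|uI. max (- ln (rho k)) (green (a + circ t x))) - (LINT x|uI. green (a + circ t x))) \<longlonglongrightarrow> 0"
      by (intro Lim_null_comparison[OF _ ll]) auto
    then show ?thesis by (simp add: LIM_zero_iff)
  qed
  have "(LINT z|level (rho k). bump s (a - z)) =
     (LINT x|uI. max (- ln (rho k)) (green (a + circ s x))) - (LINT x|uI. max (- ln (rho k)) (green (a + circ (s / 2) x)))" for k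
  proof -
    have [measurable]: "(\<lambda>x. psi (circ (rho k) x)) \<in> borel_measurable borel" by (rule psi_circle_measurable[OF rho])
    have lc: "integrable uI (\<lambda>y. ln (max t (cmod (a - psi (circ (rho k) y)))))" if "0 < t" for t
      by (intro integrable_uI_continuous continuous_on_ln continuous_on_max continuous_intros psi_circle_continuous rho) (use that in auto)
    have "(LINT z|level (rho k). bump s (a - z)) = (LINT x|uI. bump s (a - psi (circ (rho k) x)))"
      unfolding level_def using bump_measurable[OF s] by (subst integral_distr) auto
    also have "\<dots> = (LINT x|uI. ln (max s (cmod (a - psi (circ (rho k) x))))) - (LINT x|uI. ln (max (s / 2) (cmod (a - psi (circ (rho k) x)))))"
      unfolding bump_def using lc[OF s] lc[OF s2] by simp
    also have "\<dots> = (LINT x|uI. max (- ln (rho k)) (green (a + circ s x))) - (LINT x|uI. max (- ln (rho k)) (green (a + circ (s / 2) x)))"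
      using mean_green_level[OF rho[of k] s, of a] mean_green_level[OF rho[of k] s2, of a] by simp
    finally show ?thesis .
  qed
  then have "(\<lambda>k. LINT z|level (rho k). bump s (a - z)) \<longlonglongrightarrow> (LINT x|uI. green (a + circ s x)) - (LINT x|uI. green (a + circ (s / 2) x))"
    using tendsto_diff[OF gl[of s] gl[of "s / 2"]] by simp
  then show ?thesis by (rule LIMSEQ_unique[OF conv])
qed

end

section \<open>Geometry of analytic Jordan curves\<close>

lemma jordan_facts:
  assumes h: "h holomorphic_on annulus r R" "inj_on h (annulus r R)" and r: "0 \<le> r" "r < 1" "1 < R"
    and L: "L = h ` sphere 0 1" and E: "E = closure (inside L)"
  shows "- E = outside L" "interior E = inside L" "E = inside L \<union> L" "compact E"
    "connected (inside L)" "connected (outside L)" "inside L \<noteq> {}" "inside L \<inter> L = {}"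
    "open (inside L)" "open (outside L)" "L \<subseteq> closure (outside L)" "L \<subseteq> closure (inside L)"
    "outside L \<inter> L = {}" "inside L \<inter> outside L = {}"
proof -
  have sub: "sphere 0 1 \<subseteq> annulus r R" using r by (auto simp: annulus_def)
  define \<gamma> where "\<gamma> = h \<circ> circlepath 0 1"
  have pim: "path_image (circlepath 0 1) = sphere 0 1" by simp
  have sp: "simple_path \<gamma>"
    unfolding \<gamma>_def
    by (rule simple_path_continuous_image)
       (use pim sub in \<open>auto simp: simple_path_circlepath intro: holomorphic_continuous[OF h(1)] inj_on_subset[OF h(2)]\<close>)
  have closed: "pathfinish \<gamma> = pathstart \<gamma>" by (simp add: \<gamma>_def pathfinish_compose pathstart_compose)
  have im: "path_image \<gamma> = L" by (simp add: \<gamma>_def path_image_compose L)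
  note J = Jordan_inside_outside[OF sp closed, unfolded im]
  have un: "inside L \<union> outside L = - L" and dis: "inside L \<inter> outside L = {}" using J by auto
  have fr: "frontier (inside L) = L" "frontier (outside L) = L" using J by auto
  have op: "open (inside L)" "open (outside L)" using J by auto
  show "connected (inside L)" "connected (outside L)" "inside L \<noteq> {}" "open (inside L)" "open (outside L)" "inside L \<inter> outside L = {}" using J by auto
  show EL: "E = inside L \<union> L" using closure_Un_frontier[of "inside L"] fr E by simp
  show nE: "- E = outside L" using EL un dis by blast
  have "closure (outside L) = outside L \<union> L" using closure_Un_frontier[of "outside L"] fr by simp
  then have "interior E = - (outside L \<union> L)" using interior_closure[of E] nE by simp
  also have "\<dots> = inside L" using un dis by blast
  finally show "interior E = inside L" .
  show "inside L \<inter> L = {}" "outside L \<inter> L = {}" using un by blast+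
  show "compact E" unfolding E using J by (simp add: compact_closure)
  show "L \<subseteq> closure (outside L)" "L \<subseteq> closure (inside L)" using fr by (auto simp: frontier_def)
qed

lemma annulus_inverse:
  assumes "0 < r" "u \<in> annulus r (1 / r)"
  shows "inverse u \<in> annulus r (1 / r)"
proof -
  have u: "r < cmod u" "cmod u < inverse r" using assms by (auto simp: annulus_def inverse_eq_divide)
  have "inverse (inverse r) < inverse (cmod u)" by (rule less_imp_inverse_less) (use u assms in auto)
  moreover have "inverse (cmod u) < inverse r" by (rule less_imp_inverse_less) (use u assms in auto)
  ultimately show ?thesis by (simp add: annulus_def norm_inverse inverse_eq_divide[of r])
qed

text \<open>Each side of the unit circle in the annulus is connected and its image avoids the curve,
  so it goes to one component. Both components accumulate at \<open>h 1\<close>, and the image of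
  the annulus is an open neighbourhood of that point, so both are met and the two sides are
  separated. If they come in the wrong order, inversion of the parameter exchanges them.\<close>

lemma jordan_orientation:
  assumes h: "h holomorphic_on annulus r R" "inj_on h (annulus r R)" and r: "0 \<le> r" "r < 1" "1 < R"
    and L: "L = h ` sphere 0 1"
  obtains h2 r1 where "0 < r1" "r1 < 1" "annulus r1 (1 / r1) \<subseteq> annulus r R" "h2 = h \<or> h2 = (\<lambda>u. h (inverse u))"
    "h2 holomorphic_on annulus r1 (1 / r1)" "inj_on h2 (annulus r1 (1 / r1))" "h2 ` sphere 0 1 = L"
    "\<And>u. 1 < cmod u \<Longrightarrow> cmod u < 1 / r1 \<Longrightarrow> h2 u \<in> outside L"
    "\<And>u. r1 < cmod u \<Longrightarrow> cmod u < 1 \<Longrightarrow> h2 u \<in> inside L"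
proof -
  note J = jordan_facts[OF h r L refl]
  define r1 where "r1 = (max (max r (1 / R)) (1 / 2) + 1) / 2"
  define m where "m = max (max r (1 / R)) (1 / 2)"
  have m: "m < 1" "r \<le> m" "1 / R \<le> m" "1 / 2 \<le> m" using r by (auto simp: m_def)
  have r1: "r < r1" "1 / R < r1" "0 < r1" "r1 < 1"
  proof -
    have "r1 = (m + 1) / 2" by (simp add: r1_def m_def)
    then show "r < r1" "1 / R < r1" "0 < r1" "r1 < 1" using m by simp_all
  qed
  have R1: "1 / r1 < R" using r1 r by (simp add: field_simps)
  let ?A = "annulus r1 (1 / r1)"
  have r1': "1 < 1 / r1" using r1 by simp
  have sub: "?A \<subseteq> annulus r R" using r1 R1 by (auto simp: annulus_def)
  have hA: "h holomorphic_on ?A" "inj_on h ?A" using h sub by (auto intro: holomorphic_on_subset inj_on_subset)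
  define P where "P = {u. 1 < cmod u \<and> cmod u < 1 / r1}"
  define M where "M = {u. r1 < cmod u \<and> cmod u < 1}"
  have cPM: "connected P" "connected M"
    using connected_annulus(1)[where a = "0::complex" and ?r1.0 = 1 and ?r2.0 = "1 / r1"]
      connected_annulus(1)[where a = "0::complex" and ?r1.0 = r1 and ?r2.0 = 1] by (auto simp: P_def M_def)
  have PA: "P \<subseteq> ?A" "M \<subseteq> ?A" "sphere 0 1 \<subseteq> ?A" using r1 r1' less_trans[OF _ r1'] less_trans[OF r1(4)] by (auto simp: P_def M_def annulus_def)
  have cont: "continuous_on S h" if "S \<subseteq> ?A" for S using holomorphic_on_imp_continuous_on[OF hA(1)] that by (rule continuous_on_subset)
  have disj: "h ` S \<inter> L = {}" if "S \<subseteq> ?A" "S \<inter> sphere 0 1 = {}" for S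
    using hA(2) that PA(3) unfolding L by (fastforce dest: inj_onD)
  have side: "h ` S \<subseteq> inside L \<or> h ` S \<subseteq> outside L" if S: "connected S" "S \<subseteq> ?A" "S \<inter> sphere 0 1 = {}" for S
  proof -
    have "connected (h ` S)" using S by (intro connected_continuous_image cont) auto
    moreover have "h ` S \<subseteq> inside L \<union> outside L" using disj[OF S(2,3)] by (auto simp: inside_Un_outside)
    ultimately have "inside L \<inter> h ` S = {} \<or> outside L \<inter> h ` S = {}"
      using connectedD[of "h ` S" "inside L" "outside L"] J(9,10,14) by auto
    then show ?thesis using \<open>h ` S \<subseteq> inside L \<union> outside L\<close> by blast
  qed
  have ohA: "open (h ` ?A)" by (intro open_mapping_thm3 hA open_annulus)
  have "(1::complex) \<in> sphere 0 1" by simp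
  then have h1: "h 1 \<in> L" "h 1 \<in> h ` ?A" using PA(3) unfolding L by blast+
  have meet: "\<exists>u\<in>P \<union> M. h u \<in> V" if V: "V = inside L \<or> V = outside L" for V
  proof -
    have "h 1 \<in> closure V" using V J(11,12) h1 by blast
    then have "h ` ?A \<inter> V \<noteq> {}" using open_Int_closure_eq_empty[OF ohA, of V] h1(2) by blast
    then obtain u where u: "u \<in> ?A" "h u \<in> V" by auto
    have "h u \<notin> L" using u V J(8,13) by blast
    then have "cmod u \<noteq> 1" by (auto simp: L)
    then have "u \<in> P \<union> M" using u(1) by (auto simp: P_def M_def annulus_def)
    then show ?thesis using u by blast
  qed
  have PS: "h ` P \<subseteq> inside L \<or> h ` P \<subseteq> outside L" by (rule side) (use cPM PA in \<open>auto simp: P_def\<close>)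
  have MS: "h ` M \<subseteq> inside L \<or> h ` M \<subseteq> outside L" by (rule side) (use cPM PA in \<open>auto simp: M_def\<close>)
  have "(h ` P \<subseteq> outside L \<and> h ` M \<subseteq> inside L) \<or> (h ` P \<subseteq> inside L \<and> h ` M \<subseteq> outside L)"
    using PS MS meet[of "inside L"] meet[of "outside L"] J(14) by blast
  then show ?thesis
  proof
    assume a: "h ` P \<subseteq> outside L \<and> h ` M \<subseteq> inside L"
    show ?thesis
      by (rule that[of r1 h]) (use r1 sub hA L a in \<open>auto simp: P_def M_def\<close>)
  next
    assume a: "h ` P \<subseteq> inside L \<and> h ` M \<subseteq> outside L"
    let ?h2 = "\<lambda>u. h (inverse u)"
    have nz: "u \<noteq> 0" if "u \<in> ?A" for u using that r1 by (auto simp: annulus_def)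
    have hol2: "?h2 holomorphic_on ?A"
      by (rule holomorphic_on_compose_gen[OF _ hA(1), unfolded o_def])
         (use annulus_inverse[OF r1(3)] nz in \<open>auto intro!: holomorphic_intros\<close>)
    have inj2: "inj_on ?h2 ?A"
      by (rule inj_onI) (metis annulus_inverse[OF r1(3)] hA(2) inj_onD inverse_inverse_eq)
    have im2: "?h2 ` sphere 0 1 = L"
    proof -
      have "inverse ` sphere (0::complex) 1 = sphere 0 1"
      proof (intro equalityI subsetI)
        fix x :: complex assume "x \<in> sphere 0 1"
        then show "x \<in> inverse ` sphere 0 1" by (intro image_eqI[of _ _ "inverse x"]) (auto simp: norm_inverse)
      qed (auto simp: norm_inverse)
      then show ?thesis unfolding L by (metis image_image)
    qed
    have inP: "inverse u \<in> M" if "1 < cmod u" "cmod u < 1 / r1" for u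
      using annulus_inverse[OF r1(3), of u] that r1 less_imp_inverse_less[of 1 "cmod u"] by (auto simp: M_def annulus_def norm_inverse)
    have inM: "inverse u \<in> P" if "r1 < cmod u" "cmod u < 1" for u
      using annulus_inverse[OF r1(3), of u] that r1 r1' less_trans[OF that(2) r1'] less_imp_inverse_less[of "cmod u" 1] less_trans[OF r1(3) that(1)] by (auto simp: P_def annulus_def norm_inverse)
    show ?thesis
      by (rule that[of r1 ?h2]) (use r1 sub hol2 inj2 im2 a inP inM in blast)+
  qed
qed

text \<open>Inversion about an interior point \<open>p\<close> sends the exterior together with
  infinity to an open set whose complement is the image of \<open>E - {p}\<close>: connected, and
  unbounded because \<open>p\<close> is interior. That set is therefore simply connected, and the
  Riemann mapping theorem applies.\<close>

lemma riemann_exterior: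
  assumes E: "compact E" "connected (- E)" and p: "p \<in> interior E" and conn: "connected (E - {p})" and ne: "E \<noteq> {p}"
  shows "\<exists>psi kap c. exterior_conformal E psi kap c"
proof -
  define \<iota> where "\<iota> z = inverse (z - p)" for z
  define S where "S = insert 0 (\<iota> ` (- E))"
  have pE: "p \<in> E" using p interior_subset by auto
  have iota0: "\<iota> z = 0 \<longleftrightarrow> z = p" for z by (simp add: \<iota>_def)
  have iota_inj: "\<iota> z = \<iota> w \<longleftrightarrow> z = w" for z w by (simp add: \<iota>_def)
  have iota_inv: "\<iota> (p + inverse t) = t" for t by (simp add: \<iota>_def)
  have iota_inv2: "p + inverse (\<iota> z) = z" for z by (simp add: \<iota>_def)
  have oE: "open (- E)" using E(1) by (simp add: compact_imp_closed open_Compl)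
  have ih: "\<iota> holomorphic_on (- {p})" unfolding \<iota>_def by (intro holomorphic_intros) auto
  have oi: "open (\<iota> ` (- E))"
    by (intro open_mapping_thm3 holomorphic_on_subset[OF ih] oE) (use pE in \<open>auto simp: inj_on_def iota_inj\<close>)
  obtain T where T: "0 < T" "E \<subseteq> ball p T" using bounded_subset_ballD[OF compact_imp_bounded[OF E(1)]] by blast
  have ballS: "ball 0 (1 / T) \<subseteq> S"
  proof
    fix t :: complex assume t: "t \<in> ball 0 (1 / T)"
    show "t \<in> S"
    proof (cases "t = 0")
      case False
      have "T < cmod (inverse t)" using t False T by (simp add: norm_divide field_simps)
      then have "p + inverse t \<notin> ball p T" by (simp add: dist_norm)
      then have "p + inverse t \<in> - E" using T by auto
      then show ?thesis using iota_inv[of t] by (auto simp: S_def intro!: image_eqI[of _ _ "p + inverse t"])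
    qed (simp add: S_def)
  qed
  have S2: "S = ball 0 (1 / T) \<union> \<iota> ` (- E)" using ballS T by (auto simp: S_def)
  have oS: "open S" unfolding S2 using oi by auto
  have cS: "connected S"
    unfolding S2
  proof (rule connected_Un)
    show "connected (\<iota> ` (- E))"
      by (intro connected_continuous_image E(2) holomorphic_continuous[OF ih]) (use pE in auto)
    have t: "of_real (1 / (2 * T)) \<in> ball (0::complex) (1 / T)" using T by (simp add: norm_divide field_simps)
    then have "of_real (1 / (2 * T)) \<in> S" using ballS by blast
    then have "of_real (1 / (2 * T)) \<in> \<iota> ` (- E)" using T by (auto simp: S_def)
    then show "ball 0 (1 / T) \<inter> \<iota> ` (- E) \<noteq> {}" using t by blast
  qed auto
  have comp: "- S = \<iota> ` (E - {p})"
  proof (intro equalityI subsetI)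
    fix t assume t: "t \<in> - S"
    then have t0: "t \<noteq> 0" by (auto simp: S_def)
    have "p + inverse t \<in> E" using t iota_inv[of t] by (auto simp: S_def) (metis ComplI image_eqI)
    moreover have "p + inverse t \<noteq> p" using t0 by simp
    ultimately show "t \<in> \<iota> ` (E - {p})" using iota_inv[of t] by (intro image_eqI[of _ _ "p + inverse t"]) auto
  next
    fix t assume "t \<in> \<iota> ` (E - {p})"
    then show "t \<in> - S" by (auto simp: S_def iota0 iota_inj)
  qed
  have neS: "- S \<noteq> {}" unfolding comp using ne pE by auto
  have connC: "connected (- S)"
    unfolding comp by (intro connected_continuous_image conn holomorphic_continuous[OF ih]) auto
  have unb: "\<not> bounded (- S)"
  proof
    assume "bounded (- S)"
    then obtain b where b: "\<And>t. t \<in> - S \<Longrightarrow> cmod t \<le> b" unfolding bounded_iff by blast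
    obtain e where e: "e > 0" "ball p e \<subseteq> E" using p by (metis mem_interior)
    define dlt where "dlt = min (e / 2) (1 / (\<bar>b\<bar> + 1))"
    have dlt: "0 < dlt" "dlt < e" "dlt \<le> 1 / (\<bar>b\<bar> + 1)" using e by (auto simp: dlt_def)
    have "p + of_real dlt \<in> E - {p}" using e dlt by (auto simp: dist_norm subset_iff)
    then have "\<iota> (p + of_real dlt) \<in> - S" unfolding comp by blast
    then have "cmod (\<iota> (p + of_real dlt)) \<le> b" by (rule b)
    then have "1 / dlt \<le> b" using dlt by (simp add: \<iota>_def norm_divide inverse_eq_divide)
    moreover have "\<bar>b\<bar> + 1 \<le> 1 / dlt" using dlt by (simp add: field_simps)
    ultimately show False by linarith
  qed
  have "components (- S) = {- S}" using connC neS by (simp add: components_eq_sing_iff)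
  then have scS: "simply_connected S"
    using simply_connected_eq_unbounded_complement_components[OF oS] cS unb by simp
  have "S \<noteq> {}" "S \<noteq> UNIV" using neS by (auto simp: S_def)
  then have "\<exists>f g. f holomorphic_on S \<and> g holomorphic_on ball 0 1 \<and>
           (\<forall>z \<in> S. f z \<in> ball 0 1 \<and> g(f z) = z) \<and> (\<forall>z \<in> ball 0 1. g z \<in> S \<and> f(g z) = z)"
    using Riemann_mapping_theorem[of S] oS scS by blast
  then obtain f g where f: "f holomorphic_on S" and g: "g holomorphic_on ball 0 1"
    and fg: "\<And>z. z \<in> S \<Longrightarrow> f z \<in> ball 0 1 \<and> g (f z) = z" and gf: "\<And>z. z \<in> ball 0 1 \<Longrightarrow> g z \<in> S \<and> f (g z) = z"
    by blast
  have S0: "0 \<in> S" by (simp add: S_def)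
  have f0: "f 0 \<in> ball 0 1" using fg[OF S0] by simp
  \<comment> \<open>A disk automorphism moves the image of infinity to \<open>0\<close>.\<close>
  obtain F G where F: "F (f 0) = 0" "F holomorphic_on ball 0 1" "F ` ball 0 1 \<subseteq> ball 0 1"
    and G: "G holomorphic_on ball 0 1" "G ` ball 0 1 \<subseteq> ball 0 1"
    and FG: "\<And>z. z \<in> ball 0 1 \<Longrightarrow> F (G z) = z" and GF: "\<And>z. z \<in> ball 0 1 \<Longrightarrow> G (F z) = z"
    by (rule ball_biholomorphism_exists[OF f0]) blast
  define f2 where "f2 = F \<circ> f"
  define g2 where "g2 = g \<circ> G"
  have f2h: "f2 holomorphic_on S" unfolding f2_def using fg by (intro holomorphic_on_compose_gen[OF f F(2)]) auto
  have g2h: "g2 holomorphic_on ball 0 1" unfolding g2_def using G(2) by (intro holomorphic_on_compose_gen[OF G(1) g]) auto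
  have f2b: "f2 z \<in> ball 0 1" "g2 (f2 z) = z" if "z \<in> S" for z
    using fg[OF that] F(3) GF[of "f z"] by (auto simp: f2_def g2_def image_subset_iff)
  have g2b: "g2 z \<in> S" "f2 (g2 z) = z" if "z \<in> ball 0 1" for z
  proof -
    have "G z \<in> ball 0 1" using that G(2) by blast
    then show "g2 z \<in> S" "f2 (g2 z) = z" using gf[of "G z"] FG[OF that] by (auto simp: f2_def g2_def)
  qed
  have g20: "g2 0 = 0"
  proof -
    have "G 0 = f 0" using GF[OF f0] F(1) by simp
    then show ?thesis using fg[OF S0] by (simp add: g2_def)
  qed
  have f20: "f2 0 = 0" using F(1) by (simp add: f2_def)
  have g2inj: "inj_on g2 (ball 0 1)" by (rule inj_onI) (metis g2b(2))
  have g2z: "g2 z = 0 \<longleftrightarrow> z = 0" if "z \<in> ball 0 1" for z using that g2b(2)[OF that] f20 g20 by auto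
  define d where "d = deriv g2 0"
  have d0: "d \<noteq> 0" unfolding d_def by (rule holomorphic_injective_imp_regular[OF g2h _ g2inj]) auto
  define psi where "psi zeta = p + inverse (g2 zeta)" for zeta
  define kap where "kap z = f2 (\<iota> z)" for z
  have "exterior_conformal E psi kap (1 / d)"
  proof
    show "compact E" by fact
    show "psi holomorphic_on (ball 0 1 - {0})"
      unfolding psi_def by (intro holomorphic_intros holomorphic_on_subset[OF g2h]) (use g2z in auto)
    have sub: "- E \<subseteq> - {p}" using pE by auto
    show "kap holomorphic_on (- E)"
      unfolding kap_def
      by (rule holomorphic_on_compose_gen[OF holomorphic_on_subset[OF ih sub] f2h, unfolded o_def]) (auto simp: S_def)
    fix zeta :: complex assume zeta: "zeta \<in> ball 0 1 - {0}"
    have "g2 zeta \<in> S" "g2 zeta \<noteq> 0" using g2b(1)[of zeta] g2z[of zeta] zeta by auto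
    then obtain z where z: "z \<notin> E" "g2 zeta = \<iota> z" by (auto simp: S_def)
    have psz: "psi zeta = z" by (simp add: psi_def z iota_inv2)
    then show "psi zeta \<notin> E" using z by simp
    show "kap (psi zeta) = zeta" using psz z g2b(2)[of zeta] zeta by (simp add: kap_def)
  next
    fix z assume z: "z \<notin> E"
    have iS: "\<iota> z \<in> S" using z by (auto simp: S_def)
    have "z \<noteq> p" using z pE by auto
    then have "f2 (\<iota> z) \<noteq> 0" using f2b(2)[OF iS] g20 iota0[of z] by auto
    then show "kap z \<in> ball 0 1 - {0}" using f2b(1)[OF iS] by (auto simp: kap_def)
    show "psi (kap z) = z" by (simp add: psi_def kap_def f2b(2)[OF iS] iota_inv2)
  next
    have "(g2 has_field_derivative d) (at 0)"
      unfolding d_def using holomorphic_derivI[OF g2h, of 0] by auto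
    then have "((\<lambda>zeta. g2 zeta / zeta) \<longlongrightarrow> d) (at 0)" by (simp add: has_field_derivative_iff g20)
    then have "((\<lambda>zeta. zeta * p + inverse (g2 zeta / zeta)) \<longlongrightarrow> 0 * p + inverse d) (at 0)"
      using d0 by (intro tendsto_intros) auto
    then show "((\<lambda>zeta. zeta * psi zeta) \<longlongrightarrow> 1 / d) (at 0)"
      by (simp add: psi_def distrib_left divide_inverse mult.commute)
    show "1 / d \<noteq> 0" using d0 by simp
  qed
  then show ?thesis by blast
qed

text \<open>The Faber polynomials refer to a given map, so the locale has to be instantiated with
  that map. The limit of \<open>\<Phi> z / z\<close> determines the derivative at \<open>0\<close>
  of \<open>j\<close>, the function \<open>1 / \<Phi> (1 / t)\<close>; inverting \<open>j\<close>
  turns it into the limit required of \<open>psi\<close>.\<close>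

lemma exterior_map_conformal:
  assumes E: "compact E" and \<Phi>: "exterior_map E \<Phi>"
  shows "\<exists>psi \<gamma>. 0 < \<gamma> \<and> exterior_conformal E psi (\<lambda>z. inverse (\<Phi> z)) (of_real \<gamma>)"
proof -
  have hol: "\<Phi> holomorphic_on (- E)" and inj: "inj_on \<Phi> (- E)" and im: "\<Phi> ` (- E) = {w. 1 < cmod w}"
    using \<Phi> by (auto simp: exterior_map_def)
  obtain g :: real where g: "0 < g" "((\<lambda>z. \<Phi> z / z) \<longlongrightarrow> of_real g) at_infinity"
    using \<Phi> by (auto simp: exterior_map_def)
  have oE: "open (- E)" using E by (simp add: compact_imp_closed open_Compl)
  obtain \<Psi> where \<Psi>: "\<Psi> holomorphic_on {w. 1 < cmod w}" "\<And>z. z \<notin> E \<Longrightarrow> \<Psi> (\<Phi> z) = z"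
  proof -
    obtain \<Psi> where "\<Psi> holomorphic_on \<Phi> ` (- E)" "\<And>z. z \<in> - E \<Longrightarrow> \<Psi> (\<Phi> z) = z"
      by (rule holomorphic_has_inverse[OF hol oE inj]) blast
    then show ?thesis using that[of \<Psi>] unfolding im by simp
  qed
  have Phi_gt: "1 < cmod (\<Phi> z)" if "z \<notin> E" for z
  proof -
    have "\<Phi> z \<in> \<Phi> ` (- E)" using that by simp
    then show ?thesis unfolding im by simp
  qed
  have Psi: "\<Psi> u \<notin> E" "\<Phi> (\<Psi> u) = u" if "1 < cmod u" for u
  proof -
    have "u \<in> \<Phi> ` (- E)" unfolding im using that by simp
    then obtain z where z: "z \<notin> E" "\<Phi> z = u" by auto
    have "\<Psi> u = z" using \<Psi>(2)[OF z(1)] z(2) by simp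
    then show "\<Psi> u \<notin> E" "\<Phi> (\<Psi> u) = u" using z by simp_all
  qed
  define psi where "psi zeta = \<Psi> (inverse zeta)" for zeta
  define kap where "kap z = inverse (\<Phi> z)" for z
  obtain T where T: "0 < T" "E \<subseteq> ball 0 T" using bounded_subset_ballD[OF compact_imp_bounded[OF E]] by blast
  define j where "j t = (if t = 0 then 0 else kap (inverse t))" for t
  have outE: "inverse t \<notin> E" if "t \<in> ball 0 (1 / T) - {0}" for t
  proof -
    have "inverse (1 / T) < inverse (cmod t)" using that T by (intro less_imp_inverse_less) auto
    then have "T < cmod (inverse t)" by (simp add: norm_inverse)
    then have "inverse t \<notin> ball 0 T" by simp
    then show ?thesis using T(2) by blast
  qed
  have lim: "((\<lambda>t. j t / t) \<longlongrightarrow> inverse (of_real g)) (at 0)"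
  proof -
    have "((\<lambda>t. \<Phi> (inverse t) / inverse t) \<longlongrightarrow> of_real g) (at 0)"
      using g(2) unfolding lim_at_infinity_0 by (simp add: o_def)
    then have "((\<lambda>t. inverse (\<Phi> (inverse t) / inverse t)) \<longlongrightarrow> inverse (of_real g)) (at 0)"
      using g(1) by (intro tendsto_inverse) auto
    then show ?thesis
      by (rule Lim_transform_eventually) (auto simp: eventually_at_filter j_def kap_def divide_inverse)
  qed
  have j0: "((\<lambda>t. kap (inverse t)) \<longlongrightarrow> 0) (at 0)"
  proof -
    have "((\<lambda>t. j t / t * t) \<longlongrightarrow> inverse (of_real g) * 0) (at 0)" by (intro tendsto_intros lim)
    then have "((\<lambda>t. j t / t * t) \<longlongrightarrow> 0) (at 0)" by simp
    then show ?thesis by (rule Lim_transform_eventually) (auto simp: eventually_at_filter j_def)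
  qed
  have kh: "kap holomorphic_on (- E)" unfolding kap_def by (intro holomorphic_intros hol) (use Phi_gt in force)
  have "(\<lambda>t. kap (inverse t)) holomorphic_on (ball 0 (1 / T) - {0})"
    by (rule holomorphic_on_compose_gen[OF _ kh, unfolded o_def]) (use outE in \<open>auto intro!: holomorphic_intros\<close>)
  from holomorphic_removable[OF this j0] have jh: "j holomorphic_on ball 0 (1 / T)" by (simp add: j_def[abs_def])
  have kne: "kap z \<noteq> 0" if "z \<notin> E" for z using Phi_gt[OF that] by (auto simp: kap_def)
  have jinj: "inj_on j (ball 0 (1 / T))"
  proof (rule inj_onI)
    fix a b assume ab: "a \<in> ball 0 (1 / T)" "b \<in> ball 0 (1 / T)" "j a = j b"
    show "a = b"
    proof (cases "a = 0 \<or> b = 0")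
      case True
      then show ?thesis using ab kne[OF outE[of a]] kne[OF outE[of b]] by (auto simp: j_def split: if_splits)
    next
      case False
      then have "\<Phi> (inverse a) = \<Phi> (inverse b)" using ab by (auto simp: j_def kap_def)
      then have "inverse a = inverse b" using inj_onD[OF inj, of "inverse a" "inverse b"] outE[of a] outE[of b] ab False by auto
      then show ?thesis by simp
    qed
  qed
  obtain ji where ji: "ji holomorphic_on j ` ball 0 (1 / T)" "\<And>t. t \<in> ball 0 (1 / T) \<Longrightarrow> deriv j t * deriv ji (j t) = 1"
      "\<And>t. t \<in> ball 0 (1 / T) \<Longrightarrow> ji (j t) = t"
    using holomorphic_has_inverse[OF jh open_ball jinj] by metis
  have b0: "0 \<in> ball (0::complex) (1 / T)" using T by simp
  have jz: "j 0 = 0" by (simp add: j_def)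
  have oj: "open (j ` ball 0 (1 / T))" by (intro open_mapping_thm3 jh jinj open_ball)
  have z0: "0 \<in> j ` ball 0 (1 / T)" using b0 jz by (metis image_eqI)
  have "(j has_field_derivative inverse (of_real g)) (at 0)"
    using lim by (simp add: has_field_derivative_iff jz)
  then have dj: "deriv j 0 = inverse (of_real g)" by (rule DERIV_imp_deriv)
  have dji: "deriv ji 0 = of_real g" using ji(2)[OF b0] g(1) by (simp add: dj jz field_simps)
  have "(ji has_field_derivative of_real g) (at 0)"
    using holomorphic_derivI[OF ji(1) oj z0] dji by simp
  moreover have "ji 0 = 0" using ji(3)[OF b0] jz by simp
  ultimately have "((\<lambda>zeta. ji zeta / zeta) \<longlongrightarrow> of_real g) (at 0)" by (simp add: has_field_derivative_iff)
  then have l2: "((\<lambda>zeta. inverse (ji zeta / zeta)) \<longlongrightarrow> inverse (of_real g)) (at 0)" using g(1) by (intro tendsto_inverse) auto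
  have plim: "((\<lambda>zeta. zeta * psi zeta) \<longlongrightarrow> inverse (of_real g)) (at 0)"
  proof (rule Lim_transform_eventually[OF l2])
    have "\<forall>\<^sub>F zeta in at 0. zeta \<in> j ` ball 0 (1 / T) - {0}"
      using oj z0 unfolding eventually_at_topological by blast
    then show "\<forall>\<^sub>F zeta in at 0. inverse (ji zeta / zeta) = zeta * psi zeta"
    proof eventually_elim
      case (elim zeta)
      then obtain t where t: "t \<in> ball 0 (1 / T)" "zeta = j t" "zeta \<noteq> 0" by auto
      have t0: "t \<noteq> 0" using t jz by auto
      have "inverse zeta = \<Phi> (inverse t)" using t t0 by (simp add: j_def kap_def)
      then have "psi zeta = inverse t" using \<Psi>(2)[OF outE[of t]] t t0 by (simp add: psi_def)
      then show ?case using ji(3)[OF t(1)] t by (simp add: divide_inverse)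
    qed
  qed
  have inv1: "1 < cmod (inverse zeta)" if "zeta \<in> ball 0 1 - {0}" for zeta using that by (simp add: norm_inverse one_less_inverse)
  have "exterior_conformal E psi (\<lambda>z. inverse (\<Phi> z)) (of_real (inverse g))"
  proof
    show "compact E" by fact
    show "psi holomorphic_on (ball 0 1 - {0})"
      unfolding psi_def by (rule holomorphic_on_compose_gen[OF _ \<Psi>(1), unfolded o_def]) (use inv1 in \<open>auto intro!: holomorphic_intros\<close>)
    show "(\<lambda>z. inverse (\<Phi> z)) holomorphic_on (- E)" using kh by (simp add: kap_def[abs_def])
    show "psi zeta \<notin> E" "inverse (\<Phi> (psi zeta)) = zeta" if "zeta \<in> ball 0 1 - {0}" for zeta
      using Psi[OF inv1[OF that]] by (auto simp: psi_def)
    show "inverse (\<Phi> z) \<in> ball 0 1 - {0}" "psi (inverse (\<Phi> z)) = z" if "z \<notin> E" for z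
      using Phi_gt[OF that] \<Psi>(2)[OF that] by (auto simp: psi_def norm_inverse inverse_less_1_iff)
    show "((\<lambda>zeta. zeta * psi zeta) \<longlongrightarrow> of_real (inverse g)) (at 0)" using plim by simp
    show "of_real (inverse g) \<noteq> (0::complex)" using g by simp
  qed
  then show ?thesis using g by (intro exI[of _ psi] exI[of _ "inverse g"]) auto
qed

section \<open>Faber polynomials\<close>

text \<open>A derivative has zero integral over a closed contour; the factor \<open>circ s x\<close>
  is what the mean carries in place of \<open>du\<close>.\<close>

lemma mean_deriv_zero:
  assumes G: "G holomorphic_on annulus r R" and s: "r < s" "s < R" "0 \<le> r"
  shows "(LINT x|uI. circ s x * deriv G (circ s x)) = 0"
proof -
  let ?F = "\<lambda>u. u * deriv G u"
  have sub: "sphere 0 s \<subseteq> annulus r R" using s by (auto simp: annulus_def)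
  have dG: "deriv G holomorphic_on annulus r R" by (intro holomorphic_deriv G open_annulus)
  have c: "continuous_on (sphere 0 s) ?F"
    by (intro continuous_intros holomorphic_continuous[OF dG sub])
  have "((\<lambda>u. ?F u / (u - 0)) has_contour_integral (2 * of_real pi * \<i> * (LINT x|uI. ?F (0 + circ s x)))) (circlepath 0 s)"
    by (rule circlepath_mean[OF c]) (use s in auto)
  moreover have "(deriv G has_contour_integral (G (pathfinish (circlepath 0 s)) - G (pathstart (circlepath 0 s)))) (circlepath 0 s)"
  proof (rule contour_integral_primitive)
    fix u assume "u \<in> annulus r R"
    then have "(G has_field_derivative deriv G u) (at u)" by (rule holomorphic_derivI[OF G open_annulus])
    then show "(G has_field_derivative deriv G u) (at u within annulus r R)" by (rule has_field_derivative_at_within)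
  qed (use sub s in auto)
  then have "(deriv G has_contour_integral 0) (circlepath 0 s)" by simp
  then have "((\<lambda>u. ?F u / (u - 0)) has_contour_integral 0) (circlepath 0 s)"
    by (rule has_contour_integral_eq) (use s in auto)
  ultimately show ?thesis by (auto dest: has_contour_integral_unique)
qed

lemma poly_antiderivative:
  fixes q :: "complex poly"
  obtains Q where "pderiv Q = q"
proof -
  define Q where "Q = (\<Sum>i\<le>degree q. monom (coeff q i / of_nat (Suc i)) (Suc i))"
  have "pderiv Q = (\<Sum>i\<le>degree q. monom (coeff q i) i)"
  proof -
    have "pderiv (\<Sum>i\<in>A. f i) = (\<Sum>i\<in>A. pderiv (f i))" if "finite A" for f :: "nat \<Rightarrow> complex poly" and A
      using that by (induction A) (auto simp: pderiv_add)
    then show ?thesis unfolding Q_def by (simp add: pderiv_monom del: of_nat_Suc)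
  qed
  then show ?thesis using that[of Q] by (simp add: poly_as_sum_of_monoms)
qed

lemma removable_quotient:
  assumes a: "a holomorphic_on ball 0 (e::real)" and e: "0 < e"
  obtains b where "b holomorphic_on ball 0 e" "\<And>t. t \<in> ball 0 e \<Longrightarrow> a t = a 0 + t * b t"
  by (rule that[OF pole_lemma[OF a, of 0]]) (use e in auto)

text \<open>Splitting off the constant term repeatedly keeps the remainder holomorphic. In
  \<open>faber_exists\<close> this shows at once that the tail of the Laurent expansion vanishes at
  infinity.\<close>

lemma taylor_poly:
  assumes "a holomorphic_on ball 0 (e::real)" and e: "0 < e"
  shows "\<exists>q b. degree q \<le> m \<and> coeff q 0 = a 0 \<and> b holomorphic_on ball 0 e \<and> (\<forall>t\<in>ball 0 e. a t = poly q t + t ^ Suc m * b t)"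
  using assms(1)
proof (induction m arbitrary: a)
  case 0
  obtain b where "b holomorphic_on ball 0 e" "\<And>t. t \<in> ball 0 e \<Longrightarrow> a t = a 0 + t * b t"
    by (rule removable_quotient[OF 0 e]) blast
  then show ?case by (intro exI[of _ "[:a 0:]"] exI[of _ b]) auto
next
  case (Suc m)
  obtain b where b: "b holomorphic_on ball 0 e" "\<And>t. t \<in> ball 0 e \<Longrightarrow> a t = a 0 + t * b t"
    by (rule removable_quotient[OF Suc.prems e]) blast
  obtain q b' where q: "degree q \<le> m" "b' holomorphic_on ball 0 e" "\<forall>t\<in>ball 0 e. b t = poly q t + t ^ Suc m * b' t"
    using Suc.IH[OF b(1)] by blast
  have "degree (pCons (a 0) q) \<le> Suc m" using q(1) degree_pCons_le[of "a 0" q] by linarith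
  moreover have "\<forall>t\<in>ball 0 e. a t = poly (pCons (a 0) q) t + t ^ Suc (Suc m) * b' t"
    using b(2) q(3) by (simp add: algebra_simps)
  ultimately show ?case using q(2) by (intro exI[of _ "pCons (a 0) q"] exI[of _ b']) auto
qed

lemma thin_collar:
  assumes "open U" "sphere 0 1 \<subseteq> U"
  obtains dlt where "0 < dlt" "dlt < 1" "\<And>u::complex. \<bar>cmod u - 1\<bar> < dlt \<Longrightarrow> u \<in> U"
proof -
  obtain d where d: "0 < d" "\<And>x y. x \<in> sphere 0 1 \<Longrightarrow> y \<in> - U \<Longrightarrow> d \<le> dist x y"
  proof -
    have "sphere 0 1 \<inter> - U = {}" using assms(2) by blast
    then show ?thesis using separate_compact_closed[of "sphere (0::complex) 1" "- U"] assms(1) that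
      by (metis closed_Compl compact_sphere)
  qed
  define dlt where "dlt = min d (1 / 2)"
  have "u \<in> U" if u: "\<bar>cmod u - 1\<bar> < dlt" for u
  proof (rule ccontr)
    assume "u \<notin> U"
    have u0: "cmod u \<noteq> 0" using u by (auto simp: dlt_def)
    have "d \<le> dist (sgn u) u" using \<open>u \<notin> U\<close> u0 by (intro d(2)) (auto simp: norm_sgn)
    also have "sgn u - u = of_real (1 - cmod u) * sgn u"
      using u0 by (simp add: sgn_eq field_simps)
    then have "dist (sgn u) u = \<bar>1 - cmod u\<bar>" using u0 by (simp add: dist_norm norm_mult norm_sgn del: of_real_diff)
    finally show False using u by (simp add: dlt_def abs_minus_commute)
  qed
  then show ?thesis using that[of dlt] d by (auto simp: dlt_def)
qed

context exterior_conformal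
begin

lemma psi_infinity: "filterlim psi at_infinity (at 0)"
proof -
  have "filterlim (\<lambda>zeta. (zeta * psi zeta) * inverse zeta) at_infinity (at 0)"
    by (rule tendsto_mult_filterlim_at_infinity[OF psi_lim c_nonzero filterlim_inverse_at_infinity])
  then show ?thesis
    by (rule filterlim_mono_eventually[OF _ order_refl order_refl]) (auto simp: eventually_at_filter)
qed

lemma deriv_H:
  assumes "zeta \<in> ball 0 1 - {0}"
  shows "deriv H zeta = psi zeta + zeta * deriv psi zeta"
proof -
  have d: "(psi has_field_derivative deriv psi zeta) (at zeta)"
    by (rule holomorphic_derivI[OF psi_hol _ assms]) auto
  have "((\<lambda>zeta. zeta * psi zeta) has_field_derivative psi zeta + zeta * deriv psi zeta) (at zeta)"
    by (rule derivative_eq_intros d refl)+ simp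
  then have "(H has_field_derivative psi zeta + zeta * deriv psi zeta) (at zeta)"
    by (rule has_field_derivative_transform_within_open[where S = "ball 0 1 - {0}"]) (use assms in \<open>auto simp: H_def\<close>)
  then show ?thesis by (rule DERIV_imp_deriv)
qed

text \<open>For nonzero \<open>zeta\<close> this is
  \<open>- (zeta * deriv psi zeta) / (psi zeta - z)\<close>, the Cauchy kernel of the exterior curve
  in the disk coordinate. The form through \<open>H\<close> shows that it extends holomorphically to
  \<open>0\<close> with value one.\<close>

definition cauchy_kernel :: "complex \<Rightarrow> complex \<Rightarrow> complex" where
  "cauchy_kernel z zeta = 1 - zeta * (deriv H zeta - z) / (H zeta - z * zeta)"

lemma cauchy_kernel:
  assumes z: "z \<in> E"
  shows "cauchy_kernel z holomorphic_on ball 0 1" "cauchy_kernel z 0 = 1"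
    and "zeta \<in> ball 0 1 - {0} \<Longrightarrow> cauchy_kernel z zeta = - (zeta * deriv psi zeta) / (psi zeta - z)"
proof -
  have ne: "psi zeta \<noteq> z" if "zeta \<in> ball 0 1 - {0}" for zeta using psi_in[OF that] z by auto
  have Hz: "H zeta - z * zeta = zeta * (psi zeta - z)" if "zeta \<noteq> 0" for zeta using that by (simp add: H_def algebra_simps)
  have "H zeta - z * zeta \<noteq> 0" if "zeta \<in> ball 0 1" for zeta
  proof (cases "zeta = 0")
    case True then show ?thesis using c_nonzero by (simp add: H_def)
  next
    case False then show ?thesis using Hz[OF False] ne[of zeta] that by auto
  qed
  then show "cauchy_kernel z holomorphic_on ball 0 1"
    unfolding cauchy_kernel_def by (intro holomorphic_intros H_hol holomorphic_deriv[OF H_hol]) auto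
  show "cauchy_kernel z 0 = 1" by (simp add: cauchy_kernel_def)
  assume zeta: "zeta \<in> ball 0 1 - {0}"
  then show "cauchy_kernel z zeta = - (zeta * deriv psi zeta) / (psi zeta - z)"
    using ne[OF zeta] Hz[of zeta] deriv_H[OF zeta] by (simp add: cauchy_kernel_def field_simps)
qed

text \<open>\<open>inverse (kap z)\<close> is the exterior map up to a unimodular factor, so the
  notion also applies to a conformal map without normalization.\<close>

definition faber_like :: "nat \<Rightarrow> complex poly \<Rightarrow> bool" where
  "faber_like k F \<longleftrightarrow> ((\<lambda>z. inverse (kap z) ^ k - poly F z) \<longlongrightarrow> 0) at_infinity"

lemma faber_remainder:
  assumes F: "faber_like k F"
  obtains D where "D holomorphic_on ball 0 1" "D 0 = 0" "\<And>zeta. zeta \<in> ball 0 1 - {0} \<Longrightarrow> poly F (psi zeta) = inverse zeta ^ k - D zeta"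
proof -
  have h: "(\<lambda>zeta. inverse zeta ^ k - poly F (psi zeta)) holomorphic_on (ball 0 1 - {0})"
    by (intro holomorphic_intros psi_hol) auto
  have "((\<lambda>zeta. inverse (kap (psi zeta)) ^ k - poly F (psi zeta)) \<longlongrightarrow> 0) (at 0)"
    using filterlim_compose[OF F[unfolded faber_like_def] psi_infinity] .
  moreover have "\<forall>\<^sub>F zeta in at 0. zeta \<in> ball (0::complex) 1 - {0}"
    unfolding eventually_at_topological by (intro exI[of _ "ball 0 1"]) auto
  then have "\<forall>\<^sub>F zeta in at 0. inverse (kap (psi zeta)) ^ k - poly F (psi zeta) = inverse zeta ^ k - poly F (psi zeta)"
    by eventually_elim (simp add: kappa_psi)
  ultimately have "((\<lambda>zeta. inverse zeta ^ k - poly F (psi zeta)) \<longlongrightarrow> 0) (at 0)" by (rule Lim_transform_eventually)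
  from holomorphic_removable[OF h this] show ?thesis by (rule that) auto
qed

text \<open>Cauchy's formula without winding numbers. When the polynomial is written as its value at
  \<open>z\<close> plus \<open>psi - z\<close> times a quotient, the quotient part is the derivative
  of a polynomial in \<open>psi\<close> and has mean zero, while the kernel has mean one. The
  remainder \<open>D\<close> of the expansion contributes its value at the origin, which is
  zero.\<close>

lemma faber_integral:
  assumes F: "faber_like k F" and z: "z \<in> E" and rho: "0 < rho" "rho < 1"
  shows "poly F z = (LINT x|uI. inverse (circ rho x) ^ k * cauchy_kernel z (circ rho x))"
proof -
  obtain D where D: "D holomorphic_on ball 0 1" "D 0 = 0" "\<And>zeta. zeta \<in> ball 0 1 - {0} \<Longrightarrow> poly F (psi zeta) = inverse zeta ^ k - D zeta"
    by (rule faber_remainder[OF F]) blast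
  let ?e = "\<lambda>x. circ rho x"
  let ?\<Lambda> = "cauchy_kernel z"
  note K = cauchy_kernel[OF z]
  have inb: "?e x \<in> ball 0 1 - {0}" for x using rho by (simp add: norm_mult)
  have sub: "sphere 0 rho \<subseteq> ball 0 1 - {0}" using rho by auto
  have co: "continuous_on (sphere 0 rho) f" if "f holomorphic_on (ball 0 1 - {0})" for f :: "complex \<Rightarrow> complex"
    using holomorphic_on_imp_continuous_on[OF that] sub by (rule continuous_on_subset)
  have ci: "integrable uI (\<lambda>x. f (?e x))" if "f holomorphic_on (ball 0 1 - {0})" for f :: "complex \<Rightarrow> complex"
    using integrable_circle[OF co[OF that]] rho by simp
  have Kh: "?\<Lambda> holomorphic_on (ball 0 1 - {0})" by (rule holomorphic_on_subset[OF K(1)]) auto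
  have Dh: "D holomorphic_on (ball 0 1 - {0})" by (rule holomorphic_on_subset[OF D(1)]) auto
  define q where "q = synthetic_div F z"
  obtain Q where Q: "pderiv Q = q" by (rule poly_antiderivative)
  have Fq: "poly F w = poly F z + (w - z) * poly q w" for w
  proof -
    have "poly F w = poly ([:- z, 1:] * q + [:poly F z:]) w" unfolding q_def synthetic_div_correct' ..
    then show ?thesis by (simp add: left_diff_distrib)
  qed
  have dpsi: "(psi has_field_derivative deriv psi zeta) (at zeta)" if "zeta \<in> ball 0 1 - {0}" for zeta
    by (rule holomorphic_derivI[OF psi_hol _ that]) auto
  have ann: "annulus 0 1 = ball 0 1 - {0}" by (auto simp: annulus_def)
  have QH: "(\<lambda>zeta. poly Q (psi zeta)) holomorphic_on annulus 0 1" unfolding ann by (intro holomorphic_intros psi_hol)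
  have dQ: "deriv (\<lambda>zeta. poly Q (psi zeta)) zeta = poly q (psi zeta) * deriv psi zeta" if "zeta \<in> ball 0 1 - {0}" for zeta
  proof (rule DERIV_imp_deriv)
    show "((\<lambda>zeta. poly Q (psi zeta)) has_field_derivative poly q (psi zeta) * deriv psi zeta) (at zeta)"
      using DERIV_chain2[OF poly_DERIV[of Q "psi zeta"] dpsi[OF that]] Q by simp
  qed
  have m1: "(LINT x|uI. ?e x * (poly q (psi (?e x)) * deriv psi (?e x))) = 0"
    using mean_deriv_zero[OF QH, of rho] rho dQ[OF inb] by simp
  have m2: "(LINT x|uI. ?\<Lambda> (?e x)) = 1"
    using mean_holomorphic[OF K(1), of rho] rho K(2) by simp
  have m3: "(LINT x|uI. D (?e x) * ?\<Lambda> (?e x)) = 0"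
    using mean_holomorphic[OF holomorphic_on_mult[OF D(1) K(1)], of rho] rho D(2) by simp
  have i1: "integrable uI (\<lambda>x. ?e x * (poly q (psi (?e x)) * deriv psi (?e x)))"
    by (rule ci[of "\<lambda>zeta. zeta * (poly q (psi zeta) * deriv psi zeta)"]) (intro holomorphic_intros psi_hol holomorphic_deriv, auto)
  have i2: "integrable uI (\<lambda>x. ?\<Lambda> (?e x))" by (rule ci[OF Kh])
  have i3: "integrable uI (\<lambda>x. D (?e x) * ?\<Lambda> (?e x))"
    by (rule ci[of "\<lambda>zeta. D zeta * ?\<Lambda> zeta"]) (intro holomorphic_intros Kh Dh)
  have i4: "integrable uI (\<lambda>x. inverse (?e x) ^ k * ?\<Lambda> (?e x))"
    by (rule ci[of "\<lambda>zeta. inverse zeta ^ k * ?\<Lambda> zeta"]) (intro holomorphic_intros Kh, auto)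
  have pt: "poly F z * ?\<Lambda> (?e x) - ?e x * (poly q (psi (?e x)) * deriv psi (?e x)) = inverse (?e x) ^ k * ?\<Lambda> (?e x) - D (?e x) * ?\<Lambda> (?e x)" for x
  proof -
    have ne: "psi (?e x) - z \<noteq> 0" using psi_in[OF inb[of x]] z by auto
    have "poly F (psi (?e x)) * ?\<Lambda> (?e x) = poly F z * ?\<Lambda> (?e x) + poly q (psi (?e x)) * ((psi (?e x) - z) * ?\<Lambda> (?e x))"
      by (subst Fq) (simp add: algebra_simps)
    also have "(psi (?e x) - z) * ?\<Lambda> (?e x) = - (?e x * deriv psi (?e x))"
      using ne by (simp add: K(3)[OF inb])
    finally show ?thesis using D(3)[OF inb[of x]] by (simp add: algebra_simps)
  qed
  have "(LINT x|uI. poly F z * ?\<Lambda> (?e x) - ?e x * (poly q (psi (?e x)) * deriv psi (?e x))) = poly F z * 1 - 0"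
    unfolding Bochner_Integration.integral_diff[OF integrable_mult_right[OF i2] i1] m1 integral_mult_right_zero m2 ..
  moreover have "(LINT x|uI. inverse (?e x) ^ k * ?\<Lambda> (?e x) - D (?e x) * ?\<Lambda> (?e x)) = (LINT x|uI. inverse (?e x) ^ k * ?\<Lambda> (?e x)) - 0"
    unfolding Bochner_Integration.integral_diff[OF i4 i3] m3 ..
  ultimately show ?thesis unfolding pt by simp
qed

text \<open>The image of the circle under \<open>psi\<close> keeps a positive distance from
  \<open>E\<close>, which makes the constant uniform in \<open>z\<close> and \<open>k\<close>. Any
  radius below one is allowed, so letting \<open>rho\<close> tend to one gives subexponential growth
  on \<open>E\<close>.\<close>

lemma faber_bound:
  assumes rho: "0 < rho" "rho < 1"
  obtains C where "0 \<le> C" "\<And>k F z. faber_like k F \<Longrightarrow> z \<in> E \<Longrightarrow> cmod (poly F z) \<le> C * inverse rho ^ k"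
proof -
  have sub: "sphere 0 rho \<subseteq> ball 0 1 - {0}" using rho by auto
  have cp: "compact (psi ` sphere 0 rho)"
    by (intro compact_continuous_image holomorphic_continuous[OF psi_hol sub]) auto
  have "psi ` sphere 0 rho \<inter> E = {}" using psi_in sub by blast
  then obtain d where d: "0 < d" "\<And>x y. x \<in> psi ` sphere 0 rho \<Longrightarrow> y \<in> E \<Longrightarrow> d \<le> dist x y"
    using separate_compact_closed[OF cp compact_imp_closed[OF compact_E]] by blast
  have "deriv psi holomorphic_on (ball 0 1 - {0})" by (intro holomorphic_deriv psi_hol) auto
  from compact_norm_bound[OF compact_sphere holomorphic_continuous[OF this sub]]
  obtain B where B: "\<And>zeta. zeta \<in> sphere 0 rho \<Longrightarrow> cmod (deriv psi zeta) \<le> B" by blast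
  have e: "circ rho x \<in> sphere 0 rho" for x using rho by (simp add: norm_mult)
  have B0: "0 \<le> B" using B[OF e[of 0]] norm_ge_zero order_trans by blast
  have "cmod (poly F z) \<le> rho * B / d * inverse rho ^ k" if F: "faber_like k F" and z: "z \<in> E" for k F z
  proof -
    let ?f = "\<lambda>x. inverse (circ rho x) ^ k * cauchy_kernel z (circ rho x)"
    have bd: "cmod (?f x) \<le> rho * B / d * inverse rho ^ k" for x
    proof -
      have inb: "circ rho x \<in> ball 0 1 - {0}" using e sub by blast
      have "cmod (cauchy_kernel z (circ rho x)) = rho * cmod (deriv psi (circ rho x)) / cmod (psi (circ rho x) - z)"
        using rho by (simp add: cauchy_kernel(3)[OF z inb] norm_divide norm_mult)
      also have "\<dots> \<le> rho * B / d"
        using rho B[OF e] B0 d(1) d(2)[OF imageI[OF e] z] by (intro frac_le mult_left_mono) (auto simp: dist_norm)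
      finally have "cmod (cauchy_kernel z (circ rho x)) \<le> rho * B / d" .
      then have "inverse rho ^ k * cmod (cauchy_kernel z (circ rho x)) \<le> inverse rho ^ k * (rho * B / d)"
        using rho by (intro mult_left_mono) auto
      then show ?thesis using rho by (simp add: norm_mult norm_power norm_inverse mult.commute)
    qed
    have i: "integrable uI ?f"
    proof -
      have "continuous_on (sphere 0 rho) (\<lambda>zeta. inverse zeta ^ k * cauchy_kernel z zeta)"
        by (intro continuous_intros holomorphic_continuous[OF cauchy_kernel(1)[OF z]]) (use rho in auto)
      from integrable_circle[OF this] show ?thesis using rho by simp
    qed
    have "cmod (poly F z) \<le> (LINT x|uI. cmod (?f x))"
      unfolding faber_integral[OF F z rho] by (rule integral_norm_bound)
    also have "\<dots> \<le> (LINT x|uI. rho * B / d * inverse rho ^ k)"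
      using i bd by (intro integral_mono) auto
    finally show ?thesis using uI.prob_space by simp
  qed
  then show ?thesis using that[of "rho * B / d"] rho B0 d by auto
qed

text \<open>In the variable \<open>t = 1 / z\<close> the power of the exterior map is
  \<open>inverse t ^ k\<close> times a holomorphic function. Its Taylor polynomial of degree
  \<open>k\<close>, with the coefficients read in reverse, is the polynomial part.\<close>

lemma faber_exists:
  obtains F where "faber_like k F" "degree F = k" "lead_coeff F = inverse c ^ k"
proof -
  obtain T where T: "0 < T" "\<And>z. T < cmod z \<Longrightarrow> z \<notin> E \<and> cmod (kap z) < 1" by (rule kappa_small[of 1]) auto
  define e where "e t = (if t = 0 then c else kap (inverse t) / t)" for t
  have out: "inverse t \<notin> E" if "t \<in> ball 0 (1 / T) - {0}" for t
  proof -
    have "inverse (1 / T) < inverse (cmod t)" using that T by (intro less_imp_inverse_less) auto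
    then show ?thesis using T(2)[of "inverse t"] by (simp add: norm_inverse)
  qed
  have eh: "e holomorphic_on ball 0 (1 / T)"
  proof -
    have "(\<lambda>t. kap (inverse t)) holomorphic_on (ball 0 (1 / T) - {0})"
      by (rule holomorphic_on_compose_gen[OF _ kappa_hol, unfolded o_def]) (use out in \<open>auto intro!: holomorphic_intros\<close>)
    then have "(\<lambda>t. kap (inverse t) / t) holomorphic_on (ball 0 (1 / T) - {0})" by (intro holomorphic_intros) auto
    moreover have "((\<lambda>t. kap (inverse t) / t) \<longlongrightarrow> c) (at 0)"
      using kappa_asymp unfolding lim_at_infinity_0 by (simp add: o_def divide_inverse mult.commute)
    ultimately show ?thesis unfolding e_def[abs_def] by (rule holomorphic_removable)
  qed
  have enz: "e t \<noteq> 0" if "t \<in> ball 0 (1 / T)" for t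
    using c_nonzero kappa_bounds(1)[OF out[of t]] that by (auto simp: e_def)
  have ah: "(\<lambda>t. inverse (e t) ^ k) holomorphic_on ball 0 (1 / T)"
    by (intro holomorphic_intros eh enz)
  obtain q b where q: "degree q \<le> k" "coeff q 0 = inverse (e 0) ^ k" "b holomorphic_on ball 0 (1 / T)"
    "\<And>t. t \<in> ball 0 (1 / T) \<Longrightarrow> inverse (e t) ^ k = poly q t + t ^ Suc k * b t"
    using taylor_poly[OF ah, of k] T by auto
  define F where "F = (\<Sum>j\<le>k. monom (coeff q j) (k - j))"
  have Ft: "poly F (inverse t) = inverse t ^ k * poly q t" if "t \<noteq> 0" for t
  proof -
    have "inverse t ^ (k - j) = inverse t ^ k * t ^ j" if "j \<le> k" for j
    proof -
      have "inverse t ^ k = inverse t ^ (k - j) * inverse t ^ j" using that by (simp flip: power_add)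
      then show ?thesis using \<open>t \<noteq> 0\<close> by (simp add: power_inverse)
    qed
    moreover have "poly q t = (\<Sum>j\<le>k. coeff q j * t ^ j)"
      unfolding poly_altdef by (rule sum.mono_neutral_left) (use q(1) in \<open>auto simp: coeff_eq_0\<close>)
    ultimately show ?thesis
      unfolding F_def poly_sum poly_monom by (simp add: sum_distrib_left mult_ac)
  qed
  have cF: "coeff F k = inverse c ^ k"
  proof -
    have "coeff F k = (\<Sum>j\<le>k. if k - j = k then coeff q j else 0)"
      unfolding F_def coeff_sum coeff_monom ..
    also have "\<dots> = (\<Sum>j\<in>{0}. if k - j = k then coeff q j else 0)"
      by (rule sum.mono_neutral_right) auto
    finally show ?thesis using q(2) by (simp add: e_def)
  qed
  have degF: "degree F = k"
  proof (rule antisym)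
    show "degree F \<le> k" unfolding F_def by (rule degree_sum_le) (auto intro!: order_trans[OF degree_monom_le])
    show "k \<le> degree F" by (rule le_degree) (use cF c_nonzero in simp)
  qed
  have "((\<lambda>t. t * b t) \<longlongrightarrow> 0 * b 0) (at 0)"
  proof (intro tendsto_intros)
    have "isCont b 0" using continuous_on_eq_continuous_at[OF open_ball, of 0 "1 / T" b] holomorphic_on_imp_continuous_on[OF q(3)] T by simp
    then show "(b \<longlongrightarrow> b 0) (at 0)" by (simp add: isCont_def)
  qed
  then have tb: "((\<lambda>t. t * b t) \<longlongrightarrow> 0) (at 0)" by simp
  have "((\<lambda>t. inverse (kap (inverse t)) ^ k - poly F (inverse t)) \<longlongrightarrow> 0) (at 0)"
  proof (rule Lim_transform_eventually[OF tb])
    have "\<forall>\<^sub>F t in at 0. t \<in> ball (0::complex) (1 / T) - {0}"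
      unfolding eventually_at_topological using T by (intro exI[of _ "ball 0 (1 / T)"]) auto
    then show "\<forall>\<^sub>F t in at 0. t * b t = inverse (kap (inverse t)) ^ k - poly F (inverse t)"
    proof eventually_elim
      case (elim t)
      then have t: "t \<in> ball 0 (1 / T)" "t \<noteq> 0" by auto
      have "kap (inverse t) = t * e t" using t by (simp add: e_def)
      then have "inverse (kap (inverse t)) ^ k = inverse t ^ k * inverse (e t) ^ k" by (simp add: power_mult_distrib)
      also have "\<dots> = inverse t ^ k * poly q t + inverse t ^ k * t ^ k * (t * b t)"
        unfolding q(4)[OF t(1)] by (simp add: algebra_simps)
      also have "inverse t ^ k * t ^ k = 1" using t by (simp flip: power_mult_distrib)
      finally show ?case using Ft[OF t(2)] by simp
    qed
  qed
  then have "faber_like k F" unfolding faber_like_def lim_at_infinity_0 by (simp add: o_def)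
  then show ?thesis using that degF cF by simp
qed

lemma faber_unique:
  assumes "faber_like k F" "faber_like k G"
  shows "F = G"
proof -
  have "((\<lambda>z. (inverse (kap z) ^ k - poly F z) - (inverse (kap z) ^ k - poly G z)) \<longlongrightarrow> 0 - 0) at_infinity"
    using assms unfolding faber_like_def by (intro tendsto_diff)
  then have "((\<lambda>z. poly (G - F) z) \<longlongrightarrow> 0) at_infinity" by simp
  then have "poly (G - F) z = 0" for z
    by (intro Liouville_weak_0) (auto intro!: holomorphic_intros)
  then have "G - F = 0" by (metis poly_all_0_iff_0)
  then show ?thesis by simp
qed

end

section \<open>Admissible bases\<close>

context oriented_jordan
begin

lemma sphere_annulus: "sphere 0 1 \<subseteq> collar"
  using r0 by (auto simp: annulus_def)

lemma h_continuous: "continuous_on (collar) h"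
  by (rule holomorphic_on_imp_continuous_on[OF h_hol])

lemma frontier_E: "frontier E = h ` sphere 0 1"
  unfolding frontier_def closure_closed[OF compact_imp_closed[OF compact_E]] using h_circle by blast

lemma circle_in_E: "cmod u = 1 \<Longrightarrow> h u \<in> E"
  by (subst h_circle(1)) auto

lemma poly_max_boundary:
  fixes p :: "complex poly"
  assumes "\<And>u. cmod u = 1 \<Longrightarrow> cmod (poly p (h u)) \<le> m" "z \<in> E"
  shows "cmod (poly p z) \<le> m"
proof (rule maximum_modulus_frontier[of "poly p" E])
  show "bounded E" by (rule compact_imp_bounded[OF compact_E])
  show "cmod (poly p w) \<le> m" if "w \<in> frontier E" for w using that assms(1) by (auto simp: frontier_E)
qed (auto intro!: holomorphic_intros continuous_intros assms(2))

lemma green_collar: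
  assumes "0 < eps"
  obtains sig where "1 < sig" "sig < 1 / r0" "\<And>u. cmod u = sig \<Longrightarrow> green (h u) < eps"
proof -
  define U where "U = {u \<in> collar. green (h u) < eps}"
  have "continuous_on (collar) (\<lambda>u. green (h u))"
    by (rule continuous_on_compose2[OF green_continuous h_continuous]) auto
  then have "open (collar \<inter> (\<lambda>u. green (h u)) -` {..<eps})"
    by (rule continuous_open_preimage) (auto intro: open_annulus)
  moreover have "collar \<inter> (\<lambda>u. green (h u)) -` {..<eps} = U" by (auto simp: U_def)
  ultimately have "open U" by simp
  moreover have "sphere 0 1 \<subseteq> U"
    using sphere_annulus circle_in_E assms by (auto simp: U_def green_def)
  ultimately obtain dlt where dlt: "0 < dlt" "dlt < 1" "\<And>u. \<bar>cmod u - 1\<bar> < dlt \<Longrightarrow> u \<in> U"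
    by (rule thin_collar) blast
  have "1 + dlt / 2 < 1 / r0"
    using dlt(3)[of "of_real (1 + dlt / 2)"] dlt(1) by (simp add: U_def annulus_def del: of_real_add of_real_divide)
  moreover have "green (h u) < eps" if "cmod u = 1 + dlt / 2" for u using dlt(3)[of u] that dlt(1) by (simp add: U_def)
  ultimately show ?thesis using that[of "1 + dlt / 2"] dlt(1) by simp
qed

text \<open>A three circles argument in the collar: Bernstein--Walsh controls the outer circle in terms of
  the maximum on the curve, so that the interior bound on the inner circle wins.\<close>

lemma subexponential_on_E:
  assumes deg: "\<And>k. degree (B k) \<le> k"
    and int: "\<And>K. compact K \<Longrightarrow> K \<subseteq> interior E \<Longrightarrow> \<exists>C. \<forall>k. \<forall>z\<in>K. cmod (poly (B k) z) \<le> C"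
    and eps: "0 < eps"
  shows "\<exists>C>0. \<forall>k. \<forall>z\<in>E. cmod (poly (B k) z) \<le> C * exp (eps * real k)"
proof -
  obtain sig where sig: "1 < sig" "sig < 1 / r0" "\<And>u. cmod u = sig \<Longrightarrow> green (h u) < eps" by (rule green_collar[OF eps]) blast
  have rsig: "r0 < 1 / sig" using sig r0 by (simp add: field_simps)
  have isig: "1 / sig < 1" using sig by simp
  have subin: "sphere 0 (1 / sig) \<subseteq> collar" proof -
    have "1 / sig < 1 / r0" using isig sig by linarith
    then show ?thesis using rsig by (auto simp: annulus_def)
  qed
  have "compact (h ` sphere 0 (1 / sig))" by (intro compact_continuous_image continuous_on_subset[OF h_continuous subin]) auto
  moreover have "h ` sphere 0 (1 / sig) \<subseteq> interior E" using h_inner rsig isig by auto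
  ultimately have "\<exists>C. \<forall>k. \<forall>z\<in>h ` sphere 0 (1 / sig). cmod (poly (B k) z) \<le> C" by (rule int)
  then obtain C where C: "\<And>k z. z \<in> h ` sphere 0 (1 / sig) \<Longrightarrow> cmod (poly (B k) z) \<le> C" by blast
  define C0 where "C0 = max C 1"
  have C0: "cmod (poly (B k) (h u)) \<le> C0" if "cmod u = 1 / sig" for k u
    using C[of "h u" k] that by (auto simp: C0_def)
  have C0p: "1 \<le> C0" by (simp add: C0_def)
  have "cmod (poly (B k) z) \<le> C0 * sig * exp 1 * exp (eps * real k)" if z: "z \<in> E" for k z
  proof -
    have cont1: "continuous_on (sphere 0 1) (\<lambda>u. cmod (poly (B k) (h u)))"
      by (intro continuous_intros continuous_on_subset[OF h_continuous sphere_annulus])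
    obtain u0 where u0: "cmod u0 = 1" and u0m: "\<And>u. cmod u = 1 \<Longrightarrow> cmod (poly (B k) (h u)) \<le> cmod (poly (B k) (h u0))"
      using continuous_attains_sup[OF _ _ cont1] by (auto simp: sphere_eq_empty)
    define m where "m = cmod (poly (B k) (h u0))"
    have mE: "cmod (poly (B k) w) \<le> m" if "w \<in> E" for w
      by (rule poly_max_boundary[OF _ that]) (simp add: m_def u0m)
    \<comment> \<open>With this \<open>N\<close> the outer circle contributes at most
      \<open>m / exp 1\<close>, which is less than a positive \<open>m\<close>; the bound from the
      inner circle must then prevail, and \<open>sig ^ N\<close> is still only of order
      \<open>exp (eps * real k)\<close>.\<close>
    define N where "N = nat \<lceil>(eps * real k + 1) / ln sig\<rceil>"
    have ls: "0 < ln sig" using sig by simp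
    have N1: "eps * real k + 1 \<le> real N * ln sig"
    proof -
      have "(eps * real k + 1) / ln sig \<le> real N" unfolding N_def by linarith
      then show ?thesis using ls by (simp add: field_simps)
    qed
    have N2: "real N * ln sig \<le> eps * real k + 1 + ln sig"
    proof -
      have "0 \<le> (eps * real k + 1) / ln sig" using eps ls by simp
      then have "real N \<le> (eps * real k + 1) / ln sig + 1" unfolding N_def by linarith
      then show ?thesis using ls by (simp add: field_simps)
    qed
    have sigN: "sig ^ N = exp (real N * ln sig)" using sig by (simp add: exp_of_nat_mult)
    define S where "S = cball 0 sig - ball (0::complex) (1 / sig)"
    have Ssub: "S \<subseteq> collar" using rsig sig by (auto simp: S_def annulus_def)
    have S0: "u \<noteq> 0" if "u \<in> S" for u using that sig by (auto simp: S_def)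
    have cl: "closed S" unfolding S_def by (intro closed_Diff) auto
    have intS: "interior S \<subseteq> ball 0 sig - cball 0 (1 / sig)"
    proof -
      have "interior S = interior (cball 0 sig) - closure (ball 0 (1 / sig))"
        unfolding S_def by (simp only: interior_diff)
      then show ?thesis using sig by simp
    qed
    have frS: "frontier S \<subseteq> sphere 0 sig \<union> sphere 0 (1 / sig)"
    proof -
      have "ball 0 sig - cball 0 (1 / sig) \<subseteq> interior S"
        by (rule interior_maximal) (auto simp: S_def)
      then have "frontier S \<subseteq> S - (ball 0 sig - cball 0 (1 / sig))" unfolding frontier_def closure_closed[OF cl] by blast
      then show ?thesis unfolding S_def by force
    qed
    let ?f = "\<lambda>u. poly (B k) (h u) / u ^ N"
    have bound: "cmod (?f u0) \<le> max (m * exp (eps * real k) / sig ^ N) (C0 * sig ^ N)"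
    proof (rule maximum_modulus_frontier[of ?f S])
      show "?f holomorphic_on interior S"
        by (intro holomorphic_intros holomorphic_on_subset[OF h_hol]) (use Ssub interior_subset[of S] S0 in auto)
      show "continuous_on (closure S) ?f" unfolding closure_closed[OF cl]
        by (intro continuous_intros continuous_on_subset[OF h_continuous Ssub]) (use S0 in auto)
      show "bounded S" unfolding S_def by (rule bounded_subset[of "cball 0 sig"]) auto
      show "u0 \<in> S" using u0 sig isig by (simp add: S_def)
      fix u assume "u \<in> frontier S"
      then consider "cmod u = sig" | "cmod u = 1 / sig" using frS by auto
      then show "cmod (?f u) \<le> max (m * exp (eps * real k) / sig ^ N) (C0 * sig ^ N)"
      proof cases
        case 1
        have "cmod (poly (B k) (h u)) \<le> m * exp (real (degree (B k)) * green (h u))"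
          by (rule bernstein_walsh[OF mE]) (auto simp: m_def)
        also have "\<dots> \<le> m * exp (eps * real k)"
          using mult_mono[of "real (degree (B k))" "real k" "green (h u)" eps] deg[of k] sig(3)[OF 1] green_nonneg[of "h u"] eps
          by (intro mult_left_mono) (auto simp: m_def mult.commute)
        finally have "cmod (?f u) \<le> m * exp (eps * real k) / sig ^ N"
          using 1 sig by (simp add: norm_divide norm_power divide_right_mono)
        then show ?thesis by simp
      next
        case 2
        have "cmod (?f u) = cmod (poly (B k) (h u)) * sig ^ N" using 2 sig by (simp add: norm_divide norm_power power_divide)
        also have "\<dots> \<le> C0 * sig ^ N" using C0[OF 2] sig by (intro mult_right_mono) auto
        finally show ?thesis by simp
      qed
    qed
    have "exp (eps * real k) * exp 1 \<le> sig ^ N" unfolding sigN using N1 by (simp flip: exp_add)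
    then have "exp (eps * real k) / sig ^ N \<le> 1 / exp 1" using sig by (simp add: field_simps)
    then have "m * exp (eps * real k) / sig ^ N \<le> m * (1 / exp 1)"
      using mult_left_mono[of "exp (eps * real k) / sig ^ N" "1 / exp 1" m] by (simp add: m_def)
    moreover have "cmod (?f u0) = m" using u0 by (simp add: m_def norm_divide norm_power)
    moreover have "m * (1 / exp 1) < m" if "0 < m" using that by (simp add: field_simps)
    moreover have "0 \<le> m" by (simp add: m_def)
    ultimately have "m \<le> C0 * sig ^ N"
    proof -
      have "0 \<le> C0 * sig ^ N" using C0p sig by simp
      then show ?thesis using bound \<open>m * exp (eps * real k) / sig ^ N \<le> m * (1 / exp 1)\<close> \<open>cmod (?f u0) = m\<close>
          \<open>0 < m \<Longrightarrow> m * (1 / exp 1) < m\<close> \<open>0 \<le> m\<close> by linarith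
    qed
    also have "\<dots> \<le> C0 * exp (eps * real k + 1 + ln sig)" unfolding sigN using N2 C0p by (intro mult_left_mono) auto
    also have "\<dots> = C0 * sig * exp 1 * exp (eps * real k)" using sig by (simp add: exp_add)
    finally show ?thesis using mE[OF z] by linarith
  qed
  then show ?thesis using C0p sig by (intro exI[of _ "C0 * sig * exp 1"]) auto
qed

text \<open>What the three bases have in common. The last clause keeps the random polynomials from
  being uniformly small inside: \<open>a 0\<close> does not change with \<open>n\<close>, so each of
  them exceeds a fixed constant somewhere on \<open>K\<close>.\<close>

definition admissible :: "(nat \<Rightarrow> complex poly) \<Rightarrow> bool" where
  "admissible B \<longleftrightarrow> (\<forall>k. degree (B k) = k)
    \<and> (\<forall>eps>0. \<exists>C>0. \<forall>k. \<forall>z\<in>E. cmod (poly (B k) z) \<le> C * exp (eps * real k))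
    \<and> (\<forall>eps>0. \<exists>C>0. \<forall>k. 1 \<le> C * exp (eps * real k) * cmod c ^ k * cmod (lead_coeff (B k)))
    \<and> (\<exists>K C. compact K \<and> K \<subseteq> interior E \<and> 0 < C \<and>
        (\<forall>a n m. (\<forall>z\<in>K. cmod (poly (\<Sum>k\<le>n. smult (a k) (B k)) z) \<le> m) \<longrightarrow> cmod (a 0) \<le> C * m))"

end

lemma poly_basis_expansion:
  fixes B :: "nat \<Rightarrow> complex poly"
  assumes B: "\<And>k. degree (B k) = k" "\<And>k. B k \<noteq> 0" and F: "degree F \<le> k"
  shows "\<exists>a. F = (\<Sum>j\<le>k. smult (a j) (B j)) \<and> coeff F k = a k * lead_coeff (B k)"
  using F
proof (induction k arbitrary: F)
  case 0
  obtain b where b: "B 0 = [:b:]" using B(1)[of 0] by (metis degree_eq_zeroE)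
  obtain f where f: "F = [:f:]" using 0 by (metis degree_eq_zeroE le_zero_eq)
  have "b \<noteq> 0" using B(2)[of 0] b by simp
  then show ?case using b f by (intro exI[of _ "\<lambda>_. f / b"]) auto
next
  case (Suc k)
  have nz: "coeff (B (Suc k)) (Suc k) \<noteq> 0" using B[of "Suc k"] by (metis leading_coeff_0_iff)
  define t where "t = coeff F (Suc k) / coeff (B (Suc k)) (Suc k)"
  have "degree (F - smult t (B (Suc k))) \<le> Suc k"
    using Suc.prems B(1)[of "Suc k"] by (intro degree_diff_le) (auto intro: order_trans[OF degree_smult_le])
  moreover have "coeff (F - smult t (B (Suc k))) (Suc k) = 0" using nz by (simp add: t_def)
  ultimately have "degree (F - smult t (B (Suc k))) \<le> k"
    by (metis Suc_le_eq degree_0 le_degree le_less_Suc_eq leading_coeff_0_iff le0 not_less_eq_eq order_le_less)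
  then obtain a where a: "F - smult t (B (Suc k)) = (\<Sum>j\<le>k. smult (a j) (B j))" using Suc.IH by blast
  have "(\<Sum>j\<le>Suc k. smult ((a(Suc k := t)) j) (B j)) = (\<Sum>j\<le>k. smult (a j) (B j)) + smult t (B (Suc k))"
    by simp
  also have "\<dots> = F" unfolding a[symmetric] by simp
  finally show ?case using nz B(1)[of "Suc k"]
    by (intro exI[of _ "a(Suc k := t)"]) (simp add: t_def)
qed

context oriented_jordan
begin

text \<open>Arclength and area are treated at once. Unit L2 norm and finite mass bound the L1 norms,
  so \<open>int\<close> bounds the polynomials on interior compact sets and
  \<open>subexponential_on_E\<close> extends this to \<open>E\<close>. Pairing with the constant
  \<open>B 0\<close> expresses \<open>a 0\<close> by an integral, to which \<open>mean\<close>
  applies.\<close>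

lemma orthonormal_admissible:
  fixes nu :: "complex measure"
  assumes fin: "finite_measure nu" and sets: "sets nu = sets borel" and supp: "AE z in nu. z \<in> E"
    and deg: "\<And>k. degree (B k) = k"
    and orth: "\<And>j k. (LINT z|nu. poly (B j) z * cnj (poly (B k) z)) = (if j = k then 1 else 0)"
    and int: "\<And>K. compact K \<Longrightarrow> K \<subseteq> interior E \<Longrightarrow> \<exists>C\<ge>0. \<forall>p. \<forall>z\<in>K. cmod (poly p z) \<le> C * (LINT z|nu. cmod (poly p z))"
    and mean: "\<exists>K C. compact K \<and> K \<subseteq> interior E \<and> 0 < C \<and> (\<forall>p m. (\<forall>z\<in>K. cmod (poly p z) \<le> m) \<longrightarrow> cmod (LINT z|nu. poly p z) \<le> C * m)"
  shows "admissible B"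
proof -
  interpret nu: finite_measure nu by (rule fin)
  note [measurable_cong] = sets
  have ib: "integrable nu f" if [measurable]: "f \<in> borel_measurable borel" and fb: "\<forall>z\<in>E. cmod (f z) \<le> bb" for f bb
    by (rule nu.integrable_const_bound[where B = bb]) (use supp fb in \<open>auto elim: eventually_mono\<close>)
  have pb: "\<exists>b\<ge>0. \<forall>z\<in>E. cmod (poly p z) \<le> b" for p
  proof -
    have "compact (poly p ` E)" by (intro compact_continuous_image compact_E continuous_intros)
    then obtain b where "\<And>z. z \<in> E \<Longrightarrow> cmod (poly p z) \<le> b" using compact_imp_bounded[of "poly p ` E"] unfolding bounded_iff by blast
    then show ?thesis by (intro exI[of _ "max 0 b"]) (auto simp: max.coboundedI2)
  qed
  have ipc: "integrable nu (\<lambda>z. poly p z * cnj (poly q z))" for p q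
  proof -
    obtain b1 b2 where "\<forall>z\<in>E. cmod (poly p z) \<le> b1" "\<forall>z\<in>E. cmod (poly q z) \<le> b2" "0 \<le> b1" using pb by metis
    then show ?thesis by (intro ib[where bb = "b1 * b2"] borel_measurable_continuous_onI continuous_intros) (auto simp: norm_mult intro!: mult_mono)
  qed
  have inp: "integrable nu (\<lambda>z. cmod (poly p z))" for p
  proof -
    obtain b1 where "\<forall>z\<in>E. cmod (poly p z) \<le> b1" using pb by metis
    then show ?thesis by (intro integrable_norm ib[where bb = b1]) auto
  qed
  have nz: "B k \<noteq> 0" for k using orth[of k k] by auto
  have coef: "(LINT z|nu. poly (\<Sum>j\<le>n. smult (a j) (B j)) z * cnj (poly (B i) z)) = (if i \<le> n then a i else 0)" for a n i
  proof -
    have "(LINT z|nu. poly (\<Sum>j\<le>n. smult (a j) (B j)) z * cnj (poly (B i) z)) = (LINT z|nu. (\<Sum>j\<le>n. a j * (poly (B j) z * cnj (poly (B i) z))))"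
      by (simp add: poly_sum sum_distrib_right mult.assoc)
    also have "\<dots> = (\<Sum>j\<le>n. LINT z|nu. a j * (poly (B j) z * cnj (poly (B i) z)))"
      using ipc by (intro Bochner_Integration.integral_sum) auto
    also have "\<dots> = (\<Sum>j\<le>n. if j = i then a i else 0)" by (intro sum.cong refl) (simp add: orth)
    finally show ?thesis by simp
  qed
  have l2: "(LINT z|nu. cmod (poly (B k) z)) \<le> (1 + measure nu (space nu)) / 2" for k
  proof -
    have isq: "integrable nu (\<lambda>z. (cmod (poly (B k) z))\<^sup>2)"
      using integrable_norm[OF ipc[of "B k" "B k"]] by (simp add: norm_mult power2_eq_square)
    have eq1: "(LINT z|nu. (cmod (poly (B k) z))\<^sup>2) = 1"
    proof -
      have "of_real (LINT z|nu. (cmod (poly (B k) z))\<^sup>2) = (LINT z|nu. complex_of_real ((cmod (poly (B k) z))\<^sup>2))"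
        using isq by (simp only: integral_complex_of_real)
      also have "\<dots> = 1" using orth[of k k] by (simp only: complex_norm_square) simp
      finally show ?thesis by (metis of_real_eq_1_iff)
    qed
    have "(LINT z|nu. cmod (poly (B k) z)) \<le> (LINT z|nu. (1 + (cmod (poly (B k) z))\<^sup>2) / 2)"
    proof (rule integral_mono[OF inp])
      show "integrable nu (\<lambda>z. (1 + (cmod (poly (B k) z))\<^sup>2) / 2)" using isq by auto
      show "cmod (poly (B k) z) \<le> (1 + (cmod (poly (B k) z))\<^sup>2) / 2" for z
        using zero_le_power2[of "cmod (poly (B k) z) - 1"] by (simp add: power2_diff)
    qed
    also have "\<dots> = (measure nu (space nu) + 1) / 2" using isq eq1 by simp
    finally show ?thesis by (simp add: add.commute)
  qed
  have up: "\<exists>C>0. \<forall>k. \<forall>z\<in>E. cmod (poly (B k) z) \<le> C * exp (eps * real k)" if eps: "0 < eps" for eps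
  proof (rule subexponential_on_E[OF _ _ eps])
    show "degree (B k) \<le> k" for k using deg by simp
    fix K assume K: "compact K" "K \<subseteq> interior E"
    obtain C where C: "0 \<le> C" "\<And>p z. z \<in> K \<Longrightarrow> cmod (poly p z) \<le> C * (LINT z|nu. cmod (poly p z))" using int[OF K] by blast
    have "cmod (poly (B k) z) \<le> C * ((1 + measure nu (space nu)) / 2)" if "z \<in> K" for k z
      using C(2)[OF that, of "B k"] mult_left_mono[OF l2[of k] C(1)] by linarith
    then show "\<exists>C. \<forall>k. \<forall>z\<in>K. cmod (poly (B k) z) \<le> C" by blast
  qed
  \<comment> \<open>Comparison with the Faber polynomial of degree \<open>k\<close>: its coefficient
    along \<open>B k\<close> is an inner product of two functions of subexponential size on
    \<open>E\<close>, and multiplied by the leading coefficient of \<open>B k\<close> it must give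
    \<open>inverse c ^ k\<close>.\<close>
  have lo: "\<exists>C>0. \<forall>k. 1 \<le> C * exp (eps * real k) * cmod c ^ k * cmod (lead_coeff (B k))" if eps: "0 < eps" for eps
  proof -
    obtain C1 where C1: "0 < C1" "\<And>k z. z \<in> E \<Longrightarrow> cmod (poly (B k) z) \<le> C1 * exp (eps / 2 * real k)"
      using up[of "eps / 2"] eps by auto
    obtain C2 where C2: "0 \<le> C2" "\<And>k F z. faber_like k F \<Longrightarrow> z \<in> E \<Longrightarrow> cmod (poly F z) \<le> C2 * inverse (exp (- (eps / 2))) ^ k"
      using faber_bound[of "exp (- (eps / 2))"] eps by auto
    define m where "m = measure nu (space nu)"
    have "1 \<le> (C1 * C2 * m + 1) * exp (eps * real k) * cmod c ^ k * cmod (lead_coeff (B k))" for k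
    proof -
      obtain F where F: "faber_like k F" "degree F = k" "lead_coeff F = inverse c ^ k" by (rule faber_exists)
      obtain a where a: "F = (\<Sum>j\<le>k. smult (a j) (B j))" "coeff F k = a k * lead_coeff (B k)"
        using poly_basis_expansion[OF deg nz, of F k] F(2) by auto
      have FC: "cmod (poly F z) \<le> C2 * exp (eps / 2 * real k)" if "z \<in> E" for z
        using C2(2)[OF F(1) that] by (simp flip: exp_minus add: exp_of_nat_mult[symmetric] mult.commute)
      have "a k = (LINT z|nu. poly F z * cnj (poly (B k) z))" using coef[of a k k] a(1) by simp
      then have "cmod (a k) \<le> (LINT z|nu. cmod (poly F z * cnj (poly (B k) z)))" by simp
      also have "\<dots> \<le> (LINT z|nu. C1 * C2 * exp (eps * real k))"
      proof (rule integral_mono_AE)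
        show "integrable nu (\<lambda>z. cmod (poly F z * cnj (poly (B k) z)))" by (intro integrable_norm ipc)
        show "AE z in nu. cmod (poly F z * cnj (poly (B k) z)) \<le> C1 * C2 * exp (eps * real k)"
          using supp
        proof eventually_elim
          case (elim z)
          have "cmod (poly F z * cnj (poly (B k) z)) \<le> (C2 * exp (eps / 2 * real k)) * (C1 * exp (eps / 2 * real k))"
            unfolding norm_mult complex_mod_cnj using FC[OF elim] C1 elim C2(1) by (intro mult_mono) auto
          also have "\<dots> = C1 * C2 * (exp (eps / 2 * real k) * exp (eps / 2 * real k))" by simp
          also have "exp (eps / 2 * real k) * exp (eps / 2 * real k) = exp (eps * real k)" by (simp flip: exp_add)
          finally show ?case .
        qed
      qed auto
      also have "\<dots> = C1 * C2 * m * exp (eps * real k)" by (simp add: m_def)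
      finally have ak: "cmod (a k) \<le> C1 * C2 * m * exp (eps * real k)" .
      have "1 = cmod c ^ k * cmod (coeff F k)"
        using F c_nonzero by (simp add: norm_power norm_inverse flip: power_mult_distrib)
      also have "\<dots> = cmod (a k) * (cmod c ^ k * cmod (lead_coeff (B k)))" by (simp add: a(2) norm_mult)
      also have "\<dots> \<le> ((C1 * C2 * m + 1) * exp (eps * real k)) * (cmod c ^ k * cmod (lead_coeff (B k)))"
        using ak exp_gt_zero[of "eps * real k"] by (intro mult_right_mono) (auto simp: algebra_simps simp del: exp_gt_zero)
      finally show ?thesis by (simp add: mult_ac)
    qed
    moreover have "0 < C1 * C2 * m + 1" using C1 C2 by (simp add: m_def add_nonneg_pos)
    ultimately show ?thesis by blast
  qed
  obtain K C where K: "compact K" "K \<subseteq> interior E" "0 < C" "\<And>p m. (\<forall>z\<in>K. cmod (poly p z) \<le> m) \<Longrightarrow> cmod (LINT z|nu. poly p z) \<le> C * m"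
    using mean by blast
  obtain b where b: "B 0 = [:b:]" using deg[of 0] by (metis degree_eq_zeroE)
  have b0: "b \<noteq> 0" using nz[of 0] b by simp
  have "cmod (a 0) \<le> (C * cmod b) * m" if "\<forall>z\<in>K. cmod (poly (\<Sum>k\<le>n. smult (a k) (B k)) z) \<le> m" for a n m
  proof -
    have "a 0 = (LINT z|nu. poly (\<Sum>k\<le>n. smult (a k) (B k)) z) * cnj b"
      using coef[of a n 0] b by simp
    then show ?thesis using mult_right_mono[OF K(4)[OF that], of "cmod b"] by (simp add: norm_mult mult_ac)
  qed
  then have "\<exists>K C. compact K \<and> K \<subseteq> interior E \<and> 0 < C \<and>
        (\<forall>a n m. (\<forall>z\<in>K. cmod (poly (\<Sum>k\<le>n. smult (a k) (B k)) z) \<le> m) \<longrightarrow> cmod (a 0) \<le> C * m)"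
    using K b0 by (intro exI[of _ K] exI[of _ "C * cmod b"]) auto
  then show ?thesis unfolding admissible_def using deg up lo by blast
qed

end

section \<open>Reflection in circles, the arclength measure and the Szego polynomials\<close>

lemma mean_norm_bound:
  fixes f :: "real \<Rightarrow> complex"
  assumes "continuous_on UNIV f" "\<And>x. cmod (f x) \<le> m"
  shows "cmod (LINT x|uI. f x) \<le> m"
proof -
  have "cmod (LINT x|uI. f x) \<le> (LINT x|uI. cmod (f x))" by (rule integral_norm_bound)
  also have "\<dots> \<le> (LINT x|uI. m)"
    using assms(2) by (intro integral_mono integrable_norm integrable_uI_continuous assms(1)) auto
  finally show ?thesis using uI.prob_space by simp
qed

text \<open>For positive \<open>t\<close>, \<open>t / cnj u\<close> is the reflection of
  \<open>u\<close> in the circle of radius \<open>sqrt t\<close>. Conjugating inside and outside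
  leaves a holomorphic function of \<open>t / u\<close>.\<close>

lemma reflect_holomorphic:
  assumes f: "f holomorphic_on A" "open A" and S: "0 \<notin> S" "\<And>u. u \<in> S \<Longrightarrow> of_real t / cnj u \<in> A"
  shows "(\<lambda>u. cnj (f (of_real t / cnj u))) holomorphic_on S"
proof -
  have o: "open (cnj ` A)" using f(2) by (simp add: image_cnj_conv_vimage_cnj open_vimage continuous_on_cnj)
  have "f holomorphic_on (cnj ` (cnj ` A))" using f(1) by (simp add: image_image)
  from holomorphic_on_compose_cnj_cnj[OF this o] have g: "(\<lambda>z. cnj (f (cnj z))) holomorphic_on cnj ` A" by (simp add: o_def)
  have i: "(\<lambda>u. of_real t / u) holomorphic_on S" using S(1) by (intro holomorphic_intros) auto
  have "(\<lambda>u. of_real t / u) ` S \<subseteq> cnj ` A"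
  proof
    fix w assume "w \<in> (\<lambda>u. of_real t / u) ` S"
    then obtain u where u: "u \<in> S" "w = of_real t / u" by auto
    then have "cnj w \<in> A" using S(2)[of u] by simp
    then show "w \<in> cnj ` A" by (metis complex_cnj_cnj imageI)
  qed
  from holomorphic_on_compose_gen[OF i g this] show ?thesis by (simp add: o_def)
qed

lemma lbint_circle:
  fixes F :: "complex \<Rightarrow> complex"
  assumes "continuous_on (sphere 0 1) F"
  shows "(LBINT t=0..2*pi. F (cis t)) = 2 * of_real pi * (LINT x|uI. F (ucis x))"
proof -
  have c: "continuous_on A (\<lambda>t. F (cis t))" for A
    by (rule continuous_on_compose2[OF assms]) (auto intro!: continuous_intros)
  have cu: "continuous_on UNIV (\<lambda>x. F (ucis x))" using continuous_on_circle[OF assms] by simp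
  have si: "set_integrable lborel {0..2 * pi} (\<lambda>t. F (cis t))" by (rule borel_integrable_atLeastAtMost'[OF c])
  have "(LBINT t=0..2*pi. F (cis t)) = integral {0..2 * pi} (\<lambda>t. F (cis t))"
    using interval_integral_eq_integral[OF _ si] by (simp add: zero_ereal_def)
  moreover have "((\<lambda>t. F (cis t)) has_integral integral {0..2 * pi} (\<lambda>t. F (cis t))) (cbox 0 (2 * pi))"
    using set_borel_integral_eq_integral(1)[OF si] by (simp add: integrable_integral)
  from has_integral_affinity'[OF this, of "2 * pi" 0]
  have "((\<lambda>x. F (ucis x)) has_integral integral {0..2 * pi} (\<lambda>t. F (cis t)) /\<^sub>R (2 * pi)) {0..1}"
    by (simp add: ucis_def)
  then have "(LINT x|uI. F (ucis x)) = integral {0..2 * pi} (\<lambda>t. F (cis t)) /\<^sub>R (2 * pi)"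
    using has_integral_uI[OF cu] has_integral_unique by blast
  ultimately show ?thesis by (simp add: scaleR_conv_of_real field_simps)
qed

text \<open>The map from \<open>x\<close> to \<open>1 - x\<close> preserves \<open>uI\<close>. It is
  used where the orientation of the circle is reversed, and to turn negative powers into positive
  ones.\<close>

lemma mean_inverse:
  fixes F :: "complex \<Rightarrow> complex"
  assumes F: "continuous_on (sphere 0 1) F"
  shows "(LINT x|uI. F (inverse (ucis x))) = (LINT x|uI. F (ucis x))"
proof -
  have u: "ucis (1 - x) = inverse (ucis x)" for x
  proof -
    have "ucis (1 - x) = cis (2 * pi - 2 * pi * x)" by (simp add: ucis_def algebra_simps)
    also have "\<dots> = inverse (ucis x)" using cis_2pi by (simp add: ucis_def cis_divide[symmetric] divide_inverse)
    finally show ?thesis .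
  qed
  have d: "distr uI borel (\<lambda>x. 1 - x) = uI"
  proof (rule measure_eqI)
    fix A assume "A \<in> sets (distr uI borel (\<lambda>x. 1 - x))"
    then have A[measurable]: "A \<in> sets borel" by simp
    have "emeasure (distr uI borel (\<lambda>x. 1 - x)) A = emeasure uI ((\<lambda>x. 1 - x) -` A)" by (subst emeasure_distr) auto
    also have "\<dots> = (\<integral>\<^sup>+x. indicator {0..1} x * indicator ((\<lambda>x. 1 - x) -` A) x \<partial>lborel)"
      unfolding uI_def by (subst emeasure_density) (auto intro: measurable_sets_borel[where M = borel, OF _ A])
    also have "\<dots> = (\<integral>\<^sup>+x. indicator {0..1} (1 + (-1) * x) * indicator A (1 + (-1) * x) \<partial>lborel)"
      by (intro nn_integral_cong) (auto simp: indicator_def)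
    also have "\<dots> = (\<integral>\<^sup>+x. indicator {0..1} x * indicator A x \<partial>lborel)"
      by (subst nn_integral_real_affine[where c = "-1" and t = 1 and f = "\<lambda>x. indicator {0..1} x * indicator A x"]) auto
    also have "\<dots> = emeasure uI A" unfolding uI_def by (subst emeasure_density) auto
    finally show "emeasure (distr uI borel (\<lambda>x. 1 - x)) A = emeasure uI A" .
  qed simp
  have "(\<lambda>x. F (ucis x)) \<in> borel_measurable borel"
    using continuous_on_circle[OF F, of UNIV] by (intro borel_measurable_continuous_onI) simp
  then have "(LINT x|distr uI borel (\<lambda>x. 1 - x). F (ucis x)) = (LINT x|uI. F (ucis (1 - x)))"
    by (intro integral_distr) auto
  then show ?thesis unfolding d u by simp
qed

context oriented_jordan
begin

lemma deriv_h_hol: "deriv h holomorphic_on collar"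
  by (rule holomorphic_deriv[OF h_hol open_annulus])

lemma deriv_h_nz: "u \<in> collar \<Longrightarrow> deriv h u \<noteq> 0"
  by (rule holomorphic_injective_imp_regular[OF h_hol open_annulus h_inj])

lemma interior_inside: "interior E \<subseteq> inside (h ` sphere 0 1)"
proof
  fix z assume z: "z \<in> interior E"
  let ?C = "connected_component_set (- (h ` sphere 0 1)) z"
  have zL: "z \<notin> h ` sphere 0 1" using z h_circle(2) by blast
  have zC: "z \<in> ?C" using zL by simp
  have sub: "?C \<subseteq> interior E \<union> - E"
    using connected_component_subset[of "- (h ` sphere 0 1)" z] h_circle(1) by blast
  have "?C \<inter> - E = {}"
  proof (rule ccontr)
    assume "?C \<inter> - E \<noteq> {}"
    moreover have "interior E \<inter> - E \<inter> ?C = {}" using interior_subset by blast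
    ultimately show False
      using connectedD[OF connected_connected_component[of "- (h ` sphere 0 1)" z] open_interior open_compl_E _ sub] z zC by blast
  qed
  then have "?C \<subseteq> E" by blast
  then show "z \<in> inside (h ` sphere 0 1)"
    unfolding inside_def using zL bounded_subset[OF compact_imp_bounded[OF compact_E]] by blast
qed

text \<open>The winding number of the boundary curve about \<open>z\<close>, written as a mean. Only
  its modulus enters the estimates, so the sense in which the curve is run through stays
  undetermined.\<close>

definition wind :: "complex \<Rightarrow> complex" where
  "wind z = (LINT x|uI. ucis x * deriv h (ucis x) / (h (ucis x) - z))"

lemma ucis_annulus: "ucis x \<in> collar"
  using sphere_annulus by (auto simp: subset_iff)

lemma h_ne_interior: "z \<in> interior E \<Longrightarrow> cmod u = 1 \<Longrightarrow> h u - z \<noteq> 0"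
  using h_circle(2) by auto

lemma cont_h_sphere: "continuous_on (sphere 0 1) h" "continuous_on (sphere 0 1) (deriv h)"
  by (rule continuous_on_subset[OF h_continuous sphere_annulus])
     (rule holomorphic_continuous[OF deriv_h_hol sphere_annulus])

lemma norm_wind:
  assumes z: "z \<in> interior E"
  shows "cmod (wind z) = 1"
proof -
  let ?c = "circlepath (0::complex) 1"
  have pim: "path_image ?c = sphere 0 1" by simp
  have sp: "simple_path (h \<circ> ?c)"
    by (rule simple_path_continuous_image)
       (use sphere_annulus in \<open>auto simp: simple_path_circlepath intro: cont_h_sphere inj_on_subset[OF h_inj]\<close>)
  have vp: "valid_path (h \<circ> ?c)"
    by (rule valid_path_compose_holomorphic[OF _ h_hol open_annulus]) (use sphere_annulus in auto)
  have pi: "path_image (h \<circ> ?c) = h ` sphere 0 1" by (simp add: path_image_compose)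
  have zin: "z \<in> inside (path_image (h \<circ> ?c))" unfolding pi using z interior_inside by blast
  have zn: "z \<notin> path_image (h \<circ> ?c)" unfolding pi using z h_circle(2) by blast
  let ?F = "\<lambda>u. u * deriv h u / (h u - z)"
  have "continuous_on (sphere 0 1) ?F"
    using h_ne_interior[OF z] by (intro continuous_intros cont_h_sphere) auto
  from circlepath_mean[OF this] have "((\<lambda>u. ?F u / (u - 0)) has_contour_integral (2 * of_real pi * \<i> * wind z)) ?c"
    by (simp add: wind_def)
  then have "((\<lambda>w. deriv h w * (1 / (h w - z))) has_contour_integral (2 * of_real pi * \<i> * wind z)) ?c"
    by (rule has_contour_integral_eq) auto
  then have ci: "contour_integral ?c (\<lambda>w. deriv h w * (1 / (h w - z))) = 2 * of_real pi * \<i> * wind z"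
    by (rule contour_integral_unique)
  have "winding_number (h \<circ> ?c) z = 1 / (2 * pi * \<i>) * contour_integral (h \<circ> ?c) (\<lambda>w. 1 / (w - z))"
    by (rule winding_number_valid_path[OF vp zn])
  also have "contour_integral (h \<circ> ?c) (\<lambda>w. 1 / (w - z)) = contour_integral ?c (\<lambda>w. deriv h w * (1 / (h w - z)))"
    by (rule contour_integral_comp_analyticW[where s = "collar"])
       (use sphere_annulus in \<open>auto simp: analytic_on_open open_annulus h_hol\<close>)
  finally have "winding_number (h \<circ> ?c) z = wind z" unfolding ci by (simp del: comp_apply add: field_simps)
  then show ?thesis using simple_closed_path_norm_winding_number_inside[OF sp zin] by simp
qed

text \<open>As in \<open>faber_integral\<close>, the quotient part is an exact derivative with mean
  zero; the remaining kernel has mean \<open>wind z\<close>.\<close>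

lemma cauchy_boundary:
  assumes z: "z \<in> interior E"
  shows "(LINT x|uI. poly p (h (ucis x)) * (ucis x * deriv h (ucis x) / (h (ucis x) - z))) = poly p z * wind z"
proof -
  define q where "q = synthetic_div p z"
  obtain Q where Q: "pderiv Q = q" by (rule poly_antiderivative)
  have pq: "poly p w = poly p z + (w - z) * poly q w" for w
  proof -
    have "poly p w = poly ([:- z, 1:] * q + [:poly p z:]) w" unfolding q_def synthetic_div_correct' ..
    then show ?thesis by (simp add: left_diff_distrib)
  qed
  have QH: "(\<lambda>u. poly Q (h u)) holomorphic_on collar" by (intro holomorphic_intros h_hol)
  have dQ: "deriv (\<lambda>u. poly Q (h u)) u = poly q (h u) * deriv h u" if "u \<in> collar" for u
  proof (rule DERIV_imp_deriv)
    show "((\<lambda>u. poly Q (h u)) has_field_derivative poly q (h u) * deriv h u) (at u)"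
      using DERIV_chain2[OF poly_DERIV[of Q "h u"] holomorphic_derivI[OF h_hol open_annulus that]] Q by simp
  qed
  have m1: "(LINT x|uI. ucis x * (poly q (h (ucis x)) * deriv h (ucis x))) = 0"
    using mean_deriv_zero[OF QH, of 1] r0 dQ[OF ucis_annulus] by simp
  have i1: "integrable uI (\<lambda>x. ucis x * (poly q (h (ucis x)) * deriv h (ucis x)))"
    using integrable_circle[of 0 1 "\<lambda>u. u * (poly q (h u) * deriv h u)"] by (simp add: continuous_intros cont_h_sphere)
  have i2: "integrable uI (\<lambda>x. poly p z * (ucis x * deriv h (ucis x) / (h (ucis x) - z)))"
    using integrable_circle[of 0 1 "\<lambda>u. poly p z * (u * deriv h u / (h u - z))"] h_ne_interior[OF z]
    by (simp add: continuous_intros cont_h_sphere)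
  have "(LINT x|uI. poly p (h (ucis x)) * (ucis x * deriv h (ucis x) / (h (ucis x) - z))) =
     (LINT x|uI. poly p z * (ucis x * deriv h (ucis x) / (h (ucis x) - z)) + ucis x * (poly q (h (ucis x)) * deriv h (ucis x)))"
  proof (intro Bochner_Integration.integral_cong refl)
    fix x
    have "h (ucis x) - z \<noteq> 0" by (rule h_ne_interior[OF z]) simp
    then show "poly p (h (ucis x)) * (ucis x * deriv h (ucis x) / (h (ucis x) - z)) =
      poly p z * (ucis x * deriv h (ucis x) / (h (ucis x) - z)) + ucis x * (poly q (h (ucis x)) * deriv h (ucis x))"
      by (subst pq) (simp add: field_simps)
  qed
  also have "\<dots> = poly p z * wind z"
    unfolding Bochner_Integration.integral_add[OF i2 i1] m1 wind_def integral_mult_right_zero by simp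
  finally show ?thesis .
qed

lemma arclength_interior_bound:
  assumes K: "compact K" "K \<subseteq> interior E"
  shows "\<exists>C\<ge>0. \<forall>p. \<forall>z\<in>K. cmod (poly p z) \<le> C * (LINT x|uI. cmod (deriv h (ucis x)) * cmod (poly p (h (ucis x))))"
proof -
  have cL: "compact (h ` sphere 0 1)" by (intro compact_continuous_image cont_h_sphere) auto
  have "K \<inter> h ` sphere 0 1 = {}" using K(2) h_circle(2) by blast
  then obtain d where d: "0 < d" "\<And>x y. x \<in> K \<Longrightarrow> y \<in> h ` sphere 0 1 \<Longrightarrow> d \<le> dist x y"
    using separate_compact_closed[OF K(1) compact_imp_closed[OF cL]] by blast
  have "cmod (poly p z) \<le> inverse d * (LINT x|uI. cmod (deriv h (ucis x)) * cmod (poly p (h (ucis x))))" if z: "z \<in> K" for p z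
  proof -
    have zi: "z \<in> interior E" using z K by blast
    have "cmod (poly p z) = cmod (LINT x|uI. poly p (h (ucis x)) * (ucis x * deriv h (ucis x) / (h (ucis x) - z)))"
      unfolding cauchy_boundary[OF zi] by (simp add: norm_mult norm_wind[OF zi])
    also have "\<dots> \<le> (LINT x|uI. cmod (poly p (h (ucis x)) * (ucis x * deriv h (ucis x) / (h (ucis x) - z))))"
      by (rule integral_norm_bound)
    also have "\<dots> \<le> (LINT x|uI. inverse d * (cmod (deriv h (ucis x)) * cmod (poly p (h (ucis x)))))"
    proof (rule integral_mono)
      show "integrable uI (\<lambda>x. cmod (poly p (h (ucis x)) * (ucis x * deriv h (ucis x) / (h (ucis x) - z))))"
        using integrable_circle[of 0 1 "\<lambda>u. cmod (poly p (h u) * (u * deriv h u / (h u - z)))"] h_ne_interior[OF zi]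
        by (simp add: continuous_intros cont_h_sphere)
      show "integrable uI (\<lambda>x. inverse d * (cmod (deriv h (ucis x)) * cmod (poly p (h (ucis x)))))"
        using integrable_circle[of 0 1 "\<lambda>u. inverse d * (cmod (deriv h u) * cmod (poly p (h u)))"]
        by (simp add: continuous_intros cont_h_sphere)
      fix x
      have "d \<le> cmod (h (ucis x) - z)" using d(2)[OF z, of "h (ucis x)"] by (simp add: dist_norm norm_minus_commute)
      then have "inverse (cmod (h (ucis x) - z)) \<le> inverse d" using d(1) by (intro le_imp_inverse_le) auto
      then have "inverse (cmod (h (ucis x) - z)) * (cmod (deriv h (ucis x)) * cmod (poly p (h (ucis x)))) \<le> inverse d * (cmod (deriv h (ucis x)) * cmod (poly p (h (ucis x))))"
        by (intro mult_right_mono) auto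
      then show "cmod (poly p (h (ucis x)) * (ucis x * deriv h (ucis x) / (h (ucis x) - z))) \<le> inverse d * (cmod (deriv h (ucis x)) * cmod (poly p (h (ucis x))))"
        by (simp add: norm_mult norm_inverse divide_inverse mult_ac)
    qed
    finally show ?thesis by simp
  qed
  then show ?thesis using d(1) by (intro exI[of _ "inverse d"]) auto
qed

text \<open>On the unit circle the arclength density is the restriction of the square root of
  \<open>h' u * cnj (h' (1 / cnj u))\<close>, which is holomorphic nearby, so the contour can be moved inside.\<close>

lemma arclength_mean_bound:
  "\<exists>K C. compact K \<and> K \<subseteq> interior E \<and> 0 < C \<and>
    (\<forall>p m. (\<forall>z\<in>K. cmod (poly p z) \<le> m) \<longrightarrow> cmod (LINT x|uI. cmod (deriv h (ucis x)) *\<^sub>R poly p (h (ucis x))) \<le> C * m)"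
proof -
  define k where "k u = deriv h u * cnj (deriv h (of_real 1 / cnj u))" for u
  have refl1: "of_real 1 / cnj u \<in> collar" if "u \<in> collar" for u
  proof -
    have "cnj (inverse u) \<in> collar" using annulus_inverse[OF r0(1) that] by (simp add: annulus_def norm_inverse)
    then show ?thesis by (simp add: divide_inverse)
  qed
  have "0 \<notin> collar" using r0 by (simp add: annulus_def)
  then have kh: "k holomorphic_on collar"
    unfolding k_def by (intro holomorphic_on_mult deriv_h_hol reflect_holomorphic[OF deriv_h_hol open_annulus] refl1)
  have k1: "k u = of_real ((cmod (deriv h u))\<^sup>2)" if u: "cmod u = 1" for u
  proof -
    have "of_real 1 / cnj u = u" using u by (metis complex_cnj_zero_iff complex_norm_square norm_zero of_real_1 one_power2 nonzero_eq_divide_eq zero_neq_one)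
    then show ?thesis by (simp add: k_def complex_norm_square flip: of_real_power)
  qed
  \<comment> \<open>On the circle \<open>k\<close> is positive, so on a thin annulus it stays in the
    right half-plane, away from the branch cut of \<open>csqrt\<close>.\<close>
  have "open (collar \<inter> k -` {z. 0 < Re z})"
    by (intro continuous_open_preimage holomorphic_on_imp_continuous_on[OF kh] open_annulus open_halfspace_Re_gt)
  moreover have "sphere 0 1 \<subseteq> collar \<inter> k -` {z. 0 < Re z}"
  proof
    fix u :: complex assume u: "u \<in> sphere 0 1"
    then have ua: "u \<in> collar" using sphere_annulus by blast
    have "0 < Re (k u)" using k1[of u] u deriv_h_nz[OF ua] by simp
    then show "u \<in> collar \<inter> k -` {z. 0 < Re z}" using ua by simp
  qed
  ultimately obtain dlt where dlt: "0 < dlt" "dlt < 1" and dltk: "\<And>u. \<bar>cmod u - 1\<bar> < dlt \<Longrightarrow> u \<in> collar \<inter> k -` {z. 0 < Re z}"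
    by (rule thin_collar) blast
  define q where "q u = csqrt (k u)" for u
  have sub: "annulus (1 - dlt) (1 + dlt) \<subseteq> collar" using dltk by (force simp: annulus_def[of "1 - dlt"] abs_less_iff)
  have qh: "q holomorphic_on annulus (1 - dlt) (1 + dlt)"
    unfolding q_def
  proof (rule holomorphic_on_csqrt'[OF holomorphic_on_subset[OF kh sub]])
    fix u assume "u \<in> annulus (1 - dlt) (1 + dlt)"
    then have "0 < Re (k u)" using dltk[of u] by (auto simp: annulus_def abs_less_iff)
    then show "k u \<notin> \<real>\<^sub>\<le>\<^sub>0" by (auto simp: complex_nonpos_Reals_iff)
  qed
  have q1: "q u = of_real (cmod (deriv h u))" if "cmod u = 1" for u
    unfolding q_def k1[OF that] by (subst of_real_sqrt[symmetric]) auto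
  define s where "s = 1 - dlt / 2"
  have s: "1 - dlt < s" "s < 1" "0 < s" using dlt by (auto simp: s_def)
  have ss: "sphere 0 s \<subseteq> annulus (1 - dlt) (1 + dlt)" using s by (auto simp: annulus_def)
  have sr: "r0 < s" using subsetD[OF subset_trans[OF ss sub], of "of_real s"] s by (simp add: annulus_def)
  have cq: "continuous_on (sphere 0 s) q" by (rule holomorphic_continuous[OF qh ss])
  have ch: "continuous_on (sphere 0 s) h" by (rule continuous_on_subset[OF h_continuous subset_trans[OF ss sub]])
  obtain C where C: "0 < C" "\<And>u. u \<in> sphere 0 s \<Longrightarrow> cmod (q u) \<le> C" by (rule compact_norm_bound[OF _ cq]) auto
  have "compact (h ` sphere 0 s)" by (intro compact_continuous_image ch) auto
  moreover have "h ` sphere 0 s \<subseteq> interior E" using h_inner s sr by auto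
  moreover have "cmod (LINT x|uI. cmod (deriv h (ucis x)) *\<^sub>R poly p (h (ucis x))) \<le> C * m"
    if m: "\<forall>z\<in>h ` sphere 0 s. cmod (poly p z) \<le> m" for p m
  proof -
    have F: "(\<lambda>u. q u * poly p (h u)) holomorphic_on annulus (1 - dlt) (1 + dlt)"
      by (intro holomorphic_intros qh holomorphic_on_subset[OF h_hol sub])
    have "(LINT x|uI. cmod (deriv h (ucis x)) *\<^sub>R poly p (h (ucis x))) = (LINT x|uI. q (circ 1 x) * poly p (h (circ 1 x)))"
      by (simp add: q1 scaleR_conv_of_real)
    also have "\<dots> = (LINT x|uI. q (circ s x) * poly p (h (circ s x)))"
      by (rule mean_annulus_radius[OF F]) (use s dlt in auto)
    also have "cmod \<dots> \<le> C * m"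
    proof (rule mean_norm_bound)
      show "continuous_on UNIV (\<lambda>x. q (circ s x) * poly p (h (circ s x)))"
        using continuous_on_circle[of 0 s "\<lambda>u. q u * poly p (h u)" UNIV] s by (simp add: continuous_intros cq ch)
      fix x
      have u: "circ s x \<in> sphere 0 s" using s by (simp add: norm_mult)
      show "cmod (q (circ s x) * poly p (h (circ s x))) \<le> C * m"
        unfolding norm_mult using C(2)[OF u] m[rule_format, OF imageI[OF u]] C(1) by (intro mult_mono) auto
    qed
    finally show ?thesis .
  qed
  ultimately show ?thesis using C(1) by blast
qed

lemma szego_admissible:
  assumes deg: "\<And>k. degree (B k) = k"
    and orth: "\<And>j k. 2 * of_real pi * (LINT x|uI. poly (B j) (h (ucis x)) * cnj (poly (B k) (h (ucis x))) * of_real (cmod (deriv h (ucis x)))) = (if j = k then 1 else 0)"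
  shows "admissible B"
proof -
  \<comment> \<open>The factor \<open>2 * pi\<close> passes from the parameter of \<open>uI\<close>,
    of total mass one, to the angle; the derivative passes from there to arclength.\<close>
  define dn where "dn x = 2 * pi * cmod (deriv h (ucis x))" for x
  define nu where "nu = distr (density uI dn) borel (\<lambda>x. h (ucis x))"
  have "continuous_on UNIV dn" unfolding dn_def
    using continuous_on_circle[OF cont_h_sphere(2), of UNIV] by (intro continuous_intros) simp
  then have [measurable]: "dn \<in> borel_measurable borel" by (rule borel_measurable_continuous_onI)
  have dn_int: "integrable uI dn" by (rule integrable_uI_continuous) fact
  have "continuous_on UNIV (\<lambda>x. h (ucis x))" using continuous_on_circle[OF cont_h_sphere(1), of UNIV] by simp
  then have [measurable]: "(\<lambda>x. h (ucis x)) \<in> borel_measurable borel" by (rule borel_measurable_continuous_onI)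
  have dn0: "0 \<le> dn x" for x by (simp add: dn_def)
  have I: "(LINT z|nu. f z) = (LINT x|uI. dn x *\<^sub>R f (h (ucis x)))" if [measurable]: "f \<in> borel_measurable borel" for f :: "complex \<Rightarrow> complex"
    unfolding nu_def using dn0 by (subst integral_distr) (auto simp: integral_density)
  have Ir: "(LINT z|nu. f z) = (LINT x|uI. dn x *\<^sub>R f (h (ucis x)))" if [measurable]: "f \<in> borel_measurable borel" for f :: "complex \<Rightarrow> real"
    unfolding nu_def using dn0 by (subst integral_distr) (auto simp: integral_density)
  have "finite_measure (density uI dn)"
  proof
    have "emeasure (density uI dn) UNIV = (\<integral>\<^sup>+x. dn x \<partial>uI)" by (subst emeasure_density) auto
    also have "\<dots> = ennreal (LINT x|uI. dn x)" using dn0 by (intro nn_integral_eq_integral dn_int) auto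
    finally show "emeasure (density uI dn) (space (density uI dn)) \<noteq> \<infinity>" by simp
  qed
  then have fin: "finite_measure nu" unfolding nu_def by (rule finite_measure.finite_measure_distr) simp
  show ?thesis
  proof (rule orthonormal_admissible[OF fin])
    show "sets nu = sets borel" by (simp add: nu_def)
    have "h (ucis x) \<in> E" for x by (rule circle_in_E) simp
    then show "AE z in nu. z \<in> E" unfolding nu_def
      by (subst AE_distr_iff) (use compact_imp_closed[OF compact_E] in \<open>auto intro: borel_closed\<close>)
    show "degree (B k) = k" for k by (rule deg)
    fix j k
    have "(LINT z|nu. poly (B j) z * cnj (poly (B k) z)) = (LINT x|uI. dn x *\<^sub>R (poly (B j) (h (ucis x)) * cnj (poly (B k) (h (ucis x)))))"
      by (intro I borel_measurable_continuous_onI continuous_intros)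
    also have "\<dots> = (LINT x|uI. (2 * of_real pi) * (poly (B j) (h (ucis x)) * cnj (poly (B k) (h (ucis x))) * of_real (cmod (deriv h (ucis x)))))"
      by (intro Bochner_Integration.integral_cong refl) (simp add: dn_def scaleR_conv_of_real)
    finally show "(LINT z|nu. poly (B j) z * cnj (poly (B k) z)) = (if j = k then 1 else 0)" using orth[of j k] by simp
  next
    fix K assume K: "compact K" "K \<subseteq> interior E"
    obtain C where C: "0 \<le> C" "\<And>p z. z \<in> K \<Longrightarrow> cmod (poly p z) \<le> C * (LINT x|uI. cmod (deriv h (ucis x)) * cmod (poly p (h (ucis x))))"
      using arclength_interior_bound[OF K] by blast
    have e: "(LINT z|nu. cmod (poly p z)) = 2 * pi * (LINT x|uI. cmod (deriv h (ucis x)) * cmod (poly p (h (ucis x))))" for p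
      by (subst Ir) (auto simp: dn_def mult.assoc)
    show "\<exists>C\<ge>0. \<forall>p. \<forall>z\<in>K. cmod (poly p z) \<le> C * (LINT z|nu. cmod (poly p z))"
      using C by (intro exI[of _ "C / (2 * pi)"]) (auto simp: e)
  next
    obtain K C where K: "compact K" "K \<subseteq> interior E" "0 < C"
      "\<And>p m. (\<forall>z\<in>K. cmod (poly p z) \<le> m) \<Longrightarrow> cmod (LINT x|uI. cmod (deriv h (ucis x)) *\<^sub>R poly p (h (ucis x))) \<le> C * m"
      using arclength_mean_bound by blast
    have e: "(LINT z|nu. poly p z) = 2 * of_real pi * (LINT x|uI. cmod (deriv h (ucis x)) *\<^sub>R poly p (h (ucis x)))" for p
      by (subst I) (auto simp: dn_def mult.assoc scaleR_conv_of_real)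
    have "cmod (LINT z|nu. poly p z) \<le> 2 * pi * C * m" if "\<forall>z\<in>K. cmod (poly p z) \<le> m" for p m
      unfolding e norm_mult using mult_left_mono[OF K(4)[OF that], of "2 * pi"] by (simp add: mult.assoc)
    then show "\<exists>K C. compact K \<and> K \<subseteq> interior E \<and> 0 < C \<and> (\<forall>p m. (\<forall>z\<in>K. cmod (poly p z) \<le> m) \<longrightarrow> cmod (LINT z|nu. poly p z) \<le> C * m)"
      using K by (intro exI[of _ K] exI[of _ "2 * pi * C"]) auto
  qed
qed

end

section \<open>The Faber polynomials as an admissible basis\<close>

context oriented_jordan
begin

text \<open>The level curves of the exterior map are reflected across the boundary curve: in the collar
  coordinate \<open>j\<close> one may replace \<open>j\<close> by \<open>1 / cnj j\<close> up to an error that vanishes as the radius tends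
  to one, and the reflected function is holomorphic, so its circle can be moved to a fixed one.\<close>

lemma faber_mean_bound:
  obtains K where "compact K" "K \<subseteq> interior E"
    "\<And>p a m. (\<And>rho. 0 < rho \<Longrightarrow> rho < 1 \<Longrightarrow> (LINT x|uI. poly p (psi (circ rho x))) = a) \<Longrightarrow> (\<And>z. z \<in> K \<Longrightarrow> cmod (poly p z) \<le> m) \<Longrightarrow> cmod a \<le> m"
proof -
  define sig0 where "sig0 = (1 + 1 / r0) / 2"
  have sig0: "1 < sig0" "sig0 < 1 / r0" using r0 by (auto simp: sig0_def field_simps)
  obtain rho1 hi where rho1: "0 < rho1" "rho1 < 1" and hi: "hi holomorphic_on h ` collar"
    and hih: "\<And>u. u \<in> collar \<Longrightarrow> hi (h u) = u"
    and co: "\<And>zeta. rho1 < cmod zeta \<Longrightarrow> cmod zeta < 1 \<Longrightarrow> psi zeta \<in> h ` collar \<and> h (hi (psi zeta)) = psi zeta \<and> 1 < cmod (hi (psi zeta)) \<and> cmod (hi (psi zeta)) < sig0"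
    by (rule collar_coordinate[OF sig0]) blast
  define j where "j zeta = hi (psi zeta)" for zeta
  define eta where "eta zeta = inverse (cnj (j zeta))" for zeta
  have ann: "annulus rho1 1 \<subseteq> ball 0 1 - {0}" using rho1 by (auto simp: annulus_def)
  have j_hol: "j holomorphic_on annulus rho1 1"
    unfolding j_def
    by (rule holomorphic_on_compose_gen[OF holomorphic_on_subset[OF psi_hol ann] hi, unfolded o_def])
       (use co in \<open>auto simp: annulus_def\<close>)
  have j_ann: "1 < cmod (j zeta)" "cmod (j zeta) < sig0" if "zeta \<in> annulus rho1 1" for zeta
    using co[of zeta] that by (auto simp: j_def annulus_def)
  have rs: "r0 < 1 / sig0" using sig0 r0 by (simp add: field_simps)
  have eta_ann: "1 / sig0 < cmod (eta zeta)" "cmod (eta zeta) < 1" if "zeta \<in> annulus rho1 1" for zeta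
  proof -
    have "0 < cmod (j zeta)" using j_ann(1)[OF that] by linarith
    then show "1 / sig0 < cmod (eta zeta)" "cmod (eta zeta) < 1"
      using j_ann[OF that] sig0 by (auto simp: eta_def inverse_eq_divide norm_divide divide_strict_left_mono field_simps)
  qed
  define t where "t = (rho1 + 1) / 2"
  have t: "rho1 < t" "t < 1" "0 < t" using rho1 by (auto simp: t_def)
  have st: "sphere 0 t \<subseteq> annulus rho1 1" using t by (auto simp: annulus_def)
  have eta_cont: "continuous_on (annulus rho1 1) eta"
  proof -
    have "j zeta \<noteq> 0" if "zeta \<in> annulus rho1 1" for zeta using j_ann(1)[OF that] by auto
    then show ?thesis unfolding eta_def
      by (intro continuous_intros holomorphic_on_imp_continuous_on[OF j_hol]) auto
  qed
  have eta_in: "eta zeta \<in> collar" if "zeta \<in> annulus rho1 1" for zeta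
    using eta_ann[OF that] rs sig0 by (auto simp: annulus_def)
  have heta_cont: "continuous_on (annulus rho1 1) (\<lambda>zeta. h (eta zeta))"
    by (rule continuous_on_compose2[OF h_continuous eta_cont]) (use eta_in in auto)
  define K where "K = (\<lambda>zeta. h (eta zeta)) ` sphere 0 t"
  have "compact K" unfolding K_def
    by (intro compact_continuous_image continuous_on_subset[OF heta_cont st]) auto
  moreover have "K \<subseteq> interior E"
  proof
    fix z assume "z \<in> K"
    then obtain zeta where zeta: "zeta \<in> sphere 0 t" "z = h (eta zeta)" unfolding K_def by blast
    then have "zeta \<in> annulus rho1 1" using st by blast
    from eta_ann[OF this] rs show "z \<in> interior E" unfolding zeta(2) by (intro h_inner) auto
  qed
  moreover have "cmod a \<le> m"
    if a: "\<And>rho. 0 < rho \<Longrightarrow> rho < 1 \<Longrightarrow> (LINT x|uI. poly p (psi (circ rho x))) = a"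
      and m: "\<And>z. z \<in> K \<Longrightarrow> cmod (poly p z) \<le> m" for p a m
  proof (rule field_le_epsilon)
    fix e :: real assume e: "0 < e"
    define S where "S = cball 0 sig0 - ball (0::complex) (1 / sig0)"
    have Ssub: "S \<subseteq> collar" using rs sig0 by (auto simp: S_def annulus_def)
    have "compact S" unfolding S_def by (intro compact_diff) auto
    moreover have cph: "continuous_on (collar) (\<lambda>u. poly p (h u))" by (intro continuous_intros h_continuous)
    ultimately have "uniformly_continuous_on S (\<lambda>u. poly p (h u))"
      by (intro compact_uniformly_continuous continuous_on_subset[OF cph Ssub])
    then obtain d where d: "0 < d" "\<And>u v. u \<in> S \<Longrightarrow> v \<in> S \<Longrightarrow> dist v u < d \<Longrightarrow> dist (poly p (h v)) (poly p (h u)) < e"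
      using e unfolding uniformly_continuous_on_def by metis
    \<comment> \<open>A point \<open>v\<close> outside the unit circle and its reflection are at
      distance at most \<open>2 * (cmod v - 1)\<close>, hence less than \<open>d\<close> once
      \<open>cmod v < sig\<close>.\<close>
    define sig where "sig = min sig0 (1 + d / 2)"
    have sig: "1 < sig" "sig < 1 / r0" using sig0 d(1) by (auto simp: sig_def min_less_iff_disj)
    obtain rho2 hi2 where rho2: "0 < rho2" "rho2 < 1" and hih2: "\<And>u. u \<in> collar \<Longrightarrow> hi2 (h u) = u"
      and co2: "\<And>zeta. rho2 < cmod zeta \<Longrightarrow> cmod zeta < 1 \<Longrightarrow> psi zeta \<in> h ` collar \<and> h (hi2 (psi zeta)) = psi zeta \<and> 1 < cmod (hi2 (psi zeta)) \<and> cmod (hi2 (psi zeta)) < sig"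
      by (rule collar_coordinate[OF sig]) blast
    define rho where "rho = (max t rho2 + 1) / 2"
    have rho: "t < rho" "rho2 < rho" "rho < 1" "rho1 < rho" "0 < rho" using t rho2 by (auto simp: rho_def)
    let ?e = "\<lambda>x. circ rho x"
    have ea: "?e x \<in> annulus rho1 1" for x using rho by (simp add: annulus_def norm_mult)
    have close: "cmod (poly p (psi (?e x)) - poly p (h (eta (?e x)))) \<le> e" for x
    proof -
      have c1: "psi (?e x) \<in> h ` collar" "h (j (?e x)) = psi (?e x)" "1 < cmod (hi2 (psi (?e x)))" "cmod (hi2 (psi (?e x))) < sig"
        using co[of "?e x"] co2[of "?e x"] rho by (auto simp: norm_mult j_def)
      have "hi2 (psi (?e x)) = hi (psi (?e x))" using c1(1) hih hih2 by auto
      then have j1: "1 < cmod (j (?e x))" "cmod (j (?e x)) < sig" using c1 by (auto simp: j_def)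
      have jS: "j (?e x) \<in> S" "eta (?e x) \<in> S"
        using j_ann[OF ea[of x]] eta_ann[OF ea[of x]] sig0 by (auto simp: S_def)
      have "dist (j (?e x)) (eta (?e x)) < d"
      proof -
        define v where "v = j (?e x)"
        have v: "1 < cmod v" "cmod v < sig" using j1 by (auto simp: v_def)
        have "v \<noteq> 0" using v by auto
        have "v - inverse (cnj v) = (v * cnj v - 1) / cnj v" using \<open>v \<noteq> 0\<close> by (simp add: field_simps)
        also have "v * cnj v - 1 = of_real ((cmod v)\<^sup>2 - 1)" by (simp add: complex_norm_square del: of_real_power)
        finally have "cmod (v - inverse (cnj v)) = ((cmod v)\<^sup>2 - 1) / cmod v"
          using v(1) by (simp add: norm_divide del: of_real_diff of_real_power)
        also have "\<dots> = cmod v - 1 / cmod v" using \<open>v \<noteq> 0\<close> by (simp add: field_simps power2_eq_square)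
        also have "\<dots> \<le> 2 * (cmod v - 1)"
        proof -
          have "2 - cmod v \<le> 1 / cmod v"
            using v(1) zero_le_power2[of "cmod v - 1"] by (subst pos_le_divide_eq) (auto simp: algebra_simps power2_eq_square)
          then show ?thesis by (simp add: algebra_simps)
        qed
        also have "\<dots> < d" using v(2) by (simp add: sig_def)
        finally show ?thesis unfolding eta_def v_def[symmetric] by (simp add: dist_norm)
      qed
      from d(2)[OF jS(2) jS(1) this] show ?thesis unfolding c1(2)[symmetric] by (simp add: dist_norm)
    qed
    \<comment> \<open>On the circle of radius \<open>rho\<close> this agrees with
      \<open>eta\<close>, but unlike \<open>eta\<close> it is holomorphic. Reflection sends the
      radius \<open>rho ^ 2 / t\<close> to \<open>t\<close>, so moving the circle outward to that
      radius leads to the fixed compact set \<open>K\<close>.\<close>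
    define js where "js zeta = inverse (cnj (j (of_real (rho\<^sup>2) / cnj zeta)))" for zeta
    let ?A = "annulus (rho\<^sup>2) (rho\<^sup>2 / rho1)"
    have A0: "0 \<notin> ?A" by (auto simp: annulus_def)
    have A1: "of_real (rho\<^sup>2) / cnj zeta \<in> annulus rho1 1" if "zeta \<in> ?A" for zeta
    proof -
      have "0 < cmod zeta" using that zero_le_power2[of rho] by (auto simp: annulus_def simp del: zero_le_power2)
      then show ?thesis using that rho1 by (auto simp: annulus_def norm_divide norm_power field_simps)
    qed
    have jseta: "js zeta = eta (of_real (rho\<^sup>2) / cnj zeta)" for zeta by (simp add: js_def eta_def)
    have js_hol: "js holomorphic_on ?A" unfolding js_def
    proof (rule holomorphic_on_inverse[OF reflect_holomorphic[OF j_hol open_annulus A0 A1]])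
      fix zeta assume "zeta \<in> ?A"
      from j_ann(1)[OF A1[OF this]] show "cnj (j (of_real (rho\<^sup>2) / cnj zeta)) \<noteq> 0" by auto
    qed
    have F: "(\<lambda>zeta. poly p (h (js zeta))) holomorphic_on ?A"
      by (intro holomorphic_intros holomorphic_on_compose_gen[OF js_hol h_hol, unfolded o_def])
         (use eta_in[OF A1] jseta in auto)
    have rad: "of_real (rho\<^sup>2) / cnj (circ s x) = circ (rho\<^sup>2 / s) x" if "0 < s" for s x
    proof -
      have "inverse (cnj (ucis x)) = ucis x" by (simp add: ucis_def cis_cnj flip: cis_inverse)
      then show ?thesis by (simp add: divide_inverse mult_ac)
    qed
    have "rho\<^sup>2 / t < rho\<^sup>2 / rho1" using t rho1 rho by (simp add: frac_less2)
    moreover have "rho\<^sup>2 < rho\<^sup>2 / t" using t rho by (simp add: field_simps)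
    moreover have "rho\<^sup>2 < rho" "rho < rho\<^sup>2 / rho1" using rho rho1 by (simp_all add: power2_eq_square field_simps)
    ultimately have move: "(LINT x|uI. poly p (h (js (?e x)))) = (LINT x|uI. poly p (h (js (circ (rho\<^sup>2 / t) x))))"
      by (intro mean_annulus_radius[OF F]) auto
    have e1: "js (?e x) = eta (?e x)" for x unfolding jseta rad[OF rho(5)] using rho by (simp add: power2_eq_square)
    have e2: "js (circ (rho\<^sup>2 / t) x) = eta (circ t x)" for x
    proof -
      have "0 < rho\<^sup>2 / t" using rho t by simp
      from rad[OF this] show ?thesis unfolding jseta using rho t by simp
    qed
    have c1: "continuous_on UNIV (\<lambda>x. poly p (h (eta (circ s x))))" if "rho1 < s" "s < 1" for s
    proof -
      have "sphere 0 s \<subseteq> annulus rho1 1" using that by (auto simp: annulus_def)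
      then have "continuous_on (sphere 0 s) (\<lambda>zeta. poly p (h (eta zeta)))"
        by (intro continuous_intros continuous_on_subset[OF heta_cont])
      from continuous_on_circle[OF this, of UNIV] show ?thesis using that rho1 by simp
    qed
    have c2: "continuous_on UNIV (\<lambda>x. poly p (psi (?e x)))"
      by (intro continuous_intros psi_circle_continuous rho)
    have "a = (LINT x|uI. poly p (psi (?e x)))" using a rho by simp
    also have "\<dots> = (LINT x|uI. poly p (psi (?e x)) - poly p (h (eta (?e x)))) + (LINT x|uI. poly p (h (eta (?e x))))"
      by (subst Bochner_Integration.integral_diff) (auto intro!: integrable_uI_continuous c1 c2 rho)
    also have "(LINT x|uI. poly p (h (eta (?e x)))) = (LINT x|uI. poly p (h (eta (circ t x))))"
      using move unfolding e1 e2 .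
    finally have "cmod a \<le> cmod (LINT x|uI. poly p (psi (?e x)) - poly p (h (eta (?e x)))) + cmod (LINT x|uI. poly p (h (eta (circ t x))))"
      by (simp add: norm_triangle_ineq)
    also have "cmod (LINT x|uI. poly p (psi (?e x)) - poly p (h (eta (?e x)))) \<le> e"
      by (rule mean_norm_bound[OF _ close]) (intro continuous_intros c1 c2 rho)
    also have "cmod (LINT x|uI. poly p (h (eta (circ t x)))) \<le> m"
    proof (rule mean_norm_bound[OF c1[OF t(1,2)]])
      fix x
      have "circ t x \<in> sphere 0 t" using t by (simp add: norm_mult)
      then show "cmod (poly p (h (eta (circ t x)))) \<le> m" by (intro m) (auto simp: K_def)
    qed
    finally show "cmod a \<le> m + e" by simp
  qed
  ultimately show ?thesis using that by blast
qed

text \<open>Over every level curve \<open>B k\<close> has mean zero for positive \<open>k\<close>,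
  because \<open>inverse zeta ^ k\<close> and the remainder both do, while \<open>B 0\<close> has
  mean one. So \<open>a 0\<close> is the mean of the linear combination, and
  \<open>faber_mean_bound\<close> applies.\<close>

lemma faber_admissible:
  assumes B: "\<And>k. faber_like k (B k)"
  shows "admissible B"
proof -
  have BF: "degree (B k) = k" "lead_coeff (B k) = inverse c ^ k" for k
  proof -
    obtain F where F: "faber_like k F" "degree F = k" "lead_coeff F = inverse c ^ k" by (rule faber_exists)
    have "B k = F" by (rule faber_unique[OF B F(1)])
    then show "degree (B k) = k" "lead_coeff (B k) = inverse c ^ k" using F by auto
  qed
  have up: "\<exists>C>0. \<forall>k. \<forall>z\<in>E. cmod (poly (B k) z) \<le> C * exp (eps * real k)" if eps: "0 < eps" for eps
  proof -
    obtain C where C: "0 \<le> C" "\<And>k F z. faber_like k F \<Longrightarrow> z \<in> E \<Longrightarrow> cmod (poly F z) \<le> C * inverse (exp (- eps)) ^ k"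
      using faber_bound[of "exp (- eps)"] eps by auto
    have "cmod (poly (B k) z) \<le> (C + 1) * exp (eps * real k)" if "z \<in> E" for k z
    proof -
      have "cmod (poly (B k) z) \<le> C * exp (eps * real k)"
        using C(2)[OF B that] by (simp flip: exp_minus add: exp_of_nat_mult[symmetric] mult.commute)
      also have "\<dots> \<le> (C + 1) * exp (eps * real k)" by (intro mult_right_mono) auto
      finally show ?thesis .
    qed
    then show ?thesis using C(1) by (intro exI[of _ "C + 1"]) auto
  qed
  have lo: "\<exists>C>0. \<forall>k. 1 \<le> C * exp (eps * real k) * cmod c ^ k * cmod (lead_coeff (B k))" if eps: "0 < eps" for eps
  proof -
    have "1 \<le> 1 * exp (eps * real k) * cmod c ^ k * cmod (lead_coeff (B k))" for k
    proof -
      have "cmod c ^ k * cmod (lead_coeff (B k)) = 1"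
        using c_nonzero unfolding BF(2) by (simp add: norm_power norm_inverse power_inverse)
      then show ?thesis using eps by (simp add: mult.assoc)
    qed
    then show ?thesis using zero_less_one by blast
  qed
  obtain K where K: "compact K" "K \<subseteq> interior E"
    and Km: "\<And>p a m. (\<And>rho. 0 < rho \<Longrightarrow> rho < 1 \<Longrightarrow> (LINT x|uI. poly p (psi (circ rho x))) = a) \<Longrightarrow> (\<And>z. z \<in> K \<Longrightarrow> cmod (poly p z) \<le> m) \<Longrightarrow> cmod a \<le> m"
    by (rule faber_mean_bound) blast
  have mean_B: "(LINT x|uI. poly (B k) (psi (circ rho x))) = (if k = 0 then 1 else 0)" if rho: "0 < rho" "rho < 1" for rho k
  proof -
    obtain D where D: "D holomorphic_on ball 0 1" "D 0 = 0" "\<And>zeta. zeta \<in> ball 0 1 - {0} \<Longrightarrow> poly (B k) (psi zeta) = inverse zeta ^ k - D zeta"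
      by (rule faber_remainder[OF B]) blast
    let ?e = "\<lambda>x. circ rho x"
    have inb: "?e x \<in> ball 0 1 - {0}" for x using rho by (simp add: norm_mult)
    have D0: "(LINT x|uI. D (?e x)) = 0" using mean_holomorphic[OF D(1), of rho] rho D(2) by simp
    have sD: "sphere 0 rho \<subseteq> ball 0 1" using rho by auto
    have iD: "integrable uI (\<lambda>x. D (?e x))"
      using integrable_circle[of 0 rho D] holomorphic_continuous[OF D(1) sD] rho by simp
    have i1: "integrable uI (\<lambda>x. inverse (?e x) ^ k)"
      using rho by (intro integrable_uI_continuous continuous_intros) auto
    have "(LINT x|uI. inverse (?e x) ^ k) = (if k = 0 then 1 else 0)"
    proof (cases "k = 0")
      case True
      then show ?thesis using uI.prob_space by simp
    next
      case False
      have "(LINT x|uI. inverse (?e x) ^ k) = (LINT x|uI. (of_real (inverse rho) * inverse (ucis x)) ^ k)"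
        by simp
      also have "\<dots> = (LINT x|uI. (0 + circ (inverse rho) x) ^ k)"
        using mean_inverse[of "\<lambda>u. (of_real (inverse rho) * u) ^ k"] by (simp add: continuous_intros)
      also have "\<dots> = 0 ^ k"
        by (rule mean_holomorphic[of _ _ "inverse rho + 1"]) (use rho in \<open>auto intro!: holomorphic_intros\<close>)
      finally show ?thesis using False by simp
    qed
    then show ?thesis unfolding D(3)[OF inb] Bochner_Integration.integral_diff[OF i1 iD] D0 by simp
  qed
  have "cmod (a 0) \<le> 1 * m" if m: "\<forall>z\<in>K. cmod (poly (\<Sum>k\<le>n. smult (a k) (B k)) z) \<le> m" for a n m
  proof -
    have "(LINT x|uI. poly (\<Sum>k\<le>n. smult (a k) (B k)) (psi (circ rho x))) = a 0" if rho: "0 < rho" "rho < 1" for rho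
    proof -
      have "integrable uI (\<lambda>x. a k * poly (B k) (psi (circ rho x)))" for k
        by (intro integrable_uI_continuous continuous_intros psi_circle_continuous rho)
      then have "(LINT x|uI. poly (\<Sum>k\<le>n. smult (a k) (B k)) (psi (circ rho x))) = (\<Sum>k\<le>n. a k * (LINT x|uI. poly (B k) (psi (circ rho x))))"
        by (simp add: poly_sum Bochner_Integration.integral_sum)
      also have "\<dots> = (\<Sum>k\<le>n. if k = 0 then a 0 else 0)" by (intro sum.cong refl) (simp add: mean_B[OF rho])
      finally show ?thesis by simp
    qed
    from Km[OF this, of m] m show ?thesis by simp
  qed
  then have "\<exists>K C. compact K \<and> K \<subseteq> interior E \<and> 0 < C \<and>
        (\<forall>a n m. (\<forall>z\<in>K. cmod (poly (\<Sum>k\<le>n. smult (a k) (B k)) z) \<le> m) \<longrightarrow> cmod (a 0) \<le> C * m)"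
    using K by (intro exI[of _ K] exI[of _ "1::real"]) auto
  then show ?thesis unfolding admissible_def using BF(1) up lo by blast
qed

end

section \<open>The area measure and the Bergman polynomials\<close>

lemma det_complex_mult: "det (matrix (\<lambda>v. cv (a * vc v))) = (cmod a)\<^sup>2"
proof -
  have "matrix (\<lambda>v. cv (a * vc v)) $ i $ j = cv (a * vc (axis j 1)) $ i" for i j
    by (simp add: matrix_def)
  then show ?thesis
    by (simp add: det_2 vc_def axis_def cmod_power2) (simp add: power2_eq_square)
qed

text \<open>Multiplication by a complex number has its squared modulus as real determinant. The
  formula is transported to \<open>real^2\<close>, where it holds for Lebesgue measure, and the
  completion is removed again because the integrands are Borel.\<close>

lemma holomorphic_change_of_variables:
  fixes f :: "complex \<Rightarrow> complex"
  assumes A: "open A" "h holomorphic_on A" "inj_on h A" and S: "S \<subseteq> A" "S \<in> sets borel" "h ` S \<in> sets borel"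
    and f: "continuous_on UNIV f" "set_integrable lborel (h ` S) f"
  shows "set_integrable lborel S (\<lambda>w. (cmod (deriv h w))\<^sup>2 *\<^sub>R f (h w))"
    and "(LINT z:h ` S|lborel. f z) = (LINT w:S|lborel. (cmod (deriv h w))\<^sup>2 *\<^sub>R f (h w))"
proof -
  define J where "J w = (cmod (deriv h w))\<^sup>2 *\<^sub>R f (h w)" for w
  define S' where "S' = vc -` S"
  define g where "g v = cv (h (vc v))" for v
  define g' where "g' x v = cv (deriv h (vc x) * vc v)" for x v
  define F where "F v = cv (f (vc v))" for v
  have [measurable]: "S \<in> sets borel" "h ` S \<in> sets borel" by fact+
  have [measurable]: "f \<in> borel_measurable borel" using f(1) by (rule borel_measurable_continuous_onI)
  have S'b: "S' \<in> sets borel" unfolding S'_def using measurable_sets[OF measurable_vc S(2)] by simp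
  have gS: "g ` S' = vc -` (h ` S)"
  proof
    show "g ` S' \<subseteq> vc -` (h ` S)" by (auto simp: g_def S'_def)
    show "vc -` (h ` S) \<subseteq> g ` S'"
    proof
      fix v assume "v \<in> vc -` (h ` S)"
      then obtain w where w: "w \<in> S" "vc v = h w" by auto
      then have "v = g (cv w)" "cv w \<in> S'" by (auto simp: g_def S'_def) (metis cv_vc)
      then show "v \<in> g ` S'" by blast
    qed
  qed
  have inj: "inj_on g S'"
  proof (rule inj_onI)
    fix v v' assume v: "v \<in> S'" "v' \<in> S'" "g v = g v'"
    have "h (vc v) = h (vc v')" using arg_cong[OF v(3), of vc] by (simp add: g_def)
    then have "vc v = vc v'" using v S(1) A(3) by (auto simp: S'_def inj_on_def)
    then show "v = v'" by (metis cv_vc)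
  qed
  have der: "(g has_derivative g' x) (at x within S')" if "x \<in> S'" for x
  proof -
    have "(h has_field_derivative deriv h (vc x)) (at (vc x))"
      using that S(1) by (intro holomorphic_derivI[OF A(2,1)]) (auto simp: S'_def)
    then have "(h has_derivative (*) (deriv h (vc x))) (at (vc x))" by (simp add: has_field_derivative_def)
    from has_derivative_compose[OF bounded_linear.has_derivative[OF bounded_linear_vc has_derivative_ident] this]
    have "((\<lambda>v. h (vc v)) has_derivative (\<lambda>v. deriv h (vc x) * vc v)) (at x)" .
    from bounded_linear.has_derivative[OF bounded_linear_cv this]
    show ?thesis unfolding g_def g'_def by (rule has_derivative_at_withinI)
  qed
  have det: "\<bar>det (matrix (g' x))\<bar> = (cmod (deriv h (vc x)))\<^sup>2" for x
    unfolding g'_def det_complex_mult by simp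
  have FJ: "\<bar>det (matrix (g' x))\<bar> *\<^sub>R F (g x) = cv (J (vc x))" for x
    by (simp add: det F_def g_def J_def linear_cmul[OF bounded_linear.linear[OF bounded_linear_cv]])
  have pull: "integrable lborel (\<lambda>v. indicator (vc -` T) v *\<^sub>R cv (k (vc v)))"
    "(LINT v|lborel. indicator (vc -` T) v *\<^sub>R cv (k (vc v))) = cv (LINT z:T|lborel. k z)"
    if "set_integrable lborel T k" for T and k :: "complex \<Rightarrow> complex"
  proof -
    have e: "indicator (vc -` T) v *\<^sub>R cv (k (vc v)) = cv (indicator T (vc v) *\<^sub>R k (vc v))" for v
      by (simp add: linear_cmul[OF bounded_linear.linear[OF bounded_linear_cv]] indicator_def)
    have i: "integrable (distr lborel borel vc) (\<lambda>z. indicator T z *\<^sub>R k z)"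
      using that unfolding set_integrable_def lborel_complex_eq[symmetric] .
    then have m: "(\<lambda>z. indicator T z *\<^sub>R k z) \<in> borel_measurable borel" by auto
    have i': "integrable lborel (\<lambda>v. indicator T (vc v) *\<^sub>R k (vc v))"
      using i by (subst (asm) integrable_distr_eq) (use m in auto)
    show "integrable lborel (\<lambda>v. indicator (vc -` T) v *\<^sub>R cv (k (vc v)))"
      unfolding e by (rule integrable_bounded_linear[OF bounded_linear_cv i'])
    have "(LINT z:T|lborel. k z) = (LINT v|lborel. indicator T (vc v) *\<^sub>R k (vc v))"
      unfolding set_lebesgue_integral_def by (subst lborel_complex_eq, subst integral_distr) (use m in auto)
    then show "(LINT v|lborel. indicator (vc -` T) v *\<^sub>R cv (k (vc v))) = cv (LINT z:T|lborel. k z)"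
      unfolding e using integral_bounded_linear[OF bounded_linear_cv i'] by simp
  qed
  have FT: "set_integrable lborel (vc -` (h ` S)) F" "(LINT v:vc -` (h ` S)|lborel. F v) = cv (LINT z:h ` S|lborel. f z)"
    using pull[OF f(2)] by (simp_all add: F_def set_integrable_def set_lebesgue_integral_def)
  have FA: "F absolutely_integrable_on g ` S'" unfolding gS
    using FT(1) unfolding set_integrable_def by (rule integrable_completion[THEN iffD2, rotated]) (use FT(1) in \<open>auto simp: set_integrable_def\<close>)
  have FI: "integral (g ` S') F = cv (LINT z:h ` S|lborel. f z)"
    unfolding gS FT(2)[symmetric] by (rule set_borel_integral_eq_integral(2)[OF FT(1), symmetric])
  have "(\<lambda>x. cv (J (vc x))) absolutely_integrable_on S' \<and> integral S' (\<lambda>x. cv (J (vc x))) = cv (LINT z:h ` S|lborel. f z)"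
    using has_absolute_integral_change_of_variables[of S' g g' F "cv (LINT z:h ` S|lborel. f z)", OF _ der inj] S'b FA FI
    unfolding FJ by auto
  then have GA: "(\<lambda>x. cv (J (vc x))) absolutely_integrable_on S'" and GI: "integral S' (\<lambda>x. cv (J (vc x))) = cv (LINT z:h ` S|lborel. f z)" by auto
  have cJ: "continuous_on S J"
    unfolding J_def using A S(1)
    by (intro continuous_intros holomorphic_continuous[OF holomorphic_deriv[OF A(2,1)] ]
        continuous_on_compose2[OF f(1)] holomorphic_continuous[OF A(2)]) auto
  have Jm: "(\<lambda>w. indicator S w *\<^sub>R J w) \<in> borel_measurable borel"
    by (rule borel_measurable_continuous_on_indicator[OF _ cJ]) fact
  have e: "indicator S' v *\<^sub>R cv (J (vc v)) = cv (indicator S (vc v) *\<^sub>R J (vc v))" for v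
    by (simp add: linear_cmul[OF bounded_linear.linear[OF bounded_linear_cv]] indicator_def S'_def)
  have "(\<lambda>v. cv (indicator S (vc v) *\<^sub>R J (vc v))) \<in> borel_measurable borel" using Jm by measurable
  then have em: "(\<lambda>v. indicator S' v *\<^sub>R cv (J (vc v))) \<in> borel_measurable lborel" unfolding e by simp
  have Gi: "integrable lborel (\<lambda>v. indicator S' v *\<^sub>R cv (J (vc v)))"
    using GA unfolding set_integrable_def by (simp only: integrable_completion[OF em])
  then have "integrable lborel (\<lambda>v. vc (indicator S' v *\<^sub>R cv (J (vc v))))" by (rule integrable_bounded_linear[OF bounded_linear_vc])
  then have "integrable lborel (\<lambda>v. indicator S (vc v) *\<^sub>R J (vc v))" unfolding e by simp
  then have "integrable (distr lborel borel vc) (\<lambda>w. indicator S w *\<^sub>R J w)" by (subst integrable_distr_eq) (use Jm in auto)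
  then have Ji: "set_integrable lborel S J" unfolding set_integrable_def lborel_complex_eq[symmetric] .
  have "cv (LINT z:h ` S|lborel. f z) = (LINT v:S'|lborel. cv (J (vc v)))"
    unfolding GI[symmetric] by (rule set_borel_integral_eq_integral(2)[symmetric]) (use Gi in \<open>simp add: set_integrable_def\<close>)
  also have "\<dots> = cv (LINT w:S|lborel. J w)" using pull(2)[OF Ji] by (simp add: S'_def set_lebesgue_integral_def)
  finally have "(LINT z:h ` S|lborel. f z) = (LINT w:S|lborel. J w)" by (metis vc_cv)
  then show "set_integrable lborel S (\<lambda>w. (cmod (deriv h w))\<^sup>2 *\<^sub>R f (h w))"
    "(LINT z:h ` S|lborel. f z) = (LINT w:S|lborel. (cmod (deriv h w))\<^sup>2 *\<^sub>R f (h w))"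
    using Ji unfolding J_def by auto
qed

context oriented_jordan
begin

lemma area_interior_bound:
  assumes K: "compact K" "K \<subseteq> interior E"
  shows "\<exists>C\<ge>0. \<forall>p. \<forall>z\<in>K. cmod (poly p z) \<le> C * (LINT z:E|lborel. cmod (poly p z))"
proof -
  have "K \<inter> - interior E = {}" using K(2) by blast
  then obtain d where d: "0 < d" "\<And>x y. x \<in> K \<Longrightarrow> y \<in> - interior E \<Longrightarrow> d \<le> dist x y"
    using separate_compact_closed[OF K(1), of "- interior E"] by (metis closed_Compl open_interior)
  have "cmod (poly p z) \<le> inverse (pi * d\<^sup>2) * (LINT z:E|lborel. cmod (poly p z))" if z: "z \<in> K" for p z
  proof -
    have sub: "ball z d \<subseteq> E" using d(2)[OF z] interior_subset[of E] by (force simp: not_less)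
    have bE: "E \<in> sets borel" using compact_E by (simp add: borel_compact)
    have i: "set_integrable lborel E (\<lambda>w. cmod (poly p w))"
      unfolding set_integrable_def by (rule borel_integrable_compact[OF compact_E]) (auto intro!: continuous_intros)
    have ib: "set_integrable lborel (ball z d) (\<lambda>w. cmod (poly p w))" by (rule set_integrable_subset[OF i _ sub]) simp
    have "pi * d\<^sup>2 * cmod (poly p z) \<le> (LINT w:ball z d|lborel. cmod (poly p w))" by (rule area_mean_norm[OF d(1)])
    also have "\<dots> \<le> (LINT w:E|lborel. cmod (poly p w))"
      unfolding set_lebesgue_integral_def using i ib sub
      by (intro integral_mono) (auto simp: set_integrable_def indicator_def)
    finally show ?thesis using d(1) by (simp add: field_simps)
  qed
  then show ?thesis using d(1) by (intro exI[of _ "inverse (pi * d\<^sup>2)"]) auto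
qed

text \<open>On the circle of radius \<open>s\<close> the area density \<open>h' v * cnj (h' v)\<close> agrees with
  \<open>h' v * cnj (h' (s\<^sup>2 / cnj v))\<close>, which is holomorphic, so every circular mean can be moved to the inner radius.\<close>

lemma collar_mean_bound:
  assumes rho: "r0 < rho" "rho < 1" and D: "\<And>v. rho \<le> cmod v \<Longrightarrow> cmod v \<le> 1 / rho \<Longrightarrow> cmod (deriv h v) \<le> D"
    and w: "rho < cmod w" "cmod w \<le> 1" and m: "\<And>v. cmod v = rho \<Longrightarrow> cmod (poly p (h v)) \<le> m"
  shows "cmod (LINT x|uI. (cmod (deriv h (ucis x * w)))\<^sup>2 *\<^sub>R poly p (h (ucis x * w))) \<le> m * D * D"
proof -
  define s where "s = cmod w"
  have s: "rho < s" "s \<le> 1" using w by (auto simp: s_def)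
  have pos: "0 < rho" "0 < s" using r0 rho s by auto
  \<comment> \<open>The argument of \<open>w\<close> is split off, so that the circle through
    \<open>w\<close> is parametrized by \<open>circ s x\<close> and the rotation sits inside
    \<open>h\<close>.\<close>
  define e where "e = sgn w"
  have e1: "cmod e = 1" using pos by (simp add: e_def norm_sgn s_def)
  have we: "w = of_real s * e" using pos by (simp add: e_def s_def sgn_eq)
  \<comment> \<open>Below \<open>s ^ 2 / r0\<close> the reflected point \<open>s ^ 2 / cnj v\<close>
    has modulus above \<open>r0\<close>; the other bound keeps \<open>v\<close> itself in the
    collar.\<close>
  define R1 where "R1 = min (1 / r0) (s\<^sup>2 / r0)"
  have r1: "1 < 1 / r0" using r0 by simp
  have "s < s\<^sup>2 / r0" using s rho pos r0 by (simp add: field_simps power2_eq_square)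
  then have R1: "s < R1" using r1 s by (simp add: R1_def)
  let ?A = "annulus r0 R1"
  have A0: "0 \<notin> ?A" using r0 by (simp add: annulus_def)
  have va: "v * e \<in> collar" if "v \<in> ?A" for v
    using that e1 by (simp add: annulus_def norm_mult R1_def)
  have vr: "of_real (s\<^sup>2) / cnj v \<in> collar" if "v \<in> ?A" for v
  proof -
    have v: "r0 < cmod v" "cmod v < s\<^sup>2 / r0" using that by (auto simp: annulus_def R1_def)
    have v0: "0 < cmod v" using v r0 by linarith
    have "s\<^sup>2 * r0 \<le> 1 * r0" using s pos r0 by (intro mult_right_mono) (auto simp: power_le_one)
    then have "s\<^sup>2 * r0 < cmod v" using v by linarith
    then show ?thesis using v v0 r0 by (simp add: annulus_def norm_divide norm_power field_simps)
  qed
  define F where "F v = poly p (h (v * e)) * deriv h (v * e) * cnj (deriv h (e * (of_real (s\<^sup>2) / cnj v)))" for v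
  have dh: "(\<lambda>v. deriv h (e * v)) holomorphic_on collar"
    by (rule holomorphic_on_compose_gen[OF _ deriv_h_hol, unfolded o_def])
       (use e1 in \<open>auto intro!: holomorphic_intros simp: annulus_def norm_mult\<close>)
  have F: "F holomorphic_on ?A"
    unfolding F_def
  proof (intro holomorphic_on_mult)
    show "(\<lambda>v. poly p (h (v * e))) holomorphic_on ?A"
      by (intro holomorphic_intros holomorphic_on_compose_gen[OF _ h_hol, unfolded o_def]) (use va in auto)
    show "(\<lambda>v. deriv h (v * e)) holomorphic_on ?A"
      by (rule holomorphic_on_compose_gen[OF _ deriv_h_hol, unfolded o_def]) (use va in \<open>auto intro!: holomorphic_intros\<close>)
    show "(\<lambda>v. cnj (deriv h (e * (of_real (s\<^sup>2) / cnj v)))) holomorphic_on ?A"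
      by (rule reflect_holomorphic[OF dh open_annulus A0 vr])
  qed
  have rad: "of_real (s\<^sup>2) / cnj (circ t x) = circ (s\<^sup>2 / t) x" if "0 < t" for t x
  proof -
    have "inverse (cnj (ucis x)) = ucis x" by (simp add: ucis_def cis_cnj flip: cis_inverse)
    then show ?thesis by (simp add: divide_inverse mult_ac)
  qed
  have "(cmod (deriv h (ucis x * w)))\<^sup>2 *\<^sub>R poly p (h (ucis x * w)) = F (circ s x)" for x
  proof -
    have "e * (of_real (s\<^sup>2) / cnj (circ s x)) = ucis x * w"
      unfolding rad[OF pos(2)] we using pos by (simp add: power2_eq_square)
    moreover have "circ s x * e = ucis x * w" by (simp add: we)
    ultimately show ?thesis unfolding F_def
      by (simp only: scaleR_conv_of_real complex_norm_square) (simp add: mult_ac)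
  qed
  then have "(LINT x|uI. (cmod (deriv h (ucis x * w)))\<^sup>2 *\<^sub>R poly p (h (ucis x * w))) = (LINT x|uI. F (circ s x))" by simp
  also have "\<dots> = (LINT x|uI. F (circ rho x))"
    by (rule mean_annulus_radius[OF F]) (use s rho R1 r0 in auto)
  also have "cmod \<dots> \<le> m * D * D"
  proof (rule mean_norm_bound)
    have "sphere 0 rho \<subseteq> ?A" using rho s R1 by (auto simp: annulus_def)
    from continuous_on_circle[OF holomorphic_continuous[OF F this], of UNIV]
    show "continuous_on UNIV (\<lambda>x. F (circ rho x))" using pos by simp
    fix x
    let ?v = "circ rho x"
    have nv: "cmod (?v * e) = rho" using pos e1 by (simp add: norm_mult)
    have "cmod (e * (of_real (s\<^sup>2) / cnj ?v)) = s\<^sup>2 / rho" unfolding rad[OF pos(1)] using pos e1 by (simp add: norm_mult norm_divide norm_power)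
    moreover have "rho \<le> s\<^sup>2 / rho" using s pos mult_mono[of rho s rho s] by (simp add: field_simps power2_eq_square)
    moreover have "s\<^sup>2 / rho \<le> 1 / rho" using s pos by (intro divide_right_mono) (auto simp: power_le_one)
    ultimately have d2: "cmod (deriv h (e * (of_real (s\<^sup>2) / cnj ?v))) \<le> D" by (intro D) auto
    have "rho \<le> 1 / rho" using pos rho mult_mono[of rho 1 rho 1] by (simp add: field_simps)
    then have d1: "cmod (deriv h (?v * e)) \<le> D" by (intro D) (simp_all add: nv)
    have m1: "cmod (poly p (h (?v * e))) \<le> m" by (rule m[OF nv])
    have D0: "0 \<le> D" using d1 norm_ge_zero order_trans by blast
    have m0: "0 \<le> m" using m1 norm_ge_zero order_trans by blast
    show "cmod (F ?v) \<le> m * D * D"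
      unfolding F_def norm_mult[of _ "cnj _"] norm_mult[of "poly _ _"] complex_mod_cnj
      using d1 d2 m1 D0 m0 by (intro mult_mono mult_nonneg_nonneg) auto
  qed
  finally show ?thesis .
qed

text \<open>\<open>E\<close> splits into the image of a half-collar and a compact remainder in the
  interior. The remainder is estimated directly; on the half-collar the change of variables and
  averaging over rotations reduce the integral to the circular means of
  \<open>collar_mean_bound\<close>.\<close>

lemma area_mean_bound:
  "\<exists>K C. compact K \<and> K \<subseteq> interior E \<and> 0 < C \<and>
    (\<forall>p m. (\<forall>z\<in>K. cmod (poly p z) \<le> m) \<longrightarrow> cmod (LINT z:E|lborel. poly p z) \<le> C * m)"
proof -
  define rho where "rho = (1 + r0) / 2"
  have rho: "r0 < rho" "rho < 1" "0 < rho" using r0 by (auto simp: rho_def)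
  have rhoi: "1 < 1 / rho" "1 / rho < 1 / r0" using rho r0 by (auto simp: divide_strict_left_mono)
  define S where "S = {w. rho < cmod w \<and> cmod w \<le> 1}"
  define V where "V = annulus rho (1 / rho)"
  have Vsub: "V \<subseteq> collar" using rho rhoi by (auto simp: V_def annulus_def)
  have SV: "S \<subseteq> V" using rhoi by (auto simp: S_def V_def annulus_def)
  have Ssub: "S \<subseteq> collar" using SV Vsub by blast
  have oV: "open (h ` V)"
    by (rule open_mapping_thm3[OF holomorphic_on_subset[OF h_hol Vsub] _ inj_on_subset[OF h_inj Vsub]]) (simp add: V_def open_annulus)
  have hS: "h ` S = E \<inter> h ` V"
  proof
    show "h ` S \<subseteq> E \<inter> h ` V"
    proof
      fix z assume "z \<in> h ` S"
      then obtain w where w: "w \<in> S" "z = h w" by blast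
      have "h w \<in> E"
      proof (cases "cmod w = 1")
        case False
        then have "h w \<in> interior E" using w rho by (intro h_inner) (auto simp: S_def)
        then show ?thesis using interior_subset by blast
      qed (rule circle_in_E)
      then show "z \<in> E \<inter> h ` V" using w SV by blast
    qed
    show "E \<inter> h ` V \<subseteq> h ` S"
    proof
      fix z assume "z \<in> E \<inter> h ` V"
      then obtain w where w: "w \<in> V" "z = h w" "h w \<in> E" by blast
      have "cmod w < 1 / r0" using w(1) rhoi by (auto simp: V_def annulus_def)
      then have "cmod w \<le> 1" using h_outer[of w] w(3) by force
      then show "z \<in> h ` S" using w by (auto simp: S_def V_def annulus_def)
    qed
  qed
  have bE: "E \<in> sets borel" using compact_E by (simp add: borel_compact)
  have bS: "S \<in> sets borel"
  proof -
    have "S = cball 0 1 - cball 0 rho" by (auto simp: S_def)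
    then show ?thesis by simp
  qed
  have bhS: "h ` S \<in> sets borel" unfolding hS using bE oV by auto
  define K1 where "K1 = E - h ` V"
  have cK1: "compact K1" unfolding K1_def by (rule compact_diff[OF compact_E oV])
  have "sphere 0 1 \<subseteq> V" using rho rhoi by (auto simp: V_def annulus_def)
  then have K1i: "K1 \<subseteq> interior E" using h_circle(1) unfolding K1_def by blast
  have sph: "sphere 0 rho \<subseteq> collar"
  proof -
    have "rho < 1 / r0" using rho rhoi by linarith
    then show ?thesis using rho by (auto simp: annulus_def)
  qed
  define K where "K = K1 \<union> h ` sphere 0 rho"
  have K: "compact K" "K \<subseteq> interior E"
  proof -
    have "compact (h ` sphere 0 rho)" by (intro compact_continuous_image continuous_on_subset[OF h_continuous sph]) auto
    then show "compact K" unfolding K_def using cK1 by (rule compact_Un[rotated])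
    have "h ` sphere 0 rho \<subseteq> interior E" using h_inner rho by auto
    then show "K \<subseteq> interior E" unfolding K_def using K1i by blast
  qed
  have cs: "compact (cball 0 (1 / rho) - ball (0::complex) rho)" by (intro compact_diff) auto
  have "cball 0 (1 / rho) - ball 0 rho \<subseteq> collar" using rho rhoi by (auto simp: annulus_def)
  from compact_norm_bound[OF cs holomorphic_continuous[OF deriv_h_hol this]]
  obtain D where D: "0 < D" "\<And>v. v \<in> cball 0 (1 / rho) - ball 0 rho \<Longrightarrow> cmod (deriv h v) \<le> D" by blast
  have D': "cmod (deriv h v) \<le> D" if "rho \<le> cmod v" "cmod v \<le> 1 / rho" for v using D(2)[of v] that by simp
  \<comment> \<open>\<open>pi * 4\<close> is the area of \<open>ball 0 2\<close>, which contains the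
    half-collar \<open>S\<close>.\<close>
  define C where "C = measure lborel E + D * D * (pi * 4)"
  have "cmod (LINT z:E|lborel. poly p z) \<le> C * m" if m: "\<forall>z\<in>K. cmod (poly p z) \<le> m" for p m
  proof -
    have m0: "0 \<le> m"
    proof -
      have "h (of_real rho) \<in> K" unfolding K_def using rho by auto
      then have "cmod (poly p (h (of_real rho))) \<le> m" using m by blast
      then show ?thesis using norm_ge_zero order_trans by blast
    qed
    have iE: "set_integrable lborel E (poly p)"
      unfolding set_integrable_def by (rule borel_integrable_compact[OF compact_E]) (auto intro!: continuous_intros)
    have iS: "set_integrable lborel (h ` S) (poly p)" by (rule set_integrable_subset[OF iE]) (use bhS hS in auto)
    have iK: "set_integrable lborel K1 (poly p)" by (rule set_integrable_subset[OF iE]) (use cK1 in \<open>auto simp: borel_compact K1_def\<close>)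
    have "E = K1 \<union> h ` S" "K1 \<inter> h ` S = {}" unfolding hS K1_def by blast+
    then have split: "(LINT z:E|lborel. poly p z) = (LINT z:K1|lborel. poly p z) + (LINT z:h ` S|lborel. poly p z)"
      using set_integral_Un[OF _ iK iS] by simp
    have fE: "emeasure lborel E < \<infinity>" using emeasure_compact_finite[OF compact_E] by simp
    have b1: "cmod (LINT z:K1|lborel. poly p z) \<le> measure lborel E * m"
    proof -
      have "cmod (LINT z:K1|lborel. poly p z) \<le> (LINT z|lborel. norm (indicator K1 z *\<^sub>R poly p z))"
        unfolding set_lebesgue_integral_def by (rule integral_norm_bound)
      also have "\<dots> \<le> (LINT z|lborel. indicator E z * m)"
      proof (rule integral_mono)
        show "integrable lborel (\<lambda>z. norm (indicator K1 z *\<^sub>R poly p z))" using iK unfolding set_integrable_def by (rule integrable_norm)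
        show "integrable lborel (\<lambda>z. indicator E z * m)" using bE fE by (intro integrable_mult_left integrable_real_indicator) auto
        fix z show "norm (indicator K1 z *\<^sub>R poly p z) \<le> indicator E z * m"
          using m m0 by (auto simp: indicator_def K_def K1_def)
      qed
      also have "\<dots> = measure lborel E * m" using bE by simp
      finally show ?thesis .
    qed
    define J where "J w = (cmod (deriv h w))\<^sup>2 *\<^sub>R poly p (h w)" for w
    have cv: "set_integrable lborel S J" "(LINT z:h ` S|lborel. poly p z) = (LINT w:S|lborel. J w)"
      unfolding J_def
      by (rule holomorphic_change_of_variables[OF open_annulus h_hol h_inj Ssub bS bhS _ iS], intro continuous_intros)+
    have "(LINT w:S|lborel. J w) = (LINT w|lborel. (LINT x|uI. indicator S (ucis x * w) *\<^sub>R J (ucis x * w)))"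
      unfolding set_lebesgue_integral_def by (rule rotation_average) (use cv(1) in \<open>simp add: set_integrable_def\<close>)
    also have "cmod \<dots> \<le> (LINT w|lborel. norm (LINT x|uI. indicator S (ucis x * w) *\<^sub>R J (ucis x * w)))"
      by (rule integral_norm_bound)
    also have "\<dots> \<le> (LINT w|lborel. indicator (ball (0::complex) 2) w * (m * D * D))"
    proof (rule integral_mono')
      show "integrable lborel (\<lambda>w. indicator (ball (0::complex) 2) w * (m * D * D))"
        by (intro integrable_mult_left integrable_real_indicator) (auto simp: emeasure_ball_complex)
      fix w :: complex
      show "0 \<le> indicator (ball (0::complex) 2) w * (m * D * D)" using m0 D(1) by simp
      show "norm (LINT x|uI. indicator S (ucis x * w) *\<^sub>R J (ucis x * w)) \<le> indicator (ball (0::complex) 2) w * (m * D * D)"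
      proof (cases "w \<in> S")
        case True
        then have "ucis x * w \<in> S" for x by (simp add: S_def norm_mult)
        then have "(LINT x|uI. indicator S (ucis x * w) *\<^sub>R J (ucis x * w)) = (LINT x|uI. J (ucis x * w))" by simp
        moreover have "cmod (LINT x|uI. J (ucis x * w)) \<le> m * D * D"
          unfolding J_def by (rule collar_mean_bound[OF rho(1,2) D']) (use True m in \<open>auto simp: S_def K_def\<close>)
        moreover have "w \<in> ball 0 2" using True by (simp add: S_def)
        ultimately show ?thesis by simp
      next
        case False
        then have "ucis x * w \<notin> S" for x by (simp add: S_def norm_mult)
        then show ?thesis using m0 D(1) by simp
      qed
    qed
    also have "\<dots> = D * D * (pi * 4) * m" by (simp add: measure_ball_complex)
    finally have b2: "cmod (LINT z:h ` S|lborel. poly p z) \<le> D * D * (pi * 4) * m" unfolding cv(2) .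
    have "cmod (LINT z:E|lborel. poly p z) \<le> measure lborel E * m + D * D * (pi * 4) * m"
      unfolding split by (rule order_trans[OF norm_triangle_ineq add_mono[OF b1 b2]])
    then show ?thesis by (simp add: C_def algebra_simps)
  qed
  moreover have "0 < C" unfolding C_def using D(1) by (intro add_nonneg_pos mult_pos_pos) auto
  ultimately show ?thesis using K by blast
qed

lemma bergman_admissible:
  assumes "bergman_polys E B"
  shows "admissible B"
proof -
  have deg: "degree (B k) = k" for k using assms by (simp add: bergman_polys_def)
  have orth: "(LINT z:E|lborel. poly (B j) z * cnj (poly (B k) z)) = (if j = k then 1 else 0)" for j k
    using assms by (simp add: bergman_polys_def)
  define nu where "nu = density lborel (\<lambda>z. ennreal (indicator E z))"
  have bE[measurable]: "E \<in> sets borel" using compact_E by (simp add: borel_compact)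
  have I: "(LINT z|nu. f z) = (LINT z:E|lborel. f z)" if "f \<in> borel_measurable borel" for f :: "complex \<Rightarrow> complex"
    unfolding nu_def set_lebesgue_integral_def using that by (subst integral_density) auto
  have Ir: "(LINT z|nu. f z) = (LINT z:E|lborel. f z)" if "f \<in> borel_measurable borel" for f :: "complex \<Rightarrow> real"
    unfolding nu_def set_lebesgue_integral_def using that by (subst integral_density) auto
  have fin: "finite_measure nu"
  proof
    have "emeasure nu UNIV = emeasure lborel E" unfolding nu_def by (subst emeasure_density) (auto simp: ennreal_indicator)
    then show "emeasure nu (space nu) \<noteq> \<infinity>" using emeasure_compact_finite[OF compact_E] by (simp add: nu_def)
  qed
  have cm: "(\<lambda>z. poly (B j) z * cnj (poly (B k) z)) \<in> borel_measurable borel" for j k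
    by (intro borel_measurable_continuous_onI continuous_intros)
  show ?thesis
  proof (rule orthonormal_admissible[OF fin])
    show "sets nu = sets borel" by (simp add: nu_def)
    show "AE z in nu. z \<in> E" unfolding nu_def by (subst AE_density) (auto simp: indicator_def)
    show "degree (B k) = k" for k by (rule deg)
    show "(LINT z|nu. poly (B j) z * cnj (poly (B k) z)) = (if j = k then 1 else 0)" for j k
      unfolding I[OF cm] by (rule orth)
    show "\<exists>C\<ge>0. \<forall>p. \<forall>z\<in>K. cmod (poly p z) \<le> C * (LINT z|nu. cmod (poly p z))" if "compact K" "K \<subseteq> interior E" for K
      using area_interior_bound[OF that] by (simp add: Ir)
    show "\<exists>K C. compact K \<and> K \<subseteq> interior E \<and> 0 < C \<and> (\<forall>p m. (\<forall>z\<in>K. cmod (poly p z) \<le> m) \<longrightarrow> cmod (LINT z|nu. poly p z) \<le> C * m)"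
      using area_mean_bound by (simp add: I)
  qed
qed

end

section \<open>Equidistribution of zeros\<close>

lemma subexponential_log:
  fixes X :: "nat \<Rightarrow> real"
  assumes sub: "\<And>eps. 0 < eps \<Longrightarrow> \<exists>C>0. \<forall>n. X n \<le> C * exp (eps * real n)" and ge: "\<And>n. 1 \<le> X n"
  shows "(\<lambda>n. ln (X n) / real n) \<longlonglongrightarrow> 0"
proof (rule LIMSEQ_I)
  fix r :: real assume r: "0 < r"
  obtain C where C: "0 < C" "\<And>n. X n \<le> C * exp (r / 2 * real n)" using sub[of "r / 2"] r by auto
  have "(\<lambda>n. ln C / real n) \<longlonglongrightarrow> 0" by (rule lim_const_over_n)
  then obtain N where N: "\<And>n. N \<le> n \<Longrightarrow> \<bar>ln C / real n\<bar> < r / 2"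
    using LIMSEQ_D[of "\<lambda>n. ln C / real n" 0 "r / 2"] r by (auto simp del: abs_divide)
  have "norm (ln (X n) / real n - 0) < r" if n: "max N 1 \<le> n" for n
  proof -
    have n0: "0 < real n" using n by simp
    have "ln (X n) \<le> ln (C * exp (r / 2 * real n))" using C ge[of n] by (intro ln_mono) auto
    also have "\<dots> = ln C + r / 2 * real n" using C by (simp add: ln_mult)
    finally have "ln (X n) / real n \<le> (ln C + r / 2 * real n) / real n" using n0 by (intro divide_right_mono) auto
    also have "\<dots> = ln C / real n + r / 2" using n0 by (simp add: add_divide_distrib)
    also have "\<dots> < r" using N[of n] n abs_le_D1[of "ln C / real n" "\<bar>ln C / real n\<bar>"] by (simp del: abs_divide)
    finally show ?thesis using ge[of n] n0 by simp
  qed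
  then show "\<exists>N. \<forall>n\<ge>N. norm (ln (X n) / real n - 0) < r" by blast
qed

lemma subexponential_max:
  fixes X :: "nat \<Rightarrow> real"
  assumes "\<exists>C>0. \<forall>n. X n \<le> C * exp (eps * real n)" and eps: "0 < eps"
  shows "\<exists>C>0. \<forall>n. max 1 (X n) \<le> C * exp (eps * real n)"
proof -
  obtain C where C: "0 < C" "\<And>n. X n \<le> C * exp (eps * real n)" using assms(1) by blast
  have "max 1 (X n) \<le> (1 + C) * exp (eps * real n)" for n
    using C(2)[of n] C(1) eps by (simp add: distrib_right add_increasing2 add_increasing)
  then show ?thesis using C(1) by (intro exI[of _ "1 + C"]) auto
qed

lemma subexponential_mult:
  fixes X Y :: "nat \<Rightarrow> real"
  assumes "\<And>eps. 0 < eps \<Longrightarrow> \<exists>C>0. \<forall>n. X n \<le> C * exp (eps * real n)" "\<And>eps. 0 < eps \<Longrightarrow> \<exists>C>0. \<forall>n. Y n \<le> C * exp (eps * real n)"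
    and "\<And>n. 0 \<le> X n" "\<And>n. 0 \<le> Y n" and eps: "0 < eps"
  shows "\<exists>C>0. \<forall>n. X n * Y n \<le> C * exp (eps * real n)"
proof -
  obtain C1 where C1: "0 < C1" "\<And>n. X n \<le> C1 * exp (eps / 2 * real n)" using assms(1)[of "eps / 2"] eps by auto
  obtain C2 where C2: "0 < C2" "\<And>n. Y n \<le> C2 * exp (eps / 2 * real n)" using assms(2)[of "eps / 2"] eps by auto
  have "X n * Y n \<le> C1 * C2 * exp (eps * real n)" for n
  proof -
    have "X n * Y n \<le> (C1 * exp (eps / 2 * real n)) * (C2 * exp (eps / 2 * real n))"
      using C1 C2 assms by (intro mult_mono) auto
    also have "\<dots> = C1 * C2 * (exp (eps / 2 * real n) * exp (eps / 2 * real n))" by simp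
    also have "exp (eps / 2 * real n) * exp (eps / 2 * real n) = exp (eps * real n)" by (simp flip: exp_add)
    finally show ?thesis .
  qed
  then show ?thesis using C1 C2 by (intro exI[of _ "C1 * C2"]) auto
qed

context exterior_conformal
begin

text \<open>A level curve sufficiently close to \<open>E\<close> lies inside the circle, so its side
  of \<open>mean_green_level\<close> is \<open>ln T\<close>, while on the circle
  \<open>green\<close> is at least \<open>- ln rho\<close> and the maximum on the other side reduces
  to \<open>green\<close>.\<close>

lemma mean_green_circle:
  assumes T: "0 < T" "E \<subseteq> ball 0 T"
  shows "(LINT x|uI. green (circ T x)) = ln T - ln (cmod c)"
proof -
  obtain rho0 where rho0: "0 < rho0" "rho0 < 1" "\<And>z. z \<notin> ball 0 T \<Longrightarrow> cmod (kap z) \<le> rho0" by (rule kappa_exhaust[OF open_ball T(2)]) blast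
  define rho where "rho = (rho0 + 1) / 2"
  have rho: "0 < rho" "rho < 1" "rho0 < rho" using rho0 by (auto simp: rho_def)
  have "max T (cmod (0 - psi (circ rho y))) = T" for y
  proof -
    have b: "circ rho y \<in> ball 0 1 - {0}" using rho by (simp add: norm_mult)
    have "psi (circ rho y) \<in> ball 0 T"
    proof (rule ccontr)
      assume "psi (circ rho y) \<notin> ball 0 T"
      from rho0(3)[OF this] show False using rho unfolding kappa_psi[OF b] by (simp add: norm_mult)
    qed
    then show ?thesis by simp
  qed
  moreover have "max (- ln rho) (green (0 + circ T x)) = green (circ T x)" for x
  proof -
    let ?z = "circ T x"
    have nb: "?z \<notin> ball 0 T" using T by (simp add: norm_mult)
    then have "?z \<notin> E" using T by blast
    moreover have "ln (cmod (kap ?z)) \<le> ln rho"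
      using rho0(3)[OF nb] rho kappa_bounds(1)[OF \<open>?z \<notin> E\<close>] by (intro ln_mono) auto
    ultimately show ?thesis by (simp add: green_def)
  qed
  ultimately show ?thesis using mean_green_level[OF rho(1,2) T(1), of 0] uI.prob_space by simp
qed

text \<open>By Jensen's formula the mean over the circle of the quantity on the left is at most the
  bound without \<open>dlt\<close>. The slack \<open>dlt\<close> leaves room to pick a point that is
  not a root.\<close>

lemma exterior_point:
  fixes p :: "complex poly"
  assumes T: "0 < T" "E \<subseteq> ball 0 T" and p: "p \<noteq> 0" "degree p = n" "0 < n" and dlt: "0 < dlt"
  shows "\<exists>y. cmod y = T \<and> poly p y \<noteq> 0 \<and> green y - ln (cmod (poly p y)) / real n \<le> - (ln (cmod c ^ n * cmod (lead_coeff p)) / real n) + dlt"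
proof (rule ccontr)
  assume neg: "\<not> ?thesis"
  let ?b = "- (ln (cmod c ^ n * cmod (lead_coeff p)) / real n)"
  let ?e = "\<lambda>x. 0 + circ T x"
  have "continuous_on UNIV (\<lambda>x. green (?e x))" by (rule continuous_on_compose2[OF green_continuous]) (auto intro!: continuous_intros)
  then have ig: "integrable uI (\<lambda>x. green (?e x))" by (rule integrable_uI_continuous)
  have il: "integrable uI (\<lambda>x. ln (cmod (poly p (?e x))) / real n)" using mean_ln_poly(2)[OF p(1) T(1), of 0] by auto
  have "AE x in uI. poly p (?e x) \<noteq> 0" by (rule poly_circle_nonzero_AE[OF p(1) T(1)])
  then have "AE x in uI. ?b + dlt \<le> green (?e x) - ln (cmod (poly p (?e x))) / real n"
  proof eventually_elim
    case (elim x)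
    have "cmod (?e x) = T" using T by (simp add: norm_mult)
    then show ?case using neg elim by force
  qed
  then have "(LINT x|uI. ?b + dlt) \<le> (LINT x|uI. green (?e x) - ln (cmod (poly p (?e x))) / real n)"
    by (intro integral_mono_AE Bochner_Integration.integrable_diff ig il) auto
  also have "\<dots> = (LINT x|uI. green (?e x)) - (LINT x|uI. ln (cmod (poly p (?e x)))) / real n"
    by (subst Bochner_Integration.integral_diff[OF ig il]) simp
  also have "(LINT x|uI. green (?e x)) = ln T - ln (cmod c)" using mean_green_circle[OF T] by simp
  also have "ln T - ln (cmod c) - (LINT x|uI. ln (cmod (poly p (?e x)))) / real n \<le> ?b"
  proof -
    have "(\<Sum>a\<in>{a. poly p a = 0}. real (order a p) * ln T) \<le> (\<Sum>a\<in>{a. poly p a = 0}. real (order a p) * ln (max T (cmod (0 - a))))"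
      using T by (intro sum_mono mult_left_mono ln_mono) auto
    moreover have "(\<Sum>a\<in>{a. poly p a = 0}. real (order a p) * ln T) = real n * ln T"
      using sum_order_eq_degree[OF p(1)] p(2) by (simp flip: sum_distrib_right of_nat_sum)
    ultimately have "ln (cmod (lead_coeff p)) + real n * ln T \<le> (LINT x|uI. ln (cmod (poly p (?e x))))"
      unfolding mean_ln_poly(1)[OF p(1) T(1)] by simp
    then have "(ln (cmod (lead_coeff p)) + real n * ln T) / real n \<le> (LINT x|uI. ln (cmod (poly p (?e x)))) / real n"
      by (intro divide_right_mono) auto
    moreover have "ln (cmod c ^ n * cmod (lead_coeff p)) = real n * ln (cmod c) + ln (cmod (lead_coeff p))"
      using c_nonzero p(1) by (simp add: ln_mult ln_realpow)
    ultimately show ?thesis using p(3) by (simp add: add_divide_distrib)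
  qed
  finally have "?b + dlt \<le> ?b" using uI.prob_space by simp
  then show False using dlt by simp
qed

end

context oriented_jordan
begin

text \<open>Convergence is shown by contradiction: along a subsequence staying away from the limit,
  compactness makes the almost extremal points converge, one sequence inside
  \<open>interior E\<close> and one outside \<open>E\<close>, and these limits are the starting
  points from which smallness of the defect spreads.\<close>

theorem zeros_equidistribute:
  assumes eq: "equilibrium_measure E \<mu>" and adm: "admissible B"
    and nz: "\<And>k. a k \<noteq> 0"
    and up: "\<And>eps. 0 < eps \<Longrightarrow> \<exists>C>0. \<forall>k. cmod (a k) \<le> C * exp (eps * real k)"
    and lo: "\<And>eps. 0 < eps \<Longrightarrow> \<exists>C>0. \<forall>k. 1 / cmod (a k) \<le> C * exp (eps * real k)"
  shows "weak_conv_zeros (\<lambda>n. \<Sum>k\<le>n. smult (a k) (B k)) \<mu>"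
proof -
  define P where "P n = (\<Sum>k\<le>n. smult (a k) (B k))" for n
  have deg: "degree (B k) = k" for k using adm by (simp add: admissible_def)
  have Bup: "\<exists>C>0. \<forall>k. \<forall>z\<in>E. cmod (poly (B k) z) \<le> C * exp (eps * real k)" if "0 < eps" for eps
    using conjunct1[OF conjunct2[OF adm[unfolded admissible_def]]] that by (elim allE impE)
  have Blo: "\<exists>C>0. \<forall>k. 1 \<le> C * exp (eps * real k) * cmod c ^ k * cmod (lead_coeff (B k))" if "0 < eps" for eps
    using conjunct1[OF conjunct2[OF conjunct2[OF adm[unfolded admissible_def]]]] that by (elim allE impE)
  note adm4 = conjunct2[OF conjunct2[OF conjunct2[OF adm[unfolded admissible_def]]]]
  obtain K C0 where K: "compact K" "K \<subseteq> interior E" "0 < C0"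
    and Km': "\<forall>a n m. (\<forall>z\<in>K. cmod (poly (\<Sum>k\<le>n. smult (a k) (B k)) z) \<le> m) \<longrightarrow> cmod (a 0) \<le> C0 * m"
    using adm4 by (elim exE conjE) (rule that)
  have Km: "(\<forall>z\<in>K. cmod (poly (P n) z) \<le> m) \<Longrightarrow> cmod (a 0) \<le> C0 * m" for n m
    unfolding P_def by (rule Km'[THEN spec, THEN spec, THEN spec, THEN mp])
  have lcB: "0 < cmod c ^ k * cmod (lead_coeff (B k))" for k
  proof -
    obtain C where "0 < C" "1 \<le> C * exp (1 * real k) * cmod c ^ k * cmod (lead_coeff (B k))" using Blo[of 1] by auto
    then have "lead_coeff (B k) \<noteq> 0" by (metis mult_zero_right norm_zero not_one_le_zero)
    then show ?thesis using c_nonzero by simp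
  qed
  have cP: "coeff (P n) n = a n * lead_coeff (B n)" for n
  proof -
    have "coeff (P n) n = (\<Sum>k\<le>n. a k * coeff (B k) n)" by (simp add: P_def coeff_sum)
    also have "\<dots> = (\<Sum>k\<in>{n}. a k * coeff (B k) n)"
      by (rule sum.mono_neutral_right) (auto simp: coeff_eq_0 deg)
    finally show ?thesis by (simp add: deg)
  qed
  have cPn: "coeff (P n) n \<noteq> 0" for n using cP[of n] nz[of n] lcB[of n] by auto
  have degP: "degree (P n) = n" for n
  proof (rule antisym)
    show "degree (P n) \<le> n" unfolding P_def
      by (rule degree_sum_le) (auto intro!: order_trans[OF degree_smult_le] simp: deg)
    show "n \<le> degree (P n)" by (rule le_degree[OF cPn])
  qed
  have Pnz: "P n \<noteq> 0" for n using cPn[of n] by auto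
  have Pup: "\<exists>C>0. \<forall>n. \<forall>z\<in>E. cmod (poly (P n) z) \<le> C * exp (eps * real n)" if eps: "0 < eps" for eps
  proof -
    \<comment> \<open>One third of \<open>eps\<close> is spent on the coefficients, one on the
      basis, and one on the number of terms \<open>n + 1\<close>, with \<open>D\<close> as its
      constant.\<close>
    obtain C1 where C1: "0 < C1" "\<And>k. cmod (a k) \<le> C1 * exp (eps / 3 * real k)" using up[of "eps / 3"] eps by auto
    obtain C2 where C2: "0 < C2" "\<And>k z. z \<in> E \<Longrightarrow> cmod (poly (B k) z) \<le> C2 * exp (eps / 3 * real k)" using Bup[of "eps / 3"] eps by auto
    define D where "D = max 1 (3 / eps)"
    have "cmod (poly (P n) z) \<le> (C1 * C2 * D) * exp (eps * real n)" if z: "z \<in> E" for n z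
    proof -
      have "cmod (poly (P n) z) \<le> (\<Sum>k\<le>n. cmod (a k * poly (B k) z))" unfolding P_def poly_sum poly_smult by (rule norm_sum)
      also have "\<dots> \<le> (\<Sum>k\<le>n. C1 * C2 * exp (2 * eps / 3 * real n))"
      proof (rule sum_mono)
        fix k assume "k \<in> {..n}"
        then have kn: "exp (eps / 3 * real k) \<le> exp (eps / 3 * real n)" using eps by simp
        have "cmod (a k * poly (B k) z) \<le> (C1 * exp (eps / 3 * real n)) * (C2 * exp (eps / 3 * real n))"
          unfolding norm_mult
        proof (rule mult_mono)
          show "cmod (a k) \<le> C1 * exp (eps / 3 * real n)"
            using C1(2)[of k] mult_left_mono[OF kn, of C1] C1(1) by linarith
          show "cmod (poly (B k) z) \<le> C2 * exp (eps / 3 * real n)"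
            using C2(2)[OF z, of k] mult_left_mono[OF kn, of C2] C2(1) by linarith
        qed (use C1 in auto)
        also have "\<dots> = C1 * C2 * (exp (eps / 3 * real n) * exp (eps / 3 * real n))" by simp
        also have "exp (eps / 3 * real n) * exp (eps / 3 * real n) = exp (2 * eps / 3 * real n)" by (simp flip: exp_add)
        finally show "cmod (a k * poly (B k) z) \<le> C1 * C2 * exp (2 * eps / 3 * real n)" .
      qed
      also have "\<dots> = C1 * C2 * (real (n + 1) * exp (2 * eps / 3 * real n))" by simp
      also have "\<dots> \<le> C1 * C2 * (D * exp (eps * real n))"
      proof (rule mult_left_mono)
        have "real (n + 1) \<le> D * (1 + eps / 3 * real n)"
        proof -
          have "1 \<le> D" "1 \<le> D * (eps / 3)" using eps by (auto simp: D_def max_def field_simps)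
          then have "real n \<le> D * (eps / 3) * real n" by (metis mult_right_mono mult_1 of_nat_0_le_iff)
          then show ?thesis using \<open>1 \<le> D\<close> by (simp add: algebra_simps)
        qed
        also have "\<dots> \<le> D * exp (eps / 3 * real n)" by (intro mult_left_mono exp_ge_add_one_self) (simp add: D_def)
        finally have "real (n + 1) * exp (2 * eps / 3 * real n) \<le> D * exp (eps / 3 * real n) * exp (2 * eps / 3 * real n)"
          by (intro mult_right_mono) auto
        also have "\<dots> = D * exp (eps / 3 * real n + 2 * eps / 3 * real n)" by (simp only: exp_add mult.assoc)
        also have "eps / 3 * real n + 2 * eps / 3 * real n = eps * real n" by (simp add: field_simps)
        finally show "real (n + 1) * exp (2 * eps / 3 * real n) \<le> D * exp (eps * real n)" .
      qed (use C1 C2 in auto)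
      finally show ?thesis by (simp add: mult.assoc)
    qed
    moreover have "0 < C1 * C2 * D" using C1 C2 by (simp add: D_def)
    ultimately show ?thesis by blast
  qed
  \<comment> \<open>The maximum with \<open>1\<close> makes \<open>eps\<close> nonnegative, also
    when the polynomial is small on \<open>E\<close>.\<close>
  define M where "M n = max 1 (SUP z\<in>E. cmod (poly (P n) z))" for n
  define eps where "eps n = ln (M n) / real n" for n
  have bdd: "bdd_above ((\<lambda>z. cmod (poly (P n) z)) ` E)" for n
    by (intro compact_imp_bounded bounded_imp_bdd_above compact_continuous_image compact_E continuous_intros)
  have Ene: "E \<noteq> {}" using int_ne interior_subset by blast
  have M1: "1 \<le> M n" for n by (simp add: M_def)
  have eps0: "0 \<le> eps n" for n using M1[of n] by (simp add: eps_def)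
  have epslim: "eps \<longlonglongrightarrow> 0"
    unfolding eps_def
  proof (rule subexponential_log[OF _ M1])
    fix e :: real assume e: "0 < e"
    then obtain C where C: "0 < C" "\<And>n z. z \<in> E \<Longrightarrow> cmod (poly (P n) z) \<le> C * exp (e * real n)" using Pup by blast
    have "(SUP z\<in>E. cmod (poly (P n) z)) \<le> C * exp (e * real n)" for n using C(2) by (intro cSUP_least Ene)
    then show "\<exists>C>0. \<forall>n. M n \<le> C * exp (e * real n)"
      unfolding M_def using C(1) by (intro subexponential_max e) blast
  qed
  have upper: "cmod (poly (P n) z) \<le> exp (real n * (green z + eps n))" if n: "0 < n" for n z
  proof -
    have "cmod (poly (P n) z) \<le> M n * exp (real (degree (P n)) * green z)"
    proof (rule bernstein_walsh)
      fix z assume "z \<in> E"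
      then have "cmod (poly (P n) z) \<le> (SUP z\<in>E. cmod (poly (P n) z))" by (intro cSUP_upper bdd)
      then show "cmod (poly (P n) z) \<le> M n" by (simp add: M_def)
    qed (use M1[of n] in simp)
    also have "M n = exp (real n * eps n)" using M1[of n] n by (simp add: eps_def)
    also have "exp (real n * eps n) * exp (real (degree (P n)) * green z) = exp (real n * (green z + eps n))"
      unfolding degP by (simp flip: exp_add add: algebra_simps)
    finally show ?thesis .
  qed
  define v where "v n = max 1 (1 / (cmod c ^ n * cmod (lead_coeff (P n))))" for n
  have vlim: "(\<lambda>n. ln (v n) / real n) \<longlonglongrightarrow> 0"
  proof (rule subexponential_log)
    show "1 \<le> v n" for n by (simp add: v_def)
    fix e :: real assume e: "0 < e"
    have "\<exists>C>0. \<forall>n. (1 / cmod (a n)) * (1 / (cmod c ^ n * cmod (lead_coeff (B n)))) \<le> C * exp (e * real n)"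
    proof (rule subexponential_mult[OF lo _ _ _ e])
      fix e' :: real assume e': "0 < e'"
      then obtain C where C: "0 < C" "\<And>k. 1 \<le> C * exp (e' * real k) * cmod c ^ k * cmod (lead_coeff (B k))" using Blo by blast
      have "1 / (cmod c ^ n * cmod (lead_coeff (B n))) \<le> C * exp (e' * real n)" for n
        using C(2)[of n] lcB[of n] by (simp add: pos_divide_le_eq mult.assoc)
      then show "\<exists>C>0. \<forall>n. 1 / (cmod c ^ n * cmod (lead_coeff (B n))) \<le> C * exp (e' * real n)" using C(1) by blast
    qed auto
    moreover have "(1 / cmod (a n)) * (1 / (cmod c ^ n * cmod (lead_coeff (B n)))) = 1 / (cmod c ^ n * cmod (lead_coeff (P n)))" for n
      unfolding degP cP by (simp add: norm_mult mult_ac)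
    ultimately show "\<exists>C>0. \<forall>n. v n \<le> C * exp (e * real n)"
      unfolding v_def by (intro subexponential_max e) (simp only:)
  qed
  obtain T where T: "0 < T" "E \<subseteq> ball 0 T"
    using compact_imp_bounded[OF compact_E] bounded_subset_ballD[of E 0] by blast
  have "\<exists>y. cmod y = T \<and> (0 < n \<longrightarrow> poly (P n) y \<noteq> 0 \<and> green y - ln (cmod (poly (P n) y)) / real n \<le> ln (v n) / real n + 1 / real n)" for n
  proof (cases "0 < n")
    case True
    obtain y where y: "cmod y = T" "poly (P n) y \<noteq> 0"
      "green y - ln (cmod (poly (P n) y)) / real n \<le> - (ln (cmod c ^ n * cmod (lead_coeff (P n))) / real n) + 1 / real n"
      using exterior_point[OF T Pnz degP True, of "1 / real n"] True by auto
    have pos: "0 < cmod c ^ n * cmod (lead_coeff (P n))" using c_nonzero Pnz[of n] by simp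
    have "- ln (cmod c ^ n * cmod (lead_coeff (P n))) = ln (1 / (cmod c ^ n * cmod (lead_coeff (P n))))"
      using c_nonzero Pnz[of n] by (simp add: ln_div)
    also have "\<dots> \<le> ln (v n)" using pos by (intro ln_mono) (auto simp: v_def)
    finally have "- ln (cmod c ^ n * cmod (lead_coeff (P n))) / real n \<le> ln (v n) / real n" by (rule divide_right_mono) simp
    then have "- (ln (cmod c ^ n * cmod (lead_coeff (P n))) / real n) \<le> ln (v n) / real n" by (simp only: minus_divide_left)
    then show ?thesis using y by (intro exI[of _ y]) auto
  next
    case False
    then show ?thesis using T by (intro exI[of _ "of_real T"]) auto
  qed
  then obtain y where y: "\<And>n. cmod (y n) = T" "\<And>n. 0 < n \<Longrightarrow> poly (P n) (y n) \<noteq> 0"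
    "\<And>n. 0 < n \<Longrightarrow> green (y n) - ln (cmod (poly (P n) (y n))) / real n \<le> ln (v n) / real n + 1 / real n" by metis
  \<comment> \<open>Half of the lower bound that admissibility gives for the maximum over
    \<open>K\<close>, so that it is strictly exceeded.\<close>
  define eta where "eta = cmod (a 0) / (2 * C0)"
  have eta: "0 < eta" using nz[of 0] K(3) by (simp add: eta_def)
  have "\<exists>x\<in>K. eta < cmod (poly (P n) x)" for n
  proof (rule ccontr)
    assume "\<not> ?thesis"
    then have "cmod (a 0) \<le> C0 * eta" by (intro Km[of n]) (auto simp: not_less)
    then show False using nz[of 0] K(3) by (simp add: eta_def)
  qed
  then obtain x where x: "\<And>n. x n \<in> K" "\<And>n. eta < cmod (poly (P n) (x n))" by metis
  note eqf = equilibrium_energy(1-3)[OF eq]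
  have "(\<lambda>n. zero_count_int n (P n) f) \<longlonglongrightarrow> (\<integral>z. f z \<partial>\<mu>)" if f: "continuous_on UNIV f" "bounded (range f)" for f
  proof (rule ccontr)
    let ?X = "\<lambda>n. zero_count_int n (P n) f" and ?L = "\<integral>z. f z \<partial>\<mu>"
    assume "\<not> ?X \<longlonglongrightarrow> ?L"
    then obtain e where e: "0 < e" "\<And>N. \<exists>n\<ge>N. e \<le> dist (?X n) ?L"
      unfolding lim_sequentially by (meson not_less)
    then have inf: "infinite {n. e \<le> dist (?X n) ?L}" unfolding infinite_nat_iff_unbounded_le by blast
    obtain r :: "nat \<Rightarrow> nat" where r: "strict_mono r" "\<And>n. r n \<in> {n. e \<le> dist (?X n) ?L}"
      using infinite_enumerate[OF inf] by blast
    have cp: "compact (K \<times> sphere (0::complex) T)" by (intro compact_Times K) auto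
    \<comment> \<open>The shift by \<open>Suc\<close> keeps the degrees positive, as division by the
      degree requires.\<close>
    obtain q l where q: "strict_mono (q :: nat \<Rightarrow> nat)" and l: "l \<in> K \<times> sphere 0 T" "((\<lambda>k. (x (r (Suc k)), y (r (Suc k)))) \<circ> q) \<longlonglongrightarrow> l"
      using cp[unfolded compact_def, rule_format, of "\<lambda>k. (x (r (Suc k)), y (r (Suc k)))"] x(1) y(1) by auto
    define d where "d k = r (Suc (q k))" for k
    have d_mono: "strict_mono d" using r(1) q by (auto simp: d_def strict_mono_def)
    have d_pos: "0 < d k" for k
      using seq_suble[OF r(1), of "Suc (q k)"] by (simp add: d_def)
    note sub = LIMSEQ_subseq_LIMSEQ[OF _ d_mono, unfolded o_def]
    interpret S: asymptotic_polys E psi kap c "\<lambda>k. P (d k)" d "\<lambda>k. eps (d k)"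
      by unfold_locales (use d_pos Pnz upper[OF d_pos] sub[OF epslim] eps0 in auto)
    have xl: "(\<lambda>k. x (d k)) \<longlonglongrightarrow> fst l" using tendsto_fst[OF l(2)] by (simp add: d_def o_def)
    have yl: "(\<lambda>k. y (d k)) \<longlonglongrightarrow> snd l" using tendsto_snd[OF l(2)] by (simp add: d_def o_def)
    have l1: "fst l \<in> interior E" "snd l \<in> - E"
      using l(1) K(2) T by (auto simp: mem_Times_iff subset_iff)
    have n0: "(\<lambda>n. C / real n) \<longlonglongrightarrow> 0" for C by (rule lim_const_over_n)
    have wy: "(\<lambda>k. S.w k (y (d k))) \<longlonglongrightarrow> 0"
    proof (rule tendsto_sandwich[of "\<lambda>_. 0" _ _ "\<lambda>k. eps (d k) + ln (v (d k)) / real (d k) + 1 / real (d k)"])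
      show "\<forall>\<^sub>F k in sequentially. 0 \<le> S.w k (y (d k))" using S.w_nonneg by simp
      show "\<forall>\<^sub>F k in sequentially. S.w k (y (d k)) \<le> eps (d k) + ln (v (d k)) / real (d k) + 1 / real (d k)"
        using y(3)[OF d_pos] unfolding S.w_def by (intro always_eventually) (smt (verit, best))
      have "(\<lambda>k. eps (d k) + ln (v (d k)) / real (d k) + 1 / real (d k)) \<longlonglongrightarrow> 0 + 0 + 0"
        by (intro tendsto_add sub[OF epslim] sub[OF vlim] sub[OF n0])
      then show "(\<lambda>k. eps (d k) + ln (v (d k)) / real (d k) + 1 / real (d k)) \<longlonglongrightarrow> 0" by simp
    qed simp
    have wx: "(\<lambda>k. S.w k (x (d k))) \<longlonglongrightarrow> 0"
    proof (rule tendsto_sandwich[of "\<lambda>_. 0" _ _ "\<lambda>k. eps (d k) + - ln eta / real (d k)"])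
      show "\<forall>\<^sub>F k in sequentially. 0 \<le> S.w k (x (d k))" using S.w_nonneg by simp
      have "S.w k (x (d k)) \<le> eps (d k) + - ln eta / real (d k)" for k
      proof -
        have "x (d k) \<in> E" using x(1) K(2) interior_subset by blast
        then have g: "green (x (d k)) = 0" by (simp add: green_def)
        have "ln eta \<le> ln (cmod (poly (P (d k)) (x (d k))))" using eta x(2)[of "d k"] by (intro ln_mono) auto
        then have "ln eta / real (d k) \<le> ln (cmod (poly (P (d k)) (x (d k)))) / real (d k)" by (intro divide_right_mono) auto
        then show ?thesis unfolding S.w_def g by simp
      qed
      then show "\<forall>\<^sub>F k in sequentially. S.w k (x (d k)) \<le> eps (d k) + - ln eta / real (d k)" by simp
      have "(\<lambda>k. eps (d k) + - ln eta / real (d k)) \<longlonglongrightarrow> 0 + 0"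
        by (intro tendsto_add sub[OF epslim] sub[OF n0])
      then show "(\<lambda>k. eps (d k) + - ln eta / real (d k)) \<longlonglongrightarrow> 0" by simp
    qed simp
    have px: "poly (P (d k)) (x (d k)) \<noteq> 0" for k using x(2)[of "d k"] eta by auto
    have "(\<lambda>k. zero_count_int (d k) (P (d k)) f) \<longlonglongrightarrow> ?L"
    proof (rule S.zeros_converge[OF degP _ eqf _ f])
      show "(\<lambda>k. LINT z:ball 0 T'|lborel. S.w k z) \<longlonglongrightarrow> 0" if "0 < T'" for T'
        by (rule S.L1_convergence[OF conn_ext conn_int yl l1(2) y(2)[OF d_pos] wy xl l1(1) px wx that])
      show "(LINT z|\<mu>. bump s (a - z)) = (LINT x|uI. green (a + circ s x)) - (LINT x|uI. green (a + circ (s / 2) x))" if "0 < s" for a s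
        by (rule equilibrium_potential[OF eq that])
    qed
    then obtain k where "dist (?X (d k)) ?L < e" using e(1) unfolding lim_sequentially by blast
    then show False using r(2)[of "Suc (q k)"] by (simp add: d_def)
  qed
  then show ?thesis unfolding weak_conv_zeros_def P_def by blast
qed

end

section \<open>Random coefficients\<close>

text \<open>An integral test on a logarithmic scale: the interval from \<open>u k\<close> to
  \<open>u k * exp eps\<close> carries at least \<open>1 - exp (- eps)\<close> of
  \<open>dx / x\<close>, and disjoint intervals sum to at most the whole integral. Both tails of the
  coefficients fit this form, monotonicity supplying \<open>y k \<le> q x\<close>.\<close>

lemma summable_log_intervals:
  fixes q :: "real \<Rightarrow> real"
  assumes int: "set_integrable lborel S (\<lambda>x. q x / x)" and q: "\<And>x. x \<in> S \<Longrightarrow> 0 \<le> q x / x" and eps: "0 < eps"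
    and u: "\<And>k. 0 < u k" and sub: "\<And>k. {u k..<u k * exp eps} \<subseteq> S"
    and disj: "disjoint_family (\<lambda>k::nat. {u k..<u k * exp eps})"
    and y: "\<And>k. 0 \<le> y k" "\<And>k x. x \<in> {u k..<u k * exp eps} \<Longrightarrow> y k \<le> q x"
  shows "summable y"
proof -
  define I where "I k = {u k..<u k * exp eps}" for k
  define c where "c k x = indicator (I k) x * (y k / (u k * exp eps))" for k x
  have ue: "u k \<le> u k * exp eps" for k using u[of k] eps by simp
  have ci: "integrable lborel (c k)" for k
    unfolding c_def using ue[of k] by (intro integrable_mult_left integrable_real_indicator) (auto simp: I_def)
  have cI: "(LINT x|lborel. c k x) = y k * (1 - exp (- eps))" for k
  proof -
    have "(LINT x|lborel. c k x) = (u k * exp eps - u k) * (y k / (u k * exp eps))"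
      unfolding c_def using ue[of k] by (simp add: I_def)
    also have "\<dots> = y k * (1 - exp (- eps))" using u[of k] by (simp add: exp_minus field_simps)
    finally show ?thesis .
  qed
  have pt: "(\<Sum>k\<le>n. c k x) \<le> indicator S x * (q x / x)" for n x
  proof (cases "\<exists>j\<le>n. x \<in> I j")
    case True
    then obtain j where j: "j \<le> n" "x \<in> I j" by blast
    have "c k x = 0" if "k \<noteq> j" for k
      using disjoint_family_onD[OF disj, of k j] j(2) that by (auto simp: c_def I_def indicator_def)
    then have "(\<Sum>k\<le>n. c k x) = (\<Sum>k\<in>{j}. c k x)" using j by (intro sum.mono_neutral_right) auto
    also have "\<dots> = y j / (u j * exp eps)" using j by (simp add: c_def)
    also have "\<dots> \<le> q x / x"
      using y(1)[of j] y(2)[of x j] j(2) u[of j] by (intro frac_le) (auto simp: I_def)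
    finally show ?thesis using sub[of j] j(2) by (simp add: I_def subset_iff)
  next
    case False
    then have "(\<Sum>k\<le>n. c k x) = 0" by (intro sum.neutral) (auto simp: c_def)
    then show ?thesis using q[of x] by (simp add: indicator_def)
  qed
  define s where "s = 1 - exp (- eps)"
  have s: "0 < s" using eps by (simp add: s_def)
  have "(\<Sum>k\<le>n. y k) \<le> (LINT x:S|lborel. q x / x) / s" for n
  proof -
    have "(\<Sum>k\<le>n. y k) * s = (\<Sum>k\<le>n. LINT x|lborel. c k x)" by (simp add: cI s_def sum_distrib_right)
    also have "\<dots> = (LINT x|lborel. (\<Sum>k\<le>n. c k x))" by (rule Bochner_Integration.integral_sum[symmetric]) (rule ci)
    also have "\<dots> \<le> (LINT x:S|lborel. q x / x)"
      unfolding set_lebesgue_integral_def using pt int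
      by (intro integral_mono Bochner_Integration.integrable_sum ci) (auto simp: set_integrable_def)
    finally show ?thesis using s by (simp add: field_simps)
  qed
  then show ?thesis by (intro bounded_imp_summable y(1))
qed

lemma eventually_subexponential:
  fixes X :: "nat \<Rightarrow> real"
  assumes ev: "\<forall>\<^sub>F k in sequentially. X k \<le> exp (eps * real k)" and eps: "0 < eps"
  shows "\<exists>C>0. \<forall>k. X k \<le> C * exp (eps * real k)"
proof -
  obtain N where N: "\<And>k. N \<le> k \<Longrightarrow> X k \<le> exp (eps * real k)" using ev unfolding eventually_sequentially by blast
  define C where "C = 1 + (\<Sum>k<N. \<bar>X k\<bar>)"
  have C: "1 \<le> C" by (simp add: C_def sum_nonneg)
  have "X k \<le> C * exp (eps * real k)" for k
  proof (cases "k < N")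
    case True
    have "X k \<le> (\<Sum>k<N. \<bar>X k\<bar>)" using member_le_sum[of k "{..<N}" "\<lambda>k. \<bar>X k\<bar>"] True by auto
    also have "\<dots> \<le> C" by (simp add: C_def)
    also have "\<dots> = C * 1" by simp
    also have "\<dots> \<le> C * exp (eps * real k)" using C eps by (intro mult_left_mono) auto
    finally show ?thesis .
  next
    case False
    then have "X k \<le> 1 * exp (eps * real k)" using N[of k] by simp
    also have "\<dots> \<le> C * exp (eps * real k)" using C by (intro mult_right_mono) auto
    finally show ?thesis .
  qed
  then show ?thesis using C by (intro exI[of _ C]) auto
qed

context prob_space
begin

text \<open>Borel--Cantelli: the exceptional event at index \<open>k\<close> has probability at most
  the value of the tail bound at \<open>exp (eps * real k)\<close>, and these values are summable
  because the tail bound is integrable against \<open>dx / x\<close>.\<close>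

lemma assumption1_upper:
  assumes A: "\<And>k. A k \<in> borel_measurable M" and a1: "assumption1 M A" and eps: "0 < eps"
  shows "AE \<omega> in M. \<forall>\<^sub>F k in sequentially. cmod (A k \<omega>) \<le> exp (eps * real k)"
proof -
  note [measurable] = A
  obtain a f where a: "1 < a" and f: "antimono_on {a..} f" "\<And>x. a \<le> x \<Longrightarrow> 0 \<le> f x"
    and int: "set_integrable lborel {a..} (\<lambda>x. f x / x)"
    and tail: "\<And>k x. a \<le> x \<Longrightarrow> 1 - measure M {\<omega>\<in>space M. cmod (A k \<omega>) \<le> x} \<le> f x"
    using a1 unfolding assumption1_def by blast
  \<comment> \<open>From this index on \<open>exp (eps * real k)\<close> lies in the range where the
    tail bound holds.\<close>
  define k0 where "k0 = nat \<lceil>ln a / eps\<rceil>"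
  have k0: "a \<le> exp (eps * real (k + k0))" for k
  proof -
    have "ln a / eps \<le> real k0" unfolding k0_def by linarith
    then have "ln a \<le> eps * real k0" using eps by (simp add: field_simps)
    also have "\<dots> \<le> eps * real (k + k0)" using eps by simp
    finally show ?thesis using a by (simp add: ln_ge_iff flip: ln_le_cancel_iff)
  qed
  have step: "exp (eps * real (k + k0)) * exp eps = exp (eps * real (Suc k + k0))" for k
    by (simp flip: exp_add add: algebra_simps)
  have sum: "summable (\<lambda>k. f (exp (eps * real (Suc k + k0))))"
  proof (rule summable_log_intervals[OF int _ eps, where u = "\<lambda>k. exp (eps * real (k + k0))"])
    show "0 \<le> f x / x" if "x \<in> {a..}" for x using that f(2)[of x] a by simp
    show "{exp (eps * real (k + k0))..<exp (eps * real (k + k0)) * exp eps} \<subseteq> {a..}" for k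
      using k0[of k] by auto
    show "disjoint_family (\<lambda>k. {exp (eps * real (k + k0))..<exp (eps * real (k + k0)) * exp eps})"
      unfolding step disjoint_family_on_def
    proof safe
      have gen: "exp (eps * real (Suc m + k0)) \<le> exp (eps * real (n + k0))" if "m < n" for m n
        using that eps by simp
      fix m n x assume mn: "m \<noteq> (n::nat)" and x: "x \<in> {exp (eps * real (m + k0))..<exp (eps * real (Suc m + k0))}" "x \<in> {exp (eps * real (n + k0))..<exp (eps * real (Suc n + k0))}"
      have "m < n \<or> n < m" using mn by linarith
      then show "x \<in> {}" using x gen unfolding atLeastLessThan_iff by (meson leD less_le_trans order_trans)
    qed
    show "0 \<le> f (exp (eps * real (Suc k + k0)))" for k by (rule f(2)[OF k0])
    show "f (exp (eps * real (Suc k + k0))) \<le> f x" if "x \<in> {exp (eps * real (k + k0))..<exp (eps * real (k + k0)) * exp eps}" for k x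
    proof (rule monotone_onD[OF f(1)])
      show "x \<in> {a..}" using that k0[of k] by auto
      show "exp (eps * real (Suc k + k0)) \<in> {a..}" using k0[of "Suc k"] by simp
      show "x \<le> exp (eps * real (Suc k + k0))" using that unfolding step by simp
    qed
  qed simp
  define G where "G k = {\<omega>\<in>space M. \<not> cmod (A k \<omega>) \<le> exp (eps * real k)}" for k
  have [measurable]: "G k \<in> sets M" for k unfolding G_def by measurable
  have PG: "measure M (G k) = 1 - measure M {\<omega>\<in>space M. cmod (A k \<omega>) \<le> exp (eps * real k)}" for k
    unfolding G_def by (rule prob_neg) measurable
  have "summable (\<lambda>k. measure M (G (k + Suc k0)))"
  proof (rule summable_comparison_test'[OF sum, of 0])
    fix k :: nat
    have "measure M (G (k + Suc k0)) \<le> f (exp (eps * real (k + Suc k0)))"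
      unfolding PG using k0[of "Suc k"] by (intro tail) simp
    then show "norm (measure M (G (k + Suc k0))) \<le> f (exp (eps * real (Suc k + k0)))" by simp
  qed
  then have "summable (\<lambda>k. measure M (G k))" by (rule summable_iff_shift[THEN iffD1])
  then have "AE \<omega> in M. \<forall>\<^sub>F k in sequentially. \<omega> \<in> space M - G k"
    by (intro borel_cantelli_AE1) (auto simp: emeasure_eq_measure)
  then show ?thesis by eventually_elim (auto simp: G_def elim: eventually_mono)
qed

text \<open>The mirror image of \<open>assumption1_upper\<close> at small values: the points
  \<open>exp (- eps * real k)\<close> decrease, so each summand is compared with the interval to its
  right. Nonvanishing follows because the bounds, being summable, tend to zero.\<close>

lemma assumption2_lower:
  assumes A: "\<And>k. A k \<in> borel_measurable M" and a2: "assumption2 M A" and eps: "0 < eps"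
  shows "AE \<omega> in M. \<forall>\<^sub>F k in sequentially. 1 / cmod (A k \<omega>) \<le> exp (eps * real k)"
    and "AE \<omega> in M. A k \<omega> \<noteq> 0"
proof -
  note [measurable] = A
  obtain b g where b: "0 < b" "b < 1" and g: "mono_on {0..b} g" "\<And>x. x \<in> {0..b} \<Longrightarrow> 0 \<le> g x"
    and int: "set_integrable lborel {0..b} (\<lambda>x. g x / x)"
    and tail: "\<And>k x. 0 \<le> x \<Longrightarrow> x \<le> b \<Longrightarrow> measure M {\<omega>\<in>space M. cmod (A k \<omega>) \<le> x} \<le> g x"
    using a2 unfolding assumption2_def by blast
  define k0 where "k0 = nat \<lceil>- ln b / eps\<rceil>"
  have k0: "exp (- eps * real (k + k0)) \<le> b" for k
  proof -
    have "- ln b / eps \<le> real k0" unfolding k0_def by linarith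
    then have "- ln b \<le> eps * real k0" using eps by (simp add: field_simps)
    also have "\<dots> \<le> eps * real (k + k0)" using eps by simp
    finally have "- eps * real (k + k0) \<le> ln b" by simp
    then have "exp (- eps * real (k + k0)) \<le> exp (ln b)" by (simp only: exp_le_cancel_iff)
    then show ?thesis using b by simp
  qed
  have step: "exp (- eps * real (Suc k + k0)) * exp eps = exp (- eps * real (k + k0))" for k
    by (simp flip: exp_add add: algebra_simps)
  have sum: "summable (\<lambda>k. g (exp (- eps * real (Suc k + k0))))"
  proof (rule summable_log_intervals[OF int _ eps, where u = "\<lambda>k. exp (- eps * real (Suc k + k0))"])
    show "0 \<le> g x / x" if "x \<in> {0..b}" for x using that g(2)[of x] by simp
    show "{exp (- eps * real (Suc k + k0))..<exp (- eps * real (Suc k + k0)) * exp eps} \<subseteq> {0..b}" for k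
    proof
      fix x assume "x \<in> {exp (- eps * real (Suc k + k0))..<exp (- eps * real (Suc k + k0)) * exp eps}"
      then have x: "exp (- eps * real (Suc k + k0)) \<le> x" "x < exp (- eps * real (k + k0))" unfolding step by auto
      have "0 < exp (- eps * real (Suc k + k0))" by (rule exp_gt_zero)
      then have "0 \<le> x" using x(1) by linarith
      then show "x \<in> {0..b}" using x(2) k0[of k] by simp
    qed
    show "disjoint_family (\<lambda>k. {exp (- eps * real (Suc k + k0))..<exp (- eps * real (Suc k + k0)) * exp eps})"
      unfolding step disjoint_family_on_def
    proof safe
      have gen: "exp (- eps * real (n + k0)) \<le> exp (- eps * real (Suc m + k0))" if "m < n" for m n
        using that eps by simp
      fix m n x assume mn: "m \<noteq> (n::nat)" and x: "x \<in> {exp (- eps * real (Suc m + k0))..<exp (- eps * real (m + k0))}" "x \<in> {exp (- eps * real (Suc n + k0))..<exp (- eps * real (n + k0))}"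
      have "m < n \<or> n < m" using mn by linarith
      then show "x \<in> {}" using x gen unfolding atLeastLessThan_iff by (meson leD less_le_trans order_trans)
    qed
    show "0 \<le> g (exp (- eps * real (Suc k + k0)))" for k using k0[of "Suc k"] by (intro g(2)) auto
    show "g (exp (- eps * real (Suc k + k0))) \<le> g x" if "x \<in> {exp (- eps * real (Suc k + k0))..<exp (- eps * real (Suc k + k0)) * exp eps}" for k x
    proof (rule monotone_onD[OF g(1)])
      have x: "exp (- eps * real (Suc k + k0)) \<le> x" "x < exp (- eps * real (k + k0))" using that unfolding step by auto
      have "0 < exp (- eps * real (Suc k + k0))" by (rule exp_gt_zero)
      then have "0 \<le> x" using x(1) by linarith
      then show "x \<in> {0..b}" using x(2) k0[of k] by simp
      show "exp (- eps * real (Suc k + k0)) \<in> {0..b}" using k0[of "Suc k"] by simp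
      show "exp (- eps * real (Suc k + k0)) \<le> x" by (rule x(1))
    qed
  qed simp
  define G where "G k = {\<omega>\<in>space M. cmod (A k \<omega>) \<le> exp (- eps * real k)}" for k
  have [measurable]: "G k \<in> sets M" for k unfolding G_def by measurable
  have "summable (\<lambda>k. measure M (G (k + Suc k0)))"
  proof (rule summable_comparison_test'[OF sum, of 0])
    fix k :: nat
    have "measure M (G (k + Suc k0)) \<le> g (exp (- eps * real (k + Suc k0)))"
      unfolding G_def using k0[of "Suc k"] by (intro tail) auto
    then show "norm (measure M (G (k + Suc k0))) \<le> g (exp (- eps * real (Suc k + k0)))" by simp
  qed
  then have "summable (\<lambda>k. measure M (G k))" by (rule summable_iff_shift[THEN iffD1])
  then have "AE \<omega> in M. \<forall>\<^sub>F k in sequentially. \<omega> \<in> space M - G k"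
    by (intro borel_cantelli_AE1) (auto simp: emeasure_eq_measure)
  then show "AE \<omega> in M. \<forall>\<^sub>F k in sequentially. 1 / cmod (A k \<omega>) \<le> exp (eps * real k)"
  proof eventually_elim
    case (elim \<omega>)
    then show ?case
    proof (rule eventually_mono)
      fix k assume "\<omega> \<in> space M - G k"
      then have "exp (- eps * real k) < cmod (A k \<omega>)" by (auto simp: G_def)
      then have "1 / cmod (A k \<omega>) \<le> 1 / exp (- eps * real k)"
        by (intro divide_left_mono mult_pos_pos) (auto intro: less_trans[OF exp_gt_zero])
      also have "\<dots> = exp (eps * real k)" by (simp add: exp_minus field_simps)
      finally show "1 / cmod (A k \<omega>) \<le> exp (eps * real k)" .
    qed
  qed
  \<comment> \<open>Borel--Cantelli only speaks of late indices, whereas every coefficient must be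
    nonzero; each one is treated separately by letting the threshold tend to zero.\<close>
  have "measure M {\<omega>\<in>space M. A k \<omega> = 0} \<le> g (exp (- eps * real (Suc j + k0)))" for j
  proof -
    have "measure M {\<omega>\<in>space M. A k \<omega> = 0} \<le> measure M {\<omega>\<in>space M. cmod (A k \<omega>) \<le> exp (- eps * real (Suc j + k0))}"
      by (intro finite_measure_mono) auto
    also have "\<dots> \<le> g (exp (- eps * real (Suc j + k0)))" using k0[of "Suc j"] by (intro tail) auto
    finally show ?thesis .
  qed
  then have "measure M {\<omega>\<in>space M. A k \<omega> = 0} \<le> 0"
    by (intro LIMSEQ_le_const[OF summable_LIMSEQ_zero[OF sum]]) auto
  then have "measure M {\<omega>\<in>space M. A k \<omega> = 0} = 0" using measure_nonneg[of M] by (intro antisym)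
  then show "AE \<omega> in M. A k \<omega> \<noteq> 0"
    by (intro AE_I[of _ _ "{\<omega>\<in>space M. A k \<omega> = 0}"]) (auto simp: emeasure_eq_measure)
qed

text \<open>The null set depends on \<open>eps\<close>; letting \<open>eps\<close> run through the
  reciprocals of positive integers leaves countably many.\<close>

lemma subexponential_coefficients:
  assumes A: "\<And>k. A k \<in> borel_measurable M" and a1: "assumption1 M A" and a2: "assumption2 M A"
  shows "AE \<omega> in M. (\<forall>k. A k \<omega> \<noteq> 0)
    \<and> (\<forall>eps>0. \<exists>C>0. \<forall>k. cmod (A k \<omega>) \<le> C * exp (eps * real k))
    \<and> (\<forall>eps>0. \<exists>C>0. \<forall>k. 1 / cmod (A k \<omega>) \<le> C * exp (eps * real k))"
proof -
  have "AE \<omega> in M. \<forall>m. \<forall>\<^sub>F k in sequentially. cmod (A k \<omega>) \<le> exp (inverse (real (Suc m)) * real k)"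
    unfolding AE_all_countable by (intro allI assumption1_upper[OF A a1]) simp
  moreover have "AE \<omega> in M. \<forall>m. \<forall>\<^sub>F k in sequentially. 1 / cmod (A k \<omega>) \<le> exp (inverse (real (Suc m)) * real k)"
    unfolding AE_all_countable by (intro allI assumption2_lower(1)[OF A a2]) simp
  moreover have "AE \<omega> in M. \<forall>k. A k \<omega> \<noteq> 0"
    unfolding AE_all_countable by (intro allI assumption2_lower(2)[OF A a2, of 1]) simp
  ultimately show ?thesis
  proof eventually_elim
    case (elim \<omega>)
    have *: "\<exists>C>0. \<forall>k. X k \<le> C * exp (eps * real k)"
      if X: "\<forall>m. \<forall>\<^sub>F k in sequentially. X k \<le> exp (inverse (real (Suc m)) * real k)" and eps: "0 < eps" for X :: "nat \<Rightarrow> real" and eps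
    proof (rule eventually_subexponential[OF _ eps])
      obtain m where m: "inverse (real (Suc m)) < eps" using reals_Archimedean[OF eps] by blast
      have "exp (inverse (real (Suc m)) * real k) \<le> exp (eps * real k)" for k
        using m by (simp add: mult_right_mono)
      then show "\<forall>\<^sub>F k in sequentially. X k \<le> exp (eps * real k)"
        using X[rule_format, of m] by (auto elim!: eventually_mono intro: order_trans)
    qed
    show ?case using elim *[OF elim(1)] *[OF elim(2)] by blast
  qed
qed

end

section \<open>Assembling the three cases\<close>

lemma jordan_oriented:
  assumes h: "analytic_jordan_param h r R" and E: "E = closure (inside (h ` sphere 0 1))"
  obtains h2 r1 where "h2 = h \<or> h2 = (\<lambda>u. h (inverse u))" "\<And>psi kap c. exterior_conformal E psi kap c \<Longrightarrow> oriented_jordan E psi kap c h2 r1"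
    "\<exists>psi kap c. exterior_conformal E psi kap c" "compact E"
proof -
  define L where "L = h ` sphere 0 1"
  have hh: "h holomorphic_on annulus r R" "inj_on h (annulus r R)" "0 \<le> r" "r < 1" "1 < R"
    using h by (auto simp: analytic_jordan_param_def)
  have EL: "E = closure (inside L)" using E by (simp add: L_def)
  note J = jordan_facts[OF hh L_def EL]
  obtain h2 r1 where h2: "0 < r1" "r1 < 1" "annulus r1 (1 / r1) \<subseteq> annulus r R" "h2 = h \<or> h2 = (\<lambda>u. h (inverse u))"
    "h2 holomorphic_on annulus r1 (1 / r1)" "inj_on h2 (annulus r1 (1 / r1))" "h2 ` sphere 0 1 = L"
    and out: "\<And>u. 1 < cmod u \<Longrightarrow> cmod u < 1 / r1 \<Longrightarrow> h2 u \<in> outside L"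
    and inn: "\<And>u. r1 < cmod u \<Longrightarrow> cmod u < 1 \<Longrightarrow> h2 u \<in> inside L"
    by (rule jordan_orientation[OF hh L_def]) blast
  obtain p where p: "p \<in> inside L" using J(7) by blast
  have dim: "2 \<le> DIM(complex)" by simp
  have c1: "connected (inside L - {p})" by (rule connected_open_delete[OF J(9) J(5) dim])
  \<comment> \<open>Deleting \<open>p\<close> changes the closure at most at \<open>p\<close>
    itself, so \<open>E - {p}\<close> lies between a connected set and its closure.\<close>
  have "closure (inside L) \<subseteq> closure ((inside L - {p}) \<union> {p})" by (rule closure_mono) blast
  then have "E - {p} \<subseteq> closure (inside L - {p})" unfolding EL closure_Un by auto
  moreover have "inside L - {p} \<subseteq> E - {p}" using J(3) by blast
  ultimately have c2: "connected (E - {p})" by (intro connected_intermediate_closure[OF c1])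
  have L1: "h 1 \<in> L" by (simp add: L_def)
  then have "h 1 \<in> E" unfolding J(3) by blast
  moreover have "h 1 \<noteq> p" using L1 p J(8) by blast
  ultimately have ne: "E \<noteq> {p}" by blast
  have conn: "connected (- E)" unfolding J(1) by (rule J(6))
  have pE: "p \<in> interior E" unfolding J(2) by (rule p)
  have ex: "\<exists>psi kap c. exterior_conformal E psi kap c" by (rule riemann_exterior[OF J(4) conn pE c2 ne])
  \<comment> \<open>The exterior map is left arbitrary here, since the Faber case brings its
    own.\<close>
  have oj: "oriented_jordan E psi kap c h2 r1" if "exterior_conformal E psi kap c" for psi kap c
  proof -
    interpret exterior_conformal E psi kap c by (rule that)
    show ?thesis
    proof unfold_locales
      show "h2 u \<notin> E" if "1 < cmod u" "cmod u < 1 / r1" for u using out[OF that] J(1) by blast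
      show "h2 u \<in> interior E" if "r1 < cmod u" "cmod u < 1" for u unfolding J(2) by (rule inn[OF that])
      show "E = interior E \<union> h2 ` sphere 0 1" unfolding J(2) h2(7) by (rule J(3))
      show "interior E \<inter> h2 ` sphere 0 1 = {}" unfolding J(2) h2(7) by (rule J(8))
      show "connected (- E)" unfolding J(1) by (rule J(6))
      show "connected (interior E)" unfolding J(2) by (rule J(5))
      show "interior E \<noteq> {}" unfolding J(2) by (rule J(7))
    qed (fact h2)+
  qed
  show ?thesis by (rule that[OF h2(4) oj ex J(4)])
qed

text \<open>Arclength does not see the orientation: on the unit circle inversion has derivative of
  modulus one, and \<open>mean_inverse\<close> absorbs the change of parameter.\<close>

lemma szego_polys_mean:
  assumes h: "analytic_jordan_param h r R" and h2: "h2 = h \<or> h2 = (\<lambda>u. h (inverse u))" and B: "szego_polys h B"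
  shows "2 * of_real pi * (LINT x|uI. poly (B j) (h2 (ucis x)) * cnj (poly (B k) (h2 (ucis x))) * of_real (cmod (deriv h2 (ucis x)))) = (if j = k then 1 else 0)"
proof -
  have hh: "h holomorphic_on annulus r R" "0 \<le> r" "r < 1" "1 < R" using h by (auto simp: analytic_jordan_param_def)
  have sp: "sphere 0 1 \<subseteq> annulus r R" using hh by (auto simp: annulus_def)
  define F where "F u = poly (B j) (h u) * cnj (poly (B k) (h u)) * of_real (cmod (deriv h u))" for u
  have Fc: "continuous_on (sphere 0 1) F" unfolding F_def
    by (intro continuous_intros holomorphic_continuous[OF hh(1) sp]
        holomorphic_continuous[OF holomorphic_deriv[OF hh(1) open_annulus] sp])
  from lbint_circle[OF Fc] have F: "2 * of_real pi * (LINT x|uI. F (ucis x)) = (if j = k then 1 else 0)"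
    using B unfolding szego_polys_def F_def by simp
  from h2 show ?thesis
  proof
    assume "h2 = h"
    then show ?thesis using F by (simp add: F_def)
  next
    assume h2: "h2 = (\<lambda>u. h (inverse u))"
    have "poly (B j) (h2 (ucis x)) * cnj (poly (B k) (h2 (ucis x))) * of_real (cmod (deriv h2 (ucis x))) = F (inverse (ucis x))" for x
    proof -
      have "inverse (ucis x) \<in> annulus r R" using sp by (auto simp: norm_inverse subset_iff)
      then have "(h has_field_derivative deriv h (inverse (ucis x))) (at (inverse (ucis x)))"
        by (rule holomorphic_derivI[OF hh(1) open_annulus])
      from DERIV_chain2[OF this DERIV_inverse[of "ucis x"]]
      have "deriv h2 (ucis x) = deriv h (inverse (ucis x)) * - (inverse (ucis x) ^ Suc (Suc 0))"
        unfolding h2 by (intro DERIV_imp_deriv) simp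
      then have "cmod (deriv h2 (ucis x)) = cmod (deriv h (inverse (ucis x)))"
        by (simp add: norm_mult norm_inverse)
      then show ?thesis by (simp add: F_def h2)
    qed
    then show ?thesis using F mean_inverse[OF Fc] by simp
  qed
qed

theorem theorem2p4:
  fixes h :: "complex \<Rightarrow> complex" and r R :: real and E :: "complex set"
    and B :: "nat \<Rightarrow> complex poly" and M :: "'a measure" and A :: "nat \<Rightarrow> 'a \<Rightarrow> complex"
    and \<mu> :: "complex measure"
  assumes "analytic_jordan_param h r R"
    and "E = closure (inside (h ` sphere 0 1))"
    and "szego_polys h B \<or> bergman_polys E B \<or> (\<exists>\<Phi>. exterior_map E \<Phi> \<and> faber_polys \<Phi> B)"
    and "prob_space M"
    and "\<forall>k. A k \<in> borel_measurable M"
    and "assumption1 M A"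
    and "assumption2 M A"
    and "equilibrium_measure E \<mu>"
  shows "AE \<omega> in M. weak_conv_zeros (random_poly A B \<omega>) \<mu>"
proof -
  obtain h2 r1 where h2: "h2 = h \<or> h2 = (\<lambda>u. h (inverse u))"
    and oj: "\<And>psi kap c. exterior_conformal E psi kap c \<Longrightarrow> oriented_jordan E psi kap c h2 r1"
    and ex: "\<exists>psi kap c. exterior_conformal E psi kap c" and cE: "compact E"
    by (rule jordan_oriented[OF assms(1,2)]) blast
  \<comment> \<open>Two of the bases accept any exterior map; the Faber polynomials force the one
    built from \<open>\<Phi>\<close>, so the choice is made in each case.\<close>
  have "\<exists>psi kap c. oriented_jordan E psi kap c h2 r1 \<and> oriented_jordan.admissible E c B"
    using assms(3)
  proof (elim disjE exE conjE)
    assume S: "szego_polys h B"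
    obtain psi kap c where oj1: "oriented_jordan E psi kap c h2 r1" using ex oj by blast
    interpret oriented_jordan E psi kap c h2 r1 by (rule oj1)
    have "admissible B"
      using S szego_polys_mean[OF assms(1) h2 S] by (intro szego_admissible) (auto simp: szego_polys_def)
    then show ?thesis using oj1 by blast
  next
    assume S: "bergman_polys E B"
    obtain psi kap c where oj1: "oriented_jordan E psi kap c h2 r1" using ex oj by blast
    interpret oriented_jordan E psi kap c h2 r1 by (rule oj1)
    show ?thesis using oj1 bergman_admissible[OF S] by blast
  next
    fix \<Phi> assume \<Phi>: "exterior_map E \<Phi>" "faber_polys \<Phi> B"
    obtain psi \<gamma> where e: "exterior_conformal E psi (\<lambda>z. inverse (\<Phi> z)) (of_real \<gamma>)"
      using exterior_map_conformal[OF cE \<Phi>(1)] by blast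
    interpret oriented_jordan E psi "\<lambda>z. inverse (\<Phi> z)" "of_real \<gamma>" h2 r1 by (rule oj[OF e])
    have "admissible B"
      using \<Phi>(2) by (intro faber_admissible) (simp add: faber_like_def faber_polys_def)
    then show ?thesis using oj[OF e] by blast
  qed
  then obtain psi kap c where o: "oriented_jordan E psi kap c h2 r1" and adm: "oriented_jordan.admissible E c B" by blast
  have "A k \<in> borel_measurable M" for k using assms(5) by blast
  from prob_space.subexponential_coefficients[OF assms(4) this assms(6,7)] show ?thesis
  proof eventually_elim
    case (elim \<omega>)
    then have "weak_conv_zeros (\<lambda>n. \<Sum>k\<le>n. smult (A k \<omega>) (B k)) \<mu>"
      by (intro oriented_jordan.zeros_equidistribute[OF o assms(8) adm]) auto
    then show ?case by (simp add: random_poly_def[abs_def])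
  qed
qed

end
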